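(* Let $(X,d,\mu)$ be a space of homogeneous type and $m\ge1$ an integer. Let $p_i(\cdot)\in LH\cap\mathscr P$, $i=1,\dots,m$, with $\frac1{p(\cdot)}=\sum_{i=1}^m\frac1{p_i(\cdot)}$, let $q(\cdot)\in\mathscr P_0$ and let $\eta\in[0,m)$ be a constant with $\frac1{p(\cdot)}-\frac1{q(\cdot)}=\eta$. Let $\vec\omega=(\omega_1,\dots,\omega_m,\omega)$ be a multiple weight with $\omega=\prod_{i=1}^m\omega_i$. Then $\mathscr M_\eta$ is bounded from $L^{p_1(\cdot)}(X,\omega_1)\times\cdots\times L^{p_m(\cdot)}(X,\omega_m)$ to $L^{q(\cdot)}(X,\omega)$ if and only if $\vec\omega\in A_{\vec p(\cdot),q(\cdot)}(X)$. Moreover, $$C^{-1}[\vec\omega]_{A_{\vec p(\cdot),q(\cdot)}(X)}\le\|\mathscr M_\eta\|_{\prod_{i=1}^m L^{p_i(\cdot)}(X,\omega_i)\to L^{q(\cdot)}(X,\omega)}\le C_{\vec\omega,\eta,m,\mu,X,\vec p(\cdot)},$$ where $C>0$ depends only on $\vec p(\cdot)=(p_1(\cdot),\dots,p_m(\cdot))$ and (when $\vec\omega\in A_{\vec p(\cdot),q(\cdot)}(X)$) $C_{\vec\omega,\eta,m,\mu,X,\vec p(\cdot)}$ is a finite constant depending on the indicated quantities.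
   Context: Space of homogeneous type: a nonempty set $X$ with a quasi-metric $d:X\times X\to[0,\infty)$ (i.e. $d(x,y)=0$ when $x=y$, $d(x,y)=d(y,x)$, and $d(x,y)\le A_0(d(x,z)+d(z,y))$ for some constant $A_0\ge1$) and a regular measure $\mu$ on the $\sigma$-algebra generated by open sets and quasi-metric balls $B(x,r)$, which is doubling: $0<\mu(B(x,2r))\le C_\mu\,\mu(B(x,r))<\infty$ for all $x\in X$, $r>0$. Exponents: for measurable $p(\cdot)$ on $X$, $p_-=\operatorname{ess\,inf}_X p$, $p_+=\operatorname{ess\,sup}_X p$. $\mathscr P$ is the set of measurable $p(\cdot):X\to[1,\infty)$ with $1<p_-\le p_+<\infty$; $\mathscr P_0$ is the set of measurable $p(\cdot):X\to(0,\infty)$ with $0<p_-\le p_+<\infty$. The conjugate exponent is $p'(\cdot)=p(\cdot)/(p(\cdot)-1)$. $LH$ is the class of $p(\cdot)$ for which there are a constant $C$ and a number $p_\infty\in\mathbb R$ with $|p(x)-p(y)|\le C/\log(e+1/d(x,y))$ whenever $d(x,y)<\frac12$, and $|p(x)-p_\infty|\le C/\log(e+d(x,x_0))$ for all $x\in X$, where $x_0\in X$ is a fixed point (the choice of $x_0$ is immaterial). Norms: for $p(\cdot)\in\mathscr P_0$, $\|f\|_{L^{p(\cdot)}}=\|f\|_{p(\cdot)}=\inf\{\lambda>0:\int_X|f(x)/\lambda|^{p(x)}d\mu\le1\}$, and $\|f\|_{L^{p(\cdot)}(X,\omega)}=\|\omega f\|_{p(\cdot)}$. Weights: a weight is a locally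 integrable $\omega:X\to[0,\infty]$ with $0<\omega<\infty$ a.e.; a multiple weight $\vec\omega=(\omega_1,\dots,\omega_m,\omega)$ is a tuple of weights. $\vec\omega\in A_{\vec p(\cdot),q(\cdot)}(X)$ means $$[\vec\omega]_{A_{\vec p(\cdot),q(\cdot)}(X)}:=\sup_{B\subseteq X}\mu(B)^{\eta-m}\|\omega\chi_B\|_{q(\cdot)}\prod_{i=1}^m\|\omega_i^{-1}\chi_B\|_{p_i'(\cdot)}<\infty,$$ the supremum being over all balls $B$. Operator: the multilinear fractional maximal operator is $\mathscr M_\eta(\vec f)(x)=\sup_{B\subseteq X}\mu(B)^\eta\Big(\prod_{i=1}^m\frac1{\mu(B)}\int_B|f_i|\,d\mu\Big)\chi_B(x)$, the supremum being over all balls $B$. Its operator norm is the least $C\ge0$ (possibly $\infty$) with $\|\mathscr M_\eta(\vec f)\|_{L^{q(\cdot)}(X,\omega)}\le C\prod_i\|f_i\|_{L^{p_i(\cdot)}(X,\omega_i)}$. *)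

theory Defs
  imports "HOL-Analysis.Analysis" "HOL-Probability.Essential_Supremum"
begin

text \<open>Throughout, the underlying set $X$ is \<^term>\<open>space M\<close>.\<close>

text \<open>Distinct points at distance zero are not excluded.\<close>

definition quasi_metric :: "'a set \<Rightarrow> ('a \<Rightarrow> 'a \<Rightarrow> real) \<Rightarrow> bool" where
  "quasi_metric X d \<longleftrightarrow>
     (\<forall>x\<in>X. \<forall>y\<in>X. 0 \<le> d x y) \<and>
     (\<forall>x\<in>X. d x x = 0) \<and>
     (\<forall>x\<in>X. \<forall>y\<in>X. d x y = d y x) \<and>
     (\<exists>A0\<ge>1. \<forall>x\<in>X. \<forall>y\<in>X. \<forall>z\<in>X. d x y \<le> A0 * (d x z + d z y))"

definition qball :: "'a set \<Rightarrow> ('a \<Rightarrow> 'a \<Rightarrow> real) \<Rightarrow> 'a \<Rightarrow> real \<Rightarrow> 'a set" where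
  "qball X d x r = {y \<in> X. d x y < r}"

definition qballs :: "'a set \<Rightarrow> ('a \<Rightarrow> 'a \<Rightarrow> real) \<Rightarrow> 'a set set" where
  "qballs X d = {qball X d x r | x r. x \<in> X \<and> 0 < r}"

text \<open>Quasi-metric balls need not be open in the topology they induce.\<close>

definition qopen :: "'a set \<Rightarrow> ('a \<Rightarrow> 'a \<Rightarrow> real) \<Rightarrow> 'a set \<Rightarrow> bool" where
  "qopen X d U \<longleftrightarrow> U \<subseteq> X \<and> (\<forall>x\<in>U. \<exists>r>0. qball X d x r \<subseteq> U)"

text \<open>``Regular'' is taken in its weakest usual sense, with closed rather than compact sets
  for the inner approximation.\<close>

definition regular_measure :: "'a measure \<Rightarrow> ('a \<Rightarrow> 'a \<Rightarrow> real) \<Rightarrow> bool" where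
  "regular_measure M d \<longleftrightarrow>
     (\<forall>E\<in>sets M.
        emeasure M E = (INF U\<in>{U. qopen (space M) d U \<and> E \<subseteq> U}. emeasure M U) \<and>
        emeasure M E =
          (SUP F\<in>{F. F \<subseteq> E \<and> qopen (space M) d (space M - F)}. emeasure M F))"

definition homogeneous_type :: "'a measure \<Rightarrow> ('a \<Rightarrow> 'a \<Rightarrow> real) \<Rightarrow> bool" where
  "homogeneous_type M d \<longleftrightarrow>
     space M \<noteq> {} \<and>
     quasi_metric (space M) d \<and>
     sets M = sigma_sets (space M) ({U. qopen (space M) d U} \<union> qballs (space M) d) \<and>
     regular_measure M d \<and>
     (\<exists>C::real. \<forall>x\<in>space M. \<forall>r>0.
        0 < emeasure M (qball (space M) d x (2 * r)) \<and>
        emeasure M (qball (space M) d x (2 * r))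
          \<le> ennreal C * emeasure M (qball (space M) d x r) \<and>
        emeasure M (qball (space M) d x r) < \<infinity>)"

definition ess_sup :: "'a measure \<Rightarrow> ('a \<Rightarrow> real) \<Rightarrow> ereal" where
  "ess_sup M p = esssup M (\<lambda>x. ereal (p x))"

definition ess_inf :: "'a measure \<Rightarrow> ('a \<Rightarrow> real) \<Rightarrow> ereal" where
  "ess_inf M p = - esssup M (\<lambda>x. - ereal (p x))"

definition exponents :: "'a measure \<Rightarrow> ('a \<Rightarrow> real) set" where
  "exponents M = {p \<in> borel_measurable M. (\<forall>x\<in>space M. 1 \<le> p x) \<and>
     1 < ess_inf M p \<and> ess_inf M p \<le> ess_sup M p \<and> ess_sup M p < \<infinity>}"

definition exponents0 :: "'a measure \<Rightarrow> ('a \<Rightarrow> real) set" where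
  "exponents0 M = {p \<in> borel_measurable M. (\<forall>x\<in>space M. 0 < p x) \<and>
     0 < ess_inf M p \<and> ess_inf M p \<le> ess_sup M p \<and> ess_sup M p < \<infinity>}"

text \<open>For \<open>p \<in> exponents M\<close> the set where \<open>p x = 1\<close> is a null set, so the value of the
  quotient there is irrelevant.\<close>

definition conj_exponent :: "('a \<Rightarrow> real) \<Rightarrow> 'a \<Rightarrow> real" where
  "conj_exponent p x = p x / (p x - 1)"

text \<open>When \<open>d x y = 0\<close>, the bound \<open>C / log (e + 1 / d x y)\<close> is read as \<open>0\<close>.\<close>

definition log_Hoelder :: "'a set \<Rightarrow> ('a \<Rightarrow> 'a \<Rightarrow> real) \<Rightarrow> ('a \<Rightarrow> real) \<Rightarrow> bool" where
  "log_Hoelder X d p \<longleftrightarrow>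
     (\<exists>C p_inf. \<exists>x0\<in>X.
        (\<forall>x\<in>X. \<forall>y\<in>X. d x y < 1 / 2 \<longrightarrow>
           \<bar>p x - p y\<bar> \<le> (if d x y = 0 then 0 else C / ln (exp 1 + 1 / d x y))) \<and>
        (\<forall>x\<in>X. \<bar>p x - p_inf\<bar> \<le> C / ln (exp 1 + d x x0)))"

text \<open>Power with a positive exponent, extended to the value infinity.\<close>

definition epowr :: "ennreal \<Rightarrow> real \<Rightarrow> ennreal" where
  "epowr x a = (if x = \<infinity> then \<infinity> else ennreal (enn2real x powr a))"

text \<open>The norm takes the absolute value of the function as an argument with values in
  $[0,\infty]$; it is \<open>\<infinity>\<close> if no \<open>l\<close> is admissible.\<close>

definition var_norm :: "'a measure \<Rightarrow> ('a \<Rightarrow> real) \<Rightarrow> ('a \<Rightarrow> ennreal) \<Rightarrow> ennreal" where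
  "var_norm M p f =
     (INF l\<in>{l::real. 0 < l \<and> (\<integral>\<^sup>+x. epowr (f x / ennreal l) (p x) \<partial>M) \<le> 1}. ennreal l)"

definition weighted_norm ::
  "'a measure \<Rightarrow> ('a \<Rightarrow> real) \<Rightarrow> ('a \<Rightarrow> ennreal) \<Rightarrow> ('a \<Rightarrow> ennreal) \<Rightarrow> ennreal" where
  "weighted_norm M p w f = var_norm M p (\<lambda>x. w x * f x)"

definition weighted_space ::
  "'a measure \<Rightarrow> ('a \<Rightarrow> real) \<Rightarrow> ('a \<Rightarrow> ennreal) \<Rightarrow> ('a \<Rightarrow> real) set" where
  "weighted_space M p w =
     {f \<in> borel_measurable M. weighted_norm M p w (\<lambda>x. ennreal \<bar>f x\<bar>) < \<infinity>}"

text \<open>Locally integrable means integrable over every ball.\<close>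

definition weight :: "'a measure \<Rightarrow> ('a \<Rightarrow> 'a \<Rightarrow> real) \<Rightarrow> ('a \<Rightarrow> ennreal) \<Rightarrow> bool" where
  "weight M d w \<longleftrightarrow> w \<in> borel_measurable M \<and>
     (\<forall>B\<in>qballs (space M) d. (\<integral>\<^sup>+x\<in>B. w x \<partial>M) < \<infinity>) \<and>
     (AE x in M. 0 < w x \<and> w x < \<infinity>)"

text \<open>Indices run over \<open>i < m\<close>; \<open>ws i\<close> are the weights $\omega_i$ and \<open>w\<close> is $\omega$.\<close>

definition Apq_const :: "'a measure \<Rightarrow> ('a \<Rightarrow> 'a \<Rightarrow> real) \<Rightarrow> nat \<Rightarrow> real \<Rightarrow>
    (nat \<Rightarrow> 'a \<Rightarrow> real) \<Rightarrow> ('a \<Rightarrow> real) \<Rightarrow> (nat \<Rightarrow> 'a \<Rightarrow> ennreal) \<Rightarrow> ('a \<Rightarrow> ennreal) \<Rightarrow> ennreal" where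
  "Apq_const M d m \<eta> ps q ws w =
     (SUP B\<in>qballs (space M) d.
        ennreal (measure M B powr (\<eta> - real m)) *
        var_norm M q (\<lambda>x. w x * indicator B x) *
        (\<Prod>i<m. var_norm M (conj_exponent (ps i)) (\<lambda>x. inverse (ws i x) * indicator B x)))"

definition in_Apq :: "'a measure \<Rightarrow> ('a \<Rightarrow> 'a \<Rightarrow> real) \<Rightarrow> nat \<Rightarrow> real \<Rightarrow>
    (nat \<Rightarrow> 'a \<Rightarrow> real) \<Rightarrow> ('a \<Rightarrow> real) \<Rightarrow> (nat \<Rightarrow> 'a \<Rightarrow> ennreal) \<Rightarrow> ('a \<Rightarrow> ennreal) \<Rightarrow> bool" where
  "in_Apq M d m \<eta> ps q ws w \<longleftrightarrow> Apq_const M d m \<eta> ps q ws w < \<infinity>"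

definition frac_maximal :: "'a measure \<Rightarrow> ('a \<Rightarrow> 'a \<Rightarrow> real) \<Rightarrow> nat \<Rightarrow> real \<Rightarrow>
    (nat \<Rightarrow> 'a \<Rightarrow> real) \<Rightarrow> 'a \<Rightarrow> ennreal" where
  "frac_maximal M d m \<eta> f x =
     (SUP B\<in>qballs (space M) d.
        ennreal (measure M B powr \<eta>) *
        (\<Prod>i<m. (\<integral>\<^sup>+y\<in>B. ennreal \<bar>f i y\<bar> \<partial>M) / emeasure M B) *
        indicator B x)"

definition maximal_bound :: "'a measure \<Rightarrow> ('a \<Rightarrow> 'a \<Rightarrow> real) \<Rightarrow> nat \<Rightarrow> real \<Rightarrow>
    (nat \<Rightarrow> 'a \<Rightarrow> real) \<Rightarrow> ('a \<Rightarrow> real) \<Rightarrow> (nat \<Rightarrow> 'a \<Rightarrow> ennreal) \<Rightarrow> ('a \<Rightarrow> ennreal) \<Rightarrow>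
    ennreal \<Rightarrow> bool" where
  "maximal_bound M d m \<eta> ps q ws w C \<longleftrightarrow>
     (\<forall>f. (\<forall>i<m. f i \<in> weighted_space M (ps i) (ws i)) \<longrightarrow>
        weighted_norm M q w (frac_maximal M d m \<eta> f)
          \<le> C * (\<Prod>i<m. weighted_norm M (ps i) (ws i) (\<lambda>x. ennreal \<bar>f i x\<bar>)))"

definition maximal_bounded :: "'a measure \<Rightarrow> ('a \<Rightarrow> 'a \<Rightarrow> real) \<Rightarrow> nat \<Rightarrow> real \<Rightarrow>
    (nat \<Rightarrow> 'a \<Rightarrow> real) \<Rightarrow> ('a \<Rightarrow> real) \<Rightarrow> (nat \<Rightarrow> 'a \<Rightarrow> ennreal) \<Rightarrow> ('a \<Rightarrow> ennreal) \<Rightarrow> bool" where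
  "maximal_bounded M d m \<eta> ps q ws w \<longleftrightarrow> (\<exists>C<\<infinity>. maximal_bound M d m \<eta> ps q ws w C)"

definition maximal_opnorm :: "'a measure \<Rightarrow> ('a \<Rightarrow> 'a \<Rightarrow> real) \<Rightarrow> nat \<Rightarrow> real \<Rightarrow>
    (nat \<Rightarrow> 'a \<Rightarrow> real) \<Rightarrow> ('a \<Rightarrow> real) \<Rightarrow> (nat \<Rightarrow> 'a \<Rightarrow> ennreal) \<Rightarrow> ('a \<Rightarrow> ennreal) \<Rightarrow> ennreal" where
  "maximal_opnorm M d m \<eta> ps q ws w = Inf {C. maximal_bound M d m \<eta> ps q ws w C}"

end

theory Submission
  imports Defs
begin

text \<open>
  Necessity tests the operator on the extremal functions of the conjugate norms, which gives the
  lower bound with constant $1$.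

  For sufficiency put $\sigma_i = \omega_i^{-p_i'}$ and $W = \omega^q$. Since
  $\omega \prod_i \omega_i^{-1} = 1$ and the reciprocals of $q, p_1', \dots, p_m'$ add up to the
  constant $m - \eta$, Young's inequality on a subset $E$ of a ball $B$ shows that the modulars of
  $E$, normalised by the norms of the ball, are at least $c (\mu(E)/\mu(B))^D$. This replaces the
  theory of $A_\infty$ weights: together with log-Hoelder continuity it makes $\sigma_i(B)$ and $W(B)$
  comparable to powers of the norms, and the measures $\sigma_i$ and $W$ doubling.
  The weight condition bounds the average over $B$ by a constant times
  $\prod_i A_i / \|\omega\chi_B\|_q$, where $A_i = \int_B |f_i| \, d\mu / \|\omega_i^{-1}\chi_B\|_{p_i'}$ is
  bounded, so Young's inequality again separates the $m$ functions. For one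
  function, $A_i^{p_i(x)}$ is at most $\sigma(B) \langle h\rangle_{B,\sigma}^s$ with $s > 1$ and
  $h \in L^s(\sigma)$, up to an integrable error at infinity. Finally, as in Lerner's
  proof of Buckley's theorem, $\frac{\sigma(B)}{W(B)} \langle h\rangle_{B,\sigma}^s$ is at most a
  constant times $(\langle H \rangle_{B,W})^2$ with $H = (M_\sigma h)^{s/2} (\sigma/W)^{1/2}$,
  and the maximal theorems for $\sigma$ and $W$ conclude.
\<close>

section \<open>Geometry of spaces of homogeneous type\<close>

text \<open>An exponent may be frozen on a ball at the cost of a constant factor if the logarithm of
  the base is of the order of \<open>\<Lambda> z r\<close>, since log-Hoelder oscillation on the
  ball is of order \<open>1 / \<Lambda> z r\<close>. This works for balls that are small against
  their distance from the base point. On large balls around the base point the exponent is frozen at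
  its limit instead, and an error \<open>tail t x\<close> remains. The densities grow at most
  polynomially, so a large \<open>t\<close> makes all these errors integrable. This is why arbitrary
  balls are traded for a countable family of these two kinds. The trade also gives a measurable
  supremum, estimated first over finite subfamilies. Since \<open>q\<close> may be below 1, duality
  on the target side is avoided: everything is done with modulars, and a modular bound becomes a
  norm bound because \<open>q\<close> is bounded below. The square root in \<open>H\<close> is what
  makes the last step close: the square of \<open>H\<close> times \<open>W\<close> is (M_sigma h)^s
  times sigma, so \<open>H\<close> lies in the L^2 space of \<open>W\<close> exactly by the maximal
  theorem for sigma in L^s, where \<open>s > 1\<close> is a lower bound of the exponent of the
  function.\<close>

lemma powr_perturb:
  fixes y :: real
  assumes L: "1 \<le> L" and H: "0 \<le> H" and ab: "\<bar>\<alpha> - \<beta>\<bar> \<le> H / L"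
    and al: "0 < al" "al \<le> \<alpha>" and y: "0 \<le> y" "y \<le> Y" and Y: "1 \<le> Y"
    and eps: "0 < \<epsilon>" "\<epsilon> \<le> 1" and t: "0 \<le> t"
  shows "y powr \<alpha> \<le> exp (H * (ln Y + (t + ln (1 / \<epsilon>)) / al)) * y powr \<beta> + \<epsilon> * exp (- t * L)"
\<comment> \<open>The error term disposes of small values. If \<open>y powr \<alpha>\<close> exceeds
  it, then \<open>ln y\<close> is at least a negative multiple of \<open>L\<close>, while
  \<open>ln Y\<close> bounds it above, so
  \<open>\<bar>\<alpha> - \<beta>\<bar> * \<bar>ln y\<bar>\<close> is bounded independently of
  \<open>L\<close>.\<close>
proof (cases "y powr \<alpha> \<le> \<epsilon> * exp (- t * L)")
  case True
  moreover have "0 \<le> exp (H * (ln Y + (t + ln (1 / \<epsilon>)) / al)) * y powr \<beta>" by simp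
  ultimately show ?thesis by linarith
next
  case False
  with eps have "y powr \<alpha> \<noteq> 0"
    by (metis exp_gt_zero less_eq_real_def mult_pos_pos)
  then have y0: "0 < y" using y by auto
  have l0: "0 \<le> ln (1 / \<epsilon>)" using eps by simp
  have "ln (\<epsilon> * exp (- t * L)) < ln (y powr \<alpha>)"
    using False eps y0 by (subst ln_less_cancel_iff) auto
  then have 1: "- (\<alpha> * ln y) < t * L + ln (1 / \<epsilon>)"
    using eps y0 by (simp add: ln_mult ln_powr ln_div)
  have 2: "- ln y \<le> (t + ln (1 / \<epsilon>)) / al * L"
  proof (cases "0 \<le> ln y")
    case True
    have "0 \<le> (t + ln (1 / \<epsilon>)) / al * L" using t l0 al L by simp
    with True show ?thesis by linarith
  next
    case False
    have "al * (- ln y) \<le> \<alpha> * (- ln y)" using False al by (intro mult_right_mono) auto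
    also have "\<dots> \<le> t * L + ln (1 / \<epsilon>)" using 1 by simp
    also have "\<dots> \<le> (t + ln (1 / \<epsilon>)) * L"
      using mult_left_mono[OF L l0] by (simp add: algebra_simps)
    finally show ?thesis using al by (simp add: field_simps)
  qed
  have lnY: "0 \<le> ln Y" using Y by simp
  have 3: "ln y \<le> ln Y * L"
  proof -
    have "ln y \<le> ln Y" using y y0 by simp
    also have "\<dots> \<le> ln Y * L" using mult_left_mono[OF L lnY] by simp
    finally show ?thesis .
  qed
  have q0: "0 \<le> (t + ln (1 / \<epsilon>)) / al * L" using t l0 al L by simp
  have q1: "0 \<le> ln Y * L" using lnY L by simp
  have 4: "\<bar>ln y\<bar> \<le> (ln Y + (t + ln (1 / \<epsilon>)) / al) * L"
    unfolding distrib_right using 2 3 q0 q1 by linarith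
  have "(\<alpha> - \<beta>) * ln y \<le> \<bar>\<alpha> - \<beta>\<bar> * \<bar>ln y\<bar>" by (metis abs_ge_self abs_mult)
  also have "\<dots> \<le> (H / L) * ((ln Y + (t + ln (1 / \<epsilon>)) / al) * L)"
    using ab 4 H L by (intro mult_mono) auto
  also have "\<dots> = H * (ln Y + (t + ln (1 / \<epsilon>)) / al)" using L by (simp add: field_simps)
  finally have "exp ((\<alpha> - \<beta>) * ln y) \<le> exp (H * (ln Y + (t + ln (1 / \<epsilon>)) / al))" by simp
  then have "exp ((\<alpha> - \<beta>) * ln y) * y powr \<beta> \<le> exp (H * (ln Y + (t + ln (1 / \<epsilon>)) / al)) * y powr \<beta>"
    by (intro mult_right_mono) auto
  moreover have "exp ((\<alpha> - \<beta>) * ln y) * y powr \<beta> = y powr \<alpha>"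
    using y0 by (simp add: powr_def exp_add[symmetric] algebra_simps)
  moreover have "0 \<le> \<epsilon> * exp (- t * L)" using eps by simp
  ultimately show ?thesis by linarith
qed

lemma powr_exponent_change:
  fixes y :: real
  assumes "0 < y" "\<bar>ln y\<bar> * \<bar>\<alpha> - \<beta>\<bar> \<le> C"
  shows "y powr \<alpha> \<le> exp C * y powr \<beta>"
proof -
  have "(\<alpha> - \<beta>) * ln y \<le> C"
    using assms(2) by (metis abs_ge_self abs_mult mult.commute order_trans)
  then have "exp ((\<alpha> - \<beta>) * ln y) * y powr \<beta> \<le> exp C * y powr \<beta>"
    by (intro mult_right_mono) auto
  moreover have "exp ((\<alpha> - \<beta>) * ln y) * y powr \<beta> = y powr \<alpha>"
    using assms(1) by (simp add: powr_def exp_add[symmetric] algebra_simps)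
  ultimately show ?thesis by simp
qed

text \<open>Dilating the argument costs only a constant factor in a logarithmic modulus, so radii
  may be changed by constant factors in log-Hoelder bounds.\<close>

lemma ln_affine_le:
  fixes y :: real
  assumes "0 \<le> y" "1 \<le> B"
  shows "ln (exp 1 + B * y) \<le> (1 + ln B) * ln (exp 1 + y)"
proof -
  have e: "1 \<le> ln (exp 1 + y)"
    using assms by (metis add.right_neutral add_mono_thms_linordered_semiring(2) exp_gt_zero ln_exp ln_mono)
  have "exp 1 * 1 \<le> exp 1 * B" using assms by (intro mult_left_mono) auto
  then have "exp 1 + B * y \<le> B * (exp 1 + y)" by (simp add: algebra_simps)
  moreover have "0 < exp 1 + B * y" using assms by (simp add: add_pos_nonneg)
  ultimately have "ln (exp 1 + B * y) \<le> ln (B * (exp 1 + y))" by simp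
  also have "\<dots> = ln B + ln (exp 1 + y)"
    using assms add_pos_nonneg[of "exp 1" y] by (subst ln_mult) auto
  also have "\<dots> \<le> ln B * ln (exp 1 + y) + ln (exp 1 + y)"
    using mult_left_mono[OF e, of "ln B"] assms by simp
  finally show ?thesis by (simp add: algebra_simps)
qed

lemma one_le_ln_e_add: "0 \<le> (y::real) \<Longrightarrow> 1 \<le> ln (exp 1 + y)"
  by (metis add.right_neutral add_mono_thms_linordered_semiring(2) exp_gt_zero ln_exp ln_mono)

section \<open>Balls, dilations and power weights around a base point\<close>

locale hom_type =
  fixes M :: "'a measure" and d :: "'a \<Rightarrow> 'a \<Rightarrow> real" and A :: real and Cd :: real and o' :: 'a
  assumes A: "1 \<le> A"
    and d_nonneg: "\<And>x y. x \<in> space M \<Longrightarrow> y \<in> space M \<Longrightarrow> 0 \<le> d x y"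
    and d_refl: "\<And>x. x \<in> space M \<Longrightarrow> d x x = 0"
    and d_sym: "\<And>x y. x \<in> space M \<Longrightarrow> y \<in> space M \<Longrightarrow> d x y = d y x"
    and d_tri: "\<And>x y z. x \<in> space M \<Longrightarrow> y \<in> space M \<Longrightarrow> z \<in> space M \<Longrightarrow>
                  d x y \<le> A * (d x z + d z y)"
    and ball_sets: "\<And>x r. x \<in> space M \<Longrightarrow> 0 < r \<Longrightarrow> qball (space M) d x r \<in> sets M"
    and ball_pos: "\<And>x r. x \<in> space M \<Longrightarrow> 0 < r \<Longrightarrow> 0 < emeasure M (qball (space M) d x r)"
    and ball_fin: "\<And>x r. x \<in> space M \<Longrightarrow> 0 < r \<Longrightarrow> emeasure M (qball (space M) d x r) < \<infinity>"
    and Cd: "1 \<le> Cd"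
    and doubling: "\<And>x r. x \<in> space M \<Longrightarrow> 0 < r \<Longrightarrow>
          measure M (qball (space M) d x (2 * r)) \<le> Cd * measure M (qball (space M) d x r)"
    and origin: "o' \<in> space M"
begin

abbreviation "X \<equiv> space M"
abbreviation "B x r \<equiv> qball (space M) d x r"

lemma in_B [simp]: "y \<in> B x r \<longleftrightarrow> y \<in> X \<and> d x y < r"
  by (auto simp: qball_def)

lemma B_subset_X: "B x r \<subseteq> X" by auto

lemma mB_pos: "x \<in> X \<Longrightarrow> 0 < r \<Longrightarrow> 0 < measure M (B x r)"
  using ball_pos[of x r] ball_fin[of x r] by (simp add: measure_def enn2real_positive_iff)

lemma emB: "x \<in> X \<Longrightarrow> 0 < r \<Longrightarrow> emeasure M (B x r) = ennreal (measure M (B x r))"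
  using ball_fin[of x r] by (simp add: emeasure_eq_ennreal_measure)

lemma B_fmeasurable: "x \<in> X \<Longrightarrow> 0 < r \<Longrightarrow> B x r \<in> fmeasurable M"
  using ball_fin ball_sets by (intro fmeasurableI) auto

lemma measure_sub_B:
  "x \<in> X \<Longrightarrow> 0 < r \<Longrightarrow> E \<in> sets M \<Longrightarrow> E \<subseteq> B x r \<Longrightarrow> measure M E \<le> measure M (B x r)"
  by (intro measure_mono_fmeasurable B_fmeasurable) auto

lemma emeasure_sub_B:
  assumes "x \<in> X" "0 < r" "E \<in> sets M" "E \<subseteq> B x r"
  shows "emeasure M E = ennreal (measure M E)"
proof -
  have "emeasure M E \<le> emeasure M (B x r)" using assms ball_sets by (intro emeasure_mono) auto
  then have "emeasure M E < \<infinity>" using ball_fin[OF assms(1,2)] by (simp add: order_le_less_trans)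
  then show ?thesis by (simp add: emeasure_eq_ennreal_measure)
qed

lemma measure_B_mono:
  assumes "x \<in> X" "0 < r" "y \<in> X" "0 < s" "B y s \<subseteq> B x r"
  shows "measure M (B y s) \<le> measure M (B x r)"
  using assms ball_sets by (intro measure_sub_B) auto

lemma doubling_power: "x \<in> X \<Longrightarrow> 0 < r \<Longrightarrow> measure M (B x (2 ^ k * r)) \<le> Cd ^ k * measure M (B x r)"
proof (induction k)
  case (Suc k)
  have "measure M (B x (2 ^ Suc k * r)) \<le> Cd * measure M (B x (2 ^ k * r))"
    using doubling[of x "2 ^ k * r"] Suc.prems by (simp add: mult.assoc)
  also have "\<dots> \<le> Cd * (Cd ^ k * measure M (B x r))" using Suc Cd by (intro mult_left_mono) auto
  finally show ?case by (simp add: mult.assoc)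
qed simp

text \<open>The doubling dimension: \<open>doubling_dilate\<close> bounds the growth of the measure
  of a ball under dilation by a power with this exponent.\<close>

definition "Dm = log 2 Cd"

lemma Dm_nonneg: "0 \<le> Dm" using Cd by (simp add: Dm_def)

lemma doubling_dilate:
  assumes x: "x \<in> X" and r: "0 < r" and l: "1 \<le> l"
  shows "measure M (B x (l * r)) \<le> Cd * l powr Dm * measure M (B x r)"
proof -
  define k where "k = nat \<lceil>log 2 l\<rceil>"
  have l2: "0 \<le> log 2 l" using l by simp
  have k1: "log 2 l \<le> real k" unfolding k_def using l2 by linarith
  have k2: "real k \<le> log 2 l + 1" unfolding k_def using l2 by linarith
  have lk: "l \<le> 2 ^ k" using k1 l by (simp add: log_le_iff powr_realpow)
  have "measure M (B x (l * r)) \<le> measure M (B x (2 ^ k * r))"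
  proof (rule measure_B_mono)
    have "l * r \<le> 2 ^ k * r" using lk r by simp
    then show "B x (l * r) \<subseteq> B x (2 ^ k * r)" by (auto simp: qball_def)
  qed (use x r l in auto)
  also have "\<dots> \<le> Cd ^ k * measure M (B x r)" by (rule doubling_power[OF x r])
  also have "Cd ^ k \<le> Cd * l powr Dm"
  proof -
    have "Cd ^ k = Cd powr k" using Cd by (simp add: powr_realpow)
    also have "\<dots> \<le> Cd powr (log 2 l + 1)" using k2 Cd by (simp add: powr_mono)
    also have "\<dots> = Cd * Cd powr (log 2 l)" using Cd by (simp add: powr_add)
    also have "Cd powr (log 2 l) = l powr Dm"
      using Cd l by (simp add: Dm_def powr_def log_def field_simps)
    finally show ?thesis .
  qed
  finally show ?thesis by (simp add: mult_right_mono)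
qed

lemma B_shift:
  assumes "x \<in> X" "z \<in> X" "A * (d z x + r) \<le> s"
  shows "B x r \<subseteq> B z s"
proof
  fix y assume y: "y \<in> B x r"
  then have "d z y \<le> A * (d z x + d x y)" using assms d_tri[of z y x] by simp
  also have "\<dots> < A * (d z x + r)" using y A by simp
  finally show "y \<in> B z s" using y assms by simp
qed

lemma B_diam:
  assumes "z \<in> X" "x \<in> B z r" "y \<in> B z r"
  shows "d x y < 2 * A * r"
proof -
  have "d x y \<le> A * (d x z + d z y)" using assms d_tri[of x y z] by simp
  also have "\<dots> < A * (r + r)" using assms A d_sym[of x z] by (intro mult_strict_left_mono) auto
  finally show ?thesis by simp
qed

definition "nm x = d x o'"

lemma nm_nonneg: "x \<in> X \<Longrightarrow> 0 \<le> nm x" using d_nonneg origin by (simp add: nm_def)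

definition "L x = ln (exp 1 + nm x)"

lemma L_ge_1: "x \<in> X \<Longrightarrow> 1 \<le> L x"
  unfolding L_def using one_le_ln_e_add nm_nonneg by simp

text \<open>In closed form \<open>(exp 1 + nm x) powr (- t)\<close>, a negative power of the
  distance to \<open>o'\<close>. The exponential form matches the error term of
  \<open>powr_perturb\<close>.\<close>

definition "tail t x = exp (- t * L x)"

lemma tail_pos: "0 < tail t x" by (simp add: tail_def)

lemma tail_le_1: "0 \<le> t \<Longrightarrow> x \<in> X \<Longrightarrow> tail t x \<le> 1"
  using L_ge_1[of x] by (simp add: tail_def)

lemma tail_antimono: "t \<le> t' \<Longrightarrow> x \<in> X \<Longrightarrow> tail t' x \<le> tail t x"
  using L_ge_1[of x] by (simp add: tail_def mult_right_mono)

lemma nm_measurable [measurable]: "nm \<in> borel_measurable M"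
proof (rule borel_measurableI_less)
  fix c
  show "{x \<in> X. nm x < c} \<in> sets M"
  proof (cases "0 < c")
    case True
    have "{x \<in> X. nm x < c} = B o' c"
      using d_sym origin by (auto simp: nm_def)
    then show ?thesis using ball_sets origin True by simp
  next
    case False
    then have e: "{x \<in> X. nm x < c} = {}" using nm_nonneg by force
    show ?thesis unfolding e by simp
  qed
qed

lemma tail_measurable [measurable]: "tail t \<in> borel_measurable M"
  unfolding tail_def L_def by measurable

text \<open>Two scales at once: the position of the ball and the smallness of its radius. On
  suitable balls log-Hoelder oscillations are of order \<open>1 / \<Lambda> z r\<close> and
  logarithms of norms and measures are of order \<open>\<Lambda> z r\<close>; the products of the
  two are bounded.\<close>

definition "\<Lambda> z r = L z + ln (exp 1 + 1 / r)"

lemma \<Lambda>_ge_2: "z \<in> X \<Longrightarrow> 0 < r \<Longrightarrow> 2 \<le> \<Lambda> z r"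
  unfolding \<Lambda>_def using L_ge_1[of z] one_le_ln_e_add[of "1 / r"] by simp

text \<open>With this factor the radius contributes at most \<open>(1 + nm z) / 2\<close> in the
  quasi-triangle inequality, so the distance of the centre from \<open>o'\<close> is controlled by
  that of any point of the ball.\<close>

definition "\<kappa>1 = 1 / (2 * A)"

lemma nm_compare:
  assumes "z \<in> X" "0 < r" "r \<le> \<kappa>1 * (1 + nm z)" "y \<in> B z r"
  shows "nm z \<le> 1 + 2 * A * nm y"
proof -
  have y: "y \<in> X" "d z y < r" using assms by auto
  have "nm z \<le> A * (d z y + nm y)" using d_tri[of z o' y] y assms origin by (simp add: nm_def)
  also have "\<dots> \<le> A * (\<kappa>1 * (1 + nm z)) + A * nm y"
    unfolding distrib_left[of A "d z y"] using y assms A by (intro add_mono mult_left_mono) auto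
  also have "A * (\<kappa>1 * (1 + nm z)) = (1 + nm z) / 2" using A by (simp add: \<kappa>1_def)
  finally show ?thesis by (simp add: field_simps)
qed

lemma L_compare:
  assumes "z \<in> X" "0 < r" "r \<le> \<kappa>1 * (1 + nm z)" "y \<in> B z r"
  shows "L z \<le> (1 + ln (4 * A)) * L y"
proof -
  have y: "y \<in> X" using assms by auto
  have "nm z \<le> 1 + 2 * A * nm y" using nm_compare assms by blast
  moreover have "1 \<le> exp (1::real)" by simp
  ultimately have "exp 1 + nm z \<le> 2 * exp 1 + 2 * A * nm y" by linarith
  also have "\<dots> \<le> (4 * A) * (exp 1 + nm y)"
    using A nm_nonneg[OF y] mult_mono[of 1 A "exp 1" "exp 1::real"] by (simp add: algebra_simps add_mono)
  finally have le: "exp 1 + nm z \<le> (4 * A) * (exp 1 + nm y)" .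
  have p: "0 < exp 1 + nm z" using nm_nonneg[of z] assms by (simp add: add_pos_nonneg)
  have py: "0 < exp 1 + nm y" using nm_nonneg[OF y] by (simp add: add_pos_nonneg)
  have "L z \<le> ln ((4 * A) * (exp 1 + nm y))" unfolding L_def using le p by simp
  also have "\<dots> = ln (4 * A) + L y" unfolding L_def using A py by (subst ln_mult) auto
  also have "\<dots> \<le> ln (4 * A) * L y + L y"
    using mult_left_mono[OF L_ge_1[OF y], of "ln (4 * A)"] A by simp
  finally show ?thesis by (simp add: algebra_simps)
qed

text \<open>The class $LH$ with base point \<open>o'\<close>. The limit \<open>ainf\<close> is not unique when the space is bounded.\<close>

definition "LH a H ainf \<longleftrightarrow> 0 \<le> H \<and>
   (\<forall>x\<in>X. \<forall>y\<in>X. d x y < 1 / 2 \<longrightarrow>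
      \<bar>a x - a y\<bar> \<le> (if d x y = 0 then 0 else H / ln (exp 1 + 1 / d x y))) \<and>
   (\<forall>x\<in>X. \<bar>a x - ainf\<bar> \<le> H / L x)"

text \<open>The condition at infinity gives the order \<open>1 / L z\<close>, because
  \<open>L\<close> is bounded below on the ball by a multiple of \<open>L z\<close>. The local
  condition gives the order \<open>1 / ln (exp 1 + 1 / r)\<close> when \<open>2 * A * r\<close> is
  below 1/2; for larger radii that logarithm is bounded. Multiplied by the respective logarithms,
  the two bounds add up to one for \<open>\<Lambda> z r\<close>.\<close>

lemma LH_osc:
  assumes "LH a H ainf"
  shows "\<exists>H'\<ge>0. \<forall>z r. z \<in> X \<longrightarrow> 0 < r \<longrightarrow> r \<le> \<kappa>1 * (1 + nm z) \<longrightarrow>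
     (\<forall>x\<in>B z r. \<forall>y\<in>B z r. \<bar>a x - a y\<bar> \<le> H' / \<Lambda> z r)"
proof -
  have H: "0 \<le> H" using assms by (simp add: LH_def)
  define K1 where "K1 = 2 * (1 + ln (4 * A))"
  define K2 where "K2 = 1 + ln (2 * A)"
  define K3 where "K3 = ln (exp 1 + 4 * A)"
  have K1: "2 \<le> K1" unfolding K1_def using A by simp
  have K2: "1 \<le> K2" unfolding K2_def using A by simp
  have K3: "1 \<le> K3" unfolding K3_def using A by (intro one_le_ln_e_add) auto
  define H' where "H' = 2 * H * (K1 + K2) + H * K1 * (1 + K3)"
  have H': "0 \<le> H'" unfolding H'_def using H K1 K2 K3 by simp
  have "\<bar>a x - a y\<bar> \<le> H' / \<Lambda> z r"
    if z: "z \<in> X" and r: "0 < r" and small: "r \<le> \<kappa>1 * (1 + nm z)"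
      and x: "x \<in> B z r" and y: "y \<in> B z r" for z r x y
  proof -
    have xX: "x \<in> X" and yX: "y \<in> X" using x y by auto
    have Lz: "1 \<le> L z" using L_ge_1 z by simp
    have Lx: "H / L u \<le> H * (1 + ln (4 * A)) / L z" if "u \<in> B z r" for u
    proof -
      have "L z \<le> (1 + ln (4 * A)) * L u" by (rule L_compare[OF z r small that])
      moreover have "0 < L u" using L_ge_1[of u] that by simp
      ultimately have "H * L z \<le> (H * (1 + ln (4 * A))) * L u" "0 < L u"
        using H by (auto simp: mult.assoc intro: mult_left_mono)
      then show ?thesis using Lz by (simp add: frac_le_eq divide_le_eq pos_le_divide_eq mult.commute)
    qed
    have ax: "\<bar>a u - ainf\<bar> \<le> H / L u" if "u \<in> X" for u using assms that by (simp add: LH_def)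
    have b1: "\<bar>a x - a y\<bar> \<le> H * K1 / L z"
    proof -
      have "\<bar>a x - a y\<bar> \<le> H / L x + H / L y" using ax[OF xX] ax[OF yX] by linarith
      also have "\<dots> \<le> H * (1 + ln (4 * A)) / L z + H * (1 + ln (4 * A)) / L z"
        using Lx x y by (intro add_mono) auto
      finally show ?thesis unfolding K1_def by (simp add: field_simps)
    qed
    have l2: "1 \<le> ln (exp 1 + 1 / r)" using r by (intro one_le_ln_e_add) auto
    show ?thesis
    proof (cases "2 * A * r < 1 / 2")
      case True
      have dxy: "d x y < 2 * A * r" using B_diam[OF z x y] .
      have b2: "\<bar>a x - a y\<bar> \<le> H * K2 / ln (exp 1 + 1 / r)"
      proof (cases "d x y = 0")
        case True
        then have "\<bar>a x - a y\<bar> \<le> 0" using assms xX yX unfolding LH_def by force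
        then show ?thesis using H K2 l2 by (smt (verit) divide_nonneg_nonneg mult_nonneg_nonneg)
      next
        case False
        then have dp: "0 < d x y" using d_nonneg[OF xX yX] by simp
        have "\<bar>a x - a y\<bar> \<le> H / ln (exp 1 + 1 / d x y)"
          using assms xX yX False dxy True unfolding LH_def by (smt (verit))
        also have "\<dots> \<le> H * K2 / ln (exp 1 + 1 / r)"
        proof -
          have "1 / r \<le> (2 * A) * (1 / d x y)" using dxy dp r by (simp add: field_simps)
          then have "ln (exp 1 + 1 / r) \<le> ln (exp 1 + (2 * A) * (1 / d x y))"
            using r by (subst ln_le_cancel_iff) (auto simp: add_pos_nonneg dp A intro!: add_pos_pos mult_pos_pos divide_pos_pos less_le_trans[OF zero_less_one A])
          also have "\<dots> \<le> K2 * ln (exp 1 + 1 / d x y)"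
            unfolding K2_def using A dp by (intro ln_affine_le) auto
          finally have "ln (exp 1 + 1 / r) \<le> K2 * ln (exp 1 + 1 / d x y)" .
          moreover have "1 \<le> ln (exp 1 + 1 / d x y)" using dp by (intro one_le_ln_e_add) auto
          ultimately show ?thesis using H l2
            by (simp add: field_simps) (metis mult.assoc mult.commute mult_left_mono)
        qed
        finally show ?thesis .
      qed
      have "\<bar>a x - a y\<bar> * \<Lambda> z r = \<bar>a x - a y\<bar> * L z + \<bar>a x - a y\<bar> * ln (exp 1 + 1 / r)"
        by (simp add: \<Lambda>_def algebra_simps)
      also have "\<dots> \<le> H * K1 + H * K2"
        using b1 b2 Lz l2 by (intro add_mono) (auto simp: pos_le_divide_eq)
      also have "\<dots> \<le> H'" unfolding H'_def using H K1 K2 K3 by (simp add: algebra_simps)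
      finally show ?thesis using \<Lambda>_ge_2[OF z r] by (simp add: pos_le_divide_eq)
    next
      case False
      have "1 / r \<le> 4 * A" using False r A by (simp add: field_simps)
      then have l3: "ln (exp 1 + 1 / r) \<le> K3"
        unfolding K3_def using r A by (subst ln_le_cancel_iff) (auto simp: add_pos_pos)
      have "\<bar>a x - a y\<bar> * \<Lambda> z r = \<bar>a x - a y\<bar> * L z + \<bar>a x - a y\<bar> * ln (exp 1 + 1 / r)"
        by (simp add: \<Lambda>_def algebra_simps)
      also have "\<dots> \<le> H * K1 + (H * K1) * K3"
      proof (rule add_mono)
        show "\<bar>a x - a y\<bar> * L z \<le> H * K1" using b1 Lz by (simp add: pos_le_divide_eq)
        have "H * K1 / L z \<le> H * K1" using mult_left_mono[OF Lz, of "H * K1"] Lz H K1 by (simp add: divide_le_eq)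
        with b1 have "\<bar>a x - a y\<bar> \<le> H * K1" by linarith
        then show "\<bar>a x - a y\<bar> * ln (exp 1 + 1 / r) \<le> (H * K1) * K3"
          using l3 l2 H K1 by (intro mult_mono) auto
      qed
      also have "\<dots> \<le> H'" unfolding H'_def using H K1 K2 K3 by (simp add: algebra_simps)
      finally show ?thesis using \<Lambda>_ge_2[OF z r] by (simp add: pos_le_divide_eq)
    qed
  qed
  then show ?thesis using H' by blast
qed

end

section \<open>Countable families of balls that dominate all balls\<close>

context hom_type
begin

text \<open>Packing: the balls of radius \<open>\<epsilon> / (2 * A)\<close> around separated points
  are disjoint and lie in one fixed ball, and by doubling each of them has at least a fixed fraction
  of its measure.\<close>

lemma separated_card_bound:
  assumes R: "0 < R" and e: "0 < \<epsilon>"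
  shows "\<exists>n. \<forall>F. F \<subseteq> B o' R \<longrightarrow> finite F \<longrightarrow>
    (\<forall>x\<in>F. \<forall>y\<in>F. x \<noteq> y \<longrightarrow> \<epsilon> \<le> d x y) \<longrightarrow> card F \<le> n"
proof -
  define \<rho> where "\<rho> = \<epsilon> / (2 * A)"
  have \<rho>: "0 < \<rho>" "A * (\<rho> + \<rho>) = \<epsilon>" using e A by (auto simp: \<rho>_def field_simps)
  define S where "S = A * (R + \<rho>)"
  have S: "0 < S" using R \<rho> A by (simp add: S_def)
  define l where "l = max 1 (A * (R + S) / \<rho>)"
  define K where "K = Cd * l powr Dm"
  have K: "0 < K" unfolding K_def l_def using Cd by simp
  define b where "b = measure M (B o' S) / K"
  have b: "0 < b" unfolding b_def using K mB_pos[OF origin S] by simp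
  have small: "b \<le> measure M (B x \<rho>)" if "x \<in> B o' R" for x
  proof -
    have x: "x \<in> X" "d o' x < R" using that by auto
    have "B o' S \<subseteq> B x (l * \<rho>)"
    proof (rule B_shift[OF origin x(1)])
      have "A * (d x o' + S) \<le> A * (R + S)" using x d_sym[OF x(1) origin] A by simp
      also have "\<dots> \<le> l * \<rho>" unfolding l_def using \<rho> by (simp add: max_def field_simps)
      finally show "A * (d x o' + S) \<le> l * \<rho>" .
    qed
    then have "measure M (B o' S) \<le> measure M (B x (l * \<rho>))"
      using x \<rho> S origin by (intro measure_B_mono) (auto simp: l_def)
    also have "\<dots> \<le> K * measure M (B x \<rho>)"
      unfolding K_def using x \<rho> by (intro doubling_dilate) (auto simp: l_def)
    finally show ?thesis unfolding b_def using K by (simp add: divide_le_eq mult.commute)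
  qed
  have "card F \<le> nat \<lceil>measure M (B o' S) / b\<rceil>"
    if F: "F \<subseteq> B o' R" "finite F" "\<forall>x\<in>F. \<forall>y\<in>F. x \<noteq> y \<longrightarrow> \<epsilon> \<le> d x y" for F
  proof -
    have disj: "disjoint_family_on (\<lambda>x. B x \<rho>) F"
      unfolding disjoint_family_on_def
    proof (intro ballI impI)
      fix x y assume xy: "x \<in> F" "y \<in> F" "x \<noteq> y"
      show "B x \<rho> \<inter> B y \<rho> = {}"
      proof (rule ccontr)
        assume "B x \<rho> \<inter> B y \<rho> \<noteq> {}"
        then obtain w where w: "w \<in> X" "d x w < \<rho>" "d y w < \<rho>" by auto
        have xX: "x \<in> X" and yX: "y \<in> X" using xy F by auto
        have "d x y \<le> A * (d x w + d w y)" using d_tri xX yX w by simp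
        also have "\<dots> < A * (\<rho> + \<rho>)"
          using w d_sym[OF w(1) yX] A by (intro mult_strict_left_mono) auto
        finally show False using \<rho> F(3) xy by fastforce
      qed
    qed
    have "real (card F) * b = (\<Sum>x\<in>F. b)" by simp
    also have "\<dots> \<le> (\<Sum>x\<in>F. measure M (B x \<rho>))" using small F by (intro sum_mono) auto
    also have "\<dots> = measure M (\<Union>x\<in>F. B x \<rho>)"
    proof (rule measure_finite_Union[symmetric])
      show "(\<lambda>x. B x \<rho>) ` F \<subseteq> sets M" using F \<rho> ball_sets by auto
      show "emeasure M (B x \<rho>) \<noteq> \<infinity>" if "x \<in> F" for x
        using ball_fin[of x \<rho>] that F \<rho> by auto
    qed (use F disj in auto)
    also have "\<dots> \<le> measure M (B o' S)"
    proof (rule measure_sub_B[OF origin S])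
      show "(\<Union>x\<in>F. B x \<rho>) \<in> sets M" using F \<rho> ball_sets by (intro sets.finite_UN) auto
      have "B x \<rho> \<subseteq> B o' S" if "x \<in> F" for x
        using that F A by (intro B_shift[OF _ origin]) (auto simp: S_def)
      then show "(\<Union>x\<in>F. B x \<rho>) \<subseteq> B o' S" by blast
    qed
    finally have "real (card F) \<le> measure M (B o' S) / b" using b by (simp add: field_simps)
    then show ?thesis by linarith
  qed
  then show ?thesis by blast
qed

text \<open>A separated set of greatest cardinality is a net, because a point at distance at least
  \<open>\<epsilon>\<close> from all its members could be added. The packing bound makes the
  greatest cardinality exist.\<close>

lemma finite_net:
  assumes R: "0 < R" and e: "0 < \<epsilon>"
  shows "\<exists>F. finite F \<and> F \<subseteq> X \<and> (\<forall>z\<in>B o' R. \<exists>x\<in>F. d x z < \<epsilon>)"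
proof -
  define P where "P F \<longleftrightarrow> F \<subseteq> B o' R \<and> finite F \<and> (\<forall>x\<in>F. \<forall>y\<in>F. x \<noteq> y \<longrightarrow> \<epsilon> \<le> d x y)" for F
  from separated_card_bound[OF R e] obtain n where
    "\<forall>F. F \<subseteq> B o' R \<longrightarrow> finite F \<longrightarrow> (\<forall>x\<in>F. \<forall>y\<in>F. x \<noteq> y \<longrightarrow> \<epsilon> \<le> d x y) \<longrightarrow> card F \<le> n" ..
  then have n: "card F \<le> n" if "P F" for F using that unfolding P_def by simp
  have "P {}" by (simp add: P_def)
  moreover have "\<forall>G. P G \<longrightarrow> card G < Suc n" using n by (simp add: less_Suc_eq_le)
  ultimately obtain F where F: "P F" and max: "\<And>G. P G \<Longrightarrow> card G \<le> card F"
    using ex_has_greatest_nat[of P "{}" card "Suc n"] by blast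
  have "\<exists>x\<in>F. d x z < \<epsilon>" if z: "z \<in> B o' R" for z
  proof (rule ccontr)
    assume "\<not> ?thesis"
    then have far: "\<forall>x\<in>F. \<epsilon> \<le> d x z" by auto
    have zX: "z \<in> X" using z by auto
    have "z \<notin> F" using far d_refl[OF zX] e by force
    have sub: "F \<subseteq> X" using F by (auto simp: P_def)
    have "\<epsilon> \<le> d z x" if "x \<in> F" for x
      using far that d_sym[of z x] zX sub by auto
    then have "P (insert z F)"
      unfolding P_def using F far z by (auto simp: P_def)
    then have "card (insert z F) \<le> card F" by (rule max)
    with \<open>z \<notin> F\<close> F show False by (simp add: P_def)
  qed
  moreover have "finite F" "F \<subseteq> X" using F by (auto simp: P_def)
  ultimately show ?thesis by blast
qed

text \<open>Centres from finite nets of the balls around \<open>o'\<close> and rational scales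
  suffice. Trading a ball for a comparable larger one costs a constant in the averages and leaves a
  countable, hence measurable, supremum.\<close>

lemma countable_ball_family:
  "\<exists>S C. countable S \<and> S \<subseteq> X \<times> {0<..} \<and>
    (\<forall>z\<in>X. \<forall>r>0. \<exists>(x, s)\<in>S. B z r \<subseteq> B x s \<and> measure M (B x s) \<le> C * measure M (B z r))"
proof -
  have "\<exists>F. \<forall>n \<epsilon>. 0 < \<epsilon> \<longrightarrow> finite (F n \<epsilon>) \<and> F n \<epsilon> \<subseteq> X \<and>
      (\<forall>z\<in>B o' (real (Suc n)). \<exists>x\<in>F n \<epsilon>. d x z < \<epsilon>)"
    by (intro choice allI) (simp add: finite_net del: in_B of_nat_Suc)
  then obtain F where F: "\<And>n \<epsilon>. 0 < \<epsilon> \<Longrightarrow> finite (F n \<epsilon>) \<and> F n \<epsilon> \<subseteq> X \<and>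
      (\<forall>z\<in>B o' (real (Suc n)). \<exists>x\<in>F n \<epsilon>. d x z < \<epsilon>)" by blast
  have Ff: "finite (F n \<epsilon>)" and Fs: "F n \<epsilon> \<subseteq> X"
    and Fn: "\<forall>z\<in>B o' (real (Suc n)). \<exists>x\<in>F n \<epsilon>. d x z < \<epsilon>"
    if "0 < \<epsilon>" for n \<epsilon>
    using F[OF that] by blast+
  define K where "K = Cd * (6 * A * A) powr Dm"
  \<comment> \<open>The radius \<open>2 * A * \<epsilon>\<close> makes room for a centre displaced
    by less than \<open>\<epsilon>\<close>. For \<open>r < \<epsilon> < 2 * r\<close> the new ball
    still lies in the dilate of the old one by \<open>6 * A * A\<close>.\<close>
  define S where "S = (\<Union>n. \<Union>\<epsilon>\<in>\<rat> \<inter> {0<..}. F n \<epsilon> \<times> {2 * A * \<epsilon>})"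
  have "countable S"
    unfolding S_def
  proof (intro countable_UN countable_Int1 countable_rat)
    fix n and \<epsilon> :: real assume "\<epsilon> \<in> \<rat> \<inter> {0<..}"
    then have "finite (F n \<epsilon>)" using Ff by simp
    then show "countable (F n \<epsilon> \<times> {2 * A * \<epsilon>})" by (intro countable_finite) simp
  qed simp
  moreover have "S \<subseteq> X \<times> {0<..}"
  proof
    fix p assume "p \<in> S"
    then obtain n \<epsilon> where "0 < \<epsilon>" "p \<in> F n \<epsilon> \<times> {2 * A * \<epsilon>}" by (auto simp: S_def)
    then show "p \<in> X \<times> {0<..}" using Fs[of \<epsilon> n] A by auto
  qed
  moreover have "\<exists>(x, s)\<in>S. B z r \<subseteq> B x s \<and>
      measure M (B x s) \<le> K * measure M (B z r)"
    if z: "z \<in> X" and r: "0 < r" for z r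
  proof -
    obtain \<epsilon> where e: "\<epsilon> \<in> \<rat>" "r < \<epsilon>" "\<epsilon> < 2 * r"
      using Rats_dense_in_real[of r "2 * r"] r by auto
    obtain n where n: "d o' z < real n" using reals_Archimedean2 by blast
    then have "z \<in> B o' (real (Suc n))" using z by simp
    moreover have "\<forall>z\<in>B o' (real (Suc n)). \<exists>x\<in>F n \<epsilon>. d x z < \<epsilon>" using Fn[of \<epsilon> n] e r by simp
    ultimately obtain x where x: "x \<in> F n \<epsilon>" "d x z < \<epsilon>" by blast
    have xX: "x \<in> X" using Fs[of \<epsilon> n] e r x by auto
    have mem: "(x, 2 * A * \<epsilon>) \<in> S" unfolding S_def using x e r by (intro UN_I[of n] UN_I[of \<epsilon>]) auto
    have sub: "B z r \<subseteq> B x (2 * A * \<epsilon>)"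
    proof (rule B_shift[OF z xX])
      have "A * (d x z + r) \<le> A * (\<epsilon> + \<epsilon>)" using x e A by (intro mult_left_mono) auto
      then show "A * (d x z + r) \<le> 2 * A * \<epsilon>" by simp
    qed
    have "B x (2 * A * \<epsilon>) \<subseteq> B z ((6 * A * A) * r)"
    proof (rule B_shift[OF xX z])
      have AA: "A \<le> A * A" using A mult_left_mono[of 1 A A] by simp
      have "A * (d z x + 2 * A * \<epsilon>) \<le> A * (\<epsilon> + 2 * A * \<epsilon>)"
        using x A d_sym[OF z xX] by (intro mult_left_mono) auto
      also have "\<dots> = (A + 2 * (A * A)) * \<epsilon>" by (simp add: algebra_simps)
      also have "\<dots> \<le> (3 * (A * A)) * (2 * r)" using AA e r A by (intro mult_mono) auto
      finally show "A * (d z x + 2 * A * \<epsilon>) \<le> (6 * A * A) * r" by simp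
    qed
    then have "measure M (B x (2 * A * \<epsilon>)) \<le> measure M (B z ((6 * A * A) * r))"
      using xX z e r A by (intro measure_B_mono) auto
    also have "\<dots> \<le> K * measure M (B z r)"
      unfolding K_def
    proof (rule doubling_dilate[OF z r])
      have "1 * 1 \<le> A * A" using A by (intro mult_mono) auto
      then show "1 \<le> 6 * A * A" by simp
    qed
    finally have "measure M (B x (2 * A * \<epsilon>)) \<le> K * measure M (B z r)" .
    then show ?thesis using mem sub by (intro bexI[OF _ mem]) (simp only: split)
  qed
  ultimately show ?thesis by (intro exI[of _ S] exI[of _ K] conjI) simp_all
qed

text \<open>On a ball that is small relative to the distance of its centre from \<open>o'\<close> the exponents are
  controlled by their values at the centre, on a large ball around \<open>o'\<close> by their limits at infinity.
  Every other ball lies in a comparable one of the second kind.\<close>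

definition "good \<kappa> z r \<longleftrightarrow> z \<in> X \<and> 0 < r \<and> (r \<le> \<kappa> * (1 + nm z) \<or> z = o' \<and> 1 \<le> r)"

lemma countable_good_family:
  assumes k: "0 < \<kappa>"
  shows "\<exists>S C. countable S \<and> (\<forall>(z, r)\<in>S. good \<kappa> z r) \<and> 1 \<le> C \<and>
    (\<forall>z\<in>X. \<forall>r>0. \<exists>(x, s)\<in>S. B z r \<subseteq> B x s \<and> measure M (B x s) \<le> C * measure M (B z r))"
proof -
  obtain S C where S: "countable S" "S \<subseteq> X \<times> {0<..}"
    and cov: "\<And>z r. z \<in> X \<Longrightarrow> 0 < r \<Longrightarrow>
      \<exists>(x, s)\<in>S. B z r \<subseteq> B x s \<and> measure M (B x s) \<le> C * measure M (B z r)"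
    using countable_ball_family by blast
  define T where "T = {(z, r). (z, r) \<in> S \<and> good \<kappa> z r} \<union> (\<lambda>n. (o', real (Suc n))) ` UNIV"
  \<comment> \<open>\<open>K * s\<close> will bound the integer radius chosen around
    \<open>o'\<close> for a ball that is not good. The first summand comes from
    \<open>nm x \<le> s / \<kappa>\<close>, the second pays for rounding, as
    \<open>1 \<le> s / \<kappa>\<close> for such a ball. Integer radii keep the family
    countable.\<close>
  define K where "K = A * (1 / \<kappa> + 1) + 2 / \<kappa>"
  have K: "0 < K" unfolding K_def using k A by (simp add: add_pos_pos)
  define l where "l = max 1 (A * (1 / \<kappa> + K))"
  define C' where "C' = max 1 (max 1 (Cd * l powr Dm) * max C 1)"
  have "countable {(z, r). (z, r) \<in> S \<and> good \<kappa> z r}"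
    by (rule countable_subset[OF _ S(1)]) auto
  then have "countable T" unfolding T_def by simp
  moreover have "\<forall>(z, r)\<in>T. good \<kappa> z r" unfolding T_def using origin by (auto simp: good_def)
  moreover have "1 \<le> C'" by (simp add: C'_def)
  moreover have "\<exists>(x, s)\<in>T. B z r \<subseteq> B x s \<and> measure M (B x s) \<le> C' * measure M (B z r)"
    if z: "z \<in> X" and r: "0 < r" for z r
  proof -
    obtain x s where xs: "(x, s) \<in> S" "B z r \<subseteq> B x s"
      "measure M (B x s) \<le> C * measure M (B z r)" using cov[OF z r] by auto
    have x: "x \<in> X" and s: "0 < s" using xs S by auto
    have m0: "0 < measure M (B z r)" using mB_pos z r by simp
    have Cm: "measure M (B x s) \<le> max C 1 * measure M (B z r)"
      using xs(3) m0 by (smt (verit) mult_right_mono)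
    show ?thesis
    proof (cases "good \<kappa> x s")
      case True
      have "measure M (B x s) \<le> C' * measure M (B z r)"
      proof (rule order_trans[OF Cm mult_right_mono])
        have "1 * max C 1 \<le> max 1 (Cd * l powr Dm) * max C 1" by (intro mult_right_mono) auto
        then show "max C 1 \<le> C'" unfolding C'_def by linarith
      qed (use m0 in auto)
      moreover have "(x, s) \<in> T" using True xs by (simp add: T_def)
      ultimately show ?thesis using xs(2) by blast
    next
      case False
      then have big: "\<kappa> * (1 + nm x) < s" using x s by (auto simp: good_def)
      have nx: "0 \<le> nm x" using nm_nonneg x by simp
      have nxs: "nm x \<le> s / \<kappa>" "1 \<le> s / \<kappa>"
        using big k mult_nonneg_nonneg[OF less_imp_le[OF k] nx] by (simp_all add: field_simps)
      define n where "n = nat \<lceil>A * (nm x + s)\<rceil>"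
      have "0 \<le> A * (nm x + s)" using A nx s by simp
      then have n1: "A * (nm x + s) \<le> real (Suc n)" and n2: "real (Suc n) \<le> A * (nm x + s) + 2"
        unfolding n_def by linarith+
      have n3: "real (Suc n) \<le> K * s"
      proof -
        have "A * (nm x + s) + 2 \<le> A * (s / \<kappa> + s) + 2 * (s / \<kappa>)"
          using A nxs by (intro add_mono mult_left_mono) auto
        then show ?thesis using n2 by (simp add: K_def algebra_simps)
      qed
      have sub: "B x s \<subseteq> B o' (real (Suc n))"
        using n1 d_sym[OF x origin] by (intro B_shift[OF x origin]) (simp add: nm_def)
      have "B o' (real (Suc n)) \<subseteq> B x (l * s)"
      proof (rule B_shift[OF origin x])
        have "A * (d x o' + real (Suc n)) \<le> A * (s / \<kappa> + K * s)"
          using nxs(1) n3 A unfolding nm_def by (intro mult_left_mono add_mono) auto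
        also have "\<dots> = A * (1 / \<kappa> + K) * s" by (simp add: algebra_simps)
        also have "\<dots> \<le> l * s" unfolding l_def using s by (intro mult_right_mono) auto
        finally show "A * (d x o' + real (Suc n)) \<le> l * s" .
      qed
      then have "measure M (B o' (real (Suc n))) \<le> measure M (B x (l * s))"
        using origin x s by (intro measure_B_mono) (auto simp: l_def)
      also have "\<dots> \<le> Cd * l powr Dm * measure M (B x s)"
        by (rule doubling_dilate[OF x s]) (simp add: l_def)
      also have "\<dots> \<le> max 1 (Cd * l powr Dm) * (max C 1 * measure M (B z r))"
        using Cm by (intro mult_mono) auto
      also have "\<dots> \<le> C' * measure M (B z r)"
        using m0 unfolding C'_def mult.assoc[symmetric] by (intro mult_right_mono) auto
      finally have "measure M (B o' (real (Suc n))) \<le> C' * measure M (B z r)" .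
      moreover have "(o', real (Suc n)) \<in> T" by (simp add: T_def)
      moreover have "B z r \<subseteq> B o' (real (Suc n))" using sub xs by blast
      ultimately show ?thesis by blast
    qed
  qed
  ultimately show ?thesis by (intro exI[of _ T] exI[of _ C'] conjI) simp_all
qed

lemma sigma_finite_of_balls:
  assumes "sets N = sets M" and "\<And>r. 0 < r \<Longrightarrow> emeasure N (B o' r) < \<infinity>"
  shows "sigma_finite_measure N"
proof
  have "(\<Union>n. B o' (real (Suc n))) = X"
  proof safe
    fix x assume x: "x \<in> X"
    obtain n where "d o' x < real n" using reals_Archimedean2 by blast
    then have "x \<in> B o' (real (Suc n))" using x by simp
    then show "x \<in> (\<Union>n. B o' (real (Suc n)))" by blast
  qed auto
  then show "\<exists>W. countable W \<and> W \<subseteq> sets N \<and> \<Union> W = space N \<and> (\<forall>a\<in>W. emeasure N a \<noteq> \<infinity>)"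
    using assms ball_sets origin sets_eq_imp_space_eq[OF assms(1)]
    by (intro exI[of _ "range (\<lambda>n. B o' (real (Suc n)))"])
      (auto simp: less_top[symmetric] intro: less_imp_neq)
qed

text \<open>The dilation factor in the Vitali covering lemma for a quasi-metric.\<close>

definition "\<theta> = 3 * A * A"

lemma \<theta>_ge_1: "1 \<le> \<theta>"
  using A mult_mono[of 1 A 1 A] by (simp add: \<theta>_def)

text \<open>Greedy choice by largest radius. A discarded ball meets a chosen ball of radius
  \<open>r\<close> at least as large as its own. Crossing the discarded ball costs less than
  \<open>2 * A * r\<close>, and reaching it from the chosen centre gives
  \<open>A * (r + 2 * A * r)\<close>, which is at most \<open>\<theta> * r\<close>.\<close>

lemma finite_vitali:
  assumes "finite W" "\<And>z r. (z, r) \<in> W \<Longrightarrow> z \<in> X \<and> 0 < r"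
  shows "\<exists>S\<subseteq>W. disjoint_family_on (\<lambda>(z, r). B z r) S \<and>
     (\<Union>(z, r)\<in>W. B z r) \<subseteq> (\<Union>(z, r)\<in>S. B z (\<theta> * r))"
  using assms
proof (induction "card W" arbitrary: W rule: less_induct)
  case (less W)
  show ?case
  proof (cases "W = {}")
    case False
    obtain p where p: "p \<in> W" and pmax: "\<And>q. q \<in> W \<Longrightarrow> snd q \<le> snd p"
    proof -
      have "Max (snd ` W) \<in> snd ` W" using less False by (intro Max_in) auto
      then obtain p where "p \<in> W" "snd p = Max (snd ` W)" by auto
      then show thesis using that[of p] less(2) by auto
    qed
    obtain z r where zr: "p = (z, r)" by force
    have z: "z \<in> X" and r: "0 < r" using less(3) p zr by auto
    define W' where "W' = {(x, s). (x, s) \<in> W \<and> B x s \<inter> B z r = {}}"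
    have "z \<in> B z r" using z r d_refl by simp
    then have "p \<notin> W'" unfolding W'_def zr by auto
    then have "W' \<subset> W" using p unfolding W'_def by auto
    moreover have W': "finite W'" by (rule finite_subset[OF _ less(2)]) (auto simp: W'_def)
    ultimately have "card W' < card W" using less(2) by (intro psubset_card_mono) auto
    from less(1)[OF this W'] less(3) obtain S where S: "S \<subseteq> W'"
      "disjoint_family_on (\<lambda>(z, r). B z r) S"
      "(\<Union>(z, r)\<in>W'. B z r) \<subseteq> (\<Union>(z, r)\<in>S. B z (\<theta> * r))"
      unfolding W'_def by blast
    have "disjoint_family_on (\<lambda>(z, r). B z r) (insert p S)"
      unfolding disjoint_family_on_def
    proof (intro ballI impI)
      fix i j assume ij: "i \<in> insert p S" "j \<in> insert p S" "i \<noteq> j"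
      have pS: "(case i of (z, r) \<Rightarrow> B z r) \<inter> B z r = {}" if "i \<in> S" for i
        using S(1) that unfolding W'_def by auto
      from ij consider "i = p" "j \<in> S" | "j = p" "i \<in> S" | "i \<in> S" "j \<in> S" by blast
      then show "(case i of (z, r) \<Rightarrow> B z r) \<inter> (case j of (z, r) \<Rightarrow> B z r) = {}"
      proof cases
        case 1 then show ?thesis using pS[of j] zr by (simp add: Int_commute)
      next
        case 2 then show ?thesis using pS[of i] zr by simp
      next
        case 3 then show ?thesis using S(2) ij(3) unfolding disjoint_family_on_def by blast
      qed
    qed
    moreover have "insert p S \<subseteq> W" using S(1) p by (auto simp: W'_def)
    moreover have "(\<Union>(z, r)\<in>W. B z r) \<subseteq> (\<Union>(z, r)\<in>insert p S. B z (\<theta> * r))"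
    proof
      fix y assume "y \<in> (\<Union>(z, r)\<in>W. B z r)"
      then obtain x s where xs: "(x, s) \<in> W" "y \<in> B x s" by auto
      have xX: "x \<in> X" using xs less(3) by auto
      show "y \<in> (\<Union>(z, r)\<in>insert p S. B z (\<theta> * r))"
      proof (cases "(x, s) \<in> W'")
        case True
        then show ?thesis using S(3) xs by blast
      next
        case False
        then obtain w where w: "w \<in> X" "d x w < s" "d z w < r" using xs by (auto simp: W'_def)
        have sr: "s \<le> r" using pmax[OF xs(1)] zr by simp
        have yX: "y \<in> X" using xs by simp
        have "d w y < 2 * A * s" using B_diam[OF xX, of w s y] w xs by simp
        also have "\<dots> \<le> 2 * A * r" using sr A by simp
        finally have wy: "d w y < 2 * A * r" .
        have "d z y \<le> A * (d z w + d w y)" using d_tri z yX w by simp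
        also have "\<dots> < A * (r + 2 * A * r)" using w wy A by (intro mult_strict_left_mono) auto
        also have "\<dots> \<le> \<theta> * r"
          using mult_right_mono[of A "A * A" r] mult_left_mono[of 1 A A] A r
          by (simp add: \<theta>_def algebra_simps)
        finally have "y \<in> B z (\<theta> * r)" using yX by simp
        then show ?thesis using zr by auto
      qed
    qed
    ultimately show ?thesis by blast
  qed (auto simp: disjoint_family_on_def)
qed

text \<open>The average is a real number, so an infinite integral is read as 0; finiteness of the
  integral is a separate hypothesis where it matters.\<close>

definition "avg N h E = enn2real (\<integral>\<^sup>+x\<in>E. ennreal (h x) \<partial>N) / measure N E"

text \<open>The maximal function of a finite family of balls is a maximum of finitely many simple
  functions. The inserted 0 covers points outside all the balls and the empty family. Bounds uniform
  in \<open>W\<close> later pass to countable families by monotone convergence.\<close>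

definition "MW N W h x = Max (insert 0 ((\<lambda>(z, r). avg N h (B z r) * indicator (B z r) x) ` W))"

lemma avg_nonneg: "0 \<le> avg N h E"
  by (simp add: avg_def)

lemma MW_nonneg: "finite W \<Longrightarrow> 0 \<le> MW N W h x"
  by (simp add: MW_def)

lemma MW_ge:
  assumes "finite W" "(z, r) \<in> W" "x \<in> B z r"
  shows "avg N h (B z r) \<le> MW N W h x"
proof -
  have "(case (z, r) of (z, r) \<Rightarrow> avg N h (B z r) * indicator (B z r) x) \<le> MW N W h x"
    unfolding MW_def using assms(1,2) by (intro Max_ge insertI2 imageI) auto
  then show ?thesis using assms(3) by (simp del: in_B)
qed

lemma MW_gt:
  assumes "finite W" "0 \<le> u" "u < MW N W h x"
  shows "\<exists>(z, r)\<in>W. x \<in> B z r \<and> u < avg N h (B z r)"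
proof -
  have "MW N W h x \<in> insert 0 ((\<lambda>(z, r). avg N h (B z r) * indicator (B z r) x) ` W)"
    unfolding MW_def using assms(1) by (intro Max_in) auto
  then obtain z r where zr: "(z, r) \<in> W" "u < avg N h (B z r) * indicator (B z r) x"
    using assms(2,3) by auto
  then have "x \<in> B z r" using assms(2) by (cases "x \<in> B z r") (simp_all del: in_B)
  then show ?thesis using zr by (intro bexI[of _ "(z, r)"]) simp_all
qed

lemma MW_measurable:
  assumes "finite W" "\<And>z r. (z, r) \<in> W \<Longrightarrow> z \<in> X \<and> 0 < r"
  shows "MW N W h \<in> borel_measurable M"
proof -
  have "(\<lambda>x. case p of (z, r) \<Rightarrow> avg N h (B z r) * (indicator (B z r) x :: real)) \<in> borel_measurable M"
    if "p \<in> W" for p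
  proof -
    obtain z r where "p = (z, r)" by force
    then show ?thesis using that assms(2)[of z r] ball_sets[of z r] by simp
  qed
  \<comment> \<open>The inserted 0 is indexed by \<open>None\<close>, which writes the maximum as
    one over a finite nonempty index set.\<close>
  then have "(\<lambda>x. Max ((\<lambda>i. case i of None \<Rightarrow> 0 | Some p \<Rightarrow> (case p of (z, r) \<Rightarrow> avg N h (B z r) * (indicator (B z r) x :: real)))
     ` insert None (Some ` W))) \<in> borel_measurable M"
    using assms(1) by (intro borel_measurable_Max) (auto split: option.split)
  then show ?thesis unfolding MW_def[abs_def] by (simp add: image_image)
qed

end

section \<open>The Hardy--Littlewood maximal theorem for doubling measures\<close>

text \<open>A layer-cake bound in the variable \<open>u\<close>, where the level is
  \<open>u powr (1 / (s - 1))\<close>; keeping only the upper half of the interval gives the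
  constant. In this variable the weight of the integral equals the level, and it will cancel the
  inverse level of the weak-type estimate.\<close>

lemma powr_le_layer_integral:
  fixes y s :: real
  assumes y: "0 \<le> y" and s: "1 < s"
  shows "ennreal (y powr s) \<le> ennreal (2 powr (1 + 1 / (s - 1))) *
    (\<integral>\<^sup>+u. ennreal (u powr (1 / (s - 1))) * (if 0 < u \<and> u < y powr (s - 1) then 1 else 0) \<partial>lborel)"
proof (cases "y = 0")
  case False
  then have y0: "0 < y" using y by simp
  define b where "b = 1 / (s - 1)"
  have b: "0 < b" using s by (simp add: b_def)
  define Y where "Y = y powr (s - 1)"
  have Y: "0 < Y" using y0 by (simp add: Y_def)
  have "ennreal ((Y / 2) powr b) * ennreal (Y / 2) =
      (\<integral>\<^sup>+u. ennreal ((Y / 2) powr b) * indicator {Y / 2<..<Y} u \<partial>lborel)"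
    using Y by (subst nn_integral_cmult) auto
  also have "\<dots> \<le> (\<integral>\<^sup>+u. ennreal (u powr b) * (if 0 < u \<and> u < Y then 1 else 0) \<partial>lborel)"
    using Y b by (intro nn_integral_mono) (auto simp: indicator_def powr_mono2 ennreal_leI)
  finally have 1: "ennreal ((Y / 2) powr b * (Y / 2)) \<le>
      (\<integral>\<^sup>+u. ennreal (u powr b) * (if 0 < u \<and> u < Y then 1 else 0) \<partial>lborel)"
    using Y by (subst ennreal_mult) auto
  have "(s - 1) * (1 + b) = s" unfolding b_def using s by (simp add: distrib_left)
  then have "y powr s = Y powr (1 + b)"
    unfolding Y_def powr_powr by simp
  also have "\<dots> = (2 * (Y / 2)) powr (1 + b)" by simp
  also have "\<dots> = 2 powr (1 + b) * (Y / 2) powr (1 + b)" using Y by (subst powr_mult) auto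
  also have "(Y / 2) powr (1 + b) = (Y / 2) powr b * (Y / 2)" using Y by (simp add: powr_add)
  finally have ys: "y powr s = 2 powr (1 + b) * ((Y / 2) powr b * (Y / 2))" .
  have "ennreal (y powr s) = ennreal (2 powr (1 + b)) * ennreal ((Y / 2) powr b * (Y / 2))"
    unfolding ys using Y by (subst ennreal_mult) auto
  also have "\<dots> \<le> ennreal (2 powr (1 + b)) *
      (\<integral>\<^sup>+u. ennreal (u powr b) * (if 0 < u \<and> u < Y then 1 else 0) \<partial>lborel)"
    using 1 by (intro mult_left_mono) auto
  finally show ?thesis unfolding b_def Y_def .
qed simp

lemma set_nn_integral_finite_of_powr:
  assumes h: "h \<in> borel_measurable N" and E: "E \<in> sets N" "emeasure N E < \<infinity>" and s: "1 \<le> (s::real)"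
    and fin: "(\<integral>\<^sup>+x. ennreal (h x powr s) \<partial>N) < \<infinity>"
  shows "(\<integral>\<^sup>+x\<in>E. ennreal (h x) \<partial>N) < \<infinity>"
proof -
  have "(\<integral>\<^sup>+x\<in>E. ennreal (h x) \<partial>N) \<le> (\<integral>\<^sup>+x. indicator E x + ennreal (h x powr s) \<partial>N)"
  proof (rule nn_integral_mono)
    fix x
    have "h x \<le> 1 + h x powr s"
    proof (cases "h x \<le> 1")
      case True then show ?thesis by (simp add: add_increasing2)
    next
      case False
      then have "h x powr 1 \<le> h x powr s" using s by (intro powr_mono) auto
      then show ?thesis using False by simp
    qed
    then have "ennreal (h x) \<le> 1 + ennreal (h x powr s)"
      by (metis ennreal_1 ennreal_leI ennreal_plus powr_ge_zero zero_le_one)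
    then show "ennreal (h x) * indicator E x \<le> indicator E x + ennreal (h x powr s)"
      by (auto simp: indicator_def)
  qed
  also have "\<dots> = emeasure N E + (\<integral>\<^sup>+x. ennreal (h x powr s) \<partial>N)"
    using h E by (subst nn_integral_add) auto
  also have "\<dots> < \<infinity>" using E fin by simp
  finally show ?thesis .
qed

context hom_type
begin

text \<open>Values of \<open>h\<close> up to \<open>u / 2\<close> add at most \<open>u / 2\<close>
  to any average. On a ball with average above \<open>u\<close> the larger values therefore carry at
  least half of the critical mass, and Vitali's disjoint balls sum these masses. The restriction to
  large values is what the interpolation to L^s needs.\<close>

lemma maximal_weak_type:
  assumes N: "sets N = sets M" and W: "finite W" "\<And>z r. (z, r) \<in> W \<Longrightarrow> z \<in> X \<and> 0 < r"
    and pos: "\<And>z r. (z, r) \<in> W \<Longrightarrow> 0 < emeasure N (B z r) \<and> emeasure N (B z r) < \<infinity>"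
    and dbl: "\<And>z r. (z, r) \<in> W \<Longrightarrow> emeasure N (B z (\<theta> * r)) \<le> ennreal C * emeasure N (B z r)"
    and C: "0 \<le> C"
    and h: "h \<in> borel_measurable M" "\<And>x. 0 \<le> h x"
    and fin: "\<And>z r. (z, r) \<in> W \<Longrightarrow> (\<integral>\<^sup>+x\<in>B z r. ennreal (h x) \<partial>N) < \<infinity>"
    and u: "0 < u"
  shows "emeasure N {x \<in> X. u < MW N W h x} \<le>
    ennreal (2 * C / u) * (\<integral>\<^sup>+x. ennreal (h x) * (if u / 2 < h x then 1 else 0) \<partial>N)"
proof -
  have sp: "space N = X" by (rule sets_eq_imp_space_eq[OF N])
  have hN [measurable]: "h \<in> borel_measurable N"
    using h(1) measurable_cong_sets[OF N refl] by blast
  define W' where "W' = {(z, r). (z, r) \<in> W \<and> u < avg N h (B z r)}"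
  have W': "finite W'" "W' \<subseteq> W" by (auto simp: W'_def intro: finite_subset[OF _ W(1)])
  obtain S where S: "S \<subseteq> W'" "disjoint_family_on (\<lambda>(z, r). B z r) S"
     "(\<Union>(z, r)\<in>W'. B z r) \<subseteq> (\<Union>(z, r)\<in>S. B z (\<theta> * r))"
    using finite_vitali[OF W'(1)] W'(2) W(2) by (metis (no_types, lifting) subsetD)
  have Sf: "finite S" using S W' finite_subset by blast
  define g where "g x = ennreal (h x) * (if u / 2 < h x then 1 else 0)" for x
  have g [measurable]: "g \<in> borel_measurable N" unfolding g_def by measurable
  have BN [measurable]: "B z r \<in> sets N" if "z \<in> X" "0 < r" for z r
    using ball_sets that N by simp
  have each: "emeasure N (B z (\<theta> * r)) \<le> ennreal (2 * C / u) * (\<integral>\<^sup>+x. g x * indicator (B z r) x \<partial>N)"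
    if p: "(z, r) \<in> S" for z r
  proof -
    have pW: "(z, r) \<in> W" and av: "u < avg N h (B z r)" using p S W' by (auto simp: W'_def)
    have zr: "z \<in> X" "0 < r" using W(2) pW by auto
    note [measurable] = BN[OF zr]
    define I where "I = (\<integral>\<^sup>+x\<in>B z r. ennreal (h x) \<partial>N)"
    define J where "J = (\<integral>\<^sup>+x. g x * indicator (B z r) x \<partial>N)"
    define m where "m = measure N (B z r)"
    have em: "emeasure N (B z r) = ennreal m"
      unfolding m_def using pos[OF pW] by (intro emeasure_eq_ennreal_measure) auto
    have m: "0 < m" using pos[OF pW] em by (simp add: ennreal_zero_less_mult_iff)
    have I: "I < \<infinity>" using fin[OF pW] by (simp add: I_def)
    have "J \<le> I" unfolding I_def J_def g_def by (intro nn_integral_mono) (auto simp: indicator_def)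
    then have J: "J < \<infinity>" using I by (rule order_le_less_trans)
    have "I \<le> (\<integral>\<^sup>+x. g x * indicator (B z r) x + ennreal (u / 2) * indicator (B z r) x \<partial>N)"
      unfolding I_def g_def using h(2) u
      by (intro nn_integral_mono) (auto simp: indicator_def ennreal_leI)
    also have "\<dots> = J + ennreal (u / 2) * ennreal m"
      unfolding J_def em[symmetric] by (subst nn_integral_add) (auto simp: nn_integral_cmult)
    finally have IJ: "I \<le> J + ennreal (u / 2) * ennreal m" .
    have "enn2real I \<le> enn2real (J + ennreal (u / 2) * ennreal m)"
      using IJ J by (intro enn2real_mono) (auto simp: ennreal_mult_less_top)
    also have "\<dots> = enn2real J + u / 2 * m"
      using J u m by (subst enn2real_plus) (auto simp: ennreal_mult_less_top enn2real_mult)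
    finally have "enn2real I \<le> enn2real J + u / 2 * m" .
    moreover have "u * m < enn2real I"
      using av m unfolding avg_def I_def[symmetric] m_def[symmetric] by (simp add: field_simps)
    ultimately have mJ: "m \<le> 2 / u * enn2real J" using u by (simp add: field_simps)
    have "emeasure N (B z (\<theta> * r)) \<le> ennreal C * ennreal m" using dbl[OF pW] em by simp
    also have "\<dots> \<le> ennreal C * ennreal (2 / u * enn2real J)"
      using mJ by (intro mult_left_mono ennreal_leI) auto
    also have "\<dots> = ennreal (2 * C / u) * ennreal (enn2real J)"
      using C u by (simp add: ennreal_mult[symmetric] field_simps)
    also have "ennreal (enn2real J) = J" using J by simp
    finally show ?thesis unfolding J_def .
  qed
  have "{x \<in> X. u < MW N W h x} \<subseteq> (\<Union>(z, r)\<in>S. B z (\<theta> * r))"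
  proof
    fix x assume "x \<in> {x \<in> X. u < MW N W h x}"
    then obtain z r where "(z, r) \<in> W" "x \<in> B z r" "u < avg N h (B z r)"
      using MW_gt[OF W(1), of u N h x] u by auto
    then have "(z, r) \<in> W'" "x \<in> B z r" by (auto simp: W'_def)
    then show "x \<in> (\<Union>(z, r)\<in>S. B z (\<theta> * r))" using S(3) by blast
  qed
  then have "emeasure N {x \<in> X. u < MW N W h x} \<le> emeasure N (\<Union>p\<in>S. case p of (z, r) \<Rightarrow> B z (\<theta> * r))"
  proof (rule emeasure_mono)
    have "(case p of (z, r) \<Rightarrow> B z (\<theta> * r)) \<in> sets N" if "p \<in> S" for p
    proof -
      obtain z r where p: "p = (z, r)" by force
      have "z \<in> X" "0 < r" using that S W' W(2) unfolding p by blast+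
      then show ?thesis using BN[of z "\<theta> * r"] \<theta>_ge_1 unfolding p by simp
    qed
    then show "(\<Union>p\<in>S. case p of (z, r) \<Rightarrow> B z (\<theta> * r)) \<in> sets N"
      using Sf by (intro sets.finite_UN) auto
  qed
  also have "\<dots> \<le> (\<Sum>p\<in>S. emeasure N (case p of (z, r) \<Rightarrow> B z (\<theta> * r)))"
  proof (rule emeasure_subadditive_finite[OF Sf])
    show "(\<lambda>p. case p of (z, r) \<Rightarrow> B z (\<theta> * r)) ` S \<subseteq> sets N"
    proof
      fix E assume "E \<in> (\<lambda>p. case p of (z, r) \<Rightarrow> B z (\<theta> * r)) ` S"
      then obtain z r where p: "(z, r) \<in> S" "E = B z (\<theta> * r)" by auto
      have "z \<in> X" "0 < r" using p S W' W(2) by blast+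
      then show "E \<in> sets N" using BN[of z "\<theta> * r"] \<theta>_ge_1 unfolding p by simp
    qed
  qed
  also have "\<dots> \<le> (\<Sum>p\<in>S. ennreal (2 * C / u) * (\<integral>\<^sup>+x. g x * indicator (case p of (z, r) \<Rightarrow> B z r) x \<partial>N))"
    using each by (intro sum_mono) auto
  also have "\<dots> = ennreal (2 * C / u) * (\<integral>\<^sup>+x. (\<Sum>p\<in>S. g x * indicator (case p of (z, r) \<Rightarrow> B z r) x) \<partial>N)"
  proof -
    have "(\<lambda>x. g x * indicator (case p of (z, r) \<Rightarrow> B z r) x) \<in> borel_measurable N" if "p \<in> S" for p
    proof -
      obtain z r where p: "p = (z, r)" by force
      have "z \<in> X" "0 < r" using that S W' W(2) unfolding p by blast+
      note [measurable] = BN[OF this]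
      show ?thesis unfolding p by simp
    qed
    then show ?thesis by (subst nn_integral_sum) (auto simp: sum_distrib_left)
  qed
  also have "\<dots> \<le> ennreal (2 * C / u) * (\<integral>\<^sup>+x. g x \<partial>N)"
  proof (intro mult_left_mono nn_integral_mono)
    fix x
    have "(\<Sum>p\<in>S. g x * indicator (case p of (z, r) \<Rightarrow> B z r) x) =
        g x * indicator (\<Union>p\<in>S. case p of (z, r) \<Rightarrow> B z r) x"
      by (subst indicator_UN_disjoint[OF Sf S(2)]) (simp add: sum_distrib_left del: in_B)
    also have "\<dots> \<le> g x" by (simp add: indicator_def)
    finally show "(\<Sum>p\<in>S. g x * indicator (case p of (z, r) \<Rightarrow> B z r) x) \<le> g x" .
  qed simp
  finally show ?thesis unfolding g_def .
qed

text \<open>Marcinkiewicz interpolation: the truncated weak-type estimate is integrated over the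
  levels, and Fubini moves the integration in the level inside.\<close>

lemma maximal_strong_type:
  assumes N: "sets N = sets M" and sf: "sigma_finite_measure N"
    and W: "finite W" "\<And>z r. (z, r) \<in> W \<Longrightarrow> z \<in> X \<and> 0 < r"
    and pos: "\<And>z r. (z, r) \<in> W \<Longrightarrow> 0 < emeasure N (B z r) \<and> emeasure N (B z r) < \<infinity>"
    and dbl: "\<And>z r. (z, r) \<in> W \<Longrightarrow> emeasure N (B z (\<theta> * r)) \<le> ennreal C * emeasure N (B z r)"
    and C: "1 \<le> C" and s: "1 < s"
    and h: "h \<in> borel_measurable M" "\<And>x. 0 \<le> h x"
  shows "(\<integral>\<^sup>+x. ennreal (MW N W h x powr s) \<partial>N) \<le>
    ennreal (2 powr (1 + 1 / (s - 1)) * (2 * C) * 2 powr (s - 1)) * (\<integral>\<^sup>+x. ennreal (h x powr s) \<partial>N)"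
proof (cases "(\<integral>\<^sup>+x. ennreal (h x powr s) \<partial>N) = \<infinity>")
  case True
  have "0 < 2 powr (1 + 1 / (s - 1)) * (2 * C) * 2 powr (s - 1)" using C by simp
  then show ?thesis using C unfolding True by (simp add: ennreal_mult_top)
next
  case hfin: False
  have sp: "space N = X" by (rule sets_eq_imp_space_eq[OF N])
  have hN [measurable]: "h \<in> borel_measurable N"
    using h(1) measurable_cong_sets[OF N refl] by blast
  define F where "F = MW N W h"
  have FN [measurable]: "F \<in> borel_measurable N"
    unfolding F_def using MW_measurable[OF W] measurable_cong_sets[OF N refl] by blast
  have F0: "0 \<le> F x" for x unfolding F_def by (rule MW_nonneg[OF W(1)])
  have fin: "(\<integral>\<^sup>+x\<in>B z r. ennreal (h x) \<partial>N) < \<infinity>" if p: "(z, r) \<in> W" for z r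
    using ball_sets W(2)[OF p] N pos[OF p] s hfin
    by (intro set_nn_integral_finite_of_powr[OF hN, of _ s]) (auto simp: less_top)
  define b where "b = 1 / (s - 1)"
  have b: "0 < b" using s by (simp add: b_def)
  interpret sigma_finite_measure N by (rule sf)
  interpret P: pair_sigma_finite N "lborel :: real measure" ..
  have "(\<integral>\<^sup>+x. ennreal (F x powr s) \<partial>N) \<le> (\<integral>\<^sup>+x. ennreal (2 powr (1 + b)) *
    (\<integral>\<^sup>+u. ennreal (u powr b) * (if 0 < u \<and> u < F x powr (s - 1) then 1 else 0) \<partial>lborel) \<partial>N)"
    unfolding b_def by (intro nn_integral_mono powr_le_layer_integral F0 s)
  also have "\<dots> = ennreal (2 powr (1 + b)) * (\<integral>\<^sup>+x.
    (\<integral>\<^sup>+u. ennreal (u powr b) * (if 0 < u \<and> u < F x powr (s - 1) then 1 else 0) \<partial>lborel) \<partial>N)"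
    by (rule nn_integral_cmult) measurable
  also have "(\<integral>\<^sup>+x. (\<integral>\<^sup>+u. ennreal (u powr b) * (if 0 < u \<and> u < F x powr (s - 1) then 1 else 0) \<partial>lborel) \<partial>N)
     = (\<integral>\<^sup>+u. (\<integral>\<^sup>+x. ennreal (u powr b) * (if 0 < u \<and> u < F x powr (s - 1) then 1 else 0) \<partial>N) \<partial>lborel)"
    by (rule P.Fubini'[symmetric]) measurable
  also have "\<dots> \<le> (\<integral>\<^sup>+u. (\<integral>\<^sup>+x. ennreal (2 * C) * (ennreal (h x) * (if 0 < u \<and> u < (2 * h x) powr (s - 1) then 1 else 0)) \<partial>N) \<partial>lborel)"
  proof (rule nn_integral_mono)
    fix u :: real
    show "(\<integral>\<^sup>+x. ennreal (u powr b) * (if 0 < u \<and> u < F x powr (s - 1) then 1 else 0) \<partial>N) \<le>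
      (\<integral>\<^sup>+x. ennreal (2 * C) * (ennreal (h x) * (if 0 < u \<and> u < (2 * h x) powr (s - 1) then 1 else 0)) \<partial>N)"
    proof (cases "0 < u")
      case u: True
      \<comment> \<open>The weight \<open>u powr b\<close> is the level \<open>v\<close> itself and
        cancels the factor \<open>1 / v\<close> of the weak-type bound. What remains is integrated
        over \<open>0 < u < (2 * h x) powr (s - 1)\<close>, which produces the power
        \<open>s\<close> of \<open>h x\<close>.\<close>
      define v where "v = u powr b"
      have v: "0 < v" using u by (simp add: v_def)
      have uv: "u < y powr (s - 1) \<longleftrightarrow> v < y" if "0 \<le> y" for y
      proof -
        have "u = v powr (s - 1)" unfolding v_def powr_powr b_def using u s by simp
        then show ?thesis
          using powr_less_mono2[of "s - 1" v y] powr_mono2[of "s - 1" y v] that v s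
          by (cases "v < y") auto
      qed
      have "(\<integral>\<^sup>+x. ennreal (u powr b) * (if 0 < u \<and> u < F x powr (s - 1) then 1 else 0) \<partial>N)
         = (\<integral>\<^sup>+x. ennreal v * indicator {x \<in> X. v < F x} x \<partial>N)"
        using u uv F0 sp by (intro nn_integral_cong) (auto simp: v_def[symmetric] indicator_def)
      also have "\<dots> = ennreal v * emeasure N {x \<in> X. v < F x}"
        using sp[symmetric] by (subst nn_integral_cmult_indicator) auto
      also have "\<dots> \<le> ennreal v * (ennreal (2 * C / v) * (\<integral>\<^sup>+x. ennreal (h x) * (if v / 2 < h x then 1 else 0) \<partial>N))"
        unfolding F_def using C v
        by (intro mult_left_mono maximal_weak_type[OF N W pos dbl _ h fin]) auto
      also have "\<dots> = ennreal (2 * C) * (\<integral>\<^sup>+x. ennreal (h x) * (if v / 2 < h x then 1 else 0) \<partial>N)"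
        using v C by (simp add: mult.assoc[symmetric] ennreal_mult[symmetric])
      also have "\<dots> = (\<integral>\<^sup>+x. ennreal (2 * C) * (ennreal (h x) * (if v / 2 < h x then 1 else 0)) \<partial>N)"
        by (rule nn_integral_cmult[symmetric]) measurable
      also have "\<dots> = (\<integral>\<^sup>+x. ennreal (2 * C) * (ennreal (h x) * (if 0 < u \<and> u < (2 * h x) powr (s - 1) then 1 else 0)) \<partial>N)"
        using u uv h(2) by (intro nn_integral_cong) (auto simp: field_simps)
      finally show ?thesis .
    qed simp
  qed
  also have "\<dots> = (\<integral>\<^sup>+x. (\<integral>\<^sup>+u. ennreal (2 * C) * (ennreal (h x) * (if 0 < u \<and> u < (2 * h x) powr (s - 1) then 1 else 0)) \<partial>lborel) \<partial>N)"
    by (rule P.Fubini') measurable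
  also have "\<dots> = (\<integral>\<^sup>+x. ennreal (2 * C) * ennreal (2 powr (s - 1)) * ennreal (h x powr s) \<partial>N)"
  proof (rule nn_integral_cong)
    fix x
    have "(\<integral>\<^sup>+u. ennreal (2 * C) * (ennreal (h x) * (if 0 < u \<and> u < (2 * h x) powr (s - 1) then 1 else 0)) \<partial>lborel)
      = (\<integral>\<^sup>+u. (ennreal (2 * C) * ennreal (h x)) * indicator {0<..<(2 * h x) powr (s - 1)} u \<partial>lborel)"
      by (intro nn_integral_cong) (auto simp: indicator_def)
    also have "\<dots> = ennreal (2 * C) * ennreal (h x) * ennreal ((2 * h x) powr (s - 1))"
      by (subst nn_integral_cmult_indicator) auto
    also have "\<dots> = ennreal (2 * C) * (ennreal (h x * (2 * h x) powr (s - 1)))"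
      using h(2)[of x] by (simp add: ennreal_mult mult.assoc)
    also have "h x * (2 * h x) powr (s - 1) = 2 powr (s - 1) * h x powr s"
    proof (cases "h x = 0")
      case False
      then have "0 < h x" using h(2)[of x] by simp
      then have "h x * h x powr (s - 1) = h x powr s" by (simp add: powr_diff)
      then show ?thesis using h(2)[of x] by (subst powr_mult) auto
    qed simp
    finally show "(\<integral>\<^sup>+u. ennreal (2 * C) * (ennreal (h x) * (if 0 < u \<and> u < (2 * h x) powr (s - 1) then 1 else 0)) \<partial>lborel)
       = ennreal (2 * C) * ennreal (2 powr (s - 1)) * ennreal (h x powr s)"
      by (simp add: ennreal_mult mult.assoc)
  qed
  also have "\<dots> = ennreal (2 * C) * ennreal (2 powr (s - 1)) * (\<integral>\<^sup>+x. ennreal (h x powr s) \<partial>N)"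
    by (rule nn_integral_cmult) measurable
  finally have "(\<integral>\<^sup>+x. ennreal (F x powr s) \<partial>N) \<le> ennreal (2 powr (1 + b)) *
      (ennreal (2 * C) * ennreal (2 powr (s - 1)) * (\<integral>\<^sup>+x. ennreal (h x powr s) \<partial>N))"
    by (simp add: mult_left_mono)
  then show ?thesis unfolding F_def b_def using C by (simp add: ennreal_mult mult.assoc)
qed

end

section \<open>Densities with a variable exponent norm\<close>

lemma powr_le_max_bounds:
  fixes y :: real
  assumes "0 < y" "l \<le> \<alpha>" "\<alpha> \<le> u"
  shows "y powr \<alpha> \<le> max (y powr l) (y powr u)"
proof (cases "1 \<le> y")
  case True
  then have "y powr \<alpha> \<le> y powr u" using assms by (intro powr_mono) auto
  then show ?thesis by simp
next
  case False
  then have "y powr \<alpha> \<le> y powr l" using assms by (intro powr_mono') auto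
  then show ?thesis by simp
qed

text \<open>\<open>n z r\<close> stands for the norm of \<open>\<rho> powr (1 / a)\<close> on the ball. Of this norm only the upper bound
  on the modular of the ball and the lower bound on the modulars of its subsets matter.\<close>

locale density_data = hom_type M d A Cd o'
  for M :: "'a measure" and d A Cd o' +
  fixes \<rho> a :: "'a \<Rightarrow> real" and n :: "'a \<Rightarrow> real \<Rightarrow> real" and al au H ainf K c D :: real
  assumes rho_meas [measurable]: "\<rho> \<in> borel_measurable M"
    and rho_nonneg: "\<And>x. 0 \<le> \<rho> x"
    and a_meas [measurable]: "a \<in> borel_measurable M"
    and al: "0 < al"
    and a_bounds: "\<And>x. x \<in> space M \<Longrightarrow> al \<le> a x \<and> a x \<le> au"
    and ainf_bounds: "al \<le> ainf \<and> ainf \<le> au"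
    and LH_a: "LH a H ainf"
    and n_pos: "\<And>z r. z \<in> space M \<Longrightarrow> 0 < r \<Longrightarrow> 0 < n z r"
    and K: "1 \<le> K" and c: "0 < c" "c \<le> 1" and D: "0 \<le> D"
    and up: "\<And>z r. z \<in> space M \<Longrightarrow> 0 < r \<Longrightarrow>
        (\<integral>\<^sup>+x\<in>qball (space M) d z r. ennreal (\<rho> x * n z r powr (- a x)) \<partial>M) \<le> ennreal K"
    and lo: "\<And>z r E. z \<in> space M \<Longrightarrow> 0 < r \<Longrightarrow> E \<in> sets M \<Longrightarrow> E \<subseteq> qball (space M) d z r \<Longrightarrow>
        ennreal (c * (measure M E / measure M (qball (space M) d z r)) powr D) \<le>
        (\<integral>\<^sup>+x\<in>E. ennreal (\<rho> x * n z r powr (- a x)) \<partial>M)"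
begin

definition "N = density M (\<lambda>x. ennreal (\<rho> x))"

lemma sets_N [simp, measurable_cong]: "sets N = sets M"
  by (simp add: N_def)

lemma emeasure_N: "E \<in> sets M \<Longrightarrow> emeasure N E = (\<integral>\<^sup>+x\<in>E. ennreal (\<rho> x) \<partial>M)"
  unfolding N_def by (rule emeasure_density) auto

lemma nn_integral_N: "f \<in> borel_measurable M \<Longrightarrow> (\<integral>\<^sup>+x. f x \<partial>N) = (\<integral>\<^sup>+x. ennreal (\<rho> x) * f x \<partial>M)"
  unfolding N_def by (rule nn_integral_density) auto

lemma al_le_au: "al \<le> au" using ainf_bounds by linarith

lemma rho_integral_le:
  assumes E: "E \<in> sets M" "E \<subseteq> X" and C: "0 \<le> C"
    and f: "\<And>x. x \<in> E \<Longrightarrow> 0 \<le> f x \<and> f x \<le> C * g x"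
    and [measurable]: "g \<in> borel_measurable M"
  shows "(\<integral>\<^sup>+x\<in>E. ennreal (\<rho> x * f x) \<partial>M) \<le> ennreal C * (\<integral>\<^sup>+x\<in>E. ennreal (\<rho> x * g x) \<partial>M)"
proof -
  note E(1)[measurable]
  have "(\<integral>\<^sup>+x\<in>E. ennreal (\<rho> x * f x) \<partial>M) \<le> (\<integral>\<^sup>+x. ennreal C * (ennreal (\<rho> x * g x) * indicator E x) \<partial>M)"
  proof (rule nn_integral_mono)
    fix x
    show "ennreal (\<rho> x * f x) * indicator E x \<le> ennreal C * (ennreal (\<rho> x * g x) * indicator E x)"
    proof (cases "x \<in> E")
      case True
      have "\<rho> x * f x \<le> C * (\<rho> x * g x)"
        using mult_left_mono[OF conjunct2[OF f[OF True]] rho_nonneg[of x]] by (simp add: algebra_simps)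
      then show ?thesis using True C by (simp add: ennreal_mult'[symmetric] ennreal_leI)
    qed simp
  qed
  also have "\<dots> = ennreal C * (\<integral>\<^sup>+x\<in>E. ennreal (\<rho> x * g x) \<partial>M)"
    by (rule nn_integral_cmult) measurable
  finally show ?thesis .
qed

lemma emeasure_N_le:
  assumes E: "E \<in> sets M" and y: "0 < y"
  shows "emeasure N E \<le> ennreal (max (y powr al) (y powr au)) * (\<integral>\<^sup>+x\<in>E. ennreal (\<rho> x * y powr (- a x)) \<partial>M)"
proof -
  have EX: "E \<subseteq> X" using E sets.sets_into_space by auto
  have "(\<integral>\<^sup>+x\<in>E. ennreal (\<rho> x * 1) \<partial>M) \<le>
      ennreal (max (y powr al) (y powr au)) * (\<integral>\<^sup>+x\<in>E. ennreal (\<rho> x * y powr (- a x)) \<partial>M)"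
  proof (rule rho_integral_le[OF E EX])
    fix x assume "x \<in> E"
    then have "y powr a x \<le> max (y powr al) (y powr au)"
      using a_bounds[of x] EX y by (intro powr_le_max_bounds) auto
    then have "y powr a x * y powr (- a x) \<le> max (y powr al) (y powr au) * y powr (- a x)"
      by (intro mult_right_mono) auto
    then show "0 \<le> (1::real) \<and> 1 \<le> max (y powr al) (y powr au) * y powr (- a x)"
      using y by (simp add: powr_add[symmetric])
  qed (auto simp: le_max_iff_disj)
  then show ?thesis by (simp add: emeasure_N[OF E])
qed

lemma emeasure_N_ge:
  assumes E: "E \<in> sets M" and y: "0 < y"
  shows "(\<integral>\<^sup>+x\<in>E. ennreal (\<rho> x * y powr (- a x)) \<partial>M) \<le>
    ennreal (max ((1/y) powr al) ((1/y) powr au)) * emeasure N E"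
proof -
  have EX: "E \<subseteq> X" using E sets.sets_into_space by auto
  have "(\<integral>\<^sup>+x\<in>E. ennreal (\<rho> x * y powr (- a x)) \<partial>M) \<le>
      ennreal (max ((1/y) powr al) ((1/y) powr au)) * (\<integral>\<^sup>+x\<in>E. ennreal (\<rho> x * 1) \<partial>M)"
  proof (rule rho_integral_le[OF E EX])
    fix x assume "x \<in> E"
    then have "(1/y) powr a x \<le> max ((1/y) powr al) ((1/y) powr au)"
      using a_bounds[of x] EX y by (intro powr_le_max_bounds) auto
    moreover have "y powr (- a x) = (1/y) powr a x" using y by (simp add: powr_divide powr_minus_divide)
    ultimately show "0 \<le> y powr (- a x) \<and> y powr (- a x) \<le> max ((1/y) powr al) ((1/y) powr au) * 1"
      by simp
  qed (auto simp: le_max_iff_disj)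
  then show ?thesis by (simp add: emeasure_N[OF E])
qed

lemma N_ball_le:
  assumes "z \<in> X" "0 < r"
  shows "emeasure N (B z r) \<le> ennreal (max (n z r powr al) (n z r powr au) * K)"
proof -
  have "emeasure N (B z r) \<le> ennreal (max (n z r powr al) (n z r powr au)) * ennreal K"
    using emeasure_N_le[OF ball_sets[OF assms] n_pos[OF assms]] up[OF assms]
    by (meson mult_left_mono order_trans zero_le)
  then show ?thesis using K by (simp add: ennreal_mult le_max_iff_disj)
qed

lemma N_ball_fin: "z \<in> X \<Longrightarrow> 0 < r \<Longrightarrow> emeasure N (B z r) < \<infinity>"
  using order_le_less_trans[OF N_ball_le, of z r \<infinity>] by simp

lemma N_sub_fin:
  assumes "z \<in> X" "0 < r" "E \<subseteq> B z r"
  shows "emeasure N E < \<infinity>"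
proof (cases "E \<in> sets M")
  case True
  then have "emeasure N E \<le> emeasure N (B z r)" using assms ball_sets by (intro emeasure_mono) auto
  then show ?thesis using N_ball_fin[OF assms(1,2)] by (rule order_le_less_trans)
next
  case False
  then show ?thesis by (simp add: emeasure_notin_sets)
qed

lemma emeasure_N_eq: "z \<in> X \<Longrightarrow> 0 < r \<Longrightarrow> E \<subseteq> B z r \<Longrightarrow> emeasure N E = ennreal (measure N E)"
  using N_sub_fin[of z r E] by (intro emeasure_eq_ennreal_measure) auto

lemma N_pos:
  assumes "z \<in> X" "0 < r" "E \<in> sets M" "E \<subseteq> B z r" "0 < measure M E"
  shows "0 < emeasure N E"
proof (rule ccontr)
  assume "\<not> ?thesis"
  then have "emeasure N E = 0" by simp
  then have "(\<integral>\<^sup>+x\<in>E. ennreal (\<rho> x * n z r powr (- a x)) \<partial>M) = 0"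
    using emeasure_N_ge[OF assms(3) n_pos[OF assms(1,2)]] by simp
  then have "ennreal (c * (measure M E / measure M (B z r)) powr D) \<le> 0"
    using lo[OF assms(1-4)] by simp
  moreover have "0 < c * (measure M E / measure M (B z r)) powr D"
    using c assms(5) mB_pos[OF assms(1,2)] by simp
  ultimately show False by (simp add: ennreal_eq_0_iff del: zero_less_mult_iff)
qed

lemma N_ball_pos: "z \<in> X \<Longrightarrow> 0 < r \<Longrightarrow> 0 < emeasure N (B z r)"
  by (rule N_pos[where z = z and r = r]) (use ball_sets mB_pos in auto)

lemma mN_ball_pos: "z \<in> X \<Longrightarrow> 0 < r \<Longrightarrow> 0 < measure N (B z r)"
  using N_ball_pos[of z r] emeasure_N_eq[of z r "B z r"] by simp

lemma sigma_finite_N: "sigma_finite_measure N"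
  using N_ball_fin origin by (intro sigma_finite_of_balls) auto

section \<open>Dependence of the norm on the ball\<close>

definition "C1 = ln (K / c) / al"
definition "D1 = D / al"

lemma C1_nonneg: "0 \<le> C1" and D1_nonneg: "0 \<le> D1"
  using K c al D by (auto simp: C1_def D1_def)

text \<open>Raising the normalising number from \<open>n1\<close> to \<open>n2\<close> lowers the
  modular by at least the factor \<open>(n2 / n1) powr (- al)\<close>. If the modular starts below
  \<open>K\<close> and ends above \<open>b\<close>, the quotient \<open>n2 / n1\<close> is
  bounded.\<close>

lemma ln_n_diff_le:
  assumes E: "E \<in> sets M" "E \<subseteq> X" and n: "0 < n1" "n1 \<le> n2" and b: "0 < b"
    and lower: "ennreal b \<le> (\<integral>\<^sup>+x\<in>E. ennreal (\<rho> x * n2 powr (- a x)) \<partial>M)"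
    and upper: "(\<integral>\<^sup>+x\<in>E. ennreal (\<rho> x * n1 powr (- a x)) \<partial>M) \<le> ennreal K"
  shows "ln n2 - ln n1 \<le> ln (K / b) / al"
proof -
  have n2: "0 < n2" using n by simp
  have "(\<integral>\<^sup>+x\<in>E. ennreal (\<rho> x * n2 powr (- a x)) \<partial>M) \<le>
     ennreal ((n2 / n1) powr (- al)) * (\<integral>\<^sup>+x\<in>E. ennreal (\<rho> x * n1 powr (- a x)) \<partial>M)"
  proof (rule rho_integral_le[OF E])
    fix x assume "x \<in> E"
    then have "(n2 / n1) powr (- a x) \<le> (n2 / n1) powr (- al)"
      using a_bounds[of x] E n by (intro powr_mono) auto
    then have "(n2 / n1) powr (- a x) * n1 powr (- a x) \<le> (n2 / n1) powr (- al) * n1 powr (- a x)"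
      by (intro mult_right_mono) auto
    moreover have "(n2 / n1) powr (- a x) * n1 powr (- a x) = n2 powr (- a x)"
      using n n2 by (simp add: powr_mult[symmetric])
    ultimately show "0 \<le> n2 powr (- a x) \<and> n2 powr (- a x) \<le> (n2 / n1) powr (- al) * n1 powr (- a x)"
      by simp
  qed auto
  also have "\<dots> \<le> ennreal ((n2 / n1) powr (- al)) * ennreal K"
    using upper by (intro mult_left_mono) auto
  finally have "ennreal b \<le> ennreal ((n2 / n1) powr (- al) * K)"
    using lower K by (simp add: ennreal_mult)
  then have bK: "b \<le> (n2 / n1) powr (- al) * K" using K by (subst (asm) ennreal_le_iff) auto
  then have "ln b \<le> ln ((n2 / n1) powr (- al) * K)" using b by simp
  also have "\<dots> = - al * (ln n2 - ln n1) + ln K"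
    using n n2 K by (subst ln_mult) (auto simp: ln_powr ln_div)
  finally show ?thesis using al K b by (simp add: ln_div field_simps)
qed

text \<open>The numbers \<open>n z r\<close> are known only through modular bounds, so monotonicity
  is recovered up to the factor \<open>exp C1\<close>, by comparing two modulars over the smaller
  ball.\<close>

lemma n_mono:
  assumes "z \<in> X" "0 < r" "z' \<in> X" "0 < r'" "B z' r' \<subseteq> B z r"
  shows "ln (n z' r') \<le> ln (n z r) + C1"
proof (cases "n z r \<le> n z' r'")
  case True
  have m: "measure M (B z' r') / measure M (B z' r') = 1" using mB_pos[OF assms(3,4)] by simp
  have "ln (n z' r') - ln (n z r) \<le> ln (K / c) / al"
  proof (rule ln_n_diff_le[OF _ B_subset_X n_pos True])
    show "ennreal c \<le> (\<integral>\<^sup>+x\<in>B z' r'. ennreal (\<rho> x * n z' r' powr (- a x)) \<partial>M)"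
      using lo[OF assms(3,4) ball_sets[OF assms(3,4)] order_refl] m by simp
    have "(\<integral>\<^sup>+x\<in>B z' r'. ennreal (\<rho> x * n z r powr (- a x)) \<partial>M) \<le> (\<integral>\<^sup>+x\<in>B z r. ennreal (\<rho> x * n z r powr (- a x)) \<partial>M)"
      using assms(5) by (intro nn_integral_mono mult_left_mono) (auto simp: indicator_def)
    then show "(\<integral>\<^sup>+x\<in>B z' r'. ennreal (\<rho> x * n z r powr (- a x)) \<partial>M) \<le> ennreal K"
      using up[OF assms(1,2)] by (rule order_trans)
  qed (use assms ball_sets c in auto)
  then show ?thesis by (simp add: C1_def)
next
  case False
  then have "ln (n z' r') \<le> ln (n z r)" using n_pos assms by simp
  then show ?thesis using C1_nonneg by simp
qed

text \<open>For the new direction the smaller ball is taken as the subset in the lower modular bound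
  of the larger one; its exponent \<open>D\<close> makes the comparison polynomial in the quotient
  of the measures.\<close>

lemma n_compare:
  assumes "z \<in> X" "0 < r" "z' \<in> X" "0 < r'" "B z' r' \<subseteq> B z r"
  shows "\<bar>ln (n z' r') - ln (n z r)\<bar> \<le> C1 + D1 * ln (measure M (B z r) / measure M (B z' r'))"
proof -
  let ?m = "measure M (B z r)" and ?m' = "measure M (B z' r')"
  have mp: "0 < ?m" "0 < ?m'" using mB_pos assms by auto
  have "?m' \<le> ?m" using measure_B_mono assms by blast
  then have l0: "0 \<le> ln (?m / ?m')" using mp by simp
  have "ln (n z r) - ln (n z' r') \<le> C1 + D1 * ln (?m / ?m')"
  proof (cases "n z' r' \<le> n z r")
    case True
    define b where "b = c * (?m' / ?m) powr D"
    have b: "0 < b" using c mp by (simp add: b_def)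
    have "ln (n z r) - ln (n z' r') \<le> ln (K / b) / al"
    proof (rule ln_n_diff_le[OF _ B_subset_X n_pos True])
      show "ennreal b \<le> (\<integral>\<^sup>+x\<in>B z' r'. ennreal (\<rho> x * n z r powr (- a x)) \<partial>M)"
        using lo[OF assms(1,2) ball_sets[OF assms(3,4)] assms(5)] by (simp add: b_def)
    qed (use assms ball_sets b up in auto)
    also have "ln (K / b) = ln (K / c) + D * ln (?m / ?m')"
      unfolding b_def using K c mp by (simp add: ln_div ln_mult ln_powr algebra_simps)
    finally show ?thesis by (simp add: C1_def D1_def add_divide_distrib)
  next
    case False
    then have "ln (n z r) \<le> ln (n z' r')" using n_pos assms by simp
    then show ?thesis using C1_nonneg D1_nonneg l0 by (smt (verit) mult_nonneg_nonneg)
  qed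
  moreover have "ln (n z' r') - ln (n z r) \<le> C1 + D1 * ln (?m / ?m')"
    using n_mono[OF assms] D1_nonneg l0 by (smt (verit) mult_nonneg_nonneg)
  ultimately show ?thesis by (simp add: abs_le_iff)
qed

lemma ln_doubling_le:
  assumes "x \<in> X" "0 < r" "1 \<le> l" "z \<in> X" "0 < s" "B z s \<subseteq> B x (l * r)"
  shows "ln (measure M (B z s) / measure M (B x r)) \<le> ln Cd + Dm * ln l"
proof -
  have "measure M (B z s) \<le> measure M (B x (l * r))" using assms by (intro measure_B_mono) auto
  also have "\<dots> \<le> Cd * l powr Dm * measure M (B x r)" using doubling_dilate assms by blast
  finally have "measure M (B z s) / measure M (B x r) \<le> Cd * l powr Dm"
    using mB_pos assms by (simp add: divide_le_eq)
  moreover have "0 < measure M (B z s) / measure M (B x r)" using mB_pos assms by simp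
  ultimately have "ln (measure M (B z s) / measure M (B x r)) \<le> ln (Cd * l powr Dm)"
    by simp
  then show ?thesis using Cd assms by (simp add: ln_mult ln_powr)
qed

lemma ln_n_origin:
  assumes "1 \<le> s"
  shows "\<bar>ln (n o' s)\<bar> \<le> (\<bar>ln (n o' 1)\<bar> + C1 + D1 * ln Cd) + D1 * Dm * ln s"
proof -
  have "\<bar>ln (n o' 1) - ln (n o' s)\<bar> \<le> C1 + D1 * ln (measure M (B o' s) / measure M (B o' 1))"
    using assms origin by (intro n_compare) auto
  also have "\<dots> \<le> C1 + D1 * (ln Cd + Dm * ln s)"
    using ln_doubling_le[of o' 1 s o' s] origin assms D1_nonneg
    by (intro add_left_mono mult_left_mono) auto
  finally show ?thesis by (simp add: algebra_simps)
qed

text \<open>The ball is compared with one around \<open>o'\<close> of radius about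
  \<open>1 + nm z\<close>, and that one with the unit ball around \<open>o'\<close>. By doubling
  each step costs a multiple of the logarithm of a dilation factor, and both logarithms are at most
  a constant plus \<open>\<Lambda> z r\<close>.\<close>

lemma ln_n_local:
  "\<exists>C\<ge>0. \<forall>z r. z \<in> X \<longrightarrow> 0 < r \<longrightarrow> r \<le> \<kappa>1 * (1 + nm z) \<longrightarrow> \<bar>ln (n z r)\<bar> \<le> C * \<Lambda> z r"
proof -
  define C2 where "C2 = \<bar>ln (n o' 1)\<bar> + C1 + D1 * ln Cd"
  have C2: "0 \<le> C2" unfolding C2_def using C1_nonneg D1_nonneg Cd by simp
  define E where "E = C2 + D1 * Dm * ln (2 * A) + D1 * Dm + C1 + D1 * (ln Cd + Dm * ln \<theta>) + D1 * Dm"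
  have lA: "0 \<le> ln (2 * A)" "0 \<le> ln \<theta>" "0 \<le> ln Cd" using A \<theta>_ge_1 Cd by auto
  have DD: "0 \<le> D1 * Dm" using D1_nonneg Dm_nonneg by simp
  have E: "0 \<le> E" unfolding E_def
    using C2 C1_nonneg D1_nonneg Dm_nonneg lA DD by (intro add_nonneg_nonneg mult_nonneg_nonneg) auto
  have "\<bar>ln (n z r)\<bar> \<le> E * \<Lambda> z r" if z: "z \<in> X" and r: "0 < r" and small: "r \<le> \<kappa>1 * (1 + nm z)" for z r
  proof -
    have nz: "0 \<le> nm z" using nm_nonneg z by simp
    have "\<kappa>1 \<le> 1" using A by (simp add: \<kappa>1_def)
    then have "\<kappa>1 * (1 + nm z) \<le> 1 * (1 + nm z)" using nz by (intro mult_right_mono) auto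
    from order_trans[OF small this] have r1: "r \<le> 1 + nm z" by simp
    \<comment> \<open>Since \<open>r \<le> 1 + nm z\<close>, the ball of radius \<open>s\<close>
      around \<open>o'\<close> contains \<open>B z r\<close>. It lies in turn in the ball of radius
      \<open>\<theta> * (1 + nm z)\<close> around \<open>z\<close>, the dilate of
      \<open>B z r\<close> by the factor \<open>l\<close> below.\<close>
    define s where "s = 2 * A * (1 + nm z)"
    have "2 * 1 * 1 \<le> 2 * A * (1 + nm z)" using A nz by (intro mult_mono) auto
    then have s1: "1 \<le> s" unfolding s_def by simp
    have sub: "B z r \<subseteq> B o' s"
    proof (rule B_shift[OF z origin])
      have "A * (d o' z + r) \<le> A * (2 * (1 + nm z))"
        using r1 A d_sym[OF origin z] unfolding nm_def by (intro mult_left_mono) auto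
      then show "A * (d o' z + r) \<le> s" by (simp add: s_def algebra_simps)
    qed
    define l where "l = \<theta> * (1 + nm z) / r"
    have "1 * (1 + nm z) \<le> \<theta> * (1 + nm z)" using \<theta>_ge_1 nz by (intro mult_right_mono) auto
    then have "1 + nm z \<le> \<theta> * (1 + nm z)" by simp
    from order_trans[OF r1 this] have "r \<le> \<theta> * (1 + nm z)" .
    then have l1: "1 \<le> l" unfolding l_def using r by (simp add: pos_le_divide_eq)
    have sub2: "B o' s \<subseteq> B z (l * r)"
    proof (rule B_shift[OF origin z])
      have AA: "A \<le> A * A" using A mult_left_mono[of 1 A A] by simp
      have "A * (d z o' + s) \<le> A * (1 + nm z) + 2 * (A * A) * (1 + nm z)"
        using A by (simp add: s_def nm_def algebra_simps)
      also have "\<dots> \<le> A * A * (1 + nm z) + 2 * (A * A) * (1 + nm z)"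
        using AA nz by (intro add_right_mono mult_right_mono) auto
      also have "\<dots> = \<theta> * (1 + nm z)" by (simp add: \<theta>_def algebra_simps)
      also have "\<dots> = l * r" using r by (simp add: l_def)
      finally show "A * (d z o' + s) \<le> l * r" .
    qed
    have lnm: "ln (1 + nm z) \<le> L z" unfolding L_def using nz exp_ge_add_one_self[of 1] by (subst ln_le_cancel_iff) auto
    have L0: "1 \<le> L z" using L_ge_1 z by simp
    have i0: "1 \<le> ln (exp 1 + 1 / r)" using r by (intro one_le_ln_e_add) auto
    have ir: "ln (1 / r) \<le> ln (exp 1 + 1 / r)" using r by (subst ln_le_cancel_iff) (auto simp: add_pos_pos)
    have La: "L z \<le> \<Lambda> z r" "1 \<le> \<Lambda> z r" using i0 L0 by (auto simp: \<Lambda>_def)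
    have ln_l: "ln l \<le> ln \<theta> + \<Lambda> z r"
    proof -
      have "ln l = ln \<theta> + ln (1 + nm z) + ln (1 / r)"
        unfolding l_def using \<theta>_ge_1 nz r by (simp add: ln_div ln_mult)
      then show ?thesis using lnm ir by (simp add: \<Lambda>_def)
    qed
    have ln_s: "ln s \<le> ln (2 * A) + \<Lambda> z r"
    proof -
      have "ln s = ln (2 * A) + ln (1 + nm z)" unfolding s_def using A nz by (subst ln_mult) auto
      then show ?thesis using lnm La by linarith
    qed
    have "\<bar>ln (n o' s)\<bar> \<le> C2 + D1 * Dm * ln s" using ln_n_origin[OF s1] by (simp add: C2_def)
    also have "\<dots> \<le> C2 + D1 * Dm * (ln (2 * A) + \<Lambda> z r)"
      using ln_s DD by (intro add_left_mono mult_left_mono) auto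
    finally have 1: "\<bar>ln (n o' s)\<bar> \<le> C2 + D1 * Dm * (ln (2 * A) + \<Lambda> z r)" .
    have "\<bar>ln (n z r) - ln (n o' s)\<bar> \<le> C1 + D1 * ln (measure M (B o' s) / measure M (B z r))"
      using z r s1 origin sub by (intro n_compare) auto
    also have "\<dots> \<le> C1 + D1 * (ln Cd + Dm * ln l)"
      using ln_doubling_le[OF z r l1 origin _ sub2] s1 D1_nonneg
      by (intro add_left_mono mult_left_mono) auto
    also have "\<dots> \<le> C1 + D1 * (ln Cd + Dm * (ln \<theta> + \<Lambda> z r))"
      using ln_l D1_nonneg Dm_nonneg by (intro add_left_mono mult_left_mono) auto
    finally have 2: "\<bar>ln (n z r) - ln (n o' s)\<bar> \<le> C1 + D1 * (ln Cd + Dm * (ln \<theta> + \<Lambda> z r))" .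
    define F where "F = C2 + D1 * Dm * ln (2 * A) + C1 + D1 * (ln Cd + Dm * ln \<theta>)"
    have F: "0 \<le> F" unfolding F_def
      using C2 C1_nonneg D1_nonneg Dm_nonneg lA DD by (intro add_nonneg_nonneg mult_nonneg_nonneg) auto
    have "\<bar>ln (n z r)\<bar> \<le> F + 2 * (D1 * Dm) * \<Lambda> z r"
      using 1 2 by (simp add: F_def algebra_simps)
    also have "\<dots> \<le> F * \<Lambda> z r + 2 * (D1 * Dm) * \<Lambda> z r"
      using mult_left_mono[OF La(2) F] by simp
    also have "\<dots> = E * \<Lambda> z r" by (simp add: E_def F_def algebra_simps)
    finally show ?thesis .
  qed
  then show ?thesis using E by blast
qed

text \<open>Bounds \<open>1 / n o' r\<close> above for \<open>r \<ge> 1\<close>, as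
  \<open>powr_perturb\<close> needs a bounded base when the exponent is frozen at infinity.\<close>

lemma n_origin_bounded_below: "\<exists>n0>0. \<forall>r\<ge>1. n0 \<le> n o' r"
proof (intro exI conjI allI impI)
  have p: "0 < n o' 1" using n_pos origin by simp
  show "0 < n o' 1 * exp (- C1)" using p by simp
  fix r :: real assume r: "1 \<le> r"
  have "ln (n o' 1) \<le> ln (n o' r) + C1" using origin r by (intro n_mono) auto
  then have "ln (n o' 1 * exp (- C1)) \<le> ln (n o' r)" using p by (simp add: ln_mult)
  then show "n o' 1 * exp (- C1) \<le> n o' r" using p n_pos[OF origin, of r] r by simp
qed

text \<open>On the dyadic balls around \<open>o'\<close> the density has at most geometric growth,
  by the polynomial growth of the norms. The tail decays geometrically on the same scale, with a
  ratio governed by \<open>t\<close>.\<close>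

lemma tail_integrable: "\<exists>t0\<ge>0. \<forall>t\<ge>t0. (\<integral>\<^sup>+x. ennreal (tail t x) \<partial>N) < \<infinity>"
proof -
  have au0: "0 < au" using al al_le_au by simp
  define C where "C = \<bar>ln (n o' 1)\<bar> + C1 + D1 * ln Cd"
  define C' where "C' = D1 * Dm"
  have CC: "0 \<le> C" "0 \<le> C'" unfolding C_def C'_def using C1_nonneg D1_nonneg Dm_nonneg Cd by auto
  \<comment> \<open>The masses grow with ratio \<open>2 powr (au * C')\<close>, the tail decays with
    ratio \<open>2 powr (- t)\<close>; the extra 1 makes the product of the two ratios 1/2.\<close>
  define t where "t = au * C' + 1"
  have t: "1 \<le> t" unfolding t_def using au0 CC by simp
  have NB: "emeasure N (B o' (2 ^ k)) \<le> ennreal (K * exp (au * C) * (2 powr (au * C')) ^ k)" for k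
  proof -
    have p: "0 < n o' (2 ^ k)" using n_pos origin by simp
    have "\<bar>ln (n o' (2 ^ k))\<bar> \<le> C + C' * (k * ln 2)"
      using ln_n_origin[of "2 ^ k"] by (simp add: C_def C'_def ln_realpow)
    then have ll: "\<bar>ln (n o' (2 ^ k))\<bar> * e \<le> (C + C' * (k * ln 2)) * au" if "0 \<le> e" "e \<le> au" for e
      using that CC by (intro mult_mono) auto
    \<comment> \<open>Comparing with the exponent 0 bounds both powers of the norm at once, whether
      the norm is below or above 1.\<close>
    have "n o' (2 ^ k) powr e \<le> exp ((C + C' * (k * ln 2)) * au)" if "0 \<le> e" "e \<le> au" for e
      using powr_exponent_change[of "n o' (2 ^ k)" e 0 "(C + C' * (k * ln 2)) * au"] ll[OF that] that p by simp
    then have "max (n o' (2 ^ k) powr al) (n o' (2 ^ k) powr au) \<le> exp ((C + C' * (k * ln 2)) * au)"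
      using al al_le_au by simp
    also have "\<dots> = exp (au * C) * (2 powr (au * C')) ^ k"
      by (simp add: exp_add[symmetric] powr_def exp_of_nat_mult[symmetric] algebra_simps)
    finally have "max (n o' (2 ^ k) powr al) (n o' (2 ^ k) powr au) * K \<le> exp (au * C) * (2 powr (au * C')) ^ k * K"
      using K by (intro mult_right_mono) auto
    then have "ennreal (max (n o' (2 ^ k) powr al) (n o' (2 ^ k) powr au) * K) \<le> ennreal (K * exp (au * C) * (2 powr (au * C')) ^ k)"
      by (intro ennreal_leI) (simp add: mult.commute mult.left_commute)
    then show ?thesis using N_ball_le[OF origin, of "2 ^ k"] by (auto intro: order_trans)
  qed
  have pw: "ennreal (tail t x) \<le> (\<Sum>k. ennreal (2 powr t * (2 powr (- t)) ^ k) * indicator (B o' (2 ^ k)) x)"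
    if x: "x \<in> X" for x
  proof -
    obtain m :: nat where "nm x < 2 ^ m"
      using real_arch_pow[of 2 "nm x"] by auto
    then have ex: "\<exists>m::nat. nm x < 2 ^ m" by blast
    define k where "k = (LEAST m::nat. nm x < 2 ^ m)"
    have k: "nm x < 2 ^ k" unfolding k_def by (rule LeastI_ex[OF ex])
    have "tail t x \<le> 2 powr t * (2 powr (- t)) ^ k"
    proof (cases k)
      case 0
      have "tail t x \<le> 1" using tail_le_1 t x by simp
      also have "1 \<le> 2 powr t" using t by (simp add: ge_one_powr_ge_zero)
      finally show ?thesis using 0 by simp
    next
      case (Suc j)
      have "\<not> nm x < 2 ^ j" using not_less_Least[of j "\<lambda>m. nm x < 2 ^ m"] Suc by (simp add: k_def)
      then have j: "2 ^ j \<le> exp 1 + nm x" using exp_ge_add_one_self[of 1] by linarith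
      have "real j * ln 2 = ln (2 ^ j)" by (simp add: ln_realpow)
      also have "\<dots> \<le> L x" unfolding L_def using j by (subst ln_le_cancel_iff) (auto intro: less_le_trans[OF _ j])
      finally have "t * (real j * ln 2) \<le> t * L x" using t by (intro mult_left_mono) auto
      then have "tail t x \<le> exp (- t * (real j * ln 2))" by (simp add: tail_def)
      also have "\<dots> = 2 powr t * (2 powr (- t)) ^ k"
        unfolding Suc by (simp add: powr_def exp_of_nat_mult[symmetric] exp_add[symmetric] algebra_simps)
      finally show ?thesis .
    qed
    then have "ennreal (tail t x) \<le> ennreal (2 powr t * (2 powr (- t)) ^ k) * indicator (B o' (2 ^ k)) x"
      using k x d_sym[OF origin x] by (simp add: nm_def ennreal_leI)
    also have "\<dots> \<le> (\<Sum>k. ennreal (2 powr t * (2 powr (- t)) ^ k) * indicator (B o' (2 ^ k)) x)"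
    proof -
      have "(\<Sum>k\<in>{k}. f k) \<le> (\<Sum>k. f k)" for f :: "nat \<Rightarrow> ennreal"
        by (intro sum_le_suminf) auto
      then have "f k \<le> (\<Sum>k. f k)" for f :: "nat \<Rightarrow> ennreal" by simp
      then show ?thesis .
    qed
    finally show ?thesis .
  qed
  have BM [measurable]: "B o' (2 ^ k) \<in> sets M" for k using ball_sets origin by simp
  have "(\<integral>\<^sup>+x. ennreal (tail t x) \<partial>N) \<le>
      (\<integral>\<^sup>+x. (\<Sum>k. ennreal (2 powr t * (2 powr (- t)) ^ k) * indicator (B o' (2 ^ k)) x) \<partial>N)"
    using pw sets_eq_imp_space_eq[OF sets_N] by (intro nn_integral_mono) auto
  also have "\<dots> = (\<Sum>k. \<integral>\<^sup>+x. ennreal (2 powr t * (2 powr (- t)) ^ k) * indicator (B o' (2 ^ k)) x \<partial>N)"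
    by (rule nn_integral_suminf) measurable
  also have "\<dots> = (\<Sum>k. ennreal (2 powr t * (2 powr (- t)) ^ k) * emeasure N (B o' (2 ^ k)))"
    by (subst nn_integral_cmult_indicator) auto
  also have "\<dots> \<le> (\<Sum>k. ennreal (2 powr t * K * exp (au * C) * (1 / 2) ^ k))"
  proof (intro suminf_le)
    fix k
    have "ennreal (2 powr t * (2 powr (- t)) ^ k) * emeasure N (B o' (2 ^ k)) \<le>
       ennreal (2 powr t * (2 powr (- t)) ^ k) * ennreal (K * exp (au * C) * (2 powr (au * C')) ^ k)"
      using NB by (intro mult_left_mono) auto
    also have "\<dots> = ennreal ((2 powr t * (2 powr (- t)) ^ k) * (K * exp (au * C) * (2 powr (au * C')) ^ k))"
      using K by (intro ennreal_mult[symmetric]) auto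
    also have "(2 powr t * (2 powr (- t)) ^ k) * (K * exp (au * C) * (2 powr (au * C')) ^ k)
       = 2 powr t * K * exp (au * C) * (2 powr (- t) * 2 powr (au * C')) ^ k"
      by (simp add: power_mult_distrib algebra_simps)
    also have "2 powr (- t) * 2 powr (au * C') = 1 / 2"
      by (simp add: powr_add[symmetric] t_def powr_minus_divide)
    finally show "ennreal (2 powr t * (2 powr (- t)) ^ k) * emeasure N (B o' (2 ^ k)) \<le>
      ennreal (2 powr t * K * exp (au * C) * (1 / 2) ^ k)" .
  qed auto
  also have "\<dots> < \<infinity>"
  proof -
    have "summable (\<lambda>k. 2 powr t * K * exp (au * C) * (1 / 2) ^ k :: real)"
      by (intro summable_mult summable_geometric) auto
    then show ?thesis using K by (subst suminf_ennreal2) auto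
  qed
  finally have fin: "(\<integral>\<^sup>+x. ennreal (tail t x) \<partial>N) < \<infinity>" .
  have "(\<integral>\<^sup>+x. ennreal (tail t' x) \<partial>N) < \<infinity>" if "t \<le> t'" for t'
  proof -
    have "(\<integral>\<^sup>+x. ennreal (tail t' x) \<partial>N) \<le> (\<integral>\<^sup>+x. ennreal (tail t x) \<partial>N)"
      using tail_antimono[OF that] sets_eq_imp_space_eq[OF sets_N]
      by (intro nn_integral_mono ennreal_leI) auto
    then show ?thesis using fin by (rule order_le_less_trans)
  qed
  then show ?thesis using t by (intro exI[of _ t]) auto
qed

end

lemma powr_mult_minus_cancel: "0 < (x::real) \<Longrightarrow> x powr a * (x powr (- a) * m) = m"
  by (simp add: powr_minus field_simps)

section \<open>Good balls, and the comparison of norms with measures on them\<close>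

context hom_type
begin

text \<open>A numerical switch for the error term: only on the large balls around \<open>o'\<close>
  does freezing an exponent leave a tail.\<close>

definition "far z r = (if z = o' \<and> 1 \<le> r then 1 else 0 :: real)"

lemma far_nonneg: "0 \<le> far z r" and far_le_1: "far z r \<le> 1"
  by (auto simp: far_def)

lemma goodD: "good \<kappa> z r \<Longrightarrow> z \<in> X" "good \<kappa> z r \<Longrightarrow> 0 < r"
  by (auto simp: good_def)

lemma good_near: "good \<kappa> z r \<Longrightarrow> \<not> (z = o' \<and> 1 \<le> r) \<Longrightarrow> r \<le> \<kappa> * (1 + nm z)"
  by (auto simp: good_def)

lemma center_in_B: "z \<in> X \<Longrightarrow> 0 < r \<Longrightarrow> z \<in> B z r"
  using d_refl by simp

text \<open>The Vitali dilate of a ball that is good for \<open>\<kappa>0\<close> remains good for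
  \<open>\<kappa>1\<close>, the factor for which the exponents are controlled.\<close>

definition "\<kappa>0 = \<kappa>1 / \<theta>"

lemma \<kappa>0_pos: "0 < \<kappa>0"
  using A \<theta>_ge_1 by (simp add: \<kappa>0_def \<kappa>1_def)

lemma good_dilate: "good \<kappa>0 z r \<Longrightarrow> good \<kappa>1 z (\<theta> * r)"
proof -
  assume g: "good \<kappa>0 z r"
  have zr: "z \<in> X" "0 < r" using goodD[OF g] by auto
  have t: "0 < \<theta>" using \<theta>_ge_1 by simp
  have "1 \<le> \<theta> * r" if "1 \<le> r" using mult_mono[OF \<theta>_ge_1 that] t by simp
  moreover have "\<theta> * r \<le> \<kappa>1 * (1 + nm z)" if "r \<le> \<kappa>0 * (1 + nm z)"
  proof -
    have "\<theta> * r \<le> \<theta> * (\<kappa>0 * (1 + nm z))" using that t by (intro mult_left_mono) auto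
    also have "\<dots> = \<kappa>1 * (1 + nm z)" using t by (simp add: \<kappa>0_def)
    finally show ?thesis .
  qed
  ultimately show ?thesis using g t zr by (auto simp: good_def)
qed

lemma good_mono: "good \<kappa>0 z r \<Longrightarrow> good \<kappa>1 z r"
proof -
  assume g: "good \<kappa>0 z r"
  have "\<kappa>0 \<le> \<kappa>1" unfolding \<kappa>0_def using A \<theta>_ge_1 by (simp add: \<kappa>1_def divide_le_eq)
  then have "\<kappa>0 * (1 + nm z) \<le> \<kappa>1 * (1 + nm z)"
    using nm_nonneg[OF goodD(1)[OF g]] by (intro mult_right_mono) auto
  then show ?thesis using g order_trans by (auto simp: good_def)
qed

lemma L_le_L_center:
  assumes "z \<in> X" "0 < r" "r \<le> \<kappa>1 * (1 + nm z)" "y \<in> B z r"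
  shows "L y \<le> (1 + ln (3 * A)) * L z"
proof -
  have y: "y \<in> X" "d z y < r" using assms by auto
  have nz: "0 \<le> nm z" using nm_nonneg assms by simp
  have "\<kappa>1 \<le> 1" using A by (simp add: \<kappa>1_def)
  then have "\<kappa>1 * (1 + nm z) \<le> 1 * (1 + nm z)" using nz by (intro mult_right_mono) auto
  from order_trans[OF assms(3) this] have r1: "r \<le> 1 + nm z" by simp
  have "nm y \<le> A * (d y z + nm z)" using d_tri[of y o' z] y assms origin by (simp add: nm_def)
  also have "\<dots> \<le> A * (1 + nm z + nm z)" using y r1 d_sym[OF y(1) assms(1)] A
    by (intro mult_left_mono) auto
  finally have ny: "nm y \<le> A + 2 * A * nm z" by (simp add: algebra_simps)
  have e: "1 \<le> exp (1::real)" by simp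
  have "A * 1 \<le> A * exp 1" "1 * exp 1 \<le> A * exp (1::real)" using A e by (auto intro: mult_left_mono mult_right_mono)
  moreover have "0 \<le> A * nm z" "0 \<le> A * exp (1::real)" using A nz by auto
  ultimately have "exp 1 + nm y \<le> 3 * A * exp 1 + 3 * A * nm z" using ny by linarith
  then have le: "exp 1 + nm y \<le> 3 * A * (exp 1 + nm z)" by (simp add: algebra_simps)
  have p: "0 < exp 1 + nm z" "0 < exp 1 + nm y" using nz nm_nonneg[OF y(1)] by (auto simp: add_pos_nonneg)
  have "L y \<le> ln (3 * A * (exp 1 + nm z))" unfolding L_def using le p by simp
  also have "\<dots> = ln (3 * A) + L z" unfolding L_def using A p by (subst ln_mult) auto
  also have "\<dots> \<le> ln (3 * A) * L z + L z"
    using mult_left_mono[OF L_ge_1[OF assms(1)], of "ln (3 * A)"] A by simp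
  finally show ?thesis by (simp add: algebra_simps)
qed

end

context density_data
begin

definition "aref z r = (if z = o' \<and> 1 \<le> r then ainf else a z)"

lemma aref_bounds: "z \<in> X \<Longrightarrow> al \<le> aref z r \<and> aref z r \<le> au"
  using a_bounds ainf_bounds by (simp add: aref_def)

lemma H_nonneg: "0 \<le> H" using LH_a by (simp add: LH_def)

text \<open>On a near ball the logarithm of the norm is of order \<open>\<Lambda> z r\<close> and
  the oscillation of \<open>a\<close> of order \<open>1 / \<Lambda> z r\<close>, so the powers agree
  up to a constant. On a far ball \<open>powr_perturb\<close> is applied to
  \<open>1 / n z r\<close>, which is bounded. The factor \<open>\<epsilon>\<close> stays free
  because a lower bound for a measure has to absorb the error.\<close>

lemma ref_compare:
  assumes eps: "0 < \<epsilon>" "\<epsilon> \<le> 1" and t: "0 \<le> t"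
  shows "\<exists>C\<ge>1. \<forall>z r x. good \<kappa>1 z r \<longrightarrow> x \<in> B z r \<longrightarrow>
    n z r powr (- a x) \<le> C * n z r powr (- aref z r) + \<epsilon> * (far z r * tail t x) \<and>
    n z r powr (- aref z r) \<le> C * n z r powr (- a x) + \<epsilon> * (far z r * tail t x)"
proof -
  obtain Cn where Cn: "0 \<le> Cn" and
    near: "\<And>z r. z \<in> X \<Longrightarrow> 0 < r \<Longrightarrow> r \<le> \<kappa>1 * (1 + nm z) \<Longrightarrow> \<bar>ln (n z r)\<bar> \<le> Cn * \<Lambda> z r"
    using ln_n_local by blast
  obtain H' where H': "0 \<le> H'" and
    osc: "\<And>z r x y. z \<in> X \<Longrightarrow> 0 < r \<Longrightarrow> r \<le> \<kappa>1 * (1 + nm z) \<Longrightarrow> x \<in> B z r \<Longrightarrow> y \<in> B z r \<Longrightarrow>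
      \<bar>a x - a y\<bar> \<le> H' / \<Lambda> z r"
    using LH_osc[OF LH_a] by blast
  obtain n0 where n0: "0 < n0" "\<And>r. 1 \<le> r \<Longrightarrow> n0 \<le> n o' r" using n_origin_bounded_below by blast
  define Y where "Y = max 1 (1 / n0)"
  define E1 where "E1 = Cn * H'"
  define E2 where "E2 = H * (ln Y + (t + ln (1 / \<epsilon>)) / al)"
  have E: "0 \<le> E1" "0 \<le> E2" unfolding E1_def E2_def Y_def using Cn H' H_nonneg t eps al by auto
  define C where "C = max (exp E1) (exp E2)"
  have C: "1 \<le> C" unfolding C_def using E by (simp add: le_max_iff_disj)
  have "n z r powr (- a x) \<le> C * n z r powr (- aref z r) + \<epsilon> * (far z r * tail t x) \<and>
    n z r powr (- aref z r) \<le> C * n z r powr (- a x) + \<epsilon> * (far z r * tail t x)"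
    if g: "good \<kappa>1 z r" and x: "x \<in> B z r" for z r x
  proof -
    have zr: "z \<in> X" "0 < r" using goodD[OF g] by auto
    have xX: "x \<in> X" using x by simp
    have np: "0 < n z r" using n_pos zr by simp
    have neg: "n z r powr (- \<alpha>) = (1 / n z r) powr \<alpha>" for \<alpha>
      using np by (simp add: powr_divide powr_minus_divide)
    show ?thesis
    proof (cases "z = o' \<and> 1 \<le> r")
      case True
      have y: "0 \<le> 1 / n z r" "1 / n z r \<le> Y" using n0(2)[of r] n0(1) True np
        by (auto simp: Y_def le_max_iff_disj frac_le)
      have Y1: "1 \<le> Y" by (simp add: Y_def)
      have LHx: "\<bar>a x - ainf\<bar> \<le> H / L x" using LH_a xX by (simp add: LH_def)
      have ax: "al \<le> a x" "al \<le> ainf" using a_bounds[OF xX] ainf_bounds by auto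
      have 1: "(1 / n z r) powr a x \<le> exp E2 * (1 / n z r) powr ainf + \<epsilon> * exp (- t * L x)"
        unfolding E2_def by (rule powr_perturb[OF L_ge_1[OF xX] H_nonneg LHx al ax(1) y Y1 eps t])
      have LHx': "\<bar>ainf - a x\<bar> \<le> H / L x" using LHx by (simp add: abs_minus_commute)
      have 2: "(1 / n z r) powr ainf \<le> exp E2 * (1 / n z r) powr a x + \<epsilon> * exp (- t * L x)"
        unfolding E2_def by (rule powr_perturb[OF L_ge_1[OF xX] H_nonneg LHx' al ax(2) y Y1 eps t])
      have "exp E2 * q \<le> C * q" if "0 \<le> q" for q
        using that by (intro mult_right_mono) (auto simp: C_def)
      then show ?thesis using 1 2 True unfolding neg aref_def far_def tail_def
        by (auto intro: order_trans)
    next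
      case False
      have small: "r \<le> \<kappa>1 * (1 + nm z)" by (rule good_near[OF g False])
      have "\<bar>ln (n z r)\<bar> * \<bar>a x - a z\<bar> \<le> (Cn * \<Lambda> z r) * (H' / \<Lambda> z r)"
        using near[OF zr small] osc[OF zr small x center_in_B[OF zr]] Cn \<Lambda>_ge_2[OF zr]
        by (intro mult_mono) auto
      also have "\<dots> = E1" using \<Lambda>_ge_2[OF zr] by (simp add: E1_def)
      finally have le: "\<bar>ln (n z r)\<bar> * \<bar>a x - a z\<bar> \<le> E1" .
      have "n z r powr (- a x) \<le> exp E1 * n z r powr (- a z)"
        by (rule powr_exponent_change[OF np]) (use le in \<open>simp add: abs_minus_commute\<close>)
      moreover have "n z r powr (- a z) \<le> exp E1 * n z r powr (- a x)"
        by (rule powr_exponent_change[OF np]) (use le in \<open>simp add: abs_minus_commute\<close>)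
      moreover have "exp E1 * q \<le> C * q" if "0 \<le> q" for q
        using that by (intro mult_right_mono) (auto simp: C_def)
      ultimately show ?thesis using False unfolding aref_def far_def
        by (auto intro: order_trans)
    qed
  qed
  then show ?thesis using C by blast
qed

lemma rho_const_integral:
  assumes E: "E \<in> sets M" and y: "0 \<le> y"
  shows "(\<integral>\<^sup>+x\<in>E. ennreal (\<rho> x * y) \<partial>M) = ennreal y * emeasure N E"
proof -
  note E[measurable]
  have "(\<integral>\<^sup>+x\<in>E. ennreal (\<rho> x * y) \<partial>M) = (\<integral>\<^sup>+x. ennreal y * (ennreal (\<rho> x) * indicator E x) \<partial>M)"
    using y rho_nonneg by (intro nn_integral_cong) (simp add: ennreal_mult mult_ac)
  also have "\<dots> = ennreal y * emeasure N E"
    unfolding emeasure_N[OF E] by (rule nn_integral_cmult) measurable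
  finally show ?thesis .
qed

lemma rho_integral_add_tail:
  assumes E: "E \<in> sets M" and C: "0 \<le> C" and eps: "0 \<le> \<epsilon>"
    and f: "\<And>x. x \<in> E \<Longrightarrow> 0 \<le> f x \<and> f x \<le> C * g x + \<epsilon> * tail t x"
    and g: "\<And>x. 0 \<le> g x" and [measurable]: "g \<in> borel_measurable M"
  shows "(\<integral>\<^sup>+x\<in>E. ennreal (\<rho> x * f x) \<partial>M) \<le>
    ennreal C * (\<integral>\<^sup>+x\<in>E. ennreal (\<rho> x * g x) \<partial>M) + ennreal \<epsilon> * (\<integral>\<^sup>+x. ennreal (tail t x) \<partial>N)"
proof -
  note E[measurable]
  have "(\<integral>\<^sup>+x\<in>E. ennreal (\<rho> x * f x) \<partial>M) \<le>
     (\<integral>\<^sup>+x. ennreal C * (ennreal (\<rho> x * g x) * indicator E x) + ennreal \<epsilon> * (ennreal (\<rho> x) * ennreal (tail t x)) \<partial>M)"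
  proof (rule nn_integral_mono)
    fix x
    show "ennreal (\<rho> x * f x) * indicator E x \<le>
      ennreal C * (ennreal (\<rho> x * g x) * indicator E x) + ennreal \<epsilon> * (ennreal (\<rho> x) * ennreal (tail t x))"
    proof (cases "x \<in> E")
      case True
      have "\<rho> x * f x \<le> C * (\<rho> x * g x) + \<epsilon> * (\<rho> x * tail t x)"
        using mult_left_mono[OF conjunct2[OF f[OF True]] rho_nonneg[of x]] by (simp add: algebra_simps)
      then have "ennreal (\<rho> x * f x) \<le> ennreal (C * (\<rho> x * g x) + \<epsilon> * (\<rho> x * tail t x))"
        by (rule ennreal_leI)
      also have "\<dots> = ennreal C * ennreal (\<rho> x * g x) + ennreal \<epsilon> * (ennreal (\<rho> x) * ennreal (tail t x))"
        using C eps g[of x] rho_nonneg[of x] tail_pos[of t x]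
        by (simp add: ennreal_plus ennreal_mult)
      finally show ?thesis using True by simp
    qed simp
  qed
  also have "\<dots> = ennreal C * (\<integral>\<^sup>+x\<in>E. ennreal (\<rho> x * g x) \<partial>M) + ennreal \<epsilon> * (\<integral>\<^sup>+x. ennreal (\<rho> x) * ennreal (tail t x) \<partial>M)"
    by (simp add: nn_integral_add nn_integral_cmult)
  also have "(\<integral>\<^sup>+x. ennreal (\<rho> x) * ennreal (tail t x) \<partial>M) = (\<integral>\<^sup>+x. ennreal (tail t x) \<partial>N)"
    by (subst nn_integral_N) auto
  finally show ?thesis .
qed

text \<open>With the exponent frozen, the upper modular bound becomes a bound for the mass of the
  ball times a constant power of the norm. The integrable tail only enlarges the constant.\<close>

lemma measure_le_n:
  "\<exists>C\<ge>1. \<forall>z r. good \<kappa>1 z r \<longrightarrow> measure N (B z r) \<le> C * n z r powr aref z r"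
proof -
  obtain t where t: "0 \<le> t" and T: "(\<integral>\<^sup>+x. ennreal (tail t x) \<partial>N) < \<infinity>" using tail_integrable by blast
  define T' where "T' = enn2real (\<integral>\<^sup>+x. ennreal (tail t x) \<partial>N)"
  have T': "(\<integral>\<^sup>+x. ennreal (tail t x) \<partial>N) = ennreal T'" "0 \<le> T'" using T by (auto simp: T'_def)
  obtain C where C: "1 \<le> C" and cmp: "\<And>z r x. good \<kappa>1 z r \<Longrightarrow> x \<in> B z r \<Longrightarrow>
    n z r powr (- aref z r) \<le> C * n z r powr (- a x) + 1 * (far z r * tail t x)"
    using ref_compare[of 1 t] t by auto
  have "measure N (B z r) \<le> (C * K + T') * n z r powr aref z r" if g: "good \<kappa>1 z r" for z r
  proof -
    have zr: "z \<in> X" "0 < r" using goodD[OF g] by auto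
    have np: "0 < n z r" using n_pos zr by simp
    have "ennreal (n z r powr (- aref z r)) * emeasure N (B z r) = (\<integral>\<^sup>+x\<in>B z r. ennreal (\<rho> x * n z r powr (- aref z r)) \<partial>M)"
      using rho_const_integral[OF ball_sets[OF zr], of "n z r powr (- aref z r)"] by simp
    also have "\<dots> \<le> ennreal C * (\<integral>\<^sup>+x\<in>B z r. ennreal (\<rho> x * n z r powr (- a x)) \<partial>M) + ennreal 1 * (\<integral>\<^sup>+x. ennreal (tail t x) \<partial>N)"
    proof (rule rho_integral_add_tail[OF ball_sets[OF zr]])
      fix x assume x: "x \<in> B z r"
      have "far z r * tail t x \<le> 1 * tail t x"
        using far_le_1 tail_pos[of t x] by (intro mult_right_mono) auto
      then show "0 \<le> n z r powr - aref z r \<and> n z r powr - aref z r \<le> C * n z r powr - a x + 1 * tail t x"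
        using cmp[OF g x] by simp
    qed (use C in auto)
    also have "\<dots> \<le> ennreal C * ennreal K + ennreal T'"
      using up[OF zr] T' by (auto intro!: add_mono mult_left_mono)
    also have "\<dots> = ennreal (C * K + T')" using C K T' by (simp add: ennreal_mult ennreal_plus)
    finally have "ennreal (n z r powr (- aref z r) * measure N (B z r)) \<le> ennreal (C * K + T')"
      using emeasure_N_eq[OF zr order_refl] by (simp add: ennreal_mult)
    then have "n z r powr (- aref z r) * measure N (B z r) \<le> C * K + T'"
      using C K T' by (subst (asm) ennreal_le_iff) auto
    then have le: "n z r powr aref z r * (n z r powr (- aref z r) * measure N (B z r)) \<le> n z r powr aref z r * (C * K + T')"
      by (intro mult_left_mono) auto
    show ?thesis using le unfolding powr_mult_minus_cancel[OF np] by (simp only: mult.commute)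
  qed
  moreover have "1 * 1 \<le> C * K" using C K by (intro mult_mono) auto
  then have "1 \<le> C * K + T'" using T' by simp
  ultimately show ?thesis by blast
qed

text \<open>The lower modular bound is read with the exponent frozen. Here the tail stands on the
  wrong side and must be smaller than the bound itself.\<close>

lemma n_le_measure:
  assumes dl: "0 < \<delta>"
  shows "\<exists>c'>0. \<forall>z r E. good \<kappa>1 z r \<longrightarrow> E \<in> sets M \<longrightarrow> E \<subseteq> B z r \<longrightarrow>
    \<delta> * measure M (B z r) \<le> measure M E \<longrightarrow> c' * n z r powr aref z r \<le> measure N E"
proof -
  obtain t where t: "0 \<le> t" and T: "(\<integral>\<^sup>+x. ennreal (tail t x) \<partial>N) < \<infinity>" using tail_integrable by blast
  define T' where "T' = enn2real (\<integral>\<^sup>+x. ennreal (tail t x) \<partial>N)"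
  have T': "(\<integral>\<^sup>+x. ennreal (tail t x) \<partial>N) = ennreal T'" "0 \<le> T'" using T by (auto simp: T'_def)
  define b where "b = c * \<delta> powr D"
  have b: "0 < b" unfolding b_def using c dl by simp
  \<comment> \<open>Chosen so that the tail uses up at most half of the lower bound
    \<open>b\<close>; adding 1 to \<open>T'\<close> keeps the denominator positive.\<close>
  define \<epsilon> where "\<epsilon> = min 1 (b / (2 * (T' + 1)))"
  have eps: "0 < \<epsilon>" "\<epsilon> \<le> 1" unfolding \<epsilon>_def using b T' by auto
  have "\<epsilon> * T' \<le> b / (2 * (T' + 1)) * T'" using T' by (intro mult_right_mono) (auto simp: \<epsilon>_def)
  also have "\<dots> \<le> b / 2" using b T' by (simp add: field_simps)
  finally have eT: "\<epsilon> * T' \<le> b / 2" .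
  obtain C where C: "1 \<le> C" and cmp: "\<And>z r x. good \<kappa>1 z r \<Longrightarrow> x \<in> B z r \<Longrightarrow>
    n z r powr (- a x) \<le> C * n z r powr (- aref z r) + \<epsilon> * (far z r * tail t x)"
    using ref_compare[OF eps t] by blast
  have "b / (2 * C) * n z r powr aref z r \<le> measure N E"
    if g: "good \<kappa>1 z r" and E: "E \<in> sets M" "E \<subseteq> B z r" and m: "\<delta> * measure M (B z r) \<le> measure M E" for z r E
  proof -
    have zr: "z \<in> X" "0 < r" using goodD[OF g] by auto
    have np: "0 < n z r" using n_pos zr by simp
    have "\<delta> \<le> measure M E / measure M (B z r)" using m mB_pos[OF zr] by (simp add: pos_le_divide_eq)
    then have "b \<le> c * (measure M E / measure M (B z r)) powr D"
      unfolding b_def using c dl D by (intro mult_left_mono powr_mono2) auto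
    then have "ennreal b \<le> (\<integral>\<^sup>+x\<in>E. ennreal (\<rho> x * n z r powr (- a x)) \<partial>M)"
      using lo[OF zr E] by (meson ennreal_leI order_trans)
    also have "\<dots> \<le> ennreal C * (\<integral>\<^sup>+x\<in>E. ennreal (\<rho> x * n z r powr (- aref z r)) \<partial>M) + ennreal \<epsilon> * (\<integral>\<^sup>+x. ennreal (tail t x) \<partial>N)"
    proof (rule rho_integral_add_tail[OF E(1)])
      fix x assume x: "x \<in> E"
      have "far z r * tail t x \<le> 1 * tail t x"
        using far_le_1 tail_pos[of t x] by (intro mult_right_mono) auto
      then have "\<epsilon> * (far z r * tail t x) \<le> \<epsilon> * tail t x" using eps by simp
      then show "0 \<le> n z r powr - a x \<and> n z r powr - a x \<le> C * n z r powr - aref z r + \<epsilon> * tail t x"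
        using cmp[OF g subsetD[OF E(2) x]] by simp
    qed (use C eps in auto)
    also have "\<dots> = ennreal C * (ennreal (n z r powr (- aref z r)) * ennreal (measure N E)) + ennreal \<epsilon> * ennreal T'"
      using rho_const_integral[OF E(1)] T' emeasure_N_eq[OF zr E(2)] by simp
    also have "\<dots> = ennreal (C * (n z r powr (- aref z r) * measure N E) + \<epsilon> * T')"
      using C eps T' by (simp add: ennreal_mult ennreal_plus)
    finally have "b \<le> C * (n z r powr (- aref z r) * measure N E) + \<epsilon> * T'"
      using C eps T' by (subst (asm) ennreal_le_iff) auto
    then have "b / 2 \<le> C * (n z r powr (- aref z r) * measure N E)" using eT by linarith
    then have "n z r powr aref z r * (b / 2) \<le> n z r powr aref z r * (C * (n z r powr (- aref z r) * measure N E))"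
      by (intro mult_left_mono) auto
    also have "\<dots> = C * (n z r powr aref z r * (n z r powr (- aref z r) * measure N E))" by simp
    also have "\<dots> = C * measure N E" unfolding powr_mult_minus_cancel[OF np] ..
    finally show ?thesis using C by (simp add: field_simps)
  qed
  moreover have "0 < b / (2 * C)" using b C by simp
  ultimately show ?thesis by blast
qed

lemma n_le_measure_ball:
  "\<exists>C\<ge>1. \<forall>z r. good \<kappa>1 z r \<longrightarrow> n z r powr aref z r \<le> C * measure N (B z r)"
proof -
  obtain c' where c': "0 < c'" and le: "\<And>z r E. good \<kappa>1 z r \<Longrightarrow> E \<in> sets M \<Longrightarrow> E \<subseteq> B z r \<Longrightarrow>
    1 * measure M (B z r) \<le> measure M E \<Longrightarrow> c' * n z r powr aref z r \<le> measure N E"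
    using n_le_measure[of 1] by auto
  have "n z r powr aref z r \<le> max 1 (1 / c') * measure N (B z r)" if g: "good \<kappa>1 z r" for z r
  proof -
    have "c' * n z r powr aref z r \<le> measure N (B z r)"
      using le[OF g] ball_sets goodD[OF g] by simp
    then have "n z r powr aref z r \<le> 1 / c' * measure N (B z r)" using c' by (simp add: field_simps)
    also have "\<dots> \<le> max 1 (1 / c') * measure N (B z r)" by (intro mult_right_mono) auto
    finally show ?thesis .
  qed
  then show ?thesis by (intro exI[of _ "max 1 (1 / c')"]) auto
qed

text \<open>Mass of the subset and mass of the ball are both compared with the same power of the
  norm, which then cancels.\<close>

lemma A_infinity:
  assumes "0 < \<delta>"
  shows "\<exists>c'>0. \<forall>z r E. good \<kappa>1 z r \<longrightarrow> E \<in> sets M \<longrightarrow> E \<subseteq> B z r \<longrightarrow>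
    \<delta> * measure M (B z r) \<le> measure M E \<longrightarrow> c' * measure N (B z r) \<le> measure N E"
proof -
  obtain c' where c': "0 < c'" and le: "\<And>z r E. good \<kappa>1 z r \<Longrightarrow> E \<in> sets M \<Longrightarrow> E \<subseteq> B z r \<Longrightarrow>
    \<delta> * measure M (B z r) \<le> measure M E \<Longrightarrow> c' * n z r powr aref z r \<le> measure N E"
    using n_le_measure[OF assms] by blast
  obtain C where C: "1 \<le> C" and leC: "\<And>z r. good \<kappa>1 z r \<Longrightarrow> measure N (B z r) \<le> C * n z r powr aref z r"
    using measure_le_n by blast
  have "c' / C * measure N (B z r) \<le> measure N E"
    if g: "good \<kappa>1 z r" and "E \<in> sets M" "E \<subseteq> B z r" "\<delta> * measure M (B z r) \<le> measure M E" for z r E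
  proof -
    have "c' * measure N (B z r) \<le> c' * (C * n z r powr aref z r)"
      using leC[OF g] c' by (intro mult_left_mono) auto
    also have "\<dots> = C * (c' * n z r powr aref z r)" by simp
    also have "\<dots> \<le> C * measure N E" using le[OF that] C by (intro mult_left_mono) auto
    finally show ?thesis using C by (simp add: field_simps)
  qed
  moreover have "0 < c' / C" using c' C by simp
  ultimately show ?thesis by blast
qed

text \<open>The ball is a subset of its dilate with a fixed proportion of the underlying measure, so
  the A_infinity property applies to the dilate.\<close>

lemma doubling_N:
  "\<exists>C\<ge>1. \<forall>z r. good \<kappa>0 z r \<longrightarrow> emeasure N (B z (\<theta> * r)) \<le> ennreal C * emeasure N (B z r)"
proof -
  define \<delta> where "\<delta> = 1 / (Cd * \<theta> powr Dm)"
  have q: "0 < Cd * \<theta> powr Dm" using Cd \<theta>_ge_1 by simp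
  have dl: "0 < \<delta>" unfolding \<delta>_def using q by simp
  obtain c' where c': "0 < c'" and le: "\<And>z r E. good \<kappa>1 z r \<Longrightarrow> E \<in> sets M \<Longrightarrow> E \<subseteq> B z r \<Longrightarrow>
    \<delta> * measure M (B z r) \<le> measure M E \<Longrightarrow> c' * measure N (B z r) \<le> measure N E"
    using A_infinity[OF dl] by blast
  have "emeasure N (B z (\<theta> * r)) \<le> ennreal (max 1 (1 / c')) * emeasure N (B z r)" if g: "good \<kappa>0 z r" for z r
  proof -
    have zr: "z \<in> X" "0 < r" using goodD[OF g] by auto
    have tr: "0 < \<theta> * r" "r \<le> \<theta> * r" using zr \<theta>_ge_1 by auto
    have sub: "B z r \<subseteq> B z (\<theta> * r)" using tr by (auto simp: qball_def)
    have "c' * measure N (B z (\<theta> * r)) \<le> measure N (B z r)"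
    proof (rule le[OF good_dilate[OF g] ball_sets[OF zr] sub])
      show "\<delta> * measure M (B z (\<theta> * r)) \<le> measure M (B z r)"
        using doubling_dilate[OF zr \<theta>_ge_1] q unfolding \<delta>_def by (simp add: field_simps)
    qed
    then have "measure N (B z (\<theta> * r)) \<le> 1 / c' * measure N (B z r)" using c' by (simp add: field_simps)
    also have "\<dots> \<le> max 1 (1 / c') * measure N (B z r)" by (intro mult_right_mono) auto
    finally have "ennreal (measure N (B z (\<theta> * r))) \<le> ennreal (max 1 (1 / c')) * ennreal (measure N (B z r))"
      by (simp add: ennreal_mult[symmetric] ennreal_leI le_max_iff_disj)
    then show ?thesis using emeasure_N_eq[OF zr order_refl] emeasure_N_eq[OF zr(1) tr(1) order_refl] by simp
  qed
  then show ?thesis by (intro exI[of _ "max 1 (1 / c')"]) auto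
qed

lemma n_powr_le_inverse_measure:
  assumes t: "0 \<le> t"
  shows "\<exists>C\<ge>1. \<forall>z r x. good \<kappa>1 z r \<longrightarrow> x \<in> B z r \<longrightarrow>
    n z r powr (- a x) \<le> C / measure N (B z r) + far z r * tail t x"
proof -
  obtain C where C: "1 \<le> C" and cmp: "\<And>z r x. good \<kappa>1 z r \<Longrightarrow> x \<in> B z r \<Longrightarrow>
    n z r powr (- a x) \<le> C * n z r powr (- aref z r) + 1 * (far z r * tail t x)"
    using ref_compare[of 1 t] t by auto
  obtain C' where C': "1 \<le> C'" and leC: "\<And>z r. good \<kappa>1 z r \<Longrightarrow> measure N (B z r) \<le> C' * n z r powr aref z r"
    using measure_le_n by blast
  have "n z r powr (- a x) \<le> (C * C') / measure N (B z r) + far z r * tail t x"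
    if g: "good \<kappa>1 z r" and x: "x \<in> B z r" for z r x
  proof -
    have zr: "z \<in> X" "0 < r" using goodD[OF g] by auto
    have np: "0 < n z r" using n_pos zr by simp
    have mp: "0 < measure N (B z r)" using mN_ball_pos zr by simp
    have "n z r powr (- aref z r) * measure N (B z r) \<le> n z r powr (- aref z r) * (C' * n z r powr aref z r)"
      using leC[OF g] by (intro mult_left_mono) auto
    also have "\<dots> = C'" using np by (simp add: powr_minus)
    finally have "n z r powr (- aref z r) \<le> C' / measure N (B z r)" using mp by (simp add: field_simps)
    then have "C * n z r powr (- aref z r) \<le> C * (C' / measure N (B z r))"
      using C by (intro mult_left_mono) auto
    then show ?thesis using cmp[OF g x] by simp
  qed
  moreover have "1 * 1 \<le> C * C'" using C C' by (intro mult_mono) auto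
  ultimately show ?thesis by (intro exI[of _ "C * C'"]) auto
qed

text \<open>Transfers the logarithmic bound from norms to masses, so that the exponent of a power of
  the mass can be changed as well.\<close>

lemma ln_measure_local:
  "\<exists>C\<ge>0. \<forall>z r. good \<kappa>1 z r \<longrightarrow> \<not> (z = o' \<and> 1 \<le> r) \<longrightarrow> \<bar>ln (measure N (B z r))\<bar> \<le> C * \<Lambda> z r"
proof -
  obtain Cn where Cn: "0 \<le> Cn" and
    near: "\<And>z r. z \<in> X \<Longrightarrow> 0 < r \<Longrightarrow> r \<le> \<kappa>1 * (1 + nm z) \<Longrightarrow> \<bar>ln (n z r)\<bar> \<le> Cn * \<Lambda> z r"
    using ln_n_local by blast
  obtain C1 where C1: "1 \<le> C1" and le1: "\<And>z r. good \<kappa>1 z r \<Longrightarrow> measure N (B z r) \<le> C1 * n z r powr aref z r"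
    using measure_le_n by blast
  obtain C2 where C2: "1 \<le> C2" and le2: "\<And>z r. good \<kappa>1 z r \<Longrightarrow> n z r powr aref z r \<le> C2 * measure N (B z r)"
    using n_le_measure_ball by blast
  have au0: "0 \<le> au" using al al_le_au by simp
  have "\<bar>ln (measure N (B z r))\<bar> \<le> (ln C1 + ln C2 + au * Cn) * \<Lambda> z r"
    if g: "good \<kappa>1 z r" and nf: "\<not> (z = o' \<and> 1 \<le> r)" for z r
  proof -
    have zr: "z \<in> X" "0 < r" using goodD[OF g] by auto
    have np: "0 < n z r" using n_pos zr by simp
    have mp: "0 < measure N (B z r)" using mN_ball_pos zr by simp
    have L1: "1 \<le> \<Lambda> z r" using \<Lambda>_ge_2[OF zr] by simp
    have ar: "0 \<le> aref z r" "aref z r \<le> au" using aref_bounds[OF zr(1), of r] al by auto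
    have "\<bar>aref z r * ln (n z r)\<bar> \<le> au * (Cn * \<Lambda> z r)"
      unfolding abs_mult using near[OF zr good_near[OF g nf]] ar by (intro mult_mono) auto
    moreover have "ln (measure N (B z r)) \<le> ln C1 + aref z r * ln (n z r)"
    proof -
      have "ln (measure N (B z r)) \<le> ln (C1 * n z r powr aref z r)"
        using le1[OF g] mp C1 np by (subst ln_le_cancel_iff) auto
      then show ?thesis using C1 np by (simp add: ln_mult ln_powr)
    qed
    moreover have "aref z r * ln (n z r) \<le> ln C2 + ln (measure N (B z r))"
    proof -
      have "ln (n z r powr aref z r) \<le> ln (C2 * measure N (B z r))"
        using le2[OF g] mp C2 np by (subst ln_le_cancel_iff) auto
      then show ?thesis using C2 np mp by (simp add: ln_mult ln_powr)
    qed
    moreover have l0: "0 \<le> ln C1" "0 \<le> ln C2" using C1 C2 by auto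
    ultimately have "\<bar>ln (measure N (B z r))\<bar> \<le> ln C1 + ln C2 + au * (Cn * \<Lambda> z r)" by linarith
    also have "\<dots> \<le> (ln C1 + ln C2) * \<Lambda> z r + au * (Cn * \<Lambda> z r)"
      using mult_left_mono[OF L1, of "ln C1 + ln C2"] l0 by simp
    finally show ?thesis by (simp add: algebra_simps)
  qed
  moreover have "0 \<le> ln C1 + ln C2 + au * Cn" using C1 C2 au0 Cn by simp
  ultimately show ?thesis by blast
qed

end

section \<open>Averages of a function against a dual density\<close>

text \<open>Compares \<open>y\<close> with \<open>x powr (p - 1)\<close>: in either case one summand
  alone dominates the product.\<close>

lemma young_simple:
  fixes x y :: real
  assumes "0 \<le> x" "0 \<le> y" "1 < p"
  shows "x * y \<le> x powr p + y powr (p / (p - 1))"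
proof (cases "y \<le> x powr (p - 1)")
  case True
  have "x * y \<le> x * x powr (p - 1)" using True assms by (intro mult_left_mono) auto
  also have "\<dots> = x powr p" using assms by (cases "x = 0") (auto simp: powr_diff)
  finally show ?thesis by (simp add: add_increasing2)
next
  case False
  then have y: "0 < y" by (meson le_less_trans not_le powr_ge_zero)
  have "x = (x powr (p - 1)) powr (1 / (p - 1))" using assms by (simp add: powr_powr)
  also have "\<dots> \<le> y powr (1 / (p - 1))" using False assms by (intro powr_mono2) auto
  finally have "x * y \<le> y powr (1 / (p - 1)) * y powr 1" using y by (simp add: mult_right_mono)
  also have "\<dots> = y powr (1 / (p - 1) + 1)" by (simp add: powr_add)
  also have "1 / (p - 1) + 1 = p / (p - 1)" using assms by (simp add: field_simps)
  finally show ?thesis by (simp add: add_increasing)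
qed

text \<open>Pairs the exponent \<open>p\<close> of one function with the conjugate exponent
  \<open>a\<close> of its dual density. The lower bound \<open>s\<close> of \<open>p\<close> doubles
  as the integrability exponent in the maximal theorem, which is why it exceeds 1.\<close>

locale conj_data = density_data M d A Cd o' \<rho> a n al au H ainf K c D
  for M :: "'a measure" and d A Cd o' \<rho> a n al au H ainf K c D +
  fixes p :: "'a \<Rightarrow> real" and s pp Hp pinf :: real
  assumes p_meas [measurable]: "p \<in> borel_measurable M"
    and s: "1 < s"
    and p_bounds: "\<And>x. x \<in> space M \<Longrightarrow> s \<le> p x \<and> p x \<le> pp"
    and pinf_bounds: "s \<le> pinf \<and> pinf \<le> pp"
    and LH_p: "LH p Hp pinf"
    and conj: "\<And>x. x \<in> space M \<Longrightarrow> a x = p x / (p x - 1)"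
    and conj_inf: "ainf = pinf / (pinf - 1)"
begin

text \<open>The L^s function whose averages dominate all powers of averages of \<open>g\<close>: the
  power \<open>s\<close> of its first summand is the modular integrand of \<open>g\<close>, and the
  tail absorbs every error made when an exponent is frozen.\<close>

definition "hh t g y = g y powr (p y / s) + tail t y"

lemma hh_nonneg: "0 \<le> hh t g y"
  using tail_pos[of t y] by (simp add: hh_def add_nonneg_nonneg)

lemma hh_measurable:
  assumes [measurable]: "g \<in> borel_measurable M"
  shows "hh t g \<in> borel_measurable M"
  unfolding hh_def[abs_def] by measurable

lemma space_N: "space N = X"
  by (rule sets_eq_imp_space_eq[OF sets_N])

lemma borel_N: "f \<in> borel_measurable N \<longleftrightarrow> f \<in> borel_measurable M"
  using measurable_cong_sets[OF sets_N refl] by blast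

lemma hh_power_integral:
  assumes t: "0 \<le> t" and T: "(\<integral>\<^sup>+x. ennreal (tail t x) \<partial>N) \<le> ennreal T" "0 \<le> T"
    and g: "g \<in> borel_measurable M" "\<And>x. 0 \<le> g x"
    and one: "(\<integral>\<^sup>+x. ennreal (\<rho> x * g x powr p x) \<partial>M) \<le> 1"
  shows "(\<integral>\<^sup>+x. ennreal (hh t g x powr s) \<partial>N) \<le> ennreal (2 powr s * (1 + T))"
proof -
  note g(1)[measurable]
  have pw: "hh t g x powr s \<le> 2 powr s * (g x powr p x + tail t x)" if x: "x \<in> X" for x
  proof -
    define u where "u = g x powr (p x / s)"
    have u: "0 \<le> u" "u powr s = g x powr p x" using s by (auto simp: u_def powr_powr)
    define v where "v = tail t x"
    have v: "0 \<le> v" "v \<le> 1" using tail_pos[of t x] tail_le_1[OF t x] by (auto simp: v_def)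
    have vs: "v powr s \<le> v"
      using powr_mono'[of 1 s v] v s by simp
    have "(u + v) powr s \<le> (2 * max u v) powr s" using u v s by (intro powr_mono2) auto
    also have "\<dots> = 2 powr s * max u v powr s" using u by (subst powr_mult) auto
    also have "max u v powr s \<le> u powr s + v powr s" by (auto simp: max_def add_increasing add_increasing2)
    finally show ?thesis using u vs by (simp add: hh_def u_def[symmetric] v_def[symmetric] order_trans mult_left_mono)
  qed
  have "(\<integral>\<^sup>+x. ennreal (hh t g x powr s) \<partial>N) \<le>
      (\<integral>\<^sup>+x. ennreal (2 powr s) * (ennreal (g x powr p x) + ennreal (tail t x)) \<partial>N)"
  proof (rule nn_integral_mono)
    fix x assume "x \<in> space N"
    then have "ennreal (hh t g x powr s) \<le> ennreal (2 powr s * (g x powr p x + tail t x))"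
      using pw space_N by (intro ennreal_leI) auto
    then show "ennreal (hh t g x powr s) \<le> ennreal (2 powr s) * (ennreal (g x powr p x) + ennreal (tail t x))"
      using tail_pos[of t x] by (simp add: ennreal_mult ennreal_plus)
  qed
  also have "\<dots> = ennreal (2 powr s) * ((\<integral>\<^sup>+x. ennreal (g x powr p x) \<partial>N) + (\<integral>\<^sup>+x. ennreal (tail t x) \<partial>N))"
    by (simp add: nn_integral_cmult nn_integral_add)
  also have "(\<integral>\<^sup>+x. ennreal (g x powr p x) \<partial>N) = (\<integral>\<^sup>+x. ennreal (\<rho> x * g x powr p x) \<partial>M)"
    using rho_nonneg by (subst nn_integral_N) (auto simp: ennreal_mult)
  also have "ennreal (2 powr s) * (\<dots> + (\<integral>\<^sup>+x. ennreal (tail t x) \<partial>N)) \<le> ennreal (2 powr s) * (1 + ennreal T)"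
    using one T by (intro mult_left_mono add_mono) auto
  also have "\<dots> = ennreal (2 powr s * (1 + T))" using T by (simp add: ennreal_mult ennreal_plus)
  finally show ?thesis .
qed

text \<open>Hoelder's inequality for a norm and its conjugate, obtained by integrating Young's
  inequality for the factors \<open>g x\<close> and \<open>1 / n z r\<close>; the conjugate power of
  the second is the normalised integrand of the density.\<close>

lemma ball_integral_le:
  assumes g: "g \<in> borel_measurable M" "\<And>x. 0 \<le> g x"
    and one: "(\<integral>\<^sup>+x. ennreal (\<rho> x * g x powr p x) \<partial>M) \<le> 1"
    and zr: "z \<in> X" "0 < r"
  shows "(\<integral>\<^sup>+x\<in>B z r. ennreal (g x) \<partial>N) \<le> ennreal ((1 + K) * n z r)"
proof -
  note g(1)[measurable]
  have BM [measurable]: "B z r \<in> sets M" using ball_sets zr by simp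
  have np: "0 < n z r" using n_pos zr by simp
  have "(\<integral>\<^sup>+x\<in>B z r. ennreal (g x) \<partial>N) = (\<integral>\<^sup>+x. ennreal (\<rho> x) * (ennreal (g x) * indicator (B z r) x) \<partial>M)"
    by (rule nn_integral_N) measurable
  also have "\<dots> \<le> (\<integral>\<^sup>+x. ennreal (n z r) * (ennreal (\<rho> x * g x powr p x) +
      ennreal (\<rho> x * n z r powr (- a x)) * indicator (B z r) x) \<partial>M)"
  proof (rule nn_integral_mono)
    fix x assume xX: "x \<in> X"
    show "ennreal (\<rho> x) * (ennreal (g x) * indicator (B z r) x) \<le> ennreal (n z r) *
       (ennreal (\<rho> x * g x powr p x) + ennreal (\<rho> x * n z r powr (- a x)) * indicator (B z r) x)"
    proof (cases "x \<in> B z r")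
      case True
      have "g x * (1 / n z r) \<le> g x powr p x + (1 / n z r) powr (p x / (p x - 1))"
        using g(2) np p_bounds[OF xX] s by (intro young_simple) auto
      also have "(1 / n z r) powr (p x / (p x - 1)) = n z r powr (- a x)"
        using np conj[OF xX] by (simp add: powr_divide powr_minus_divide)
      finally have "g x \<le> n z r * (g x powr p x + n z r powr (- a x))"
        using np by (simp add: field_simps)
      then have "\<rho> x * g x \<le> \<rho> x * (n z r * (g x powr p x + n z r powr (- a x)))"
        using rho_nonneg by (intro mult_left_mono)
      then have "ennreal (\<rho> x * g x) \<le> ennreal (n z r * (\<rho> x * g x powr p x + \<rho> x * n z r powr (- a x)))"
        by (intro ennreal_leI) (simp add: algebra_simps)
      also have "\<dots> = ennreal (n z r) * (ennreal (\<rho> x * g x powr p x) + ennreal (\<rho> x * n z r powr (- a x)))"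
        using np rho_nonneg[of x] by (simp add: ennreal_mult ennreal_plus)
      finally show ?thesis using True rho_nonneg[of x] g(2)[of x] by (simp add: ennreal_mult)
    qed simp
  qed
  also have "\<dots> = ennreal (n z r) * ((\<integral>\<^sup>+x. ennreal (\<rho> x * g x powr p x) \<partial>M) +
      (\<integral>\<^sup>+x\<in>B z r. ennreal (\<rho> x * n z r powr (- a x)) \<partial>M))"
    by (simp add: nn_integral_cmult nn_integral_add)
  also have "\<dots> \<le> ennreal (n z r) * (1 + ennreal K)"
    using one up[OF zr] by (intro mult_left_mono add_mono) auto
  also have "\<dots> = ennreal ((1 + K) * n z r)" using np K by (simp add: ennreal_mult ennreal_plus mult.commute)
  finally show ?thesis .
qed

text \<open>A Chebyshev-type substitute for Jensen's inequality.\<close>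

lemma avg_powr_le:
  assumes zr: "z \<in> X" "0 < r" and th: "1 \<le> \<tau>" and C: "0 \<le> C"
    and g: "g \<in> borel_measurable M" "\<And>x. 0 \<le> g x" and h: "h \<in> borel_measurable M" "\<And>x. 0 \<le> h x"
    and gh: "\<And>x. x \<in> B z r \<Longrightarrow> g x powr \<tau> \<le> C * h x"
    and fing: "(\<integral>\<^sup>+x\<in>B z r. ennreal (g x) \<partial>N) < \<infinity>"
    and finh: "(\<integral>\<^sup>+x\<in>B z r. ennreal (h x) \<partial>N) < \<infinity>"
  shows "avg N g (B z r) powr \<tau> \<le> 2 powr \<tau> * C * avg N h (B z r)"
proof (cases "avg N g (B z r) = 0")
  case True
  then show ?thesis using C avg_nonneg[of N h "B z r"] th by simp
next
  case False
  note g(1)[measurable] h(1)[measurable]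
  have BM [measurable]: "B z r \<in> sets N" using ball_sets zr by simp
  have [measurable]: "g \<in> borel_measurable N" "h \<in> borel_measurable N" using g h borel_N by auto
  \<comment> \<open>Values of \<open>g\<close> up to \<open>e\<close> account for at most half of
    the average. Above \<open>e\<close> the function is at most
    \<open>e powr (1 - \<tau>) * g x powr \<tau>\<close>, which is controlled by \<open>h\<close>;
    solving for \<open>e\<close> gives the claim.\<close>
  define e where "e = avg N g (B z r) / 2"
  have e: "0 < e" using False avg_nonneg[of N g "B z r"] by (simp add: e_def)
  define I where "I = (\<integral>\<^sup>+x\<in>B z r. ennreal (g x) \<partial>N)"
  define J where "J = (\<integral>\<^sup>+x\<in>B z r. ennreal (h x) \<partial>N)"
  define m where "m = measure N (B z r)"
  have m: "0 < m" unfolding m_def using mN_ball_pos zr by simp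
  have em: "emeasure N (B z r) = ennreal m" unfolding m_def using emeasure_N_eq[OF zr order_refl] .
  have "I \<le> (\<integral>\<^sup>+x. ennreal e * indicator (B z r) x + ennreal (e powr (1 - \<tau>) * C) * (ennreal (h x) * indicator (B z r) x) \<partial>N)"
    unfolding I_def
  proof (rule nn_integral_mono)
    fix x
    show "ennreal (g x) * indicator (B z r) x \<le>
      ennreal e * indicator (B z r) x + ennreal (e powr (1 - \<tau>) * C) * (ennreal (h x) * indicator (B z r) x)"
    proof (cases "x \<in> B z r")
      case True
      have "g x \<le> e + e powr (1 - \<tau>) * (C * h x)"
      proof (cases "g x \<le> e")
        case True
        have "0 \<le> e powr (1 - \<tau>) * (C * h x)" using C h(2)[of x] by simp
        then show ?thesis using True by linarith
      next
        case False
        then have gp: "0 < g x" using e by simp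
        have "g x = g x powr (1 - \<tau>) * g x powr \<tau>" using gp by (simp add: powr_add[symmetric])
        also have "\<dots> \<le> e powr (1 - \<tau>) * g x powr \<tau>"
          using False e th by (intro mult_right_mono powr_mono2') auto
        also have "\<dots> \<le> e powr (1 - \<tau>) * (C * h x)" using gh[OF True] by (intro mult_left_mono) auto
        finally show ?thesis using e by simp
      qed
      then have "ennreal (g x) \<le> ennreal (e + (e powr (1 - \<tau>) * C) * h x)"
        by (intro ennreal_leI) (simp add: mult.assoc)
      also have "\<dots> = ennreal e + ennreal (e powr (1 - \<tau>) * C) * ennreal (h x)"
        using e C h(2)[of x] by (simp add: ennreal_plus ennreal_mult)
      finally show ?thesis using True by simp
    qed simp
  qed
  also have "\<dots> = ennreal e * ennreal m + ennreal (e powr (1 - \<tau>) * C) * J"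
    unfolding J_def em[symmetric] using BM
    by (simp add: nn_integral_add nn_integral_cmult nn_integral_cmult_indicator)
  also have "\<dots> = ennreal (e * m + (e powr (1 - \<tau>) * C) * enn2real J)"
  proof -
    define j where "j = enn2real J"
    have "J = ennreal j" "0 \<le> j" using finh unfolding J_def j_def by auto
    then show ?thesis using e m C
      unfolding j_def[symmetric] by (simp add: ennreal_mult ennreal_plus)
  qed
  finally have "enn2real I \<le> e * m + (e powr (1 - \<tau>) * C) * enn2real J"
    using e m C by (intro enn2real_leI) auto
  moreover have "enn2real I = 2 * e * m"
    using m unfolding e_def avg_def I_def m_def by simp
  ultimately have "e * m \<le> (e powr (1 - \<tau>) * C) * enn2real J" by simp
  then have "e \<le> e powr (1 - \<tau>) * C * avg N h (B z r)"
    using m unfolding avg_def J_def[symmetric] m_def[symmetric] by (simp add: field_simps)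
  then have "e powr (\<tau> - 1) * e \<le> e powr (\<tau> - 1) * (e powr (1 - \<tau>) * C * avg N h (B z r))"
    by (intro mult_left_mono) auto
  moreover have "e powr (\<tau> - 1) * e = e powr \<tau>" using e by (simp add: powr_diff)
  moreover have "e powr (\<tau> - 1) * (e powr (1 - \<tau>) * C * avg N h (B z r)) = C * avg N h (B z r)"
    using powr_mult_minus_cancel[OF e, of "\<tau> - 1" "C * avg N h (B z r)"] by (simp add: mult.assoc)
  ultimately have "e powr \<tau> \<le> C * avg N h (B z r)" by simp
  then have "2 powr \<tau> * e powr \<tau> \<le> 2 powr \<tau> * (C * avg N h (B z r))" by (intro mult_left_mono) auto
  moreover have "avg N g (B z r) powr \<tau> = 2 powr \<tau> * e powr \<tau>"
    using e by (simp add: e_def powr_mult[symmetric])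
  ultimately show ?thesis by (simp add: mult.assoc)
qed

lemma hh_ball_fin:
  assumes t: "0 \<le> t" and T: "(\<integral>\<^sup>+x. ennreal (tail t x) \<partial>N) < \<infinity>"
    and g: "g \<in> borel_measurable M" "\<And>x. 0 \<le> g x"
    and one: "(\<integral>\<^sup>+x. ennreal (\<rho> x * g x powr p x) \<partial>M) \<le> 1"
    and zr: "z \<in> X" "0 < r"
  shows "(\<integral>\<^sup>+x\<in>B z r. ennreal (hh t g x) \<partial>N) < \<infinity>"
proof -
  have BM [measurable]: "B z r \<in> sets N" using ball_sets zr by simp
  have hm [measurable]: "hh t g \<in> borel_measurable N" using hh_measurable[OF g(1)] borel_N by simp
  define T' where "T' = enn2real (\<integral>\<^sup>+x. ennreal (tail t x) \<partial>N)"
  have "(\<integral>\<^sup>+x. ennreal (hh t g x powr s) \<partial>N) \<le> ennreal (2 powr s * (1 + T'))"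
    using T by (intro hh_power_integral[OF t _ _ g one]) (auto simp: T'_def)
  then have fin: "(\<integral>\<^sup>+x. ennreal (hh t g x powr s) \<partial>N) < \<infinity>" by (auto intro: order_le_less_trans)
  show ?thesis
    using BM N_ball_fin[OF zr] s fin by (intro set_nn_integral_finite_of_powr[OF hm, of _ s]) auto
qed

lemma Hp_nonneg: "0 \<le> Hp" using LH_p by (simp add: LH_def)

text \<open>For a small ball, \<open>near_P\<close> is an exponent below every value of \<open>p\<close> on the ball.\<close>

definition "near_P H' z r = max s (p z - H' / \<Lambda> z r)"

definition "ref_P H' z r = (if z = o' \<and> 1 \<le> r then pinf else near_P H' z r)"

end

section \<open>Powers of the normalised integral of one function\<close>

context conj_data
begin

text \<open>One oscillation constant is fixed once and for all, because the reference exponent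
  depends on it.\<close>

definition "Hosc = (SOME H'. 0 \<le> H' \<and> (\<forall>z r. z \<in> X \<longrightarrow> 0 < r \<longrightarrow> r \<le> \<kappa>1 * (1 + nm z) \<longrightarrow>
     (\<forall>x\<in>B z r. \<forall>y\<in>B z r. \<bar>p x - p y\<bar> \<le> H' / \<Lambda> z r)))"

lemma Hosc_nonneg: "0 \<le> Hosc"
  and Hosc: "z \<in> X \<Longrightarrow> 0 < r \<Longrightarrow> r \<le> \<kappa>1 * (1 + nm z) \<Longrightarrow> x \<in> B z r \<Longrightarrow> y \<in> B z r \<Longrightarrow>
     \<bar>p x - p y\<bar> \<le> Hosc / \<Lambda> z r"
  using someI_ex[OF LH_osc[OF LH_p]] unfolding Hosc_def[symmetric] by blast+

abbreviation "P z r \<equiv> ref_P Hosc z r"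

lemma P_far: "z = o' \<and> 1 \<le> r \<Longrightarrow> P z r = pinf"
  by (simp add: ref_P_def)

lemma P_bounds:
  assumes "z \<in> X" "0 < r"
  shows "s \<le> P z r" "P z r \<le> pp"
proof -
  have "0 \<le> Hosc / \<Lambda> z r" using Hosc_nonneg \<Lambda>_ge_2[OF assms] by simp
  then have "near_P Hosc z r \<le> p z" using p_bounds[OF assms(1)] by (simp add: near_P_def)
  then show "s \<le> P z r" "P z r \<le> pp"
    using p_bounds[OF assms(1)] pinf_bounds unfolding ref_P_def near_P_def by auto
qed

lemma P_near:
  assumes g: "good \<kappa>1 z r" and nf: "\<not> (z = o' \<and> 1 \<le> r)" and y: "y \<in> B z r"
  shows "P z r \<le> p y" "p y - P z r \<le> 2 * Hosc / \<Lambda> z r"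
proof -
  have zr: "z \<in> X" "0 < r" using goodD[OF g] by auto
  have "\<bar>p z - p y\<bar> \<le> Hosc / \<Lambda> z r"
    by (rule Hosc[OF zr good_near[OF g nf] center_in_B[OF zr] y])
  moreover have "s \<le> p y" using y p_bounds[of y] by simp
  ultimately show "P z r \<le> p y" "p y - P z r \<le> 2 * Hosc / \<Lambda> z r"
    using nf by (auto simp: ref_P_def near_P_def max_def)
qed

text \<open>The base \<open>v\<close> is bounded above but may be arbitrarily small. On a near ball
  the reference exponent therefore lies below \<open>p x\<close>, so that the surplus power of
  \<open>v\<close> is bounded and no error arises.\<close>

lemma powr_p_le_powr_P:
  assumes t: "0 \<le> t"
  shows "\<exists>C\<ge>1. \<forall>z r x v. good \<kappa>1 z r \<longrightarrow> x \<in> B z r \<longrightarrow> 0 \<le> v \<longrightarrow> v \<le> 1 + K \<longrightarrow>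
    v powr p x \<le> C * v powr P z r + far z r * tail t x"
proof -
  define E where "E = Hp * (ln (1 + K) + (t + ln (1 / 1)) / s)"
  define C where "C = max (exp E) ((1 + K) powr pp)"
  have "1 \<le> (1 + K) powr pp" using K p_bounds[OF origin] s by (intro ge_one_powr_ge_zero) auto
  then have C1: "1 \<le> C" by (simp add: C_def)
  have "v powr p x \<le> C * v powr P z r + far z r * tail t x"
    if g: "good \<kappa>1 z r" and x: "x \<in> B z r" and v: "0 \<le> v" "v \<le> 1 + K" for z r x v
  proof -
    have zr: "z \<in> X" "0 < r" using goodD[OF g] by auto
    have xX: "x \<in> X" using x by simp
    show ?thesis
    proof (cases "z = o' \<and> 1 \<le> r")
      case True
      have "v powr p x \<le> exp E * v powr pinf + 1 * exp (- t * L x)"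
        unfolding E_def
      proof (rule powr_perturb[OF L_ge_1[OF xX] Hp_nonneg _ _ _ v(1) v(2)])
        show "\<bar>p x - pinf\<bar> \<le> Hp / L x" using LH_p xX by (simp add: LH_def)
      qed (use s p_bounds[OF xX] K t in auto)
      moreover have "exp E * v powr pinf \<le> C * v powr pinf"
        by (intro mult_right_mono) (auto simp: C_def)
      ultimately show ?thesis using True by (simp add: P_far far_def tail_def)
    next
      case False
      have Pp: "P z r \<le> p x" "s \<le> P z r" using P_near(1)[OF g False x] P_bounds[OF zr] by auto
      have "v powr p x = v powr P z r * v powr (p x - P z r)" by (simp add: powr_add[symmetric])
      also have "\<dots> \<le> v powr P z r * (1 + K) powr pp"
      proof (rule mult_left_mono)
        have "v powr (p x - P z r) \<le> (1 + K) powr (p x - P z r)" using v Pp by (intro powr_mono2) auto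
        also have "\<dots> \<le> (1 + K) powr pp" using Pp p_bounds[OF xX] s K by (intro powr_mono) auto
        finally show "v powr (p x - P z r) \<le> (1 + K) powr pp" .
      qed simp
      also have "\<dots> \<le> C * v powr P z r" by (simp add: C_def mult.commute mult_right_mono)
      finally have "v powr p x \<le> C * v powr P z r" .
      moreover have "far z r = 0" using False by (auto simp: far_def)
      ultimately show ?thesis by simp
    qed
  qed
  then show ?thesis using C1 by blast
qed

text \<open>The exponent conjugate to \<open>aref z r\<close>. On a near ball \<open>P z r\<close>
  is slightly smaller than it.\<close>

definition "pref z r = (if z = o' \<and> 1 \<le> r then pinf else p z)"

lemma pref_bounds: "z \<in> X \<Longrightarrow> s \<le> pref z r \<and> pref z r \<le> pp"
  using p_bounds pinf_bounds by (simp add: pref_def)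

lemma aref_conj:
  assumes "z \<in> X"
  shows "1 / aref z r = 1 - 1 / pref z r" "1 \<le> aref z r"
proof -
  have eq: "aref z r = pref z r / (pref z r - 1)"
    unfolding aref_def pref_def using conj[OF assms] conj_inf by auto
  have "1 < pref z r" using pref_bounds[OF assms, of r] s by linarith
  then show "1 / aref z r = 1 - 1 / pref z r" "1 \<le> aref z r"
    unfolding eq by (simp_all add: diff_divide_distrib pos_le_divide_eq)
qed

text \<open>The mass is at most a multiple of the power \<open>aref\<close> of the norm, so mass
  over norm is at most a multiple of the power \<open>1 / pref\<close> of the mass. Raising to
  \<open>P\<close> instead of \<open>pref\<close> changes the exponent by the order of
  \<open>1 / \<Lambda> z r\<close>, against a logarithm of the mass of order
  \<open>\<Lambda> z r\<close>.\<close>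

lemma measure_over_n_powr_le:
  "\<exists>C\<ge>1. \<forall>z r. good \<kappa>1 z r \<longrightarrow> (measure N (B z r) / n z r) powr P z r \<le> C * measure N (B z r)"
proof -
  obtain C0 where C0: "1 \<le> C0" and le: "\<And>z r. good \<kappa>1 z r \<Longrightarrow> measure N (B z r) \<le> C0 * n z r powr aref z r"
    using measure_le_n by blast
  obtain C2 where C2: "0 \<le> C2" and lnm: "\<And>z r. good \<kappa>1 z r \<Longrightarrow> \<not> (z = o' \<and> 1 \<le> r) \<Longrightarrow>
      \<bar>ln (measure N (B z r))\<bar> \<le> C2 * \<Lambda> z r"
    using ln_measure_local by blast
  define C where "C = C0 powr pp * exp (C2 * (2 * Hosc))"
  have pp0: "1 < pp" using pinf_bounds s by linarith
  have "1 * 1 \<le> C0 powr pp * exp (C2 * (2 * Hosc))"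
    using C0 pp0 C2 Hosc_nonneg by (intro mult_mono ge_one_powr_ge_zero) auto
  then have C1: "1 \<le> C" by (simp add: C_def)
  have "(measure N (B z r) / n z r) powr P z r \<le> C * measure N (B z r)" if g: "good \<kappa>1 z r" for z r
  proof -
    have zr: "z \<in> X" "0 < r" using goodD[OF g] by auto
    have np: "0 < n z r" using n_pos zr by simp
    define v where "v = measure N (B z r)"
    have v: "0 < v" unfolding v_def using mN_ball_pos zr by simp
    have ar: "1 \<le> aref z r" "1 / aref z r = 1 - 1 / pref z r" using aref_conj[OF zr(1), of r] by auto
    have pr: "s \<le> pref z r" "pref z r \<le> pp" using pref_bounds[OF zr(1)] by auto
    have PP: "s \<le> P z r" "P z r \<le> pp" using P_bounds[OF zr] by auto
    have "v powr (1 / aref z r) \<le> (C0 * n z r powr aref z r) powr (1 / aref z r)"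
      using le[OF g] v ar(1) unfolding v_def[symmetric] by (intro powr_mono2) auto
    also have "\<dots> = C0 powr (1 / aref z r) * n z r"
      using C0 ar(1) np by (simp add: powr_mult powr_powr)
    also have "\<dots> \<le> C0 * n z r"
    proof (rule mult_right_mono)
      have "C0 powr (1 / aref z r) \<le> C0 powr 1" using C0 ar(1) by (intro powr_mono) auto
      then show "C0 powr (1 / aref z r) \<le> C0" using C0 by simp
    qed (use np in simp)
    finally have 1: "v powr (1 / aref z r) \<le> C0 * n z r" .
    have "v = v powr (1 / pref z r) * v powr (1 / aref z r)"
      using v by (simp add: powr_add[symmetric] ar(2))
    also have "\<dots> \<le> v powr (1 / pref z r) * (C0 * n z r)" using 1 by (intro mult_left_mono) auto
    finally have "v / n z r \<le> C0 * v powr (1 / pref z r)" using np by (simp add: field_simps)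
    then have "(v / n z r) powr P z r \<le> (C0 * v powr (1 / pref z r)) powr P z r"
      using v np PP s by (intro powr_mono2) auto
    also have "\<dots> = C0 powr P z r * v powr (P z r / pref z r)"
      using C0 by (simp add: powr_mult powr_powr)
    also have "\<dots> \<le> C0 powr pp * (exp (C2 * (2 * Hosc)) * v powr 1)"
    proof (rule mult_mono)
      show "C0 powr P z r \<le> C0 powr pp" using C0 PP by (intro powr_mono) auto
      show "v powr (P z r / pref z r) \<le> exp (C2 * (2 * Hosc)) * v powr 1"
      proof (rule powr_exponent_change[OF v])
        show "\<bar>ln v\<bar> * \<bar>P z r / pref z r - 1\<bar> \<le> C2 * (2 * Hosc)"
        proof (cases "z = o' \<and> 1 \<le> r")
          case True
          then have "P z r = pref z r" by (simp add: P_far pref_def)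
          then show ?thesis using pr s C2 Hosc_nonneg by simp
        next
          case False
          have L2: "2 \<le> \<Lambda> z r" by (rule \<Lambda>_ge_2[OF zr])
          have q: "pref z r = p z" unfolding pref_def by (rule if_not_P[OF False])
          have "\<bar>P z r - p z\<bar> \<le> 2 * Hosc / \<Lambda> z r"
            using P_near[OF g False center_in_B[OF zr]] by linarith
          moreover have "\<bar>P z r / pref z r - 1\<bar> \<le> \<bar>P z r - p z\<bar>"
          proof -
            have "P z r / pref z r - 1 = (P z r - p z) / pref z r" using pr s q by (simp add: field_simps)
            then have "\<bar>P z r / pref z r - 1\<bar> = \<bar>P z r - p z\<bar> / pref z r" using pr s by simp
            also have "\<dots> \<le> \<bar>P z r - p z\<bar> / 1" using pr s by (intro divide_left_mono) auto
            finally show ?thesis by simp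
          qed
          ultimately have "\<bar>ln v\<bar> * \<bar>P z r / pref z r - 1\<bar> \<le> (C2 * \<Lambda> z r) * (2 * Hosc / \<Lambda> z r)"
            using lnm[OF g False] C2 L2 unfolding v_def by (intro mult_mono) auto
          also have "\<dots> = C2 * (2 * Hosc)" using L2 by simp
          finally show ?thesis .
        qed
      qed
    qed auto
    finally show ?thesis unfolding C_def v_def[symmetric] using v by simp
  qed
  then show ?thesis using C1 by blast
qed

text \<open>Where \<open>g y\<close> is at least 1 the larger exponent \<open>p y\<close> dominates.
  Where it is below 1 the exponents differ by the order of \<open>1 / L y\<close>, and the error of
  \<open>powr_perturb\<close> is the tail contained in \<open>hh\<close>.\<close>

lemma powr_near_le_hh:
  assumes t: "0 \<le> t"
  shows "\<exists>C\<ge>1. \<forall>g z r y. good \<kappa>1 z r \<longrightarrow> \<not> (z = o' \<and> 1 \<le> r) \<longrightarrow> y \<in> B z r \<longrightarrow> 0 \<le> g y \<longrightarrow>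
    g y powr (P z r / s) \<le> C * hh t g y"
proof -
  define H2 where "H2 = 2 * Hosc * (1 + ln (3 * A))"
  have H2: "0 \<le> H2" unfolding H2_def using Hosc_nonneg A by simp
  define C where "C = exp (H2 * (ln 1 + (t + ln (1 / 1)) / 1))"
  have C1: "1 \<le> C" unfolding C_def using H2 t by simp
  have "g y powr (P z r / s) \<le> C * hh t g y"
    if gd: "good \<kappa>1 z r" and nf: "\<not> (z = o' \<and> 1 \<le> r)" and y: "y \<in> B z r" and g: "0 \<le> g y" for g z r y
  proof -
    have zr: "z \<in> X" "0 < r" using goodD[OF gd] by auto
    have yX: "y \<in> X" using y by simp
    have Pb: "s \<le> P z r" "P z r \<le> p y" "p y - P z r \<le> 2 * Hosc / \<Lambda> z r"
      using P_bounds[OF zr] P_near[OF gd nf y] by auto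
    show ?thesis
    proof (cases "1 \<le> g y")
      case True
      have "g y powr (P z r / s) \<le> g y powr (p y / s)"
        using True Pb s by (intro powr_mono divide_right_mono) auto
      also have "\<dots> \<le> hh t g y" using tail_pos[of t y] by (simp add: hh_def)
      also have "\<dots> \<le> C * hh t g y" using mult_right_mono[OF C1 hh_nonneg[of t g y]] by simp
      finally show ?thesis .
    next
      case False
      have "g y powr (P z r / s) \<le> C * g y powr (p y / s) + 1 * exp (- t * L y)"
        unfolding C_def
      proof (rule powr_perturb[OF L_ge_1[OF yX] H2])
        have Lz: "1 \<le> L z" using L_ge_1 zr by simp
        have Lzl: "L z \<le> \<Lambda> z r" using one_le_ln_e_add[of "1 / r"] zr unfolding \<Lambda>_def by simp
        have Ly: "1 \<le> L y" using L_ge_1 yX by simp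
        have "\<bar>P z r / s - p y / s\<bar> = (p y - P z r) / s" using Pb s by (simp add: field_simps)
        also have "\<dots> \<le> (p y - P z r) / 1" using Pb s by (intro divide_left_mono) auto
        also have "\<dots> \<le> 2 * Hosc / L z"
        proof -
          have "2 * Hosc / \<Lambda> z r \<le> 2 * Hosc / L z"
            using Lz Lzl Hosc_nonneg by (intro divide_left_mono) auto
          then show ?thesis using Pb by simp
        qed
        also have "\<dots> \<le> H2 / L y"
        proof -
          have "2 * Hosc * L y \<le> 2 * Hosc * ((1 + ln (3 * A)) * L z)"
            using L_le_L_center[OF zr good_near[OF gd nf] y] Hosc_nonneg by (intro mult_left_mono) auto
          then have "2 * Hosc * L y \<le> H2 * L z" by (simp add: H2_def mult.assoc)
          then show ?thesis using Lz Ly by (simp add: frac_le_eq divide_le_eq pos_le_divide_eq mult.commute)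
        qed
        finally show "\<bar>P z r / s - p y / s\<bar> \<le> H2 / L y" .
      qed (use False g Pb s t in auto)
      also have "\<dots> \<le> C * g y powr (p y / s) + C * exp (- t * L y)"
        using C1 by (intro add_left_mono mult_right_mono) auto
      also have "\<dots> = C * hh t g y" by (simp add: hh_def tail_def distrib_left)
      finally show ?thesis .
    qed
  qed
  then show ?thesis using C1 by blast
qed

text \<open>The limit exponent may exceed \<open>p y\<close>, so large values of \<open>g\<close>
  cannot be compared; truncation at 1 leaves the range in which \<open>powr_perturb\<close>
  works.\<close>

lemma powr_far_le_hh:
  assumes t: "0 \<le> t"
  shows "\<exists>C\<ge>1. \<forall>g y. y \<in> X \<longrightarrow> 0 \<le> g y \<longrightarrow> min (g y) 1 powr (pinf / s) \<le> C * hh t g y"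
proof -
  define C where "C = exp (Hp * (ln 1 + (t + ln (1 / 1)) / 1))"
  have C1: "1 \<le> C" unfolding C_def using Hp_nonneg t by simp
  have "min (g y) 1 powr (pinf / s) \<le> C * hh t g y" if yX: "y \<in> X" and g: "0 \<le> g y" for g y
  proof (cases "1 \<le> g y")
    case True
    then have "1 \<le> g y powr (p y / s)" using p_bounds[OF yX] s by (intro ge_one_powr_ge_zero) auto
    also have "\<dots> \<le> hh t g y" using tail_pos[of t y] by (simp add: hh_def)
    also have "\<dots> \<le> C * hh t g y" using mult_right_mono[OF C1 hh_nonneg[of t g y]] by simp
    finally show ?thesis using True by simp
  next
    case False
    have "g y powr (pinf / s) \<le> C * g y powr (p y / s) + 1 * exp (- t * L y)"
      unfolding C_def
    proof (rule powr_perturb[OF L_ge_1[OF yX] Hp_nonneg])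
      have "\<bar>pinf / s - p y / s\<bar> = \<bar>p y - pinf\<bar> / s"
        using s by (simp add: diff_divide_distrib[symmetric] abs_minus_commute)
      also have "\<dots> \<le> \<bar>p y - pinf\<bar> / 1" using s by (intro divide_left_mono) auto
      also have "\<dots> \<le> Hp / L y" using LH_p yX by (simp add: LH_def)
      finally show "\<bar>pinf / s - p y / s\<bar> \<le> Hp / L y" .
    qed (use False g pinf_bounds s t in auto)
    also have "\<dots> \<le> C * g y powr (p y / s) + C * exp (- t * L y)"
      using C1 by (intro add_left_mono mult_right_mono) auto
    also have "\<dots> = C * hh t g y" by (simp add: hh_def tail_def distrib_left)
    finally show ?thesis using False by simp
  qed
  then show ?thesis using C1 by blast
qed

text \<open>The tail in \<open>hh\<close> has a positive lower bound on the unit ball around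
  \<open>o'\<close>, which every such ball contains. A contribution of order
  \<open>1 / measure N (B o' r)\<close> can therefore be absorbed into the average of
  \<open>hh\<close>.\<close>

lemma inverse_measure_le_avg_tail:
  assumes t: "0 \<le> t" and T: "(\<integral>\<^sup>+x. ennreal (tail t x) \<partial>N) < \<infinity>"
  shows "\<exists>C\<ge>1. \<forall>g r. g \<in> borel_measurable M \<longrightarrow> (\<forall>x. 0 \<le> g x) \<longrightarrow>
    (\<integral>\<^sup>+x. ennreal (\<rho> x * g x powr p x) \<partial>M) \<le> 1 \<longrightarrow> 1 \<le> r \<longrightarrow>
    1 / measure N (B o' r) \<le> C * avg N (hh t g) (B o' r)"
proof -
  define \<nu> where "\<nu> = measure N (B o' 1)"
  have nu: "0 < \<nu>" unfolding \<nu>_def using mN_ball_pos origin by simp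
  define e where "e = exp (- t * ln (exp 1 + 1))"
  have e: "0 < e" by (simp add: e_def)
  have "1 / measure N (B o' r) \<le> max 1 (1 / (e * \<nu>)) * avg N (hh t g) (B o' r)"
    if g: "g \<in> borel_measurable M" "\<forall>x. 0 \<le> g x"
      and one: "(\<integral>\<^sup>+x. ennreal (\<rho> x * g x powr p x) \<partial>M) \<le> 1" and r: "1 \<le> r" for g r
  proof -
    have r0: "0 < r" using r by simp
    have BM: "B o' 1 \<in> sets M" using ball_sets origin by simp
    have mp: "0 < measure N (B o' r)" using mN_ball_pos origin r0 by simp
    have "ennreal (e * \<nu>) = (\<integral>\<^sup>+x. ennreal e * indicator (B o' 1) x \<partial>N)"
      using BM emeasure_N_eq[OF origin zero_less_one order_refl] e nu
      by (simp add: nn_integral_cmult_indicator \<nu>_def ennreal_mult)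
    also have "\<dots> \<le> (\<integral>\<^sup>+x\<in>B o' r. ennreal (hh t g x) \<partial>N)"
    proof (rule nn_integral_mono)
      fix x
      show "ennreal e * indicator (B o' 1) x \<le> ennreal (hh t g x) * indicator (B o' r) x"
      proof (cases "x \<in> B o' 1")
        case True
        then have x: "x \<in> X" "nm x < 1" using d_sym[OF origin] by (auto simp: nm_def)
        have "L x \<le> ln (exp 1 + 1)" unfolding L_def
          using x nm_nonneg[OF x(1)] by (subst ln_le_cancel_iff) (auto simp: add_pos_nonneg add_pos_pos)
        then have "e \<le> tail t x" unfolding e_def tail_def using t by (simp add: mult_left_mono)
        also have "\<dots> \<le> hh t g x" by (simp add: hh_def)
        finally have "ennreal e \<le> ennreal (hh t g x)" by (rule ennreal_leI)
        moreover have "x \<in> B o' r" using True r by simp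
        ultimately show ?thesis using True by (simp del: in_B)
      qed simp
    qed
    finally have le: "ennreal (e * \<nu>) \<le> (\<integral>\<^sup>+x\<in>B o' r. ennreal (hh t g x) \<partial>N)" .
    have "e * \<nu> = enn2real (ennreal (e * \<nu>))" using e nu by simp
    also have "\<dots> \<le> enn2real (\<integral>\<^sup>+x\<in>B o' r. ennreal (hh t g x) \<partial>N)"
      using hh_ball_fin[OF t T g(1) _ one origin r0] g(2) by (intro enn2real_mono[OF le]) simp
    finally have "e * \<nu> / measure N (B o' r) \<le> avg N (hh t g) (B o' r)"
      unfolding avg_def using mp by (intro divide_right_mono) auto
    then have "(1 / (e * \<nu>)) * (e * \<nu> / measure N (B o' r)) \<le> (1 / (e * \<nu>)) * avg N (hh t g) (B o' r)"
      using e nu by (intro mult_left_mono) auto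
    then have "1 / measure N (B o' r) \<le> (1 / (e * \<nu>)) * avg N (hh t g) (B o' r)"
      using e nu by simp
    also have "\<dots> \<le> max 1 (1 / (e * \<nu>)) * avg N (hh t g) (B o' r)"
      by (intro mult_right_mono avg_nonneg) auto
    finally show ?thesis .
  qed
  then show ?thesis by (intro exI[of _ "max 1 (1 / (e * \<nu>))"]) auto
qed

text \<open>The Jensen substitute is applied with the power \<open>P z r / s\<close>, then the
  result is raised to \<open>s\<close>. Far balls need a separate treatment of the values of
  \<open>g\<close> above 1.\<close>

lemma avg_powr_P_le:
  assumes t: "0 \<le> t" and T: "(\<integral>\<^sup>+x. ennreal (tail t x) \<partial>N) < \<infinity>"
  shows "\<exists>C\<ge>1. \<forall>g z r. g \<in> borel_measurable M \<longrightarrow> (\<forall>x. 0 \<le> g x) \<longrightarrow>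
    (\<integral>\<^sup>+x. ennreal (\<rho> x * g x powr p x) \<partial>M) \<le> 1 \<longrightarrow> good \<kappa>1 z r \<longrightarrow>
    avg N g (B z r) powr P z r \<le> C * avg N (hh t g) (B z r) powr s"
proof -
  obtain Ca where Ca: "1 \<le> Ca" and near: "\<And>g z r y. good \<kappa>1 z r \<Longrightarrow> \<not> (z = o' \<and> 1 \<le> r) \<Longrightarrow>
    y \<in> B z r \<Longrightarrow> 0 \<le> g y \<Longrightarrow> g y powr (P z r / s) \<le> Ca * hh t g y"
    using powr_near_le_hh[OF t] by blast
  obtain Cb where Cb: "1 \<le> Cb" and farr: "\<And>g y. y \<in> X \<Longrightarrow> 0 \<le> g y \<Longrightarrow>
    min (g y) 1 powr (pinf / s) \<le> Cb * hh t g y"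
    using powr_far_le_hh[OF t] by blast
  obtain Cc where Cc: "1 \<le> Cc" and inv: "\<And>g r. g \<in> borel_measurable M \<Longrightarrow> (\<forall>x. 0 \<le> g x) \<Longrightarrow>
    (\<integral>\<^sup>+x. ennreal (\<rho> x * g x powr p x) \<partial>M) \<le> 1 \<Longrightarrow> 1 \<le> r \<Longrightarrow>
    1 / measure N (B o' r) \<le> Cc * avg N (hh t g) (B o' r)"
    using inverse_measure_le_avg_tail[OF t T] by blast
  define \<nu> where "\<nu> = measure N (B o' 1)"
  have nu: "0 < \<nu>" unfolding \<nu>_def using mN_ball_pos origin by simp
  define V where "V = max 1 (1 / \<nu>) powr pp"
  have ppp: "1 < pp" using pinf_bounds s by linarith
  have V: "1 \<le> V" unfolding V_def using ppp by (intro ge_one_powr_ge_zero) auto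
  define Q where "Q = (2 powr pp * max Ca Cb) powr s"
  have two: "1 \<le> 2 powr pp" using ppp by (intro ge_one_powr_ge_zero) auto
  have "1 * 1 \<le> 2 powr pp * max Ca Cb" using two Ca by (intro mult_mono) auto
  then have Q: "1 \<le> Q" unfolding Q_def using s by (intro ge_one_powr_ge_zero) auto
  define C where "C = 2 powr pp * (Q + V * Cc powr s)"
  have "1 \<le> Cc powr s" using Cc s by (intro ge_one_powr_ge_zero) auto
  then have "0 \<le> V * Cc powr s" using V by simp
  then have QC: "Q \<le> Q + V * Cc powr s" by simp
  have "1 * 1 \<le> 2 powr pp * (Q + V * Cc powr s)" using two Q QC by (intro mult_mono) auto
  then have C1: "1 \<le> C" by (simp add: C_def)
  have "1 * Q \<le> 2 powr pp * (Q + V * Cc powr s)" using two Q QC by (intro mult_mono) auto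
  then have QC': "Q \<le> C" by (simp add: C_def)
  have "avg N g (B z r) powr P z r \<le> C * avg N (hh t g) (B z r) powr s"
    if g: "g \<in> borel_measurable M" "\<forall>x. 0 \<le> g x"
      and one: "(\<integral>\<^sup>+x. ennreal (\<rho> x * g x powr p x) \<partial>M) \<le> 1" and gd: "good \<kappa>1 z r" for g z r
  proof -
    have zr: "z \<in> X" "0 < r" using goodD[OF gd] by auto
    have g0: "\<And>x. 0 \<le> g x" using g(2) by simp
    have BM [measurable]: "B z r \<in> sets M" using ball_sets zr by simp
    have hm: "hh t g \<in> borel_measurable M" by (rule hh_measurable[OF g(1)])
    have hf: "(\<integral>\<^sup>+x\<in>B z r. ennreal (hh t g x) \<partial>N) < \<infinity>" by (rule hh_ball_fin[OF t T g(1) g0 one zr])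
    have gf: "(\<integral>\<^sup>+x\<in>B z r. ennreal (g x) \<partial>N) < \<infinity>"
      using ball_integral_le[OF g(1) g0 one zr] by (rule order_le_less_trans) simp
    have PP: "s \<le> P z r" "P z r \<le> pp" using P_bounds[OF zr] by auto
    define \<tau> where "\<tau> = P z r / s"
    have tau: "1 \<le> \<tau>" "\<tau> \<le> pp" "\<tau> * s = P z r"
    proof -
      show "1 \<le> \<tau>" using PP s by (simp add: \<tau>_def)
      have "P z r / s \<le> P z r / 1" using PP s by (intro divide_left_mono) auto
      then show "\<tau> \<le> pp" using PP by (simp add: \<tau>_def)
      show "\<tau> * s = P z r" using s by (simp add: \<tau>_def)
    qed
    have key: "avg N f (B z r) powr P z r \<le> Q * avg N (hh t g) (B z r) powr s"
      if f: "f \<in> borel_measurable M" "\<And>x. 0 \<le> f x" "\<And>x. x \<in> B z r \<Longrightarrow> f x powr \<tau> \<le> max Ca Cb * hh t g x"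
        "(\<integral>\<^sup>+x\<in>B z r. ennreal (f x) \<partial>N) < \<infinity>" for f
    proof -
      have "avg N f (B z r) powr \<tau> \<le> 2 powr \<tau> * max Ca Cb * avg N (hh t g) (B z r)"
        using Ca by (intro avg_powr_le[OF zr tau(1) _ f(1,2) hm hh_nonneg f(3,4) hf]) auto
      also have "\<dots> \<le> 2 powr pp * max Ca Cb * avg N (hh t g) (B z r)"
        using tau Ca by (intro mult_right_mono avg_nonneg powr_mono) auto
      finally have "(avg N f (B z r) powr \<tau>) powr s \<le> (2 powr pp * max Ca Cb * avg N (hh t g) (B z r)) powr s"
        using s by (intro powr_mono2) auto
      then show ?thesis using avg_nonneg[of N "hh t g" "B z r"] Ca
        unfolding powr_powr tau(3) Q_def by (subst (asm) powr_mult) auto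
    qed
    show ?thesis
    proof (cases "z = o' \<and> 1 \<le> r")
      case False
      have "avg N g (B z r) powr P z r \<le> Q * avg N (hh t g) (B z r) powr s"
      proof (rule key[OF g(1) g0 _ gf])
        fix x assume x: "x \<in> B z r"
        have "g x powr \<tau> \<le> Ca * hh t g x" unfolding \<tau>_def by (rule near[OF gd False x]) (rule g0)
        also have "\<dots> \<le> max Ca Cb * hh t g x" using hh_nonneg by (intro mult_right_mono) auto
        finally show "g x powr \<tau> \<le> max Ca Cb * hh t g x" .
      qed
      also have "\<dots> \<le> C * avg N (hh t g) (B z r) powr s" using QC' by (intro mult_right_mono) auto
      finally show ?thesis .
    next
      case True
      \<comment> \<open>The values above 1 are split off by
        \<open>g x \<le> f x + g x powr p x\<close>. The second part has integral at most 1, so it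
        adds at most the inverse mass of the ball to the average.\<close>
      define f where "f x = min (g x) 1" for x
      have f: "f \<in> borel_measurable M" "\<And>x. 0 \<le> f x" using g unfolding f_def by auto
      have "(\<integral>\<^sup>+x\<in>B z r. ennreal (f x) \<partial>N) \<le> (\<integral>\<^sup>+x\<in>B z r. ennreal (g x) \<partial>N)"
        unfolding f_def by (intro nn_integral_mono mult_right_mono ennreal_leI) auto
      then have ff: "(\<integral>\<^sup>+x\<in>B z r. ennreal (f x) \<partial>N) < \<infinity>" using gf by (rule order_le_less_trans)
      have 1: "avg N f (B z r) powr P z r \<le> Q * avg N (hh t g) (B z r) powr s"
      proof (rule key[OF f _ ff])
        fix x assume x: "x \<in> B z r"
        have "f x powr \<tau> \<le> Cb * hh t g x"
          unfolding \<tau>_def f_def P_far[OF True] by (rule farr) (use x g0 in auto)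
        also have "\<dots> \<le> max Ca Cb * hh t g x" using hh_nonneg by (intro mult_right_mono) auto
        finally show "f x powr \<tau> \<le> max Ca Cb * hh t g x" .
      qed
      define v where "v = measure N (B z r)"
      have v: "0 < v" unfolding v_def using mN_ball_pos zr by simp
      have "(\<integral>\<^sup>+x\<in>B z r. ennreal (g x) \<partial>N) \<le> (\<integral>\<^sup>+x\<in>B z r. ennreal (f x) \<partial>N) + 1"
      proof -
        note f(1)[measurable] g(1)[measurable]
        have [measurable]: "f \<in> borel_measurable N" "g \<in> borel_measurable N" "p \<in> borel_measurable N" "B z r \<in> sets N"
          using borel_N f(1) g(1) BM p_meas by auto
        have "(\<integral>\<^sup>+x\<in>B z r. ennreal (g x) \<partial>N) \<le> (\<integral>\<^sup>+x. ennreal (f x) * indicator (B z r) x + ennreal (g x powr p x) \<partial>N)"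
        proof (rule nn_integral_mono)
          fix x assume "x \<in> space N"
          then have xX: "x \<in> X" using space_N by simp
          have "g x \<le> f x + g x powr p x"
          proof (cases "g x \<le> 1")
            case True then show ?thesis by (simp add: f_def)
          next
            case False
            then have "g x powr 1 \<le> g x powr p x" using p_bounds[OF xX] s by (intro powr_mono) auto
            then show ?thesis using False f(2)[of x] by simp
          qed
          then have "ennreal (g x) \<le> ennreal (f x) + ennreal (g x powr p x)"
            using f(2)[of x] by (metis ennreal_leI ennreal_plus powr_ge_zero)
          then show "ennreal (g x) * indicator (B z r) x \<le> ennreal (f x) * indicator (B z r) x + ennreal (g x powr p x)"
            by (auto simp: indicator_def)
        qed
        also have "\<dots> = (\<integral>\<^sup>+x\<in>B z r. ennreal (f x) \<partial>N) + (\<integral>\<^sup>+x. ennreal (g x powr p x) \<partial>N)"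
          by (rule nn_integral_add) measurable
        also have "(\<integral>\<^sup>+x. ennreal (g x powr p x) \<partial>N) = (\<integral>\<^sup>+x. ennreal (\<rho> x * g x powr p x) \<partial>M)"
          using rho_nonneg by (subst nn_integral_N) (auto simp: ennreal_mult)
        finally show ?thesis using one by (meson add_left_mono order_trans)
      qed
      then have "enn2real (\<integral>\<^sup>+x\<in>B z r. ennreal (g x) \<partial>N) \<le> enn2real ((\<integral>\<^sup>+x\<in>B z r. ennreal (f x) \<partial>N) + 1)"
        using ff by (intro enn2real_mono) auto
      also have "\<dots> = enn2real (\<integral>\<^sup>+x\<in>B z r. ennreal (f x) \<partial>N) + 1"
        using ff by (subst enn2real_plus) auto
      finally have "avg N g (B z r) \<le> avg N f (B z r) + 1 / v"
        unfolding avg_def v_def[symmetric] using v by (simp add: add_divide_distrib[symmetric] divide_right_mono)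
      also have "\<dots> \<le> 2 * max (avg N f (B z r)) (1 / v)" by simp
      finally have "avg N g (B z r) powr P z r \<le> (2 * max (avg N f (B z r)) (1 / v)) powr P z r"
        using PP s avg_nonneg by (intro powr_mono2) auto
      also have "\<dots> = 2 powr P z r * max (avg N f (B z r)) (1 / v) powr P z r"
        using v by (subst powr_mult) (auto simp: le_max_iff_disj)
      also have "\<dots> \<le> 2 powr pp * (avg N f (B z r) powr P z r + (1 / v) powr P z r)"
        using PP by (intro mult_mono powr_mono) (auto simp: max_def)
      also have "\<dots> \<le> 2 powr pp * (Q * avg N (hh t g) (B z r) powr s + V * Cc powr s * avg N (hh t g) (B z r) powr s)"
      proof (intro mult_left_mono add_mono 1)
        have vn: "\<nu> \<le> v" unfolding \<nu>_def v_def
        proof (rule measure_mono_fmeasurable)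
          show "B o' 1 \<subseteq> B z r" using True by (auto simp: qball_def)
          show "B o' 1 \<in> sets N" using ball_sets origin by simp
          show "B z r \<in> fmeasurable N" using BM N_ball_fin[OF zr] by (intro fmeasurableI) auto
        qed
        \<comment> \<open>Only the power \<open>s\<close> of the inverse mass is turned into an
          average of \<open>hh\<close>. The surplus power is bounded, because the mass is at least
          that of the unit ball around \<open>o'\<close>.\<close>
        have "(1 / v) powr P z r = (1 / v) powr s * (1 / v) powr (P z r - s)" by (simp add: powr_add[symmetric])
        also have "\<dots> \<le> (Cc * avg N (hh t g) (B z r)) powr s * V"
        proof (rule mult_mono)
          have "1 / v \<le> Cc * avg N (hh t g) (B z r)"
            using inv[OF g one, of r] True unfolding v_def by simp
          then show "(1 / v) powr s \<le> (Cc * avg N (hh t g) (B z r)) powr s"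
            using v s by (intro powr_mono2) auto
          have "(1 / v) powr (P z r - s) \<le> max 1 (1 / \<nu>) powr (P z r - s)"
            using vn v nu PP by (intro powr_mono2) (auto simp: le_max_iff_disj frac_le)
          also have "\<dots> \<le> V" unfolding V_def using PP s by (intro powr_mono) auto
          finally show "(1 / v) powr (P z r - s) \<le> V" .
        qed auto
        also have "\<dots> = V * Cc powr s * avg N (hh t g) (B z r) powr s"
          using Cc avg_nonneg[of N "hh t g" "B z r"] by (subst powr_mult) auto
        finally show "(1 / v) powr P z r \<le> V * Cc powr s * avg N (hh t g) (B z r) powr s" .
      qed auto
      also have "\<dots> = C * avg N (hh t g) (B z r) powr s" by (simp add: C_def algebra_simps)
      finally show ?thesis .
    qed
  qed
  then show ?thesis using C1 by blast
qed

text \<open>The quantity \<open>A_i\<close> of the overview, where \<open>g\<close> is the absolute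
  value of the function divided by the density.\<close>

definition "ratio g z r = enn2real (\<integral>\<^sup>+x\<in>B z r. ennreal (g x) \<partial>N) / n z r"

lemma ratio_bounds:
  assumes "g \<in> borel_measurable M" "\<And>x. 0 \<le> g x"
    "(\<integral>\<^sup>+x. ennreal (\<rho> x * g x powr p x) \<partial>M) \<le> 1" "z \<in> X" "0 < r"
  shows "0 \<le> ratio g z r" "ratio g z r \<le> 1 + K"
proof -
  have np: "0 < n z r" using n_pos assms by simp
  show "0 \<le> ratio g z r" using np by (simp add: ratio_def)
  have "enn2real (\<integral>\<^sup>+x\<in>B z r. ennreal (g x) \<partial>N) \<le> (1 + K) * n z r"
    using ball_integral_le[OF assms] np K by (intro enn2real_leI) auto
  then show "ratio g z r \<le> 1 + K" unfolding ratio_def using np by (simp add: divide_le_eq)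
qed

lemma ratio_powr_le:
  assumes t: "0 \<le> t" and T: "(\<integral>\<^sup>+x. ennreal (tail t x) \<partial>N) < \<infinity>"
  shows "\<exists>C\<ge>1. \<forall>g z r x. g \<in> borel_measurable M \<longrightarrow> (\<forall>x. 0 \<le> g x) \<longrightarrow>
    (\<integral>\<^sup>+x. ennreal (\<rho> x * g x powr p x) \<partial>M) \<le> 1 \<longrightarrow> good \<kappa>1 z r \<longrightarrow> x \<in> B z r \<longrightarrow>
    ratio g z r powr p x \<le> C * (measure N (B z r) * avg N (hh t g) (B z r) powr s) + far z r * tail t x"
proof -
  obtain Ca where Ca: "1 \<le> Ca" and a: "\<And>z r x v. good \<kappa>1 z r \<Longrightarrow> x \<in> B z r \<Longrightarrow> 0 \<le> v \<Longrightarrow> v \<le> 1 + K \<Longrightarrow>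
    v powr p x \<le> Ca * v powr P z r + far z r * tail t x"
    using powr_p_le_powr_P[OF t] by blast
  obtain Cb where Cb: "1 \<le> Cb" and b: "\<And>z r. good \<kappa>1 z r \<Longrightarrow> (measure N (B z r) / n z r) powr P z r \<le> Cb * measure N (B z r)"
    using measure_over_n_powr_le by blast
  obtain Cc where Cc: "1 \<le> Cc" and c: "\<And>g z r. g \<in> borel_measurable M \<Longrightarrow> (\<forall>x. 0 \<le> g x) \<Longrightarrow>
    (\<integral>\<^sup>+x. ennreal (\<rho> x * g x powr p x) \<partial>M) \<le> 1 \<Longrightarrow> good \<kappa>1 z r \<Longrightarrow>
    avg N g (B z r) powr P z r \<le> Cc * avg N (hh t g) (B z r) powr s"
    using avg_powr_P_le[OF t T] by blast
  have "ratio g z r powr p x \<le> (Ca * (Cb * Cc)) * (measure N (B z r) * avg N (hh t g) (B z r) powr s) + far z r * tail t x"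
    if g: "g \<in> borel_measurable M" "\<forall>x. 0 \<le> g x"
      and one: "(\<integral>\<^sup>+x. ennreal (\<rho> x * g x powr p x) \<partial>M) \<le> 1" and gd: "good \<kappa>1 z r" and x: "x \<in> B z r" for g z r x
  proof -
    have zr: "z \<in> X" "0 < r" using goodD[OF gd] by auto
    have np: "0 < n z r" using n_pos zr by simp
    have mp: "0 < measure N (B z r)" using mN_ball_pos zr by simp
    \<comment> \<open>The first factor is governed by \<open>measure_over_n_powr_le\<close>, the
      second by \<open>avg_powr_P_le\<close>, both with the same reference exponent.\<close>
    have "ratio g z r = (measure N (B z r) / n z r) * avg N g (B z r)"
      using mp by (simp add: ratio_def avg_def)
    then have "ratio g z r powr P z r = (measure N (B z r) / n z r) powr P z r * avg N g (B z r) powr P z r"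
      by (simp only:) (subst powr_mult, use mp np avg_nonneg in auto)
    also have "\<dots> \<le> (Cb * measure N (B z r)) * (Cc * avg N (hh t g) (B z r) powr s)"
      using b[OF gd] c[OF g one gd] Cb by (intro mult_mono) auto
    finally have 1: "ratio g z r powr P z r \<le> (Cb * Cc) * (measure N (B z r) * avg N (hh t g) (B z r) powr s)"
      by (simp add: mult_ac)
    have "ratio g z r powr p x \<le> Ca * ratio g z r powr P z r + far z r * tail t x"
      using ratio_bounds[OF g(1) _ one zr] g(2) by (intro a[OF gd x]) auto
    also have "Ca * ratio g z r powr P z r \<le> Ca * ((Cb * Cc) * (measure N (B z r) * avg N (hh t g) (B z r) powr s))"
      using 1 Ca by (intro mult_left_mono) auto
    finally show ?thesis by (simp add: mult.assoc)
  qed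
  moreover have "1 * (1 * 1) \<le> Ca * (Cb * Cc)" using Ca Cb Cc by (intro mult_mono) auto
  ultimately show ?thesis by (intro exI[of _ "Ca * (Cb * Cc)"]) auto
qed

end

section \<open>The two-density estimate\<close>

context density_data
begin

text \<open>The set where the density is below \<open>\<epsilon>\<close> times its mean has at most
  the fraction \<open>\<epsilon>\<close> of the mass. If it filled a quarter of the ball, the
  A_infinity property would give it more than that.\<close>

lemma rho_small_set:
  "\<exists>\<epsilon>>0. \<forall>z r. good \<kappa>1 z r \<longrightarrow>
     measure M {x \<in> B z r. \<rho> x * measure M (B z r) < \<epsilon> * measure N (B z r)} \<le> measure M (B z r) / 4"
proof -
  obtain c' where c': "0 < c'" and le: "\<And>z r E. good \<kappa>1 z r \<Longrightarrow> E \<in> sets M \<Longrightarrow> E \<subseteq> B z r \<Longrightarrow>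
    (1 / 4) * measure M (B z r) \<le> measure M E \<Longrightarrow> c' * measure N (B z r) \<le> measure N E"
    using A_infinity[of "1 / 4"] by (metis zero_less_divide_1_iff zero_less_numeral)
  define \<epsilon> where "\<epsilon> = c' / 2"
  have eps: "0 < \<epsilon>" using c' by (simp add: \<epsilon>_def)
  have "measure M {x \<in> B z r. \<rho> x * measure M (B z r) < \<epsilon> * measure N (B z r)} \<le> measure M (B z r) / 4"
    if g: "good \<kappa>1 z r" for z r
  proof (rule ccontr)
    have zr: "z \<in> X" "0 < r" using goodD[OF g] by auto
    define E where "E = {x \<in> B z r. \<rho> x * measure M (B z r) < \<epsilon> * measure N (B z r)}"
    assume "\<not> ?thesis"
    then have big: "(1 / 4) * measure M (B z r) \<le> measure M E" by (simp add: E_def)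
    have mB: "0 < measure M (B z r)" using mB_pos zr by simp
    have mN: "0 < measure N (B z r)" using mN_ball_pos zr by simp
    have BM [measurable]: "B z r \<in> sets M" using ball_sets zr by simp
    have EM [measurable]: "E \<in> sets M"
    proof -
      have "E = B z r \<inter> {x \<in> X. \<rho> x * measure M (B z r) < \<epsilon> * measure N (B z r)}"
        by (auto simp: E_def)
      then show ?thesis by simp
    qed
    have EB: "E \<subseteq> B z r" by (auto simp: E_def)
    define k where "k = \<epsilon> * measure N (B z r) / measure M (B z r)"
    have k: "0 \<le> k" unfolding k_def using eps mN mB by simp
    have "emeasure N E = (\<integral>\<^sup>+x\<in>E. ennreal (\<rho> x) \<partial>M)" by (rule emeasure_N[OF EM])
    also have "\<dots> \<le> (\<integral>\<^sup>+x. ennreal k * indicator E x \<partial>M)"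
    proof (rule nn_integral_mono)
      fix x
      show "ennreal (\<rho> x) * indicator E x \<le> ennreal k * indicator E x"
      proof (cases "x \<in> E")
        case True
        then have "\<rho> x \<le> k" unfolding k_def E_def using mB by (simp add: pos_le_divide_eq)
        then show ?thesis using True by (simp add: ennreal_leI)
      qed simp
    qed
    also have "\<dots> = ennreal k * emeasure M E" by (rule nn_integral_cmult_indicator[OF EM])
    also have "\<dots> = ennreal (k * measure M E)"
      using emeasure_sub_B[OF zr EM EB] k by (simp add: ennreal_mult)
    finally have "ennreal (measure N E) \<le> ennreal (k * measure M E)"
      using emeasure_N_eq[OF zr EB] by simp
    then have "measure N E \<le> k * measure M E" using k by (subst (asm) ennreal_le_iff) auto
    also have "\<dots> \<le> k * measure M (B z r)"
      using measure_sub_B[OF zr EM EB] k by (intro mult_left_mono)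
    also have "\<dots> = \<epsilon> * measure N (B z r)" using mB by (simp add: k_def)
    finally have "c' * measure N (B z r) \<le> \<epsilon> * measure N (B z r)" using le[OF g EM EB big] by linarith
    then show False using mN c' unfolding \<epsilon>_def by simp
  qed
  then show ?thesis using eps by blast
qed

lemma maximal_strong_N:
  assumes s': "1 < (s'::real)"
  shows "\<exists>C\<ge>0. \<forall>W h. finite W \<longrightarrow> (\<forall>(z, r)\<in>W. good \<kappa>0 z r) \<longrightarrow> h \<in> borel_measurable M \<longrightarrow> (\<forall>x. 0 \<le> h x) \<longrightarrow>
    (\<integral>\<^sup>+x. ennreal (MW N W h x powr s') \<partial>N) \<le> ennreal C * (\<integral>\<^sup>+x. ennreal (h x powr s') \<partial>N)"
proof -
  obtain C where C: "1 \<le> C" and dbl: "\<And>z r. good \<kappa>0 z r \<Longrightarrow>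
    emeasure N (B z (\<theta> * r)) \<le> ennreal C * emeasure N (B z r)"
    using doubling_N by blast
  have "(\<integral>\<^sup>+x. ennreal (MW N W h x powr s') \<partial>N) \<le>
    ennreal (2 powr (1 + 1 / (s' - 1)) * (2 * C) * 2 powr (s' - 1)) * (\<integral>\<^sup>+x. ennreal (h x powr s') \<partial>N)"
    if W: "finite W" "\<forall>(z, r)\<in>W. good \<kappa>0 z r" and h: "h \<in> borel_measurable M" "\<forall>x. 0 \<le> h x" for W h
  proof (rule maximal_strong_type[OF sets_N sigma_finite_N W(1) _ _ _ C s' h(1)])
    fix z r assume "(z, r) \<in> W"
    then have g: "good \<kappa>0 z r" using W(2) by auto
    show "z \<in> X \<and> 0 < r" using goodD[OF g] by simp
    show "0 < emeasure N (B z r) \<and> emeasure N (B z r) < \<infinity>"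
      using goodD[OF g] N_ball_pos N_ball_fin by simp
    show "emeasure N (B z (\<theta> * r)) \<le> ennreal C * emeasure N (B z r)" by (rule dbl[OF g])
  qed (use h in auto)
  moreover have "0 \<le> 2 powr (1 + 1 / (s' - 1)) * (2 * C) * 2 powr (s' - 1)" using C by simp
  ultimately show ?thesis by blast
qed

end

context conj_data
begin

text \<open>Both densities are at least a fixed multiple of their mean on a common half of the ball,
  so \<open>sqrt (\<rho> * \<rho>')\<close> has a mean comparable to the geometric mean of their means.\<close>

lemma sqrt_ratio_le_avg:
  assumes Wt: "density_data M d A Cd o' \<rho>' a' n' al' au' H' ainf' K' c' D'"
  shows "\<exists>C\<ge>1. \<forall>z r \<phi> v. good \<kappa>1 z r \<longrightarrow> \<phi> \<in> borel_measurable M \<longrightarrow> 0 \<le> v \<longrightarrow> (\<forall>x\<in>B z r. v \<le> \<phi> x) \<longrightarrow>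
    (\<integral>\<^sup>+x\<in>B z r. ennreal (\<phi> x * sqrt (\<rho> x / \<rho>' x)) \<partial>density M (\<lambda>x. ennreal (\<rho>' x))) < \<infinity> \<longrightarrow>
    v * sqrt (measure N (B z r) / measure (density M (\<lambda>x. ennreal (\<rho>' x))) (B z r)) \<le>
      C * avg (density M (\<lambda>x. ennreal (\<rho>' x))) (\<lambda>x. \<phi> x * sqrt (\<rho> x / \<rho>' x)) (B z r)"
proof -
  interpret Wt: density_data M d A Cd o' \<rho>' a' n' al' au' H' ainf' K' c' D' by (rule Wt)
  note N'_def = Wt.N_def[symmetric]
  obtain e1 where e1: "0 < e1" and s1: "\<And>z r. good \<kappa>1 z r \<Longrightarrow>
     measure M {x \<in> B z r. \<rho> x * measure M (B z r) < e1 * measure N (B z r)} \<le> measure M (B z r) / 4"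
    using rho_small_set by blast
  obtain e2 where e2: "0 < e2" and s2: "\<And>z r. good \<kappa>1 z r \<Longrightarrow>
     measure M {x \<in> B z r. \<rho>' x * measure M (B z r) < e2 * measure Wt.N (B z r)} \<le> measure M (B z r) / 4"
    using Wt.rho_small_set by blast
  define k where "k = sqrt (e1 * e2) / 2"
  have k: "0 < k" unfolding k_def using e1 e2 by simp
  have "v * sqrt (measure N (B z r) / measure Wt.N (B z r)) \<le>
      max 1 (1 / k) * avg Wt.N (\<lambda>x. \<phi> x * sqrt (\<rho> x / \<rho>' x)) (B z r)"
    if g: "good \<kappa>1 z r" and \<phi> [measurable]: "\<phi> \<in> borel_measurable M" and v: "0 \<le> v" "\<forall>x\<in>B z r. v \<le> \<phi> x"
      and fin: "(\<integral>\<^sup>+x\<in>B z r. ennreal (\<phi> x * sqrt (\<rho> x / \<rho>' x)) \<partial>Wt.N) < \<infinity>" for z r \<phi> v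
  proof -
    have zr: "z \<in> X" "0 < r" using goodD[OF g] by auto
    define S where "S = measure N (B z r)"
    define T where "T = measure Wt.N (B z r)"
    define m where "m = measure M (B z r)"
    have pos: "0 < S" "0 < T" "0 < m"
      unfolding S_def T_def m_def using mN_ball_pos Wt.mN_ball_pos mB_pos zr by auto
    have BM [measurable]: "B z r \<in> sets M" using ball_sets zr by simp
    define E1 where "E1 = {x \<in> B z r. \<rho> x * m < e1 * S}"
    define E2 where "E2 = {x \<in> B z r. \<rho>' x * m < e2 * T}"
    have "E1 = B z r \<inter> {x \<in> X. \<rho> x * m < e1 * S}" "E2 = B z r \<inter> {x \<in> X. \<rho>' x * m < e2 * T}"
      by (auto simp: E1_def E2_def)
    then have EM [measurable]: "E1 \<in> sets M" "E2 \<in> sets M" by auto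
    have mE: "measure M E1 \<le> m / 4" "measure M E2 \<le> m / 4"
      using s1[OF g] s2[OF g] by (auto simp: E1_def E2_def m_def S_def T_def)
    define G where "G = B z r - (E1 \<union> E2)"
    have GM [measurable]: "G \<in> sets M" by (simp add: G_def)
    have GB: "G \<subseteq> B z r" by (auto simp: G_def)
    have "measure M (E1 \<union> E2) \<le> measure M E1 + measure M E2" by (rule measure_Un_le) auto
    moreover have "measure M G = m - measure M (E1 \<union> E2)"
      unfolding G_def m_def using B_fmeasurable[OF zr] EM
      by (intro measure_Diff) (auto simp: E1_def E2_def fmeasurable_def)
    ultimately have mG: "m / 2 \<le> measure M G" using mE by linarith
    \<comment> \<open>A lower bound on \<open>G\<close> for \<open>\<rho>' x\<close> times the
      integrand, which equals \<open>\<phi> x * sqrt (\<rho> x * \<rho>' x)\<close>: there both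
      densities are at least fixed multiples of their means.\<close>
    define q where "q = v * sqrt (e1 * e2 * S * T) / m"
    have q: "0 \<le> q" unfolding q_def using v pos e1 e2 by simp
    have "ennreal (q * (m / 2)) \<le> ennreal (q * measure M G)"
      using mG q by (intro ennreal_leI mult_left_mono)
    also have "\<dots> = (\<integral>\<^sup>+x. ennreal q * indicator G x \<partial>M)"
      using q emeasure_sub_B[OF zr GM GB] by (simp add: nn_integral_cmult_indicator ennreal_mult)
    also have "\<dots> \<le> (\<integral>\<^sup>+x. ennreal (\<rho>' x) * (ennreal (\<phi> x * sqrt (\<rho> x / \<rho>' x)) * indicator (B z r) x) \<partial>M)"
    proof (rule nn_integral_mono)
      fix x
      show "ennreal q * indicator G x \<le> ennreal (\<rho>' x) * (ennreal (\<phi> x * sqrt (\<rho> x / \<rho>' x)) * indicator (B z r) x)"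
      proof (cases "x \<in> G")
        case True
        then have xB: "x \<in> B z r" and x1: "e1 * S / m \<le> \<rho> x" and x2: "e2 * T / m \<le> \<rho>' x"
          using pos by (auto simp: G_def E1_def E2_def pos_divide_le_eq)
        have "0 < e2 * T / m" using e2 pos by simp
        then have r0: "0 < \<rho>' x" using x2 by linarith
        have "q = v * sqrt ((e1 * S / m) * (e2 * T / m))"
          unfolding q_def using pos by (simp add: real_sqrt_mult real_sqrt_divide)
        also have "\<dots> \<le> \<phi> x * sqrt (\<rho> x * \<rho>' x)"
        proof (rule mult_mono)
          show p: "v \<le> \<phi> x" using v(2) xB by blast
          show "0 \<le> \<phi> x" using v(1) p by linarith
          show "sqrt ((e1 * S / m) * (e2 * T / m)) \<le> sqrt (\<rho> x * \<rho>' x)"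
            using x1 x2 pos e1 e2 rho_nonneg[of x] by (intro real_sqrt_le_mono mult_mono) auto
        qed (use pos e1 e2 in auto)
        also have "\<dots> = \<rho>' x * (\<phi> x * sqrt (\<rho> x / \<rho>' x))"
          using r0 by (simp add: real_sqrt_mult real_sqrt_divide field_simps)
        finally have "ennreal q \<le> ennreal (\<rho>' x * (\<phi> x * sqrt (\<rho> x / \<rho>' x)))" by (rule ennreal_leI)
        then show ?thesis using True xB r0 by (simp add: ennreal_mult' del: in_B)
      qed simp
    qed
    also have "\<dots> = (\<integral>\<^sup>+x\<in>B z r. ennreal (\<phi> x * sqrt (\<rho> x / \<rho>' x)) \<partial>Wt.N)"
      by (rule Wt.nn_integral_N[symmetric]) measurable
    finally have le: "ennreal (q * (m / 2)) \<le> (\<integral>\<^sup>+x\<in>B z r. ennreal (\<phi> x * sqrt (\<rho> x / \<rho>' x)) \<partial>Wt.N)" .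
    have "q * (m / 2) = enn2real (ennreal (q * (m / 2)))" using q pos by simp
    also have "\<dots> \<le> enn2real (\<integral>\<^sup>+x\<in>B z r. ennreal (\<phi> x * sqrt (\<rho> x / \<rho>' x)) \<partial>Wt.N)"
      using fin by (intro enn2real_mono[OF le]) simp
    finally have "q * (m / 2) / T \<le> avg Wt.N (\<lambda>x. \<phi> x * sqrt (\<rho> x / \<rho>' x)) (B z r)"
      unfolding avg_def T_def[symmetric] using pos by (intro divide_right_mono) auto
    moreover have "q * (m / 2) / T = k * (v * sqrt (S / T))"
    proof -
      have "sqrt T * sqrt T = T" using pos by simp
      then show ?thesis unfolding q_def k_def using pos
        by (simp add: real_sqrt_mult real_sqrt_divide field_simps)
    qed
    ultimately have "k * (v * sqrt (S / T)) \<le> avg Wt.N (\<lambda>x. \<phi> x * sqrt (\<rho> x / \<rho>' x)) (B z r)" by simp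
    then have "v * sqrt (S / T) \<le> 1 / k * avg Wt.N (\<lambda>x. \<phi> x * sqrt (\<rho> x / \<rho>' x)) (B z r)"
      using k by (simp add: field_simps)
    also have "\<dots> \<le> max 1 (1 / k) * avg Wt.N (\<lambda>x. \<phi> x * sqrt (\<rho> x / \<rho>' x)) (B z r)"
      by (intro mult_right_mono avg_nonneg) auto
    finally show ?thesis unfolding S_def T_def .
  qed
  then show ?thesis unfolding N'_def by (intro exI[of _ "max 1 (1 / k)"]) auto
qed

text \<open>The density \<open>\<rho>\<close> belongs to one function and \<open>\<rho>'\<close> to
  the target weight, so this settles one of the summands into which Young's inequality separates the
  operator. The constant is independent of \<open>W\<close>.\<close>

lemma ratio_maximal_integrable:
  assumes Wt: "density_data M d A Cd o' \<rho>' a' n' al' au' H' ainf' K' c' D'"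
  shows "\<exists>C\<ge>0. \<forall>g W. g \<in> borel_measurable M \<longrightarrow> (\<forall>x. 0 \<le> g x) \<longrightarrow>
    (\<integral>\<^sup>+x. ennreal (\<rho> x * g x powr p x) \<partial>M) \<le> 1 \<longrightarrow> finite W \<longrightarrow> (\<forall>(z, r)\<in>W. good \<kappa>0 z r) \<longrightarrow>
    (\<integral>\<^sup>+x. ennreal (\<rho>' x) * (SUP (z, r)\<in>W. ennreal (ratio g z r powr p x * n' z r powr (- a' x)) * indicator (B z r) x) \<partial>M)
      \<le> ennreal C"
proof -
  interpret Wt: density_data M d A Cd o' \<rho>' a' n' al' au' H' ainf' K' c' D' by (rule Wt)
  note N'_def = Wt.N_def[symmetric]
  obtain t1 where t1: "\<And>t. t1 \<le> t \<Longrightarrow> (\<integral>\<^sup>+x. ennreal (tail t x) \<partial>N) < \<infinity>" using tail_integrable by blast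
  obtain t2 where t2: "\<And>t. t2 \<le> t \<Longrightarrow> (\<integral>\<^sup>+x. ennreal (tail t x) \<partial>Wt.N) < \<infinity>" using Wt.tail_integrable by blast
  \<comment> \<open>One decay rate at which the tail is integrable for both densities.\<close>
  define t where "t = max 0 (max t1 t2)"
  have t: "0 \<le> t" and T1: "(\<integral>\<^sup>+x. ennreal (tail t x) \<partial>N) < \<infinity>" and T2: "(\<integral>\<^sup>+x. ennreal (tail t x) \<partial>Wt.N) < \<infinity>"
    using t1[of t] t2[of t] by (auto simp: t_def)
  define T1' where "T1' = enn2real (\<integral>\<^sup>+x. ennreal (tail t x) \<partial>N)"
  have T1': "(\<integral>\<^sup>+x. ennreal (tail t x) \<partial>N) \<le> ennreal T1'" "0 \<le> T1'" using T1 by (auto simp: T1'_def)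
  define T2' where "T2' = enn2real (\<integral>\<^sup>+x. ennreal (tail t x) \<partial>Wt.N)"
  have T2': "(\<integral>\<^sup>+x. ennreal (tail t x) \<partial>Wt.N) = ennreal T2'" "0 \<le> T2'" using T2 by (auto simp: T2'_def)
  obtain Ca where Ca: "1 \<le> Ca" and a: "\<And>g z r x. g \<in> borel_measurable M \<Longrightarrow> (\<forall>x. 0 \<le> g x) \<Longrightarrow>
    (\<integral>\<^sup>+x. ennreal (\<rho> x * g x powr p x) \<partial>M) \<le> 1 \<Longrightarrow> good \<kappa>1 z r \<Longrightarrow> x \<in> B z r \<Longrightarrow>
    ratio g z r powr p x \<le> Ca * (measure N (B z r) * avg N (hh t g) (B z r) powr s) + far z r * tail t x"
    using ratio_powr_le[OF t T1] by blast
  obtain Cb where Cb: "1 \<le> Cb" and b: "\<And>z r x. good \<kappa>1 z r \<Longrightarrow> x \<in> B z r \<Longrightarrow>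
    n' z r powr (- a' x) \<le> Cb / measure Wt.N (B z r) + far z r * tail t x"
    using Wt.n_powr_le_inverse_measure[OF t] by blast
  obtain Cc where Cc: "1 \<le> Cc" and c: "\<And>z r \<phi> v. good \<kappa>1 z r \<Longrightarrow> \<phi> \<in> borel_measurable M \<Longrightarrow> 0 \<le> v \<Longrightarrow>
    (\<forall>x\<in>B z r. v \<le> \<phi> x) \<Longrightarrow>
    (\<integral>\<^sup>+x\<in>B z r. ennreal (\<phi> x * sqrt (\<rho> x / \<rho>' x)) \<partial>Wt.N) < \<infinity> \<Longrightarrow>
    v * sqrt (measure N (B z r) / measure Wt.N (B z r)) \<le>
      Cc * avg Wt.N (\<lambda>x. \<phi> x * sqrt (\<rho> x / \<rho>' x)) (B z r)"
    using sqrt_ratio_le_avg[OF Wt, unfolded N'_def] by blast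
  obtain Cd1 where Cd1: "0 \<le> Cd1" and max1: "\<And>W h. finite W \<Longrightarrow> (\<forall>(z, r)\<in>W. good \<kappa>0 z r) \<Longrightarrow>
    h \<in> borel_measurable M \<Longrightarrow> (\<forall>x. 0 \<le> h x) \<Longrightarrow>
    (\<integral>\<^sup>+x. ennreal (MW N W h x powr s) \<partial>N) \<le> ennreal Cd1 * (\<integral>\<^sup>+x. ennreal (h x powr s) \<partial>N)"
    using maximal_strong_N[OF s] by blast
  obtain Cd2 where Cd2: "0 \<le> Cd2" and max2: "\<And>W h. finite W \<Longrightarrow> (\<forall>(z, r)\<in>W. good \<kappa>0 z r) \<Longrightarrow>
    h \<in> borel_measurable M \<Longrightarrow> (\<forall>x. 0 \<le> h x) \<Longrightarrow>
    (\<integral>\<^sup>+x. ennreal (MW Wt.N W h x powr 2) \<partial>Wt.N) \<le> ennreal Cd2 * (\<integral>\<^sup>+x. ennreal (h x powr 2) \<partial>Wt.N)"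
    using Wt.maximal_strong_N[of 2] by auto
  define \<nu> where "\<nu> = measure Wt.N (B o' 1)"
  have nu: "0 < \<nu>" unfolding \<nu>_def using Wt.mN_ball_pos origin by simp
  define Rb where "Rb = (1 + K) powr pp"
  have ppp: "1 < pp" using pinf_bounds s by linarith
  have Rb: "0 \<le> Rb" by (simp add: Rb_def)
  define k1 where "k1 = Ca * Cb * Cc ^ 2"
  \<comment> \<open>Collects two tail errors. The one from the ratio gets divided by the target mass
    of a ball containing \<open>B o' 1\<close>; the one from the target norm multiplies a ratio
    power that is at most \<open>Rb\<close>.\<close>
  define k2 where "k2 = Cb / \<nu> + Rb"
  have k: "0 \<le> k1" "0 \<le> k2" unfolding k1_def k2_def using Ca Cb Cc nu Rb by auto
  define J1 where "J1 = Cd1 * (2 powr s * (1 + T1'))"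
  have J1: "0 \<le> J1" unfolding J1_def using Cd1 T1' by simp
  define CC where "CC = k1 * (Cd2 * J1) + k2 * T2'"
  have CC: "0 \<le> CC" unfolding CC_def using k Cd2 J1 T2' by simp
  have "(\<integral>\<^sup>+x. ennreal (\<rho>' x) * (SUP (z, r)\<in>W. ennreal (ratio g z r powr p x * n' z r powr (- a' x)) * indicator (B z r) x) \<partial>M)
      \<le> ennreal CC"
    if g: "g \<in> borel_measurable M" "\<forall>x. 0 \<le> g x" and one: "(\<integral>\<^sup>+x. ennreal (\<rho> x * g x powr p x) \<partial>M) \<le> 1"
      and W: "finite W" "\<forall>(z, r)\<in>W. good \<kappa>0 z r" for g W
  proof -
    have g0: "\<And>x. 0 \<le> g x" using g(2) by simp
    have Wp: "z \<in> X \<and> 0 < r" if "(z, r) \<in> W" for z r using W(2) that goodD by blast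
    define h where "h = hh t g"
    have h [measurable]: "h \<in> borel_measurable M" and h0: "\<forall>x. 0 \<le> h x"
      unfolding h_def using hh_measurable[OF g(1)] hh_nonneg by auto
    have h0': "\<And>x. 0 \<le> h x" using h0 by simp
    define F where "F = MW N W h"
    have F [measurable]: "F \<in> borel_measurable M" unfolding F_def by (rule MW_measurable[OF W(1) Wp])
    have F0: "0 \<le> F x" for x unfolding F_def by (rule MW_nonneg[OF W(1)])
    define \<phi> where "\<phi> x = F x powr (s / 2)" for x
    have \<phi> [measurable]: "\<phi> \<in> borel_measurable M" unfolding \<phi>_def[abs_def] by measurable
    \<comment> \<open>Chosen so that \<open>\<rho>' x * HH x powr 2\<close> equals
      \<open>\<rho> x * F x powr s\<close> where \<open>\<rho>' x\<close> is positive. Its L^2 bound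
      for the target density is thus the maximal theorem already applied to
      \<open>\<rho>\<close>.\<close>
    define HH where "HH x = \<phi> x * sqrt (\<rho> x / \<rho>' x)" for x
    have HH [measurable]: "HH \<in> borel_measurable M" unfolding HH_def[abs_def] by measurable
    have HH0: "0 \<le> HH x" for x unfolding HH_def \<phi>_def using rho_nonneg Wt.rho_nonneg by simp
    have Fint: "(\<integral>\<^sup>+x. ennreal (F x powr s) \<partial>N) \<le> ennreal J1"
    proof -
      have "(\<integral>\<^sup>+x. ennreal (F x powr s) \<partial>N) \<le> ennreal Cd1 * (\<integral>\<^sup>+x. ennreal (h x powr s) \<partial>N)"
        unfolding F_def by (rule max1[OF W h h0])
      also have "\<dots> \<le> ennreal Cd1 * ennreal (2 powr s * (1 + T1'))"
        unfolding h_def by (intro mult_left_mono hh_power_integral[OF t T1' g(1) g0 one]) auto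
      also have "\<dots> = ennreal J1" unfolding J1_def using Cd1 T1' by (subst ennreal_mult) auto
      finally show ?thesis .
    qed
    have Hint: "(\<integral>\<^sup>+x. ennreal (HH x powr 2) \<partial>Wt.N) \<le> ennreal J1"
    proof -
      have "(\<integral>\<^sup>+x. ennreal (HH x powr 2) \<partial>Wt.N) = (\<integral>\<^sup>+x. ennreal (\<rho>' x) * ennreal (HH x powr 2) \<partial>M)"
        by (rule Wt.nn_integral_N) measurable
      also have "\<dots> \<le> (\<integral>\<^sup>+x. ennreal (\<rho> x) * ennreal (F x powr s) \<partial>M)"
      proof (rule nn_integral_mono)
        fix x
        show "ennreal (\<rho>' x) * ennreal (HH x powr 2) \<le> ennreal (\<rho> x) * ennreal (F x powr s)"
        proof (cases "\<rho>' x = 0")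
          case False
          then have r0: "0 < \<rho>' x" using Wt.rho_nonneg[of x] by simp
          have "HH x powr 2 = HH x ^ 2" using HH0[of x] by simp
          also have "\<dots> = (\<phi> x) ^ 2 * (\<rho> x / \<rho>' x)"
            unfolding HH_def power_mult_distrib using rho_nonneg[of x] r0 by simp
          also have "(\<phi> x) ^ 2 = F x powr s"
          proof -
            have "(\<phi> x) ^ 2 = (F x powr (s / 2)) powr 2" unfolding \<phi>_def by simp
            then show ?thesis by (simp add: powr_powr)
          qed
          finally have "\<rho>' x * HH x powr 2 = \<rho> x * F x powr s" using r0 by simp
          then show ?thesis using Wt.rho_nonneg[of x] rho_nonneg[of x]
            by (simp add: ennreal_mult[symmetric])
        qed simp
      qed
      also have "\<dots> = (\<integral>\<^sup>+x. ennreal (F x powr s) \<partial>N)" by (rule nn_integral_N[symmetric]) measurable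
      finally show ?thesis using Fint by (rule order_trans)
    qed
    have Hfin: "(\<integral>\<^sup>+x\<in>B z r. ennreal (HH x) \<partial>Wt.N) < \<infinity>" if zr: "z \<in> X" "0 < r" for z r
    proof (rule set_nn_integral_finite_of_powr[where s = 2])
      show "HH \<in> borel_measurable Wt.N" unfolding measurable_cong_sets[OF Wt.sets_N refl] by (rule HH)
      show "(\<integral>\<^sup>+x. ennreal (HH x powr 2) \<partial>Wt.N) < \<infinity>" using Hint by (auto intro: order_le_less_trans)
    qed (use ball_sets[OF zr] Wt.N_ball_fin[OF zr] in auto)
    define F2 where "F2 = MW Wt.N W HH"
    have F2 [measurable]: "F2 \<in> borel_measurable M" unfolding F2_def by (rule MW_measurable[OF W(1) Wp])
    have F20: "0 \<le> F2 x" for x unfolding F2_def by (rule MW_nonneg[OF W(1)])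
    have pt: "ratio g z r powr p x * n' z r powr (- a' x) \<le> k1 * F2 x powr 2 + k2 * tail t x"
      if zW: "(z, r) \<in> W" and x: "x \<in> B z r" for z r x
    proof -
      have g0': "good \<kappa>0 z r" using W(2) zW by auto
      have gd: "good \<kappa>1 z r" by (rule good_mono[OF g0'])
      have zr: "z \<in> X" "0 < r" using goodD[OF gd] by auto
      have xX: "x \<in> X" using x by simp
      define S where "S = measure N (B z r)"
      define T where "T = measure Wt.N (B z r)"
      have pos: "0 < S" "0 < T" unfolding S_def T_def using mN_ball_pos Wt.mN_ball_pos zr by auto
      define v where "v = avg N h (B z r)"
      have v: "0 \<le> v" unfolding v_def by (rule avg_nonneg)
      have tp: "0 < tail t x" by (rule tail_pos)
      have rb: "0 \<le> ratio g z r" "ratio g z r \<le> 1 + K" using ratio_bounds[OF g(1) g0 one zr] by auto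
      have rR: "ratio g z r powr p x \<le> Rb"
      proof -
        have "ratio g z r powr p x \<le> (1 + K) powr p x"
          using rb p_bounds[OF xX] s by (intro powr_mono2) auto
        also have "\<dots> \<le> Rb" unfolding Rb_def using p_bounds[OF xX] K by (intro powr_mono) auto
        finally show ?thesis .
      qed
      have fT: "far z r / T \<le> 1 / \<nu>"
      proof (cases "z = o' \<and> 1 \<le> r")
        case True
        have "\<nu> \<le> T" unfolding \<nu>_def T_def
        proof (rule measure_mono_fmeasurable)
          show "B o' 1 \<subseteq> B z r" using True by (auto simp: qball_def)
          show "B o' 1 \<in> sets Wt.N" using ball_sets origin by simp
          show "B z r \<in> fmeasurable Wt.N" using ball_sets[OF zr] Wt.N_ball_fin[OF zr] by (intro fmeasurableI) auto
        qed
        then show ?thesis using nu pos True by (simp add: far_def frac_le)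
      next
        case False
        then have "far z r = 0" by (auto simp: far_def)
        then show ?thesis using nu by simp
      qed
      have "ratio g z r powr p x * n' z r powr (- a' x) \<le> ratio g z r powr p x * (Cb / T + far z r * tail t x)"
        using b[OF gd x] unfolding T_def by (intro mult_left_mono) auto
      also have "\<dots> = ratio g z r powr p x * (Cb / T) + ratio g z r powr p x * (far z r * tail t x)"
        by (simp add: distrib_left)
      also have "\<dots> \<le> (Ca * (S * v powr s) + far z r * tail t x) * (Cb / T) + Rb * (1 * tail t x)"
        using a[OF g one gd x] rR Cb pos tp far_nonneg[of z r] far_le_1[of z r] Rb
        unfolding S_def v_def h_def by (intro add_mono mult_mono mult_right_mono) auto
      also have "\<dots> = Ca * Cb * (S * v powr s / T) + (Cb * (far z r / T) + Rb) * tail t x"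
        by (simp add: algebra_simps add_divide_distrib)
      also have "\<dots> \<le> Ca * Cb * (Cc ^ 2 * F2 x powr 2) + k2 * tail t x"
      proof (intro add_mono mult_left_mono mult_right_mono)
        show "Cb * (far z r / T) + Rb \<le> k2" unfolding k2_def using mult_left_mono[OF fT, of Cb] Cb by simp
        have "v powr (s / 2) * sqrt (S / T) \<le> Cc * avg Wt.N HH (B z r)"
          unfolding S_def T_def HH_def[abs_def]
        proof (rule c[OF gd \<phi>])
          show "\<forall>y\<in>B z r. v powr (s / 2) \<le> \<phi> y"
            unfolding \<phi>_def v_def F_def using s MW_ge[OF W(1) zW] avg_nonneg
            by (auto intro!: powr_mono2 simp del: in_B)
          show "(\<integral>\<^sup>+x\<in>B z r. ennreal (\<phi> x * sqrt (\<rho> x / \<rho>' x)) \<partial>Wt.N) < \<infinity>"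
            using Hfin[OF zr] by (simp add: HH_def)
        qed simp
        also have "\<dots> \<le> Cc * F2 x"
          unfolding F2_def using Cc MW_ge[OF W(1) zW x] by (intro mult_left_mono) auto
        finally have "(v powr (s / 2) * sqrt (S / T)) ^ 2 \<le> (Cc * F2 x) ^ 2"
          using pos by (intro power_mono) auto
        moreover have "(v powr (s / 2) * sqrt (S / T)) ^ 2 = S * v powr s / T"
        proof -
          have "(v powr (s / 2)) ^ 2 = (v powr (s / 2)) powr 2" by simp
          also have "\<dots> = v powr s" by (simp add: powr_powr)
          finally show ?thesis using pos by (simp add: power_mult_distrib)
        qed
        ultimately show "S * v powr s / T \<le> Cc ^ 2 * F2 x powr 2"
          using F20[of x] by (simp add: power_mult_distrib)
      qed (use Ca Cb tp in auto)
      also have "\<dots> = k1 * F2 x powr 2 + k2 * tail t x" by (simp add: k1_def)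
      finally show ?thesis .
    qed
    have "(\<integral>\<^sup>+x. ennreal (\<rho>' x) * (SUP (z, r)\<in>W. ennreal (ratio g z r powr p x * n' z r powr (- a' x)) * indicator (B z r) x) \<partial>M)
      \<le> (\<integral>\<^sup>+x. ennreal (\<rho>' x) * (ennreal k1 * ennreal (F2 x powr 2) + ennreal k2 * ennreal (tail t x)) \<partial>M)"
    proof (intro nn_integral_mono mult_left_mono SUP_least)
      fix x zr assume "zr \<in> W"
      then obtain z r where zr: "zr = (z, r)" "(z, r) \<in> W" by (cases zr) auto
      show "(case zr of (z, r) \<Rightarrow> ennreal (ratio g z r powr p x * n' z r powr (- a' x)) * indicator (B z r) x)
         \<le> ennreal k1 * ennreal (F2 x powr 2) + ennreal k2 * ennreal (tail t x)"
      proof (cases "x \<in> B z r")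
        case True
        have "ennreal (ratio g z r powr p x * n' z r powr (- a' x)) \<le> ennreal (k1 * F2 x powr 2 + k2 * tail t x)"
          using pt[OF zr(2) True] by (rule ennreal_leI)
        also have "\<dots> = ennreal k1 * ennreal (F2 x powr 2) + ennreal k2 * ennreal (tail t x)"
          using k tail_pos[of t x] by (simp add: ennreal_plus ennreal_mult)
        finally show ?thesis using True unfolding zr(1) by (simp del: in_B)
      qed (simp add: zr(1) del: in_B)
    qed simp
    also have "\<dots> = (\<integral>\<^sup>+x. ennreal k1 * ennreal (F2 x powr 2) + ennreal k2 * ennreal (tail t x) \<partial>Wt.N)"
      by (rule Wt.nn_integral_N[symmetric]) measurable
    also have "\<dots> = ennreal k1 * (\<integral>\<^sup>+x. ennreal (F2 x powr 2) \<partial>Wt.N) + ennreal k2 * ennreal T2'"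
    proof -
      have m: "(\<lambda>x. ennreal (F2 x powr 2)) \<in> borel_measurable Wt.N" "(\<lambda>x. ennreal (tail t x)) \<in> borel_measurable Wt.N"
        unfolding measurable_cong_sets[OF Wt.sets_N refl] by measurable
      show ?thesis unfolding T2'(1)[symmetric] using m
        by (simp add: nn_integral_add nn_integral_cmult)
    qed
    also have "\<dots> \<le> ennreal k1 * (ennreal Cd2 * ennreal J1) + ennreal k2 * ennreal T2'"
    proof (intro add_right_mono mult_left_mono)
      have "(\<integral>\<^sup>+x. ennreal (F2 x powr 2) \<partial>Wt.N) \<le> ennreal Cd2 * (\<integral>\<^sup>+x. ennreal (HH x powr 2) \<partial>Wt.N)"
        unfolding F2_def by (rule max2[OF W HH]) (use HH0 in auto)
      also have "\<dots> \<le> ennreal Cd2 * ennreal J1" by (intro mult_left_mono Hint) auto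
      finally show "(\<integral>\<^sup>+x. ennreal (F2 x powr 2) \<partial>Wt.N) \<le> ennreal Cd2 * ennreal J1" .
    qed simp
    also have "\<dots> = ennreal CC"
      unfolding CC_def using k Cd2 J1 T2' by (simp add: ennreal_mult ennreal_plus)
    finally show ?thesis .
  qed
  then show ?thesis using CC by blast
qed

end

section \<open>Variable exponent norms\<close>

lemma epowr_ennreal: "0 \<le> x \<Longrightarrow> epowr (ennreal x) a = ennreal (x powr a)"
  by (simp add: epowr_def)

lemma epowr_mono:
  assumes "x \<le> y" "0 \<le> a"
  shows "epowr x a \<le> epowr y a"
proof (cases "y = \<infinity>")
  case False
  then have "x \<noteq> \<infinity>" using assms(1) by (auto simp: top_unique)
  have "enn2real x \<le> enn2real y" using assms(1) False by (intro enn2real_mono) (auto simp: less_top)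
  then show ?thesis using False \<open>x \<noteq> \<infinity>\<close> assms(2)
    by (auto simp: epowr_def intro!: ennreal_leI powr_mono2)
qed (simp add: epowr_def)

lemma epowr_mult_ennreal:
  assumes "0 < c"
  shows "epowr (ennreal c * y) a = ennreal (c powr a) * epowr y a"
proof (cases y)
  case (real r)
  have "ennreal c * ennreal r = ennreal (c * r)" using assms real by (simp add: ennreal_mult)
  then have "epowr (ennreal c * ennreal r) a = ennreal ((c * r) powr a)"
    using assms real by (simp add: epowr_ennreal)
  then show ?thesis using real assms by (simp add: epowr_ennreal powr_mult ennreal_mult)
next
  case top
  then show ?thesis using assms by (simp add: epowr_def ennreal_mult_top)
qed

lemma epowr_SUP_le:
  assumes "0 < a" "\<And>i. i \<in> I \<Longrightarrow> epowr (y i) a \<le> b"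
  shows "epowr (SUP i\<in>I. y i) a \<le> b"
proof (cases b)
  case (real \<beta>)
  have "y i \<le> ennreal (\<beta> powr (1 / a))" if i: "i \<in> I" for i
  proof (cases "y i")
    case (real v)
    have "ennreal (v powr a) \<le> ennreal \<beta>" using assms(2)[OF i] real \<open>b = ennreal \<beta>\<close> by (simp add: epowr_ennreal)
    then have "v powr a \<le> \<beta>" using \<open>0 \<le> \<beta>\<close> by (simp add: ennreal_le_iff)
    then have "(v powr a) powr (1 / a) \<le> \<beta> powr (1 / a)" using assms(1) by (intro powr_mono2) auto
    then show ?thesis using real assms(1) by (simp add: powr_powr ennreal_leI)
  next
    case top
    then have "(\<infinity>::ennreal) \<le> ennreal \<beta>" using assms(2)[OF i] \<open>b = ennreal \<beta>\<close> by (simp add: epowr_def)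
    then show ?thesis by (simp add: top_unique)
  qed
  then have "(SUP i\<in>I. y i) \<le> ennreal (\<beta> powr (1 / a))" by (rule SUP_least)
  then have "epowr (SUP i\<in>I. y i) a \<le> epowr (ennreal (\<beta> powr (1 / a))) a"
    using assms(1) by (intro epowr_mono) auto
  then show ?thesis using real assms(1) by (simp add: epowr_ennreal powr_powr)
qed simp

lemma ennreal_divide_real: "0 < l \<Longrightarrow> y / ennreal l = ennreal (1 / l) * y"
  by (simp add: divide_ennreal_def inverse_ennreal mult.commute inverse_eq_divide)

lemma epowr_divide:
  assumes "0 < l"
  shows "epowr (y / ennreal l) a = ennreal ((1 / l) powr a) * epowr y a"
  unfolding ennreal_divide_real[OF assms] by (rule epowr_mult_ennreal) (use assms in simp)

lemma var_norm_cong_AE: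
  assumes "AE x in M. f x = g x"
  shows "var_norm M p f = var_norm M p g"
proof -
  have "(\<integral>\<^sup>+x. epowr (f x / ennreal l) (p x) \<partial>M) = (\<integral>\<^sup>+x. epowr (g x / ennreal l) (p x) \<partial>M)" for l
    using assms by (intro nn_integral_cong_AE) auto
  then show ?thesis by (simp add: var_norm_def)
qed

lemma var_norm_le:
  assumes "0 < l" "(\<integral>\<^sup>+x. epowr (f x / ennreal l) (p x) \<partial>M) \<le> 1"
  shows "var_norm M p f \<le> ennreal l"
  unfolding var_norm_def using assms by (intro INF_lower) auto

lemma var_norm_less:
  assumes "var_norm M p f < t"
  shows "\<exists>l. 0 < l \<and> ennreal l < t \<and> (\<integral>\<^sup>+x. epowr (f x / ennreal l) (p x) \<partial>M) \<le> 1"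
  using assms unfolding var_norm_def INF_less_iff by auto

text \<open>Instead of showing that the infimum in the norm is attained, an admissible number below
  \<open>2 * n\<close> is used; the factor 2 costs \<open>2 powr au\<close>.\<close>

lemma modular_le_var_norm:
  fixes u :: "'a \<Rightarrow> real"
  assumes u: "\<And>x. 0 \<le> u x" and a: "\<And>x. x \<in> space M \<Longrightarrow> 0 < a x \<and> a x \<le> au"
    and V: "var_norm M a (\<lambda>x. ennreal (u x) * indicator E x) = ennreal n" "0 < n"
    and [measurable]: "u \<in> borel_measurable M" "a \<in> borel_measurable M" "E \<in> sets M"
  shows "(\<integral>\<^sup>+x\<in>E. ennreal (u x powr a x * n powr (- a x)) \<partial>M) \<le> ennreal (2 powr au)"
proof -
  have "var_norm M a (\<lambda>x. ennreal (u x) * indicator E x) < ennreal (2 * n)"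
    using V by (simp add: ennreal_less_iff)
  from var_norm_less[OF this] obtain l where l: "0 < l" "ennreal l < ennreal (2 * n)"
    "(\<integral>\<^sup>+x. epowr (ennreal (u x) * indicator E x / ennreal l) (a x) \<partial>M) \<le> 1" by blast
  have ln: "l < 2 * n" using l(1,2) by (simp add: ennreal_less_iff)
  have "(\<integral>\<^sup>+x\<in>E. ennreal (u x powr a x * n powr (- a x)) \<partial>M) \<le>
      (\<integral>\<^sup>+x. ennreal (2 powr au) * (ennreal (u x powr a x * (1 / l) powr a x) * indicator E x) \<partial>M)"
  proof (rule nn_integral_mono)
    fix x assume x: "x \<in> space M"
    have "n powr (- a x) = (1 / n) powr a x" using V(2) by (simp add: powr_divide powr_minus_divide)
    also have "\<dots> \<le> (2 * (1 / l)) powr a x"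
      using a[OF x] l ln V(2) by (intro powr_mono2) (auto simp: field_simps)
    also have "\<dots> = 2 powr a x * (1 / l) powr a x" using l by (subst powr_mult) auto
    also have "\<dots> \<le> 2 powr au * (1 / l) powr a x" using a[OF x] by (intro mult_right_mono powr_mono) auto
    finally have "u x powr a x * n powr (- a x) \<le> u x powr a x * (2 powr au * (1 / l) powr a x)"
      by (intro mult_left_mono) auto
    then have "u x powr a x * n powr (- a x) \<le> 2 powr au * (u x powr a x * (1 / l) powr a x)"
      by (simp add: mult_ac)
    then show "ennreal (u x powr a x * n powr (- a x)) * indicator E x \<le>
       ennreal (2 powr au) * (ennreal (u x powr a x * (1 / l) powr a x) * indicator E x)"
      by (simp add: indicator_def ennreal_mult[symmetric] ennreal_leI)
  qed
  also have "\<dots> = ennreal (2 powr au) * (\<integral>\<^sup>+x. ennreal (u x powr a x * (1 / l) powr a x) * indicator E x \<partial>M)"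
    by (rule nn_integral_cmult) measurable
  also have "(\<integral>\<^sup>+x. ennreal (u x powr a x * (1 / l) powr a x) * indicator E x \<partial>M) =
      (\<integral>\<^sup>+x. epowr (ennreal (u x) * indicator E x / ennreal l) (a x) \<partial>M)"
  proof (rule nn_integral_cong)
    fix x assume "x \<in> space M"
    show "ennreal (u x powr a x * (1 / l) powr a x) * indicator E x = epowr (ennreal (u x) * indicator E x / ennreal l) (a x)"
      using u[of x] l(1) unfolding epowr_divide[OF l(1)]
      by (cases "x \<in> E") (simp_all add: epowr_ennreal ennreal_mult mult.commute, simp add: epowr_def)
  qed
  also have "ennreal (2 powr au) * \<dots> \<le> ennreal (2 powr au) * 1" using l(3) by (intro mult_left_mono) auto
  finally show ?thesis by simp
qed

text \<open>If the norm vanished, arbitrarily small numbers would be admissible. The modular of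
  \<open>u\<close> on \<open>E\<close> would then be at most every \<open>e powr al\<close>, hence
  zero, although \<open>u\<close> is positive almost everywhere.\<close>

lemma var_norm_pos:
  fixes u :: "'a \<Rightarrow> real"
  assumes u: "AE x in M. 0 < u x" and a: "\<And>x. x \<in> space M \<Longrightarrow> al \<le> a x" "0 < al"
    and [measurable]: "u \<in> borel_measurable M" "a \<in> borel_measurable M" and E [measurable]: "E \<in> sets M"
    and pos: "0 < emeasure M E"
  shows "0 < var_norm M a (\<lambda>x. ennreal (u x) * indicator E x)"
proof (rule ccontr)
  assume "\<not> ?thesis"
  then have V: "var_norm M a (\<lambda>x. ennreal (u x) * indicator E x) = 0" by simp
  define I where "I = (\<integral>\<^sup>+x\<in>E. ennreal (u x powr a x) \<partial>M)"
  have le: "I \<le> ennreal (e powr al)" if e: "0 < e" "e \<le> 1" for e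
  proof -
    have "var_norm M a (\<lambda>x. ennreal (u x) * indicator E x) < ennreal e" using V e by simp
    from var_norm_less[OF this] obtain l where l: "0 < l" "ennreal l < ennreal e"
      "(\<integral>\<^sup>+x. epowr (ennreal (u x) * indicator E x / ennreal l) (a x) \<partial>M) \<le> 1" by blast
    have le: "l < e" using l(1,2) by (simp add: ennreal_less_iff)
    have "I \<le> (\<integral>\<^sup>+x. ennreal (e powr al) * epowr (ennreal (u x) * indicator E x / ennreal l) (a x) \<partial>M)"
      unfolding I_def
    proof (rule nn_integral_mono_AE, use u in eventually_elim)
      case (elim x)
      show ?case
      proof (cases "x \<in> E")
        case True
        then have x: "x \<in> space M" using sets.sets_into_space[OF E] by auto
        have "1 = e powr al * (1 / e) powr al" using e by (simp add: powr_divide)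
        also have "\<dots> \<le> e powr al * (1 / l) powr a x"
        proof (rule mult_left_mono)
          have "(1 / e) powr al \<le> (1 / l) powr al" using le l e a by (intro powr_mono2) (auto simp: frac_le)
          also have "\<dots> \<le> (1 / l) powr a x" using a(1)[OF x] l le e by (intro powr_mono) auto
          finally show "(1 / e) powr al \<le> (1 / l) powr a x" .
        qed simp
        finally have "1 * u x powr a x \<le> (e powr al * (1 / l) powr a x) * u x powr a x"
          by (intro mult_right_mono) auto
        then have "ennreal (u x powr a x) \<le> ennreal (e powr al * ((1 / l) powr a x * u x powr a x))"
          by (intro ennreal_leI) (simp add: mult.assoc)
        then show ?thesis using True elim unfolding epowr_divide[OF l(1)]
          by (simp add: epowr_ennreal ennreal_mult)
      qed simp
    qed
    also have "\<dots> = ennreal (e powr al) * (\<integral>\<^sup>+x. epowr (ennreal (u x) * indicator E x / ennreal l) (a x) \<partial>M)"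
      unfolding epowr_def by (rule nn_integral_cmult) measurable
    also have "\<dots> \<le> ennreal (e powr al) * 1" using l(3) by (intro mult_left_mono) auto
    finally show ?thesis by simp
  qed
  have "I = 0"
  proof (rule ccontr)
    assume "I \<noteq> 0"
    have "I \<le> 1" using le[of 1] by simp
    then obtain i where i: "I = ennreal i" "0 \<le> i" "i \<le> 1" by (cases I) (auto simp: top_unique)
    with \<open>I \<noteq> 0\<close> have "0 < i" by (simp add: ennreal_eq_0_iff)
    define e where "e = (i / 2) powr (1 / al)"
    have e: "0 < e" "e \<le> 1" "e powr al = i / 2"
      unfolding e_def using \<open>0 < i\<close> i a(2) powr_mono2[of "1 / al" "i / 2" 1] by (auto simp: powr_powr)
    have "ennreal i \<le> ennreal (i / 2)" using le[OF e(1,2)] e(3) i by simp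
    then show False using \<open>0 < i\<close> by (simp add: ennreal_le_iff)
  qed
  then have "AE x in M. ennreal (u x powr a x) * indicator E x = 0"
    unfolding I_def by (subst (asm) nn_integral_0_iff_AE) auto
  then have "AE x in M. x \<notin> E" using u by eventually_elim (auto simp: indicator_def split: if_splits)
  then have "E \<in> null_sets M" by (subst AE_iff_null_sets[OF E])
  then have "emeasure M E = 0" by (rule null_setsD1)
  then show False using pos by simp
qed

section \<open>From the definitions of spaces and exponents to constants and pointwise
  bounds\<close>

lemma homogeneous_type_imp_hom_type:
  assumes "homogeneous_type M d" "x0 \<in> space M"
  shows "\<exists>A Cd. hom_type M d A Cd x0"
proof -
  have qm: "quasi_metric (space M) d" and sM: "sets M = sigma_sets (space M) ({U. qopen (space M) d U} \<union> qballs (space M) d)"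
    using assms(1) by (auto simp: homogeneous_type_def)
  obtain C :: real where C: "\<And>x r. x \<in> space M \<Longrightarrow> 0 < r \<Longrightarrow>
        0 < emeasure M (qball (space M) d x (2 * r)) \<and>
        emeasure M (qball (space M) d x (2 * r)) \<le> ennreal C * emeasure M (qball (space M) d x r) \<and>
        emeasure M (qball (space M) d x r) < \<infinity>"
    using assms(1) unfolding homogeneous_type_def by blast
  obtain A where A: "1 \<le> A" "\<And>x y z. x \<in> space M \<Longrightarrow> y \<in> space M \<Longrightarrow> z \<in> space M \<Longrightarrow> d x y \<le> A * (d x z + d z y)"
    using qm unfolding quasi_metric_def by blast
  have "hom_type M d A (max C 1) x0"
  proof
    fix x and r :: real assume x: "x \<in> space M" and r: "0 < r"
    show "qball (space M) d x r \<in> sets M"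
      unfolding sM using x r by (intro sigma_sets.Basic) (auto simp: qballs_def)
    show "0 < emeasure M (qball (space M) d x r)" using C[OF x, of "r / 2"] r by simp
    show "emeasure M (qball (space M) d x r) < \<infinity>" using C[OF x r] by simp
    let ?a = "emeasure M (qball (space M) d x (2 * r))" and ?b = "emeasure M (qball (space M) d x r)"
    have fin: "?a \<noteq> \<infinity>" "?b \<noteq> \<infinity>" using C[OF x, of "2 * r"] C[OF x r] r by auto
    have "?a \<le> ennreal C * ?b" using C[OF x r] by simp
    also have "\<dots> \<le> ennreal (max C 1) * ?b" by (intro mult_right_mono ennreal_leI) auto
    finally have "enn2real ?a \<le> enn2real (ennreal (max C 1) * ?b)"
      using fin by (intro enn2real_mono) (auto simp: ennreal_mult_less_top less_top)
    then show "measure M (qball (space M) d x (2 * r)) \<le> max C 1 * measure M (qball (space M) d x r)"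
      by (simp add: measure_def enn2real_mult)
  qed (use qm A assms(2) in \<open>auto simp: quasi_metric_def\<close>)
  then show ?thesis by blast
qed

context hom_type
begin

text \<open>Moves the base point: the distances to \<open>o'\<close> and to the given point are
  comparable up to an additive and a multiplicative constant, both of which a logarithm turns into a
  factor.\<close>

lemma LH_of_log_Hoelder:
  assumes "log_Hoelder X d p"
  shows "\<exists>H pinf. LH p H pinf"
proof -
  obtain C pinf x1 where x1: "x1 \<in> X"
    and loc: "\<And>x y. x \<in> X \<Longrightarrow> y \<in> X \<Longrightarrow> d x y < 1 / 2 \<Longrightarrow>
       \<bar>p x - p y\<bar> \<le> (if d x y = 0 then 0 else C / ln (exp 1 + 1 / d x y))"
    and inf: "\<And>x. x \<in> X \<Longrightarrow> \<bar>p x - pinf\<bar> \<le> C / ln (exp 1 + d x x1)"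
    using assms unfolding log_Hoelder_def by blast
  define b where "b = A * (1 + d x1 o')"
  have d0: "0 \<le> d x1 o'" using d_nonneg x1 origin by simp
  have b: "1 \<le> b" unfolding b_def using mult_mono[of 1 A 1 "1 + d x1 o'"] A d0 by simp
  define H where "H = \<bar>C\<bar> * (1 + ln b)"
  have lb: "0 \<le> ln b" using b by simp
  have CH: "\<bar>C\<bar> \<le> H" unfolding H_def using mult_left_mono[of 1 "1 + ln b" "\<bar>C\<bar>"] lb by simp
  have "LH p H pinf" unfolding LH_def
  proof (intro conjI ballI impI)
    show "0 \<le> H" using CH by linarith
    fix x y assume xy: "x \<in> X" "y \<in> X" "d x y < 1 / 2"
    show "\<bar>p x - p y\<bar> \<le> (if d x y = 0 then 0 else H / ln (exp 1 + 1 / d x y))"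
    proof (cases "d x y = 0")
      case True then show ?thesis using loc[OF xy] by simp
    next
      case False
      then have "0 < d x y" using d_nonneg[OF xy(1,2)] by simp
      then have "1 \<le> ln (exp 1 + 1 / d x y)" by (intro one_le_ln_e_add) auto
      then have "C / ln (exp 1 + 1 / d x y) \<le> H / ln (exp 1 + 1 / d x y)"
        using CH by (intro divide_right_mono) auto
      then show ?thesis using loc[OF xy] False by simp
    qed
  next
    fix x assume x: "x \<in> X"
    have dx: "0 \<le> d x x1" using d_nonneg x x1 by simp
    have l1: "1 \<le> ln (exp 1 + d x x1)" by (rule one_le_ln_e_add[OF dx])
    have "L x \<le> (1 + ln b) * ln (exp 1 + d x x1)"
    proof -
      have "nm x \<le> A * (d x x1 + d x1 o')" using d_tri[OF x origin x1] by (simp add: nm_def)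
      also have "\<dots> \<le> b * d x x1 + A * d x1 o'"
      proof -
        have "A * d x x1 \<le> b * d x x1"
          unfolding b_def using A d0 dx by (intro mult_right_mono) (auto simp: algebra_simps)
        then show ?thesis by (simp add: distrib_left)
      qed
      finally have n1: "nm x \<le> b * d x x1 + A * d x1 o'" .
      have e1: "1 \<le> exp (1::real)" by simp
      have "(1 + A * d x1 o') * exp 1 \<le> b * exp 1"
        unfolding b_def using A by (intro mult_right_mono) (auto simp: algebra_simps)
      moreover have "A * d x1 o' * 1 \<le> A * d x1 o' * exp 1" using A d0 e1 by (intro mult_left_mono) auto
      ultimately have "exp 1 + nm x \<le> b * (exp 1 + d x x1)" using n1 by (simp add: algebra_simps)
      then have "L x \<le> ln (b * (exp 1 + d x x1))"
        unfolding L_def using nm_nonneg[OF x] by (subst ln_le_cancel_iff) (auto simp: add_pos_nonneg dx intro!: mult_pos_pos less_le_trans[OF zero_less_one b])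
      also have "\<dots> = ln b + ln (exp 1 + d x x1)"
        using b dx add_pos_nonneg[of "exp 1" "d x x1"] by (subst ln_mult) auto
      also have "\<dots> \<le> ln b * ln (exp 1 + d x x1) + ln (exp 1 + d x x1)"
        using mult_left_mono[OF l1 lb] by simp
      finally show ?thesis by (simp add: algebra_simps)
    qed
    then have "\<bar>C\<bar> * L x \<le> \<bar>C\<bar> * ((1 + ln b) * ln (exp 1 + d x x1))" by (intro mult_left_mono) auto
    then have "\<bar>C\<bar> * L x \<le> H * ln (exp 1 + d x x1)" by (simp add: H_def mult.assoc)
    then have "\<bar>C\<bar> / ln (exp 1 + d x x1) \<le> H / L x"
      using l1 L_ge_1[OF x] by (simp add: frac_le_eq divide_le_eq pos_le_divide_eq mult.commute)
    moreover have "C / ln (exp 1 + d x x1) \<le> \<bar>C\<bar> / ln (exp 1 + d x x1)"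
      using l1 by (intro divide_right_mono) auto
    ultimately show "\<bar>p x - pinf\<bar> \<le> H / L x" using inf[OF x] by linarith
  qed
  then show ?thesis by blast
qed

text \<open>On a bounded space the limit at infinity need not lie in the range of the function.
  Moving it to the nearest point of an interval containing the range does not increase any distance
  to it.\<close>

lemma LH_clamp:
  assumes "LH f H b" "\<And>x. x \<in> X \<Longrightarrow> l \<le> f x \<and> f x \<le> u"
  shows "LH f H (max l (min u b))"
proof -
  have "\<bar>f x - max l (min u b)\<bar> \<le> H / L x" if x: "x \<in> X" for x
  proof -
    have "\<bar>f x - max l (min u b)\<bar> \<le> \<bar>f x - b\<bar>" using assms(2)[OF x] by (auto simp: max_def min_def abs_if)
    also have "\<dots> \<le> H / L x" using assms(1) x by (simp add: LH_def)
    finally show ?thesis .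
  qed
  then show ?thesis using assms(1) by (simp add: LH_def)
qed

lemma LH_lipschitz:
  assumes LH: "LH f H b" and f: "\<And>x. x \<in> X \<Longrightarrow> l \<le> f x \<and> f x \<le> u" and b: "l \<le> b \<and> b \<le> u"
    and k: "0 \<le> k" and lip: "\<And>s t. l \<le> s \<Longrightarrow> s \<le> u \<Longrightarrow> l \<le> t \<Longrightarrow> t \<le> u \<Longrightarrow> \<bar>\<psi> s - \<psi> t\<bar> \<le> k * \<bar>s - t\<bar>"
    and g: "\<And>x. x \<in> X \<Longrightarrow> g x = \<psi> (f x)"
  shows "LH g (k * H) (\<psi> b)"
  unfolding LH_def
proof (intro conjI ballI impI)
  show "0 \<le> k * H" using LH k by (simp add: LH_def)
  fix x y assume xy: "x \<in> X" "y \<in> X" "d x y < 1 / 2"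
  have "\<bar>g x - g y\<bar> \<le> k * \<bar>f x - f y\<bar>" using lip f xy g by simp
  also have "\<dots> \<le> k * (if d x y = 0 then 0 else H / ln (exp 1 + 1 / d x y))"
    using LH xy k by (intro mult_left_mono) (simp_all add: LH_def)
  finally show "\<bar>g x - g y\<bar> \<le> (if d x y = 0 then 0 else k * H / ln (exp 1 + 1 / d x y))"
    by (simp split: if_splits)
next
  fix x assume x: "x \<in> X"
  have "\<bar>g x - \<psi> b\<bar> \<le> k * \<bar>f x - b\<bar>" using lip f x b g by simp
  also have "\<dots> \<le> k * (H / L x)" using LH x k by (intro mult_left_mono) (simp_all add: LH_def)
  finally show "\<bar>g x - \<psi> b\<bar> \<le> k * H / L x" by simp
qed

lemma LH_add:
  assumes "LH f H b" "LH g H' b'"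
  shows "LH (\<lambda>x. f x + g x) (H + H') (b + b')"
  unfolding LH_def
proof (intro conjI ballI impI)
  show "0 \<le> H + H'" using assms by (simp add: LH_def)
  fix x y assume xy: "x \<in> X" "y \<in> X" "d x y < 1 / 2"
  have 1: "\<bar>f x - f y\<bar> \<le> (if d x y = 0 then 0 else H / ln (exp 1 + 1 / d x y))"
    "\<bar>g x - g y\<bar> \<le> (if d x y = 0 then 0 else H' / ln (exp 1 + 1 / d x y))"
    using assms xy unfolding LH_def by blast+
  have "\<bar>(f x + g x) - (f y + g y)\<bar> \<le> \<bar>f x - f y\<bar> + \<bar>g x - g y\<bar>" by linarith
  then show "\<bar>f x + g x - (f y + g y)\<bar> \<le> (if d x y = 0 then 0 else (H + H') / ln (exp 1 + 1 / d x y))"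
    using 1 by (auto simp: add_divide_distrib split: if_splits)
next
  fix x assume x: "x \<in> X"
  have "\<bar>f x - b\<bar> \<le> H / L x" "\<bar>g x - b'\<bar> \<le> H' / L x" using assms x by (auto simp: LH_def)
  then show "\<bar>f x + g x - (b + b')\<bar> \<le> (H + H') / L x" unfolding add_divide_distrib by linarith
qed

lemma LH_const: "LH (\<lambda>x. c) 0 c"
  by (simp add: LH_def)

lemma LH_sum:
  assumes "finite I" "\<And>i. i \<in> I \<Longrightarrow> \<exists>H b. LH (f i) H b"
  shows "\<exists>H b. LH (\<lambda>x. \<Sum>i\<in>I. f i x) H b"
  using assms
proof (induction I)
  case empty
  then show ?case using LH_const[of 0] by auto
next
  case (insert i I)
  obtain H b where 1: "LH (f i) H b" using insert.prems[of i] by auto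
  obtain H' b' where 2: "LH (\<lambda>x. \<Sum>i\<in>I. f i x) H' b'" using insert.IH insert.prems by auto
  from LH_add[OF 1 2] show ?case using insert(1,2) by auto
qed

text \<open>A log-Hoelder function is continuous and all balls have positive measure, so bounds that
  hold almost everywhere hold everywhere.\<close>

lemma LH_AE_ge:
  assumes LH: "LH f H b" and ae: "AE x in M. l \<le> f x" and x: "x \<in> X"
  shows "l \<le> f x"
proof (rule ccontr)
  assume "\<not> ?thesis"
  then have lt: "f x < l" by simp
  define e where "e = l - f x"
  have e: "0 < e" using lt by (simp add: e_def)
  have H: "0 \<le> H" using LH by (simp add: LH_def)
  \<comment> \<open>On the ball of this radius the modulus is below \<open>e\<close>, since the
    logarithm in its denominator is at least \<open>H / e + 1\<close>.\<close>
  define r where "r = min (1 / 4) (exp (- (H / e + 1)))"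
  have r: "0 < r" "r < 1 / 2" by (auto simp: r_def)
  have below: "f y < l" if y: "y \<in> B x r" for y
  proof -
    have yX: "y \<in> X" "d x y < r" using y by auto
    show ?thesis
    proof (cases "d x y = 0")
      case True
      then have "\<bar>f x - f y\<bar> \<le> 0" using LH x yX r unfolding LH_def by force
      then show ?thesis using lt by simp
    next
      case False
      then have dp: "0 < d x y" using d_nonneg[OF x yX(1)] by simp
      have "exp (H / e + 1) \<le> 1 / r"
      proof -
        have "r \<le> exp (- (H / e + 1))" by (simp add: r_def)
        then have "1 / exp (- (H / e + 1)) \<le> 1 / r" using r by (intro divide_left_mono) auto
        moreover have "1 / exp (- v) = exp v" for v :: real by (simp add: exp_minus divide_inverse)
        ultimately show ?thesis by metis
      qed
      also have "1 / r \<le> 1 / d x y" using dp yX by (intro divide_left_mono) auto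
      also have "\<dots> \<le> exp 1 + 1 / d x y" by simp
      finally have "ln (exp (H / e + 1)) \<le> ln (exp 1 + 1 / d x y)"
        by (subst ln_le_cancel_iff) (auto intro: less_le_trans[OF exp_gt_zero])
      then have l: "H / e + 1 \<le> ln (exp 1 + 1 / d x y)" by simp
      have he: "0 \<le> H / e" using H e by simp
      have "\<bar>f x - f y\<bar> \<le> H / ln (exp 1 + 1 / d x y)"
        using LH x yX r False unfolding LH_def by (smt (verit))
      also have "\<dots> \<le> H / (H / e + 1)" using l he H by (intro divide_left_mono) auto
      also have "\<dots> < e"
      proof -
        have "0 < H / e + 1" using he by linarith
        moreover have "e * (H / e + 1) = H + e" using e by (simp add: distrib_left)
        ultimately show ?thesis using e by (simp add: pos_divide_less_eq)
      qed
      finally show ?thesis by (simp add: e_def)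
    qed
  qed
  have "AE y in M. y \<notin> B x r" using ae by eventually_elim (use below in force)
  then have "B x r \<in> null_sets M"
    using ball_sets[OF x r(1)] by (subst AE_iff_null_sets[OF ball_sets[OF x r(1)]])
  then show False using ball_pos[OF x r(1)] by (auto simp: null_sets_def)
qed

lemma LH_AE_le:
  assumes "LH f H b" "AE x in M. f x \<le> u" "x \<in> X"
  shows "f x \<le> u"
proof -
  have "LH (\<lambda>x. - f x) H (- b)"
    using assms(1) by (auto simp: LH_def abs_minus_commute)
  then have "- u \<le> - f x" by (rule LH_AE_ge) (use assms(2,3) in auto)
  then show ?thesis by simp
qed

end

lemma AE_ess_inf_gt:
  assumes "c < ess_inf M p"
  shows "\<exists>s. c < ereal s \<and> (AE x in M. s \<le> p x)"
proof -
  obtain s where s: "c < ereal s" "ereal s < ess_inf M p" using ereal_dense2[OF assms] by auto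
  have "AE x in M. - ereal (p x) \<le> esssup M (\<lambda>x. - ereal (p x))" by (rule esssup_AE)
  then have "AE x in M. s \<le> p x"
  proof eventually_elim
    case (elim x)
    then have "ess_inf M p \<le> ereal (p x)" unfolding ess_inf_def by (metis ereal_minus_le_minus ereal_uminus_uminus)
    then have "ereal s < ereal (p x)" using s(2) by (rule less_le_trans[rotated])
    then show ?case by simp
  qed
  then show ?thesis using s by blast
qed

lemma AE_ess_sup_less:
  assumes "ess_sup M p < \<infinity>"
  shows "\<exists>u. AE x in M. p x \<le> u"
proof -
  obtain u where u: "ess_sup M p < ereal u" using ereal_dense2[OF assms] by auto
  have "AE x in M. ereal (p x) \<le> esssup M (\<lambda>x. ereal (p x))" by (rule esssup_AE)
  then have "AE x in M. p x \<le> u"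
  proof eventually_elim
    case (elim x)
    then have "ereal (p x) < ereal u" using u unfolding ess_sup_def by (rule le_less_trans)
    then show ?case by simp
  qed
  then show ?thesis by blast
qed

section \<open>Norms of dual weights on balls\<close>

text \<open>A weighted inequality between geometric mean and sum: every factor is at most the sum
  raised to its weight, and the weights add up to 1.\<close>

lemma prod_powr_le_sum:
  fixes y \<tau> :: "'i \<Rightarrow> real"
  assumes J: "finite J" and y: "\<And>j. j \<in> J \<Longrightarrow> 0 \<le> y j" and th: "\<And>j. j \<in> J \<Longrightarrow> 0 \<le> \<tau> j"
    and one: "(\<Sum>j\<in>J. \<tau> j) = 1"
  shows "(\<Prod>j\<in>J. y j powr \<tau> j) \<le> (\<Sum>j\<in>J. y j)"
proof -
  define S where "S = (\<Sum>j\<in>J. y j)"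
  have yS: "y j \<le> S" if "j \<in> J" for j unfolding S_def using J y that by (intro member_le_sum) auto
  show ?thesis
  proof (cases "S = 0")
    case True
    have "J \<noteq> {}" using one by auto
    then obtain j where j: "j \<in> J" by blast
    then have "y j = 0" using True y[OF j] yS[OF j] by simp
    then have "(\<Prod>j\<in>J. y j powr \<tau> j) = 0" using J j by (intro prod_zero) auto
    then show ?thesis using True by (simp add: S_def)
  next
    case False
    have "0 \<le> S" unfolding S_def using y by (intro sum_nonneg) auto
    then have S: "0 < S" using False by simp
    have "(\<Prod>j\<in>J. y j powr \<tau> j) \<le> (\<Prod>j\<in>J. S powr \<tau> j)"
      using y th yS by (intro prod_mono conjI powr_mono2) auto
    also have "\<dots> = S powr (\<Sum>j\<in>J. \<tau> j)" using S J by (simp add: powr_sum)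
    also have "\<dots> = S" using S one by simp
    finally show ?thesis by (simp add: S_def)
  qed
qed

text \<open>Here the reciprocal exponents only satisfy an inequality, which reflects
  \<open>\<eta> \<ge> 0\<close>. It points the right way for bases at most 1, so the factors are
  normalised and the sum is truncated at 1.\<close>

lemma prod_powr_le_sum_powr:
  fixes y p :: "'i \<Rightarrow> real"
  assumes J: "finite J" and y: "\<And>j. j \<in> J \<Longrightarrow> 0 \<le> y j \<and> y j \<le> 1" and p: "\<And>j. j \<in> J \<Longrightarrow> 0 < p j"
    and q: "0 < q" "1 / q \<le> (\<Sum>j\<in>J. 1 / p j)"
  shows "(\<Prod>j\<in>J. y j) powr q \<le> (\<Sum>j\<in>J. y j powr p j)"
proof -
  define S where "S = min 1 (\<Sum>j\<in>J. y j powr p j)"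
  have S: "0 \<le> S" "S \<le> 1" unfolding S_def by (auto intro: sum_nonneg)
  have yS: "y j powr p j \<le> S" if j: "j \<in> J" for j
  proof -
    have "y j powr p j \<le> 1 powr p j" using y[OF j] p[OF j] by (intro powr_mono2) auto
    moreover have "y j powr p j \<le> (\<Sum>j\<in>J. y j powr p j)" using J j by (intro member_le_sum) auto
    ultimately show ?thesis by (simp add: S_def)
  qed
  have yS': "y j \<le> S powr (1 / p j)" if j: "j \<in> J" for j
  proof -
    have "(y j powr p j) powr (1 / p j) \<le> S powr (1 / p j)"
      using yS[OF j] p[OF j] by (intro powr_mono2) auto
    then show ?thesis using y[OF j] p[OF j] by (simp add: powr_powr)
  qed
  have J0: "J \<noteq> {}" using q by auto
  have "(\<Prod>j\<in>J. y j) \<le> (\<Prod>j\<in>J. S powr (1 / p j))" using y yS' by (intro prod_mono) auto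
  also have "\<dots> \<le> S powr (1 / q)"
  proof (cases "S = 0")
    case True
    then show ?thesis using J J0 by (simp add: zero_power card_gt_0_iff)
  next
    case False
    then have "(\<Prod>j\<in>J. S powr (1 / p j)) = S powr (\<Sum>j\<in>J. 1 / p j)" using J by (simp add: powr_sum)
    also have "\<dots> \<le> S powr (1 / q)" using S q by (intro powr_mono') auto
    finally show ?thesis .
  qed
  finally have "(\<Prod>j\<in>J. y j) powr q \<le> (S powr (1 / q)) powr q"
    using y q by (intro powr_mono2 prod_nonneg) auto
  also have "\<dots> = S" using S q by (simp add: powr_powr)
  also have "\<dots> \<le> (\<Sum>j\<in>J. y j powr p j)" by (simp add: S_def)
  finally show ?thesis .
qed

text \<open>Monotone convergence along an enumeration of \<open>S\<close>: this is how estimates for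
  finite families of balls reach the countable one.\<close>

lemma nn_integral_countable_SUP_le:
  fixes F :: "'p \<Rightarrow> 'a \<Rightarrow> ennreal"
  assumes S: "countable S" "S \<noteq> {}" and F: "\<And>p. p \<in> S \<Longrightarrow> F p \<in> borel_measurable M"
    and [measurable]: "k \<in> borel_measurable M"
    and le: "\<And>W. finite W \<Longrightarrow> W \<subseteq> S \<Longrightarrow> (\<integral>\<^sup>+x. k x * (SUP p\<in>W. F p x) \<partial>M) \<le> C"
  shows "(\<integral>\<^sup>+x. k x * (SUP p\<in>S. F p x) \<partial>M) \<le> C"
proof -
  define e where "e = from_nat_into S"
  have e: "range e = S" unfolding e_def using S by (intro range_from_nat_into) auto
  have eS: "e i \<in> S" for i using e by auto
  have eq: "(SUP p\<in>S. F p x) = (SUP j. SUP p\<in>e ` {..j}. F p x)" for x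
  proof (intro antisym SUP_least)
    fix p assume "p \<in> S"
    then obtain i where i: "p = e i" using e by auto
    have "F p x \<le> (SUP p\<in>e ` {..i}. F p x)" unfolding i by (intro SUP_upper) auto
    also have "\<dots> \<le> (SUP j. SUP p\<in>e ` {..j}. F p x)" by (intro SUP_upper) auto
    finally show "F p x \<le> (SUP j. SUP p\<in>e ` {..j}. F p x)" .
  next
    fix j p assume "p \<in> e ` {..j}"
    then have "p \<in> S" using eS by auto
    then show "F p x \<le> (SUP p\<in>S. F p x)" by (rule SUP_upper)
  qed
  have meas [measurable]: "(\<lambda>x. SUP p\<in>e ` {..j}. F p x) \<in> borel_measurable M" for j
    using F eS by (intro borel_measurable_SUP countable_finite) auto
  have "(\<integral>\<^sup>+x. k x * (SUP p\<in>S. F p x) \<partial>M) = (\<integral>\<^sup>+x. (SUP j. k x * (SUP p\<in>e ` {..j}. F p x)) \<partial>M)"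
    unfolding eq by (intro nn_integral_cong SUP_mult_left_ennreal)
  also have "\<dots> = (SUP j. \<integral>\<^sup>+x. k x * (SUP p\<in>e ` {..j}. F p x) \<partial>M)"
  proof (rule nn_integral_monotone_convergence_SUP)
    show "incseq (\<lambda>j x. k x * (SUP p\<in>e ` {..j}. F p x))"
      by (intro incseq_SucI le_funI mult_left_mono SUP_subset_mono) auto
  qed measurable
  also have "\<dots> \<le> C" using eS by (intro SUP_least le) auto
  finally show ?thesis .
qed

context hom_type
begin

text \<open>To bound the modular with index \<open>i\<close> from below, Young's inequality is
  applied with the term of \<open>i\<close> divided by a small \<open>t\<close>. Integrated over
  \<open>E\<close>, the sum is then larger than what the other terms, each at most \<open>K\<close>,
  can contribute, so the modular of \<open>i\<close> is at least \<open>t\<close>.\<close>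

lemma density_data_of_norms:
  fixes u a :: "'i \<Rightarrow> 'a \<Rightarrow> real"
  assumes J: "finite J" and i: "i \<in> J"
    and a [measurable]: "\<And>j. j \<in> J \<Longrightarrow> a j \<in> borel_measurable M"
    and al: "\<And>j. j \<in> J \<Longrightarrow> 0 < al j" and ab: "\<And>j x. j \<in> J \<Longrightarrow> x \<in> X \<Longrightarrow> al j \<le> a j x \<and> a j x \<le> au j"
    and ainf: "al i \<le> ainf \<and> ainf \<le> au i" and LH: "LH (a i) H ainf"
    and u [measurable]: "\<And>j. j \<in> J \<Longrightarrow> u j \<in> borel_measurable M" and u0: "\<And>j x. 0 \<le> u j x"
    and u1: "AE x in M. (\<Prod>j\<in>J. u j x) = 1"
    and g: "0 < \<gamma>" "\<And>x. x \<in> X \<Longrightarrow> (\<Sum>j\<in>J. 1 / a j x) = \<gamma>"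
    and n: "\<And>j z r. j \<in> J \<Longrightarrow> z \<in> X \<Longrightarrow> 0 < r \<Longrightarrow> 0 < n j z r" and K: "1 \<le> K"
    and up: "\<And>j z r. j \<in> J \<Longrightarrow> z \<in> X \<Longrightarrow> 0 < r \<Longrightarrow>
       (\<integral>\<^sup>+x\<in>B z r. ennreal (u j x powr a j x * n j z r powr (- a j x)) \<partial>M) \<le> ennreal K"
    and Kp: "0 < Kp" "\<And>z r. z \<in> X \<Longrightarrow> 0 < r \<Longrightarrow> (\<Prod>j\<in>J. n j z r) \<le> Kp * measure M (B z r) powr \<gamma>"
  shows "\<exists>c D. density_data M d A Cd o' (\<lambda>x. u i x powr a i x) (a i) (n i) (al i) (au i) H ainf K c D"
proof -
  have au0: "0 < au i" using ainf al[OF i] by linarith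
  \<comment> \<open>A lower bound for the Young weight of index \<open>i\<close>. Its inverse
    becomes the exponent \<open>D\<close> of the lower modular bound.\<close>
  define \<beta> where "\<beta> = 1 / (au i * \<gamma>)"
  have beta: "0 < \<beta>" unfolding \<beta>_def using au0 g by simp
  define G where "G = real (card J) * K + 1"
  have G: "1 \<le> G" unfolding G_def using K by simp
  \<comment> \<open>Makes the integrated Young bound at least \<open>G\<close>, which exceeds by 1
    the most that the other modulars can add up to.\<close>
  define k where "k = min 1 (Kp powr (- (1 / \<gamma>)) / G)"
  have k: "0 < k" "k \<le> 1" "k * G \<le> Kp powr (- (1 / \<gamma>))"
  proof -
    show "0 < k" "k \<le> 1" unfolding k_def using Kp G by auto
    have "k \<le> Kp powr (- (1 / \<gamma>)) / G" by (simp add: k_def)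
    then show "k * G \<le> Kp powr (- (1 / \<gamma>))" using G by (simp add: pos_le_divide_eq)
  qed
  have low: "ennreal (k powr (1 / \<beta>) * (measure M E / measure M (B z r)) powr (1 / \<beta>)) \<le>
      (\<integral>\<^sup>+x\<in>E. ennreal (u i x powr a i x * n i z r powr (- a i x)) \<partial>M)"
    if z: "z \<in> X" and r: "0 < r" and E [measurable]: "E \<in> sets M" and EB: "E \<subseteq> B z r" for z r E
  proof (cases "measure M E = 0")
    case True
    then show ?thesis by simp
  next
    case False
    define \<delta> where "\<delta> = measure M E / measure M (B z r)"
    have mB: "0 < measure M (B z r)" by (rule mB_pos[OF z r])
    have mE: "0 < measure M E" using False by (simp add: zero_less_measure_iff)
    have dl: "0 < \<delta>" "\<delta> \<le> 1"
      unfolding \<delta>_def using mE mB measure_sub_B[OF z r E EB] by (auto simp: divide_le_eq)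
    \<comment> \<open>Dividing the term of \<open>i\<close> by \<open>t\<close> enlarges the Young
      bound by at least \<open>t powr (- \<beta>) = 1 / (k * \<delta>)\<close>, which compensates
      the small relative measure of \<open>E\<close>.\<close>
    define t where "t = (k * \<delta>) powr (1 / \<beta>)"
    have kd: "0 < k * \<delta>" "k * \<delta> \<le> 1" using k dl by (auto intro: mult_le_one)
    have t: "0 < t" "t \<le> 1"
    proof -
      show "0 < t" unfolding t_def using k(1) dl(1) by simp
      have "t \<le> 1 powr (1 / \<beta>)" unfolding t_def using kd beta by (intro powr_mono2) auto
      then show "t \<le> 1" by simp
    qed
    have tb: "t powr (- \<beta>) = 1 / (k * \<delta>)"
      unfolding t_def powr_powr using beta kd by (simp add: powr_minus_divide)
    define y where "y j x = u j x powr a j x * n j z r powr (- a j x)" for j x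
    define w where "w j = (if j = i then t else 1)" for j
    have w: "0 < w j" for j using t by (simp add: w_def)
    define Q where "Q = Kp powr (- (1 / \<gamma>)) / measure M (B z r) * (1 / (k * \<delta>))"
    have Q0: "0 \<le> Q" unfolding Q_def using kd mB by simp
    have pw: "Q \<le> (\<Sum>j\<in>J. y j x / w j)" if x: "x \<in> E" and ux: "(\<Prod>j\<in>J. u j x) = 1" for x
    proof -
      have xX: "x \<in> X" using x EB by auto
      \<comment> \<open>The weights depend on the point, but their sum is 1 everywhere because the
        reciprocal exponents have the constant sum \<open>\<gamma>\<close>. Each
        \<open>u j x\<close> then enters with the same power \<open>1 / \<gamma>\<close>, so the
        product condition applies.\<close>
      define \<tau> where "\<tau> j = 1 / (\<gamma> * a j x)" for j
      have aj: "0 < a j x" if "j \<in> J" for j using al[OF that] ab[OF that xX] by linarith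
      have th: "0 \<le> \<tau> j" if "j \<in> J" for j using aj[OF that] g by (simp add: \<tau>_def)
      have "(\<Sum>j\<in>J. \<tau> j) = (\<Sum>j\<in>J. 1 / a j x) / \<gamma>" by (simp add: \<tau>_def sum_divide_distrib mult.commute)
      then have one: "(\<Sum>j\<in>J. \<tau> j) = 1" using g xX by simp
      have each: "(y j x / w j) powr \<tau> j = (u j x / n j z r) powr (1 / \<gamma>) * w j powr (- \<tau> j)" if j: "j \<in> J" for j
      proof -
        have nj: "0 < n j z r" using n j z r by simp
        define b where "b = (u j x / n j z r) powr a j x"
        have "y j x = b"
          unfolding y_def b_def using u0[of j x] nj by (simp add: powr_divide powr_minus_divide)
        moreover have "0 \<le> b" by (simp add: b_def)
        ultimately have "(y j x / w j) powr \<tau> j = b powr \<tau> j * w j powr (- \<tau> j)"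
          using w[of j] by (simp add: powr_divide powr_minus_divide)
        also have "b powr \<tau> j = ((u j x / n j z r) powr a j x) powr \<tau> j" by (simp add: b_def)
        also have "((u j x / n j z r) powr a j x) powr \<tau> j = (u j x / n j z r) powr (1 / \<gamma>)"
          unfolding powr_powr \<tau>_def using aj[OF j] by simp
        finally show ?thesis .
      qed
      have "(\<Prod>j\<in>J. u j x / n j z r) = 1 / (\<Prod>j\<in>J. n j z r)" using ux by (simp add: prod_dividef)
      moreover have np: "0 < (\<Prod>j\<in>J. n j z r)" using n z r by (intro prod_pos) auto
      ultimately have e1: "(\<Prod>j\<in>J. u j x / n j z r) powr (1 / \<gamma>) \<ge> (1 / (Kp * measure M (B z r) powr \<gamma>)) powr (1 / \<gamma>)"
        using Kp(2)[OF z r] g by (intro powr_mono2) (auto simp: frac_le Kp(1) less_imp_le)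
      have e2: "(1 / (Kp * measure M (B z r) powr \<gamma>)) powr (1 / \<gamma>) = Kp powr (- (1 / \<gamma>)) / measure M (B z r)"
        using Kp(1) mB g by (simp add: powr_divide powr_mult powr_powr powr_minus_divide)
      have e3: "(\<Prod>j\<in>J. w j powr (- \<tau> j)) = t powr (- \<tau> i)"
      proof -
        have "(\<Prod>j\<in>J. w j powr (- \<tau> j)) = (\<Prod>j\<in>J. if j = i then t powr (- \<tau> i) else 1)"
          by (intro prod.cong) (auto simp: w_def)
        then show ?thesis using J i by (simp add: prod.delta)
      qed
      have "\<beta> \<le> \<tau> i"
        unfolding \<beta>_def \<tau>_def using ab[OF i xX] aj[OF i] g by (intro divide_left_mono) (auto simp: mult.commute)
      then have "t powr (- \<beta>) \<le> t powr (- \<tau> i)" using t by (intro powr_mono') auto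
      then have e4: "1 / (k * \<delta>) \<le> t powr (- \<tau> i)" using tb by simp
      have "Q \<le> (\<Prod>j\<in>J. u j x / n j z r) powr (1 / \<gamma>) * t powr (- \<tau> i)"
        unfolding Q_def using e1 e2 e4 kd mB by (intro mult_mono) auto
      also have "\<dots> = (\<Prod>j\<in>J. (u j x / n j z r) powr (1 / \<gamma>)) * (\<Prod>j\<in>J. w j powr (- \<tau> j))"
      proof -
        have "0 \<le> u j x / n j z r" if "j \<in> J" for j using u0[of j x] n[OF that z r] by simp
        then show ?thesis unfolding e3 by (subst prod_powr_distrib) auto
      qed
      also have "\<dots> = (\<Prod>j\<in>J. (y j x / w j) powr \<tau> j)"
        unfolding prod.distrib[symmetric] using each by (intro prod.cong) auto
      also have "\<dots> \<le> (\<Sum>j\<in>J. y j x / w j)"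
        using w by (intro prod_powr_le_sum[OF J _ th one]) (auto simp: y_def less_imp_le)
      finally show ?thesis .
    qed
    define I where "I j = (\<integral>\<^sup>+x\<in>E. ennreal (y j x) \<partial>M)" for j
    have IK: "I j \<le> ennreal K" if j: "j \<in> J" for j
    proof -
      have "I j \<le> (\<integral>\<^sup>+x\<in>B z r. ennreal (y j x) \<partial>M)"
        unfolding I_def using EB by (intro nn_integral_mono mult_left_mono) (auto simp: indicator_def)
      then show ?thesis using up[OF j z r] unfolding y_def by (rule order_trans)
    qed
    define \<iota> where "\<iota> j = enn2real (I j)" for j
    have iota: "I j = ennreal (\<iota> j)" "0 \<le> \<iota> j" "\<iota> j \<le> K" if j: "j \<in> J" for j
    proof -
      show e: "I j = ennreal (\<iota> j)" using order_le_less_trans[OF IK[OF j], of \<infinity>] by (simp add: \<iota>_def)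
      show "0 \<le> \<iota> j" by (simp add: \<iota>_def)
      show "\<iota> j \<le> K" using IK[OF j] K unfolding e by (subst (asm) ennreal_le_iff) auto
    qed
    have ym [measurable]: "y j \<in> borel_measurable M" if "j \<in> J" for j
    proof -
      note a[OF that, measurable] u[OF that, measurable]
      show ?thesis unfolding y_def[abs_def] by measurable
    qed
    have "ennreal (Q * measure M E) = (\<integral>\<^sup>+x. ennreal Q * indicator E x \<partial>M)"
      using Q0 emeasure_sub_B[OF z r E EB] by (simp add: nn_integral_cmult_indicator ennreal_mult)
    also have "\<dots> \<le> (\<integral>\<^sup>+x. (\<Sum>j\<in>J. ennreal (1 / w j) * (ennreal (y j x) * indicator E x)) \<partial>M)"
    proof (rule nn_integral_mono_AE, use u1 in eventually_elim)
      case (elim x)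
      show ?case
      proof (cases "x \<in> E")
        case True
        have "ennreal Q \<le> ennreal (\<Sum>j\<in>J. y j x / w j)" using pw[OF True elim] by (rule ennreal_leI)
        also have "\<dots> = (\<Sum>j\<in>J. ennreal (y j x / w j))"
          using w by (intro sum_ennreal[symmetric]) (auto simp: y_def less_imp_le)
        also have "\<dots> = (\<Sum>j\<in>J. ennreal (1 / w j) * ennreal (y j x))"
          using w by (intro sum.cong) (auto simp: ennreal_mult[symmetric] y_def less_imp_le)
        finally show ?thesis using True by simp
      qed simp
    qed
    also have "\<dots> = (\<Sum>j\<in>J. ennreal (1 / w j) * I j)"
    proof -
      have "(\<integral>\<^sup>+x. (\<Sum>j\<in>J. ennreal (1 / w j) * (ennreal (y j x) * indicator E x)) \<partial>M)
         = (\<Sum>j\<in>J. \<integral>\<^sup>+x. ennreal (1 / w j) * (ennreal (y j x) * indicator E x) \<partial>M)"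
      proof (rule nn_integral_sum)
        fix j assume "j \<in> J"
        note ym[OF this, measurable]
        show "(\<lambda>x. ennreal (1 / w j) * (ennreal (y j x) * indicator E x)) \<in> borel_measurable M" by measurable
      qed
      also have "\<dots> = (\<Sum>j\<in>J. ennreal (1 / w j) * I j)"
      proof (rule sum.cong[OF refl])
        fix j assume "j \<in> J"
        note ym[OF this, measurable]
        show "(\<integral>\<^sup>+x. ennreal (1 / w j) * (ennreal (y j x) * indicator E x) \<partial>M) = ennreal (1 / w j) * I j"
          unfolding I_def by (rule nn_integral_cmult) measurable
      qed
      finally show ?thesis .
    qed
    also have "\<dots> = (\<Sum>j\<in>J. ennreal (\<iota> j / w j))"
      using w iota by (intro sum.cong) (auto simp: ennreal_mult[symmetric] less_imp_le)
    also have "\<dots> = ennreal (\<Sum>j\<in>J. \<iota> j / w j)"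
      using w iota by (intro sum_ennreal) (auto simp: less_imp_le)
    finally have "Q * measure M E \<le> (\<Sum>j\<in>J. \<iota> j / w j)"
      using w iota by (subst (asm) ennreal_le_iff) (auto intro!: sum_nonneg simp: less_imp_le)
    also have "\<dots> = \<iota> i / t + (\<Sum>j\<in>J - {i}. \<iota> j)"
      using J i by (simp add: sum.remove w_def)
    also have "(\<Sum>j\<in>J - {i}. \<iota> j) \<le> (\<Sum>j\<in>J - {i}. K)" using iota by (intro sum_mono) auto
    also have "\<dots> \<le> real (card J) * K"
    proof -
      have "real (card (J - {i})) \<le> real (card J)" using J by (simp add: card_Diff1_le)
      then show ?thesis using K by (simp add: mult_right_mono)
    qed
    finally have QE: "Q * measure M E \<le> \<iota> i / t + real (card J) * K" by simp
    have "Q * measure M E = Kp powr (- (1 / \<gamma>)) / k"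
      unfolding Q_def \<delta>_def using mE mB k by (simp add: field_simps)
    moreover have "G \<le> Kp powr (- (1 / \<gamma>)) / k" using k by (simp add: pos_le_divide_eq mult.commute)
    ultimately have "1 \<le> \<iota> i / t" using QE by (simp add: G_def)
    then have "t \<le> \<iota> i" using t by (simp add: pos_le_divide_eq)
    then have "ennreal t \<le> I i" using iota[OF i] by (simp add: ennreal_leI)
    moreover have "t = k powr (1 / \<beta>) * (measure M E / measure M (B z r)) powr (1 / \<beta>)"
      unfolding t_def \<delta>_def[symmetric] using k dl by (simp add: powr_mult)
    ultimately show ?thesis unfolding I_def y_def by simp
  qed
  have "k powr (1 / \<beta>) \<le> 1 powr (1 / \<beta>)" using k beta by (intro powr_mono2) auto
  then have kk: "0 < k powr (1 / \<beta>)" "k powr (1 / \<beta>) \<le> 1" using k by auto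
  note a[OF i, measurable] u[OF i, measurable]
  have "density_data M d A Cd o' (\<lambda>x. u i x powr a i x) (a i) (n i) (al i) (au i) H ainf K (k powr (1 / \<beta>)) (1 / \<beta>)"
  proof (unfold_locales)
    show "(\<lambda>x. u i x powr a i x) \<in> borel_measurable M" by measurable
    show "a i \<in> borel_measurable M" by measurable
  qed (use al[OF i] ab[OF i] ainf LH n[OF i] K kk beta up[OF i] low in auto)
  then show ?thesis by blast
qed

end

section \<open>The fractional maximal operator\<close>

context conj_data
begin

text \<open>Unfolded so that the bounds for several densities can be used side by side, without one
  interpretation for each function.\<close>

lemmas ratio_maximal_integrable' = ratio_maximal_integrable[unfolded ratio_def N_def]

lemmas ball_integral_le' = ball_integral_le[unfolded N_def]

end

context hom_type
begin

lemma frac_maximal_ball: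
  assumes z: "z \<in> X" "0 < r"
  shows "ennreal (measure M (B z r) powr \<eta>) * (\<Prod>i<m. (\<integral>\<^sup>+y\<in>B z r. ennreal \<bar>f i y\<bar> \<partial>M) / emeasure M (B z r))
    = ennreal (measure M (B z r) powr (\<eta> - real m)) * (\<Prod>i<m. \<integral>\<^sup>+y\<in>B z r. ennreal \<bar>f i y\<bar> \<partial>M)"
proof -
  define v where "v = measure M (B z r)"
  have v: "0 < v" unfolding v_def using mB_pos[OF z] .
  have "(\<Prod>i<m. (\<integral>\<^sup>+y\<in>B z r. ennreal \<bar>f i y\<bar> \<partial>M) / emeasure M (B z r)) =
    (\<Prod>i<m. ennreal (1 / v)) * (\<Prod>i<m. \<integral>\<^sup>+y\<in>B z r. ennreal \<bar>f i y\<bar> \<partial>M)"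
    unfolding emB[OF z] v_def[symmetric] ennreal_divide_real[OF v] prod.distrib ..
  also have "(\<Prod>i<m. ennreal (1 / v)) = ennreal (v powr (- real m))"
    using v by (simp add: ennreal_power powr_minus_divide powr_realpow power_one_over)
  finally have "ennreal (v powr \<eta>) * (\<Prod>i<m. (\<integral>\<^sup>+y\<in>B z r. ennreal \<bar>f i y\<bar> \<partial>M) / emeasure M (B z r)) =
    ennreal (v powr \<eta>) * ennreal (v powr (- real m)) * (\<Prod>i<m. \<integral>\<^sup>+y\<in>B z r. ennreal \<bar>f i y\<bar> \<partial>M)"
    by (simp add: mult.assoc)
  also have "ennreal (v powr \<eta>) * ennreal (v powr (- real m)) = ennreal (v powr (\<eta> - real m))"
    by (simp add: ennreal_mult[symmetric] powr_add[symmetric])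
  finally show ?thesis unfolding v_def .
qed

text \<open>The majorant \<open>G\<close> is built from countable suprema and hence measurable, so
  that constants can be moved out of its integral afterwards; the operator itself is a supremum over
  all balls.\<close>

lemma frac_maximal_modular:
  fixes \<rho> a p :: "nat \<Rightarrow> 'a \<Rightarrow> real" and n :: "nat \<Rightarrow> 'a \<Rightarrow> real \<Rightarrow> real" and \<eta> :: real
  assumes CD: "\<And>i. i < m \<Longrightarrow> conj_data M d A Cd o' (\<rho> i) (a i) (n i) (al i) (au i) (H i) (ainf i) K (c i) (D i)
      (p i) (s i) (pp i) (Hp i) (pinf i)"
    and WD: "density_data M d A Cd o' \<rho>w q nw ql qu Hq qinf Kw cw Dw"
    and ex: "\<And>x. x \<in> X \<Longrightarrow> 1 / q x \<le> (\<Sum>i<m. 1 / p i x)"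
    and pr: "\<And>z r. z \<in> X \<Longrightarrow> 0 < r \<Longrightarrow> (\<Prod>i<m. n i z r) * nw z r \<le> Kp * measure M (B z r) powr (real m - \<eta>)"
    and Kp: "0 < Kp" and eta: "\<eta> < real m" and K: "1 \<le> K"
    and pos: "\<And>i. i < m \<Longrightarrow> AE x in M. 0 < \<rho> i x"
  shows "\<exists>C\<ge>1. \<forall>f. (\<forall>i<m. f i \<in> borel_measurable M \<and>
      (\<integral>\<^sup>+x. ennreal (\<rho> i x * (\<bar>f i x\<bar> / \<rho> i x) powr p i x) \<partial>M) \<le> 1) \<longrightarrow>
    (\<exists>G\<in>borel_measurable M. (\<forall>x\<in>X. epowr (frac_maximal M d m \<eta> f x) (q x) \<le> G x) \<and>
      (\<integral>\<^sup>+x. ennreal (\<rho>w x) * G x \<partial>M) \<le> ennreal C)"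
proof -
  interpret Wt: density_data M d A Cd o' \<rho>w q nw ql qu Hq qinf Kw cw Dw by (rule WD)
  have DD: "density_data M d A Cd o' (\<rho> i) (a i) (n i) (al i) (au i) (H i) (ainf i) K (c i) (D i)" if "i < m" for i
    by (rule conj_data.axioms(1)[OF CD[OF that]])
  have rho0: "0 \<le> \<rho> i x" and rhom: "\<rho> i \<in> borel_measurable M"
    and npos: "z \<in> X \<Longrightarrow> 0 < r \<Longrightarrow> 0 < n i z r" if "i < m" for i x z r
    using density_data.rho_nonneg[OF DD[OF that]] density_data.rho_meas[OF DD[OF that]]
      density_data.n_pos[OF DD[OF that]] by auto
  define R where "R i g z r = enn2real (\<integral>\<^sup>+x\<in>B z r. ennreal (g x) \<partial>density M (\<lambda>x. ennreal (\<rho> i x))) / n i z r"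
    for i g z r
  define Q where "Q i C \<longleftrightarrow> (0::real) \<le> C \<and> (\<forall>g W. g \<in> borel_measurable M \<longrightarrow> (\<forall>x. 0 \<le> g x) \<longrightarrow>
    (\<integral>\<^sup>+x. ennreal (\<rho> i x * g x powr p i x) \<partial>M) \<le> 1 \<longrightarrow> finite W \<longrightarrow> (\<forall>(z, r)\<in>W. good \<kappa>0 z r) \<longrightarrow>
    (\<integral>\<^sup>+x. ennreal (\<rho>w x) * (SUP (z, r)\<in>W. ennreal (R i g z r powr p i x * nw z r powr (- q x)) * indicator (B z r) x) \<partial>M)
      \<le> ennreal C)" for i C
  have "\<exists>C. Q i C" if "i < m" for i
    unfolding Q_def R_def by (rule conj_data.ratio_maximal_integrable'[OF CD[OF that] WD])
  then have "\<forall>i. \<exists>C. i < m \<longrightarrow> Q i C" by blast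
  from choice[OF this] obtain Ci where "\<forall>i. i < m \<longrightarrow> Q i (Ci i)" ..
  then have QC: "Q i (Ci i)" if "i < m" for i using that by simp
  have Ci: "0 \<le> Ci i" if "i < m" for i using QC[OF that] unfolding Q_def by (rule conjunct1)
  have int: "(\<integral>\<^sup>+x. ennreal (\<rho>w x) * (SUP (z, r)\<in>W. ennreal (R i g z r powr p i x * nw z r powr (- q x)) * indicator (B z r) x) \<partial>M)
      \<le> ennreal (Ci i)"
    if "i < m" "g \<in> borel_measurable M" "\<forall>x. 0 \<le> g x" "(\<integral>\<^sup>+x. ennreal (\<rho> i x * g x powr p i x) \<partial>M) \<le> 1"
      "finite W" "\<forall>(z, r)\<in>W. good \<kappa>0 z r" for i g W
    using conjunct2[OF QC[OF that(1), unfolded Q_def], rule_format, OF that(2) _ that(4,5)] that(3,6) by simp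
  from countable_good_family[OF \<kappa>0_pos] obtain S C0 where
    "countable S \<and> (\<forall>(z, r)\<in>S. good \<kappa>0 z r) \<and> 1 \<le> C0 \<and>
     (\<forall>z\<in>X. \<forall>r>0. \<exists>(x, s)\<in>S. B z r \<subseteq> B x s \<and> measure M (B x s) \<le> C0 * measure M (B z r))"
    by (elim exE)
  then have S: "countable S" "\<forall>(z, r)\<in>S. good \<kappa>0 z r" and C0: "1 \<le> C0"
    and cov: "\<And>z r. z \<in> X \<Longrightarrow> 0 < r \<Longrightarrow>
       \<exists>(x, s)\<in>S. B z r \<subseteq> B x s \<and> measure M (B x s) \<le> C0 * measure M (B z r)"
    by simp_all
  have Sne: "S \<noteq> {}" using cov[OF origin zero_less_one] by auto
  \<comment> \<open>The cost of passing to the larger ball of the countable family, whose measure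
    enters with the negative exponent \<open>\<eta> - real m\<close>.\<close>
  define c0 where "c0 = C0 powr (real m - \<eta>)"
  have c0: "0 < c0" unfolding c0_def using C0 by simp
  define R0 where "R0 = 1 + K"
  have R0: "1 \<le> R0" unfolding R0_def using K by simp
  \<comment> \<open>\<open>R0 ^ m\<close> pays for scaling the ratios to at most 1; the lower bound
    1 lets the exponent \<open>q x\<close> be raised to \<open>qu\<close>.\<close>
  define b where "b = max 1 (c0 * Kp * R0 ^ m)"
  define C3 where "C3 = b powr qu"
  have C3: "0 \<le> C3" by (simp add: C3_def)
  define CC where "CC = 1 + C3 * (\<Sum>i<m. Ci i)"
  have Cs: "0 \<le> (\<Sum>i<m. Ci i)" using Ci by (intro sum_nonneg) auto
  have CC: "1 \<le> CC" unfolding CC_def using C3 Cs by simp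
  have "\<exists>G\<in>borel_measurable M. (\<forall>x\<in>X. epowr (frac_maximal M d m \<eta> f x) (q x) \<le> G x) \<and>
      (\<integral>\<^sup>+x. ennreal (\<rho>w x) * G x \<partial>M) \<le> ennreal CC"
    if f: "\<forall>i<m. f i \<in> borel_measurable M \<and> (\<integral>\<^sup>+x. ennreal (\<rho> i x * (\<bar>f i x\<bar> / \<rho> i x) powr p i x) \<partial>M) \<le> 1" for f
  proof -
    define g where "g i x = \<bar>f i x\<bar> / \<rho> i x" for i x
    have gm [measurable]: "g i \<in> borel_measurable M" and g0: "0 \<le> g i x"
      and g1: "(\<integral>\<^sup>+x. ennreal (\<rho> i x * g i x powr p i x) \<partial>M) \<le> 1" if i: "i < m" for i x
    proof -
      have [measurable]: "f i \<in> borel_measurable M" "\<rho> i \<in> borel_measurable M" using f i rhom by auto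
      show "g i \<in> borel_measurable M" unfolding g_def[abs_def] by measurable
      show "0 \<le> g i x" using rho0[OF i] by (simp add: g_def)
      show "(\<integral>\<^sup>+x. ennreal (\<rho> i x * g i x powr p i x) \<partial>M) \<le> 1" using f i by (simp add: g_def)
    qed
    have fg: "(\<integral>\<^sup>+y\<in>B z r. ennreal \<bar>f i y\<bar> \<partial>M) = (\<integral>\<^sup>+x\<in>B z r. ennreal (g i x) \<partial>density M (\<lambda>x. ennreal (\<rho> i x)))"
      if i: "i < m" and zr: "z \<in> X" "0 < r" for i z r
    proof -
      have [measurable]: "g i \<in> borel_measurable M" "\<rho> i \<in> borel_measurable M" "B z r \<in> sets M"
        using gm[OF i] rhom[OF i] ball_sets[OF zr] by auto
      have "(\<integral>\<^sup>+x\<in>B z r. ennreal (g i x) \<partial>density M (\<lambda>x. ennreal (\<rho> i x))) =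
         (\<integral>\<^sup>+x. ennreal (\<rho> i x) * (ennreal (g i x) * indicator (B z r) x) \<partial>M)"
        by (rule nn_integral_density) measurable
      also have "\<dots> = (\<integral>\<^sup>+y\<in>B z r. ennreal \<bar>f i y\<bar> \<partial>M)"
      proof (rule nn_integral_cong_AE, use pos[OF i] in eventually_elim)
        case (elim x)
        then have "ennreal (\<rho> i x) * ennreal (g i x) = ennreal \<bar>f i x\<bar>"
          by (simp add: g_def ennreal_mult[symmetric])
        then show ?case by (simp add: mult.assoc[symmetric])
      qed
      finally show ?thesis ..
    qed
    have Rb: "(\<integral>\<^sup>+y\<in>B z r. ennreal \<bar>f i y\<bar> \<partial>M) = ennreal (R i (g i) z r * n i z r)"
      "0 \<le> R i (g i) z r" "R i (g i) z r \<le> R0" if i: "i < m" and zr: "z \<in> X" "0 < r" for i z r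
    proof -
      have np: "0 < n i z r" using npos[OF i zr] .
      have le: "(\<integral>\<^sup>+x\<in>B z r. ennreal (g i x) \<partial>density M (\<lambda>x. ennreal (\<rho> i x))) \<le> ennreal ((1 + K) * n i z r)"
        by (rule conj_data.ball_integral_le'[OF CD[OF i] gm[OF i] g0[OF i] g1[OF i] zr])
      then have fin: "(\<integral>\<^sup>+x\<in>B z r. ennreal (g i x) \<partial>density M (\<lambda>x. ennreal (\<rho> i x))) < \<infinity>"
        by (rule order_le_less_trans) simp
      then show "(\<integral>\<^sup>+y\<in>B z r. ennreal \<bar>f i y\<bar> \<partial>M) = ennreal (R i (g i) z r * n i z r)"
        unfolding fg[OF i zr] R_def using np by simp
      show "0 \<le> R i (g i) z r" unfolding R_def using np by simp
      have "enn2real (\<integral>\<^sup>+x\<in>B z r. ennreal (g i x) \<partial>density M (\<lambda>x. ennreal (\<rho> i x))) \<le> (1 + K) * n i z r"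
        using le np K by (intro enn2real_leI) auto
      then show "R i (g i) z r \<le> R0" unfolding R_def R0_def using np by (simp add: divide_le_eq)
    qed
    define T where "T i x = (SUP (z, r)\<in>S. ennreal (R i (g i) z r powr p i x * nw z r powr (- q x)) * indicator (B z r) x)" for i x
    have pw: "epowr (frac_maximal M d m \<eta> f x) (q x) \<le> ennreal C3 * (\<Sum>i<m. T i x)" if x: "x \<in> X" for x
      unfolding frac_maximal_def
    proof (rule epowr_SUP_le)
      have qb: "ql \<le> q x" "q x \<le> qu" "0 < ql" using Wt.a_bounds[OF x] Wt.al by auto
      then show qx: "0 < q x" by linarith
      fix E assume "E \<in> qballs X d"
      then obtain z r where zr: "z \<in> X" "0 < r" and E: "E = B z r" by (auto simp: qballs_def)
      show "epowr (ennreal (measure M E powr \<eta>) * (\<Prod>i<m. (\<integral>\<^sup>+y\<in>E. ennreal \<bar>f i y\<bar> \<partial>M) / emeasure M E) * indicator E x) (q x)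
         \<le> ennreal C3 * (\<Sum>i<m. T i x)"
      proof (cases "x \<in> E")
        case False
        then show ?thesis by (simp add: epowr_def)
      next
        case True
        from cov[OF zr] obtain z' r' where S': "(z', r') \<in> S" and sub: "B z r \<subseteq> B z' r'"
          and mle: "measure M (B z' r') \<le> C0 * measure M (B z r)" by blast
        have zr': "z' \<in> X" "0 < r'" using S(2) S' goodD by blast+
        have xB: "x \<in> B z' r'" using True E sub by blast
        define v where "v = measure M (B z r)"
        define v' where "v' = measure M (B z' r')"
        have v: "0 < v" "0 < v'" unfolding v_def v'_def using mB_pos zr zr' by auto
        have nwp: "0 < nw z' r'" using Wt.n_pos zr' by simp
        define \<tau> where "\<tau> i = R i (g i) z' r'" for i
        have tau: "0 \<le> \<tau> i" "\<tau> i \<le> R0" if "i < m" for i unfolding \<tau>_def using Rb(2,3)[OF that zr'] by auto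
        have vv: "v powr (\<eta> - real m) \<le> c0 * v' powr (\<eta> - real m)"
        proof -
          have "v' / C0 \<le> v" using mle C0 unfolding v_def v'_def by (simp add: divide_le_eq mult.commute)
          then have "v powr (\<eta> - real m) \<le> (v' / C0) powr (\<eta> - real m)"
            using v C0 eta by (intro powr_mono2') auto
          also have "\<dots> = c0 * v' powr (\<eta> - real m)"
          proof -
            have "(v' / C0) powr (\<eta> - real m) = v' powr (\<eta> - real m) / C0 powr (\<eta> - real m)"
              using v C0 by (simp add: powr_divide)
            moreover have "c0 = 1 / C0 powr (\<eta> - real m)"
              unfolding c0_def using C0 powr_minus_divide[of C0 "\<eta> - real m"] by simp
            ultimately show ?thesis by simp
          qed
          finally show ?thesis .
        qed
        have "ennreal (measure M E powr \<eta>) * (\<Prod>i<m. (\<integral>\<^sup>+y\<in>E. ennreal \<bar>f i y\<bar> \<partial>M) / emeasure M E) * indicator E x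
           = ennreal (v powr (\<eta> - real m)) * (\<Prod>i<m. \<integral>\<^sup>+y\<in>B z r. ennreal \<bar>f i y\<bar> \<partial>M)"
          using True unfolding E frac_maximal_ball[OF zr] v_def by simp
        also have "\<dots> \<le> ennreal (c0 * v' powr (\<eta> - real m)) * (\<Prod>i<m. \<integral>\<^sup>+y\<in>B z' r'. ennreal \<bar>f i y\<bar> \<partial>M)"
        proof (intro mult_mono ennreal_leI vv prod_mono_ennreal)
          show "(\<integral>\<^sup>+y\<in>B z r. ennreal \<bar>f i y\<bar> \<partial>M) \<le> (\<integral>\<^sup>+y\<in>B z' r'. ennreal \<bar>f i y\<bar> \<partial>M)" for i
            using sub by (intro nn_integral_mono mult_left_mono) (auto simp: indicator_def simp del: in_B)
        qed auto
        also have "(\<Prod>i<m. \<integral>\<^sup>+y\<in>B z' r'. ennreal \<bar>f i y\<bar> \<partial>M) = ennreal (\<Prod>i<m. \<tau> i * n i z' r')"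
        proof -
          have "(\<Prod>i<m. \<integral>\<^sup>+y\<in>B z' r'. ennreal \<bar>f i y\<bar> \<partial>M) = (\<Prod>i<m. ennreal (\<tau> i * n i z' r'))"
            unfolding \<tau>_def using Rb(1)[OF _ zr'] by (intro prod.cong) auto
          also have "\<dots> = ennreal (\<Prod>i<m. \<tau> i * n i z' r')"
            using tau npos[OF _ zr'] by (intro prod_ennreal) (auto simp: less_imp_le)
          finally show ?thesis .
        qed
        also have "ennreal (c0 * v' powr (\<eta> - real m)) * ennreal (\<Prod>i<m. \<tau> i * n i z' r')
           = ennreal (c0 * v' powr (\<eta> - real m) * (\<Prod>i<m. \<tau> i * n i z' r'))"
          using c0 by (subst ennreal_mult') auto
        also have "\<dots> \<le> ennreal (b * (\<Prod>i<m. \<tau> i / R0) / nw z' r')"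
        proof (rule ennreal_leI)
          have "(\<Prod>i<m. n i z' r') \<le> Kp * v' powr (real m - \<eta>) / nw z' r'"
            using pr[OF zr'] nwp unfolding v'_def by (simp add: pos_le_divide_eq)
          then have "c0 * v' powr (\<eta> - real m) * ((\<Prod>i<m. \<tau> i) * (\<Prod>i<m. n i z' r')) \<le>
             c0 * v' powr (\<eta> - real m) * ((\<Prod>i<m. \<tau> i) * (Kp * v' powr (real m - \<eta>) / nw z' r'))"
            using c0 tau by (intro mult_left_mono prod_nonneg) auto
          also have "\<dots> = c0 * Kp * (v' powr (\<eta> - real m) * v' powr (real m - \<eta>)) * (\<Prod>i<m. \<tau> i) / nw z' r'"
            by simp
          also have "v' powr (\<eta> - real m) * v' powr (real m - \<eta>) = 1"
            using v by (simp add: powr_add[symmetric])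
          also have "c0 * Kp * 1 * (\<Prod>i<m. \<tau> i) / nw z' r' = (c0 * Kp * R0 ^ m) * ((\<Prod>i<m. \<tau> i / R0) / nw z' r')"
            using R0 by (simp add: prod_dividef)
          also have "\<dots> \<le> b * ((\<Prod>i<m. \<tau> i / R0) / nw z' r')"
            using tau R0 nwp by (intro mult_right_mono divide_nonneg_nonneg prod_nonneg) (auto simp: b_def)
          finally show "c0 * v' powr (\<eta> - real m) * (\<Prod>i<m. \<tau> i * n i z' r') \<le> b * (\<Prod>i<m. \<tau> i / R0) / nw z' r'"
            by (simp add: prod.distrib)
        qed
        finally have "epowr (ennreal (measure M E powr \<eta>) * (\<Prod>i<m. (\<integral>\<^sup>+y\<in>E. ennreal \<bar>f i y\<bar> \<partial>M) / emeasure M E) * indicator E x) (q x)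
           \<le> epowr (ennreal (b * (\<Prod>i<m. \<tau> i / R0) / nw z' r')) (q x)"
          using qx by (intro epowr_mono) auto
        also have "\<dots> = ennreal ((b * (\<Prod>i<m. \<tau> i / R0) / nw z' r') powr q x)"
          using tau R0 nwp by (intro epowr_ennreal divide_nonneg_nonneg mult_nonneg_nonneg prod_nonneg) (auto simp: b_def)
        also have "\<dots> \<le> ennreal (C3 * (\<Sum>i<m. \<tau> i powr p i x * nw z' r' powr (- q x)))"
        proof (rule ennreal_leI)
          \<comment> \<open>The factors are at most 1, as \<open>prod_powr_le_sum_powr\<close>
            demands; this is where the product over the functions turns into a sum.\<close>
          define Y where "Y = (\<Prod>i<m. \<tau> i / R0)"
          have Y0: "0 \<le> Y" unfolding Y_def using tau R0 by (intro prod_nonneg) auto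
          have p0: "0 < p i x" if "i < m" for i
            using conj_data.p_bounds[OF CD[OF that] x] conj_data.s[OF CD[OF that]] by linarith
          have "Y powr q x \<le> (\<Sum>i<m. (\<tau> i / R0) powr p i x)"
            unfolding Y_def using tau R0 qx ex[OF x] p0 by (intro prod_powr_le_sum_powr) auto
          also have "\<dots> \<le> (\<Sum>i<m. \<tau> i powr p i x)"
          proof (rule sum_mono)
            fix i assume "i \<in> {..<m}"
            then have i: "i < m" by simp
            have "\<tau> i / R0 \<le> \<tau> i / 1" using tau[OF i] R0 by (intro divide_left_mono) auto
            then show "(\<tau> i / R0) powr p i x \<le> \<tau> i powr p i x"
              using tau[OF i] R0 p0[OF i] by (intro powr_mono2) auto
          qed
          finally have Yq: "Y powr q x \<le> (\<Sum>i<m. \<tau> i powr p i x)" .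
          have bq: "b powr q x \<le> C3" unfolding C3_def using qb by (intro powr_mono) (auto simp: b_def)
          have "(b * Y / nw z' r') powr q x = b powr q x * Y powr q x * nw z' r' powr (- q x)"
          proof -
            have "0 \<le> b" by (simp add: b_def)
            then show ?thesis using Y0 nwp by (simp add: powr_divide powr_mult powr_minus_divide)
          qed
          also have "\<dots> \<le> C3 * (\<Sum>i<m. \<tau> i powr p i x) * nw z' r' powr (- q x)"
            using Yq bq by (intro mult_right_mono mult_mono) (auto simp: C3)
          finally show "(b * (\<Prod>i<m. \<tau> i / R0) / nw z' r') powr q x \<le> C3 * (\<Sum>i<m. \<tau> i powr p i x * nw z' r' powr (- q x))"
            unfolding Y_def by (simp add: sum_distrib_right mult.assoc)
        qed
        also have "\<dots> = ennreal C3 * (\<Sum>i<m. ennreal (\<tau> i powr p i x * nw z' r' powr (- q x)))"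
          using C3 by (subst sum_ennreal) (auto intro: ennreal_mult')
        also have "\<dots> \<le> ennreal C3 * (\<Sum>i<m. T i x)"
        proof (intro mult_left_mono sum_mono)
          fix i
          have "(case (z', r') of (z, r) \<Rightarrow> ennreal (R i (g i) z r powr p i x * nw z r powr (- q x)) * indicator (B z r) x) \<le> T i x"
            unfolding T_def by (rule SUP_upper[OF S'])
          then show "ennreal (\<tau> i powr p i x * nw z' r' powr (- q x)) \<le> T i x"
            using xB unfolding \<tau>_def by (simp del: in_B)
        qed simp
        finally show ?thesis .
      qed
    qed
    have Tm [measurable]: "(\<lambda>x. case zr of (z, r) \<Rightarrow> ennreal (R i (g i) z r powr p i x * nw z r powr (- q x)) * indicator (B z r) x)
       \<in> borel_measurable M" if i: "i < m" and zr: "zr \<in> S" for i zr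
    proof -
      obtain z r where e: "zr = (z, r)" by force
      have "z \<in> X" "0 < r" using S(2) zr goodD unfolding e by blast+
      then have [measurable]: "B z r \<in> sets M" using ball_sets by simp
      have [measurable]: "p i \<in> borel_measurable M" by (rule conj_data.p_meas[OF CD[OF i]])
      show ?thesis unfolding e by simp
    qed
    have TM [measurable]: "T i \<in> borel_measurable M" if "i < m" for i
      unfolding T_def[abs_def] using S(1) Tm[OF that] by (intro borel_measurable_SUP) auto
    have Tint: "(\<integral>\<^sup>+x. ennreal (\<rho>w x) * T i x \<partial>M) \<le> ennreal (Ci i)" if i: "i < m" for i
      unfolding T_def
    proof (rule nn_integral_countable_SUP_le[OF S(1) Sne Tm[OF i]])
      fix W assume W: "finite W" "W \<subseteq> S"
      then have gW: "\<forall>(z, r)\<in>W. good \<kappa>0 z r" using S(2) by blast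
      show "(\<integral>\<^sup>+x. ennreal (\<rho>w x) * (SUP (z, r)\<in>W. ennreal (R i (g i) z r powr p i x * nw z r powr (- q x)) * indicator (B z r) x) \<partial>M)
         \<le> ennreal (Ci i)"
        by (rule int[OF i gm[OF i] _ g1[OF i] W(1) gW]) (use g0[OF i] in auto)
    qed auto
    have "(\<integral>\<^sup>+x. ennreal (\<rho>w x) * (ennreal C3 * (\<Sum>i<m. T i x)) \<partial>M) =
       (\<integral>\<^sup>+x. ennreal C3 * (\<Sum>i<m. ennreal (\<rho>w x) * T i x) \<partial>M)"
      by (intro nn_integral_cong) (simp add: sum_distrib_left mult_ac)
    also have "\<dots> = ennreal C3 * (\<Sum>i<m. \<integral>\<^sup>+x. ennreal (\<rho>w x) * T i x \<partial>M)"
    proof -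
      have mm: "(\<lambda>x. ennreal (\<rho>w x) * T i x) \<in> borel_measurable M" if "i \<in> {..<m}" for i
      proof -
        have [measurable]: "T i \<in> borel_measurable M" using TM that by simp
        show ?thesis by measurable
      qed
      then have "(\<lambda>x. \<Sum>i<m. ennreal (\<rho>w x) * T i x) \<in> borel_measurable M" by (rule borel_measurable_sum)
      then have "(\<integral>\<^sup>+x. ennreal C3 * (\<Sum>i<m. ennreal (\<rho>w x) * T i x) \<partial>M) =
         ennreal C3 * (\<integral>\<^sup>+x. (\<Sum>i<m. ennreal (\<rho>w x) * T i x) \<partial>M)" by (rule nn_integral_cmult)
      also have "(\<integral>\<^sup>+x. (\<Sum>i<m. ennreal (\<rho>w x) * T i x) \<partial>M) = (\<Sum>i<m. \<integral>\<^sup>+x. ennreal (\<rho>w x) * T i x \<partial>M)"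
        by (rule nn_integral_sum[OF mm])
      finally show ?thesis .
    qed
    also have "\<dots> \<le> ennreal C3 * (\<Sum>i<m. ennreal (Ci i))"
      using Tint by (intro mult_left_mono sum_mono) auto
    also have "\<dots> = ennreal (C3 * (\<Sum>i<m. Ci i))"
    proof -
      have "(\<Sum>i<m. ennreal (Ci i)) = ennreal (\<Sum>i<m. Ci i)" using Ci by (intro sum_ennreal) auto
      then show ?thesis using C3 by (simp add: ennreal_mult')
    qed
    also have "\<dots> \<le> ennreal CC" by (intro ennreal_leI) (simp add: CC_def)
    finally have le: "(\<integral>\<^sup>+x. ennreal (\<rho>w x) * (ennreal C3 * (\<Sum>i<m. T i x)) \<partial>M) \<le> ennreal CC" .
    have "(\<lambda>x. \<Sum>i<m. T i x) \<in> borel_measurable M" using TM by (intro borel_measurable_sum) auto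
    then have "(\<lambda>x. ennreal C3 * (\<Sum>i<m. T i x)) \<in> borel_measurable M" by measurable
    then show ?thesis
      using pw le by (intro bexI[of _ "\<lambda>x. ennreal C3 * (\<Sum>i<m. T i x)"] conjI ballI)
  qed
  then show ?thesis using CC by blast
qed

end

section \<open>Necessity\<close>

lemma var_norm_mono:
  assumes "\<And>x. x \<in> space M \<Longrightarrow> f x \<le> g x" "\<And>x. x \<in> space M \<Longrightarrow> 0 \<le> p x"
  shows "var_norm M p f \<le> var_norm M p g"
proof -
  have "(\<integral>\<^sup>+x. epowr (f x / ennreal l) (p x) \<partial>M) \<le> (\<integral>\<^sup>+x. epowr (g x / ennreal l) (p x) \<partial>M)" for l
    using assms by (intro nn_integral_mono epowr_mono divide_right_mono_ennreal) auto
  then show ?thesis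
    unfolding var_norm_def by (intro INF_superset_mono) (auto intro: order_trans)
qed

lemma var_norm_cong_exponent:
  assumes "\<And>x. x \<in> space M \<Longrightarrow> p x = q x"
  shows "var_norm M p f = var_norm M q f"
proof -
  have "(\<integral>\<^sup>+x. epowr (f x / ennreal l) (p x) \<partial>M) = (\<integral>\<^sup>+x. epowr (f x / ennreal l) (q x) \<partial>M)" for l
    using assms by (intro nn_integral_cong) auto
  then show ?thesis by (simp add: var_norm_def)
qed

lemma var_norm_cmult_ge:
  assumes k: "0 < k"
  shows "ennreal k * var_norm M p f \<le> var_norm M p (\<lambda>x. ennreal k * f x)"
  unfolding var_norm_def[of M p "\<lambda>x. ennreal k * f x"]
proof (rule INF_greatest)
  fix l assume "l \<in> {l. 0 < l \<and> (\<integral>\<^sup>+x. epowr (ennreal k * f x / ennreal l) (p x) \<partial>M) \<le> 1}"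
  then have l: "0 < l" "(\<integral>\<^sup>+x. epowr (ennreal k * f x / ennreal l) (p x) \<partial>M) \<le> 1" by auto
  have lk: "0 < l / k" using l k by simp
  have eq: "y / ennreal (l / k) = ennreal k * y / ennreal l" for y
    unfolding ennreal_divide_real[OF lk] ennreal_divide_real[OF l(1)] mult.assoc[symmetric]
    using l k by (simp add: ennreal_mult[symmetric])
  have "var_norm M p f \<le> ennreal (l / k)"
    using l(2) by (intro var_norm_le[OF lk]) (simp add: eq)
  then have "ennreal k * var_norm M p f \<le> ennreal k * ennreal (l / k)" by (intro mult_left_mono) auto
  also have "\<dots> = ennreal l" using l k by (simp add: ennreal_mult[symmetric])
  finally show "ennreal k * var_norm M p f \<le> ennreal l" .
qed

text \<open>The conjugate norms may be infinite, while test functions are built for real numbers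
  below them. The factors are exhausted one at a time, each as a supremum of such numbers; a zero
  factor is trivial.\<close>

lemma mult_prod_le_of_less:
  fixes V :: "'i \<Rightarrow> ennreal"
  assumes "finite I"
    and "\<And>l. (\<And>i. i \<in> I \<Longrightarrow> 0 < l i \<and> ennreal (l i) < V i) \<Longrightarrow> k * (\<Prod>i\<in>I. ennreal (l i)) \<le> C"
  shows "k * (\<Prod>i\<in>I. V i) \<le> C"
  using assms
proof (induction I arbitrary: k)
  case empty
  then show ?case by simp
next
  case (insert j I)
  show ?case
  proof (cases "V j = 0")
    case True
    then show ?thesis using insert by simp
  next
    case False
    define T where "T = {t::real. 0 < t \<and> ennreal t < V j}"
    have step: "(k * (\<Prod>i\<in>I. V i)) * ennreal t \<le> C" if t: "t \<in> T" for t
    proof -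
      have "(k * ennreal t) * (\<Prod>i\<in>I. V i) \<le> C"
      proof (rule insert.IH)
        fix l assume l: "\<And>i. i \<in> I \<Longrightarrow> 0 < l i \<and> ennreal (l i) < V i"
        have "k * (\<Prod>i\<in>insert j I. ennreal ((l(j := t)) i)) \<le> C"
          using l t by (intro insert.prems) (auto simp: T_def)
        moreover have "(\<Prod>i\<in>I. ennreal ((l(j := t)) i)) = (\<Prod>i\<in>I. ennreal (l i))"
          using insert(2) by (intro prod.cong) auto
        ultimately show "k * ennreal t * (\<Prod>i\<in>I. ennreal (l i)) \<le> C"
          using insert(1,2) by (simp add: mult.assoc)
      qed
      then show ?thesis by (simp add: mult_ac)
    qed
    have Vj: "V j \<le> (SUP t\<in>T. ennreal t)"
    proof (rule dense_le)
      fix c assume "c < V j"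
      obtain e where e: "c < e" "e < V j" using dense[OF \<open>c < V j\<close>] by auto
      have "e \<noteq> \<infinity>" using e(2) by auto
      then obtain t where t: "e = ennreal t" "0 \<le> t" by (cases e) auto
      have "t \<noteq> 0" using e(1) t by auto
      then have "t \<in> T" using t e by (auto simp: T_def)
      then have "ennreal t \<le> (SUP t\<in>T. ennreal t)" by (rule SUP_upper)
      then show "c \<le> (SUP t\<in>T. ennreal t)" using e t by auto
    qed
    have "k * (\<Prod>i\<in>insert j I. V i) = (k * (\<Prod>i\<in>I. V i)) * V j"
      using insert(1,2) by (simp add: mult_ac)
    also have "\<dots> \<le> (k * (\<Prod>i\<in>I. V i)) * (SUP t\<in>T. ennreal t)" using Vj by (rule mult_left_mono) simp
    also have "\<dots> = (SUP t\<in>T. (k * (\<Prod>i\<in>I. V i)) * ennreal t)" by (rule SUP_mult_left_ennreal)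
    also have "\<dots> \<le> C" using step by (rule SUP_least)
    finally show ?thesis .
  qed
qed

lemma conj_exponent_bounds:
  assumes "1 < s" "s \<le> p x" "p x \<le> pp"
  shows "1 \<le> conj_exponent p x" "conj_exponent p x \<le> s / (s - 1)"
    "1 / conj_exponent p x = 1 - 1 / p x" "(conj_exponent p x - 1) * p x = conj_exponent p x"
proof -
  have "conj_exponent p x = 1 + 1 / (p x - 1)" unfolding conj_exponent_def using assms by (simp add: field_simps)
  moreover have "s / (s - 1) = 1 + 1 / (s - 1)" using assms by (simp add: field_simps)
  moreover have "1 / (p x - 1) \<le> 1 / (s - 1)" using assms by (intro divide_left_mono) auto
  ultimately show "1 \<le> conj_exponent p x" "conj_exponent p x \<le> s / (s - 1)" using assms by auto
  show "1 / conj_exponent p x = 1 - 1 / p x" "(conj_exponent p x - 1) * p x = conj_exponent p x"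
    unfolding conj_exponent_def using assms by (auto simp: field_simps)
qed

context hom_type
begin

text \<open>The extremal function of the norm conjugate formula, truncated to make its modular finite.\<close>

lemma conj_norm_extremal:
  assumes p [measurable]: "p \<in> borel_measurable M" and s: "1 < s" and pb: "\<And>x. x \<in> X \<Longrightarrow> s \<le> p x \<and> p x \<le> pp"
    and v [measurable]: "v \<in> borel_measurable M" and v0: "AE x in M. 0 < v x \<and> v x < \<infinity>"
    and zr: "z \<in> X" "0 < r" and l: "0 < l"
    and less: "ennreal l < var_norm M (conj_exponent p) (\<lambda>x. inverse (v x) * indicator (B z r) x)"
  shows "\<exists>f\<in>borel_measurable M. weighted_norm M p v (\<lambda>x. ennreal \<bar>f x\<bar>) \<le> 1 \<and>
    ennreal l \<le> (\<integral>\<^sup>+y\<in>B z r. ennreal \<bar>f y\<bar> \<partial>M)"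
proof -
  define a where "a = conj_exponent p"
  have am [measurable]: "a \<in> borel_measurable M" unfolding a_def conj_exponent_def[abs_def] by measurable
  have ab: "1 \<le> a x" "a x \<le> s / (s - 1)" "(a x - 1) * p x = a x" if "x \<in> X" for x
    using conj_exponent_bounds[of s p x pp] s pb[OF that] by (auto simp: a_def)
  define u where "u x = enn2real (inverse (v x))" for x
  have um [measurable]: "u \<in> borel_measurable M" unfolding u_def[abs_def] by measurable
  have u0: "0 \<le> u x" for x by (simp add: u_def)
  have vu: "AE x in M. 0 < u x \<and> inverse (v x) = ennreal (u x) \<and> v x = ennreal (1 / u x)"
    using v0
  proof eventually_elim
    case (elim x)
    then obtain t where t: "v x = ennreal t" "0 < t" by (cases "v x") auto
    then have "inverse (v x) = ennreal (1 / t)" by (simp add: inverse_ennreal inverse_eq_divide)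
    then have "u x = 1 / t" using t by (simp add: u_def)
    then show ?case using t \<open>inverse (v x) = ennreal (1 / t)\<close> by simp
  qed
  have BM [measurable]: "B z r \<in> sets M" using ball_sets zr by simp
  define F where "F x = (u x / l) powr a x" for x
  have Fm [measurable]: "F \<in> borel_measurable M" unfolding F_def[abs_def] by measurable
  have F0: "0 \<le> F x" for x by (simp add: F_def)
  have big: "1 < (\<integral>\<^sup>+x\<in>B z r. ennreal (F x) \<partial>M)"
  proof (rule ccontr)
    assume "\<not> ?thesis"
    then have le: "(\<integral>\<^sup>+x\<in>B z r. ennreal (F x) \<partial>M) \<le> 1" by simp
    have "(\<integral>\<^sup>+x. epowr (inverse (v x) * indicator (B z r) x / ennreal l) (conj_exponent p x) \<partial>M) =
      (\<integral>\<^sup>+x\<in>B z r. ennreal (F x) \<partial>M)"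
    proof (rule nn_integral_cong_AE, use vu in eventually_elim)
      case (elim x)
      have "epowr (ennreal (u x) / ennreal l) (a x) = ennreal (F x)"
        using l elim by (simp add: divide_ennreal epowr_ennreal F_def)
      moreover have iv: "inverse (v x) = ennreal (u x)" using elim by blast
      moreover have "epowr 0 (a x) = 0" by (simp add: epowr_def)
      ultimately show ?case unfolding iv a_def by (cases "x \<in> B z r") (simp_all del: in_B)
    qed
    then have "var_norm M (conj_exponent p) (\<lambda>x. inverse (v x) * indicator (B z r) x) \<le> ennreal l"
      using le l by (intro var_norm_le) auto
    then show False using less by simp
  qed
  \<comment> \<open>On \<open>E k\<close> the integrand is bounded, so its integral over this subset
    of a ball is finite. Monotone convergence keeps the integral above 1 for some
    \<open>k\<close>.\<close>
  define E where "E k = {x \<in> B z r. u x \<le> real k}" for k :: nat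
  have Em [measurable]: "E k \<in> sets M" for k
  proof -
    have "E k = B z r \<inter> {x \<in> X. u x \<le> real k}" by (auto simp: E_def)
    then show ?thesis by simp
  qed
  have "(SUP k. \<integral>\<^sup>+x\<in>E k. ennreal (F x) \<partial>M) = (\<integral>\<^sup>+x. (SUP k. ennreal (F x) * indicator (E k) x) \<partial>M)"
  proof (rule nn_integral_monotone_convergence_SUP[symmetric])
    show "incseq (\<lambda>k x. ennreal (F x) * indicator (E k) x)"
      by (intro incseq_SucI le_funI mult_left_mono) (auto simp: E_def indicator_def)
  qed measurable
  also have "\<dots> = (\<integral>\<^sup>+x\<in>B z r. ennreal (F x) \<partial>M)"
  proof (rule nn_integral_cong)
    fix x
    have "(SUP k. indicator (E k) x :: ennreal) = indicator (B z r) x"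
    proof (cases "x \<in> B z r")
      case True
      obtain k :: nat where "u x \<le> real k" using real_arch_simple by blast
      then have "x \<in> E k" using True by (simp add: E_def)
      then have "(1::ennreal) \<le> (SUP k. indicator (E k) x)" by (intro SUP_upper2[of k]) auto
      moreover have "(SUP k. indicator (E k) x) \<le> (1::ennreal)" by (intro SUP_least) (simp add: indicator_def)
      ultimately have "(SUP k. indicator (E k) x) = (1::ennreal)" by (rule antisym[rotated])
      then show ?thesis using True by (simp del: in_B)
    next
      case False
      then have "x \<notin> E k" for k by (auto simp: E_def)
      then show ?thesis using False by (simp del: in_B)
    qed
    then show "(SUP k. ennreal (F x) * indicator (E k) x) = ennreal (F x) * indicator (B z r) x"
      by (simp add: SUP_mult_left_ennreal[symmetric])
  qed
  finally have "1 < (SUP k. \<integral>\<^sup>+x\<in>E k. ennreal (F x) \<partial>M)" using big by simp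
  then obtain k where k: "1 < (\<integral>\<^sup>+x\<in>E k. ennreal (F x) \<partial>M)" by (auto simp: less_SUP_iff)
  define \<Theta> where "\<Theta> = enn2real (\<integral>\<^sup>+x\<in>E k. ennreal (F x) \<partial>M)"
  have fin: "(\<integral>\<^sup>+x\<in>E k. ennreal (F x) \<partial>M) < \<infinity>"
  proof -
    define b where "b = max 1 (real k / l) powr (s / (s - 1))"
    have "(\<integral>\<^sup>+x\<in>E k. ennreal (F x) \<partial>M) \<le> (\<integral>\<^sup>+x. ennreal b * indicator (B z r) x \<partial>M)"
    proof (rule nn_integral_mono)
      fix x assume x: "x \<in> X"
      show "ennreal (F x) * indicator (E k) x \<le> ennreal b * indicator (B z r) x"
      proof (cases "x \<in> E k")
        case True
        then have xk: "x \<in> B z r" "u x \<le> real k" by (auto simp: E_def)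
        have "F x \<le> (max 1 (real k / l)) powr a x"
          unfolding F_def using xk u0[of x] l ab[OF x] by (intro powr_mono2) (auto simp: le_max_iff_disj divide_right_mono)
        also have "\<dots> \<le> b" unfolding b_def using ab[OF x] by (intro powr_mono) auto
        finally show ?thesis using True xk by (simp add: ennreal_leI del: in_B)
      qed simp
    qed
    also have "\<dots> = ennreal b * emeasure M (B z r)" by (rule nn_integral_cmult_indicator[OF BM])
    also have "\<dots> < \<infinity>" using ball_fin[OF zr] by (simp add: ennreal_mult_less_top)
    finally show ?thesis .
  qed
  then have Th: "(\<integral>\<^sup>+x\<in>E k. ennreal (F x) \<partial>M) = ennreal \<Theta>" by (simp add: \<Theta>_def)
  then have Th1: "1 < \<Theta>" using k by (simp add: one_less_ennreal)
  \<comment> \<open>The conjugacy relation \<open>(a x - 1) * p x = a x\<close> makes the weighted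
    modular integrand of \<open>f\<close> equal to \<open>F x / \<Theta>\<close>, so its integral is
    1.\<close>
  define f where "f x = indicator (E k) x * (u x * (u x / l) powr (a x - 1) * \<Theta> powr (- (1 / p x)))" for x
  have fm: "f \<in> borel_measurable M" unfolding f_def[abs_def] by measurable
  have f0: "0 \<le> f x" for x using u0[of x] by (simp add: f_def)
  have "(\<integral>\<^sup>+x. epowr (v x * ennreal \<bar>f x\<bar> / ennreal 1) (p x) \<partial>M) = (\<integral>\<^sup>+x. ennreal (1 / \<Theta>) * (ennreal (F x) * indicator (E k) x) \<partial>M)"
  proof (rule nn_integral_cong_AE, use vu AE_space in eventually_elim)
    case (elim x)
    have px: "1 < p x" using pb[of x] elim s by auto
    show ?case
    proof (cases "x \<in> E k")
      case True
      define y where "y = (u x / l) powr (a x - 1) * \<Theta> powr (- (1 / p x))"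
      have y0: "0 \<le> y" by (simp add: y_def)
      have "v x * ennreal \<bar>f x\<bar> = ennreal (1 / u x) * ennreal (u x * y)"
        using elim True f0[of x] by (simp add: f_def y_def mult.assoc)
      also have "\<dots> = ennreal y" using elim y0 by (simp add: ennreal_mult[symmetric])
      finally have vf: "v x * ennreal \<bar>f x\<bar> = ennreal y" .
      have "y powr p x = (u x / l) powr ((a x - 1) * p x) * \<Theta> powr (- 1)"
        unfolding y_def using Th1 px by (simp add: powr_mult powr_powr)
      also have "\<dots> = 1 / \<Theta> * F x" using ab[of x] elim Th1 by (simp add: F_def powr_minus_divide)
      finally have yp: "y powr p x = 1 / \<Theta> * F x" .
      have "epowr (v x * ennreal \<bar>f x\<bar> / ennreal 1) (p x) = ennreal (y powr p x)"
        unfolding vf epowr_divide[OF zero_less_one] using y0 by (simp add: epowr_ennreal)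
      also have "\<dots> = ennreal (1 / \<Theta>) * ennreal (F x)" unfolding yp using Th1 by (intro ennreal_mult) (auto simp: F0)
      finally show ?thesis using True by simp
    next
      case False
      then show ?thesis by (simp add: f_def epowr_def)
    qed
  qed
  also have "\<dots> = ennreal (1 / \<Theta>) * (\<integral>\<^sup>+x\<in>E k. ennreal (F x) \<partial>M)" by (rule nn_integral_cmult) measurable
  also have "\<dots> = 1" unfolding Th using Th1 by (simp add: ennreal_mult[symmetric])
  finally have "var_norm M p (\<lambda>x. v x * ennreal \<bar>f x\<bar>) \<le> ennreal 1" by (intro var_norm_le) auto
  then have 1: "weighted_norm M p v (\<lambda>x. ennreal \<bar>f x\<bar>) \<le> 1" by (simp add: weighted_norm_def)
  have "ennreal l = ennreal (l / \<Theta>) * (\<integral>\<^sup>+x\<in>E k. ennreal (F x) \<partial>M)"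
    unfolding Th using Th1 l by (simp add: ennreal_mult[symmetric])
  also have "\<dots> = (\<integral>\<^sup>+x. ennreal (l / \<Theta>) * (ennreal (F x) * indicator (E k) x) \<partial>M)"
    by (rule nn_integral_cmult[symmetric]) measurable
  also have "\<dots> \<le> (\<integral>\<^sup>+y\<in>B z r. ennreal \<bar>f y\<bar> \<partial>M)"
  proof (rule nn_integral_mono_AE, use vu AE_space in eventually_elim)
    case (elim x)
    have px: "1 < p x" using pb[of x] elim s by auto
    show ?case
    proof (cases "x \<in> E k")
      case True
      then have xB: "x \<in> B z r" by (simp add: E_def)
      have "l / \<Theta> * F x = l * F x * \<Theta> powr (- 1)" using Th1 by (simp add: powr_minus_divide)
      \<comment> \<open>Uses \<open>\<Theta> > 1\<close> and \<open>p x > 1\<close>. This is why the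
        integral was kept above 1 and not merely positive.\<close>
      also have "\<dots> \<le> l * F x * \<Theta> powr (- (1 / p x))"
        using Th1 px l F0[of x] by (intro mult_left_mono powr_mono) auto
      also have "l * F x = u x * (u x / l) powr (a x - 1)"
        using elim l by (simp add: F_def powr_diff)
      finally have "l / \<Theta> * F x \<le> \<bar>f x\<bar>" using True f0[of x] by (simp add: f_def)
      then have "ennreal (l / \<Theta>) * ennreal (F x) \<le> ennreal \<bar>f x\<bar>"
        using Th1 l F0[of x] by (simp add: ennreal_mult[symmetric] ennreal_leI)
      then show ?thesis using True xB by (simp del: in_B)
    qed simp
  qed
  finally show ?thesis using 1 fm by blast
qed

lemma Apq_const_le_of_bound:
  assumes ps: "\<And>i. i < m \<Longrightarrow> ps i \<in> borel_measurable M" and s: "\<And>i. i < m \<Longrightarrow> 1 < s i"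
    and pb: "\<And>i x. i < m \<Longrightarrow> x \<in> X \<Longrightarrow> s i \<le> ps i x \<and> ps i x \<le> pp i"
    and ws: "\<And>i. i < m \<Longrightarrow> ws i \<in> borel_measurable M" "\<And>i. i < m \<Longrightarrow> AE x in M. 0 < ws i x \<and> ws i x < \<infinity>"
    and q: "\<And>x. x \<in> X \<Longrightarrow> 0 \<le> q x"
    and bd: "maximal_bound M d m \<eta> ps q ws w C"
  shows "Apq_const M d m \<eta> ps q ws w \<le> C"
  unfolding Apq_const_def
proof (rule SUP_least)
  fix E assume "E \<in> qballs X d"
  then obtain z r where zr: "z \<in> X" "0 < r" and E: "E = B z r" by (auto simp: qballs_def)
  define v where "v = measure M (B z r)"
  have v: "0 < v" unfolding v_def using mB_pos[OF zr] .
  show "ennreal (measure M E powr (\<eta> - real m)) * var_norm M q (\<lambda>x. w x * indicator E x) *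
     (\<Prod>i<m. var_norm M (conj_exponent (ps i)) (\<lambda>x. inverse (ws i x) * indicator E x)) \<le> C"
    unfolding E v_def[symmetric]
  proof (rule mult_prod_le_of_less)
    fix l assume l: "\<And>i. i \<in> {..<m} \<Longrightarrow> 0 < l i \<and>
      ennreal (l i) < var_norm M (conj_exponent (ps i)) (\<lambda>x. inverse (ws i x) * indicator (B z r) x)"
    have "\<exists>f. i < m \<longrightarrow> f \<in> borel_measurable M \<and> weighted_norm M (ps i) (ws i) (\<lambda>x. ennreal \<bar>f x\<bar>) \<le> 1 \<and>
      ennreal (l i) \<le> (\<integral>\<^sup>+y\<in>B z r. ennreal \<bar>f y\<bar> \<partial>M)" for i
    proof (cases "i < m")
      case True
      then show ?thesis
        using conj_norm_extremal[OF ps[OF True] s[OF True] pb[OF True] ws(1)[OF True] ws(2)[OF True] zr, of "l i"] l[of i]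
        by auto
    qed simp
    then have "\<forall>i. \<exists>f. i < m \<longrightarrow> f \<in> borel_measurable M \<and> weighted_norm M (ps i) (ws i) (\<lambda>x. ennreal \<bar>f x\<bar>) \<le> 1 \<and>
      ennreal (l i) \<le> (\<integral>\<^sup>+y\<in>B z r. ennreal \<bar>f y\<bar> \<partial>M)" ..
    from choice[OF this] obtain f where f: "\<forall>i. i < m \<longrightarrow> f i \<in> borel_measurable M \<and>
      weighted_norm M (ps i) (ws i) (\<lambda>x. ennreal \<bar>f i x\<bar>) \<le> 1 \<and>
      ennreal (l i) \<le> (\<integral>\<^sup>+y\<in>B z r. ennreal \<bar>f i y\<bar> \<partial>M)" ..
    \<comment> \<open>A lower bound on the ball for the maximal function of the test
      functions.\<close>
    define k where "k = v powr (\<eta> - real m) * (\<Prod>i<m. l i)"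
    have k: "0 < k" unfolding k_def using v l by (intro mult_pos_pos prod_pos) auto
    have kk: "ennreal k = ennreal (v powr (\<eta> - real m)) * (\<Prod>i<m. ennreal (l i))"
    proof -
      have "(\<Prod>i<m. ennreal (l i)) = ennreal (\<Prod>i<m. l i)"
        using l by (intro prod_ennreal) (auto intro: less_imp_le)
      then show ?thesis unfolding k_def by (simp add: ennreal_mult')
    qed
    have low: "ennreal k * (w x * indicator (B z r) x) \<le> w x * frac_maximal M d m \<eta> f x" for x
    proof (cases "x \<in> B z r")
      case True
      have "ennreal k \<le> ennreal (v powr (\<eta> - real m)) * (\<Prod>i<m. \<integral>\<^sup>+y\<in>B z r. ennreal \<bar>f i y\<bar> \<partial>M)"
        unfolding kk using f by (intro mult_left_mono prod_mono_ennreal) auto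
      also have "\<dots> = ennreal (measure M (B z r) powr \<eta>) *
          (\<Prod>i<m. (\<integral>\<^sup>+y\<in>B z r. ennreal \<bar>f i y\<bar> \<partial>M) / emeasure M (B z r)) * indicator (B z r) x"
        unfolding frac_maximal_ball[OF zr] v_def using True by (simp del: in_B)
      also have "\<dots> \<le> frac_maximal M d m \<eta> f x"
        unfolding frac_maximal_def using zr by (intro SUP_upper) (auto simp: qballs_def)
      finally have "w x * ennreal k \<le> w x * frac_maximal M d m \<eta> f x" by (rule mult_left_mono) simp
      then show ?thesis using True by (simp add: mult.commute del: in_B)
    qed (simp del: in_B)
    have "ennreal (v powr (\<eta> - real m)) * var_norm M q (\<lambda>x. w x * indicator (B z r) x) * (\<Prod>i<m. ennreal (l i))
       = ennreal k * var_norm M q (\<lambda>x. w x * indicator (B z r) x)"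
      unfolding kk by (simp add: mult_ac)
    also have "\<dots> \<le> var_norm M q (\<lambda>x. ennreal k * (w x * indicator (B z r) x))" by (rule var_norm_cmult_ge[OF k])
    also have "\<dots> \<le> weighted_norm M q w (frac_maximal M d m \<eta> f)"
      unfolding weighted_norm_def using low q by (intro var_norm_mono) auto
    also have "\<dots> \<le> C * (\<Prod>i<m. weighted_norm M (ps i) (ws i) (\<lambda>x. ennreal \<bar>f i x\<bar>))"
    proof -
      have "f i \<in> weighted_space M (ps i) (ws i)" if i: "i < m" for i
      proof -
        have "weighted_norm M (ps i) (ws i) (\<lambda>x. ennreal \<bar>f i x\<bar>) \<le> 1" using f i by simp
        then have "weighted_norm M (ps i) (ws i) (\<lambda>x. ennreal \<bar>f i x\<bar>) < \<infinity>" by (rule order_le_less_trans) simp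
        then show ?thesis using f i by (simp add: weighted_space_def)
      qed
      then show ?thesis using bd unfolding maximal_bound_def by blast
    qed
    also have "\<dots> \<le> C * (\<Prod>i<m. 1)" using f by (intro mult_left_mono prod_mono_ennreal) auto
    finally show "ennreal (v powr (\<eta> - real m)) * var_norm M q (\<lambda>x. w x * indicator (B z r) x) * (\<Prod>i<m. ennreal (l i)) \<le> C"
      by simp
  qed simp
qed

end

section \<open>Sufficiency\<close>

context hom_type
begin

text \<open>Continuity turns the essential bounds into bounds at every point, and the limit at
  infinity is clamped to the same interval, as \<open>conj_data\<close> requires.\<close>

lemma exponents_bounds:
  assumes p: "p \<in> exponents M" and LH: "log_Hoelder X d p"
  shows "\<exists>s pp Hp pinf. 1 < s \<and> (\<forall>x\<in>X. s \<le> p x \<and> p x \<le> pp) \<and> s \<le> pinf \<and> pinf \<le> pp \<and> LH p Hp pinf"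
proof -
  obtain Hp b where Hb: "LH p Hp b" using LH_of_log_Hoelder[OF LH] by auto
  have "1 < ess_inf M p" "ess_sup M p < \<infinity>" using p by (auto simp: exponents_def)
  then obtain s u where s: "1 < ereal s" "AE x in M. s \<le> p x" and u: "AE x in M. p x \<le> u"
    using AE_ess_inf_gt[of 1 M p] AE_ess_sup_less[of M p] by auto
  have bd: "s \<le> p x \<and> p x \<le> u" if "x \<in> X" for x
    using LH_AE_ge[OF Hb s(2) that] LH_AE_le[OF Hb u that] by simp
  have su: "s \<le> u" using bd[OF origin] by linarith
  have "LH p Hp (max s (min u b))" by (rule LH_clamp[OF Hb bd])
  moreover have "s \<le> max s (min u b)" "max s (min u b) \<le> u" using su by auto
  moreover have "1 < s" using s(1) by simp
  ultimately show ?thesis using bd by (intro exI[of _ s] exI[of _ u] exI[of _ Hp] exI[of _ "max s (min u b)"]) auto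
qed

lemma LH_conj_exponent:
  assumes s: "1 < s" and pb: "\<forall>x\<in>X. s \<le> p x \<and> p x \<le> pp" and pinf: "s \<le> pinf" "pinf \<le> pp" and LH: "LH p Hp pinf"
  shows "LH (conj_exponent p) (1 / (s - 1) ^ 2 * Hp) (pinf / (pinf - 1))"
proof (rule LH_lipschitz[OF LH, where \<psi> = "\<lambda>t. t / (t - 1)" and l = s and u = pp])
  fix x y assume xy: "s \<le> x" "x \<le> pp" "s \<le> y" "y \<le> pp"
  have "x / (x - 1) - y / (y - 1) = (y - x) / ((x - 1) * (y - 1))"
    using xy s by (simp add: field_simps)
  then have "\<bar>x / (x - 1) - y / (y - 1)\<bar> = \<bar>x - y\<bar> / ((x - 1) * (y - 1))"
    using xy s by (simp add: abs_mult abs_minus_commute)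
  also have "\<dots> \<le> \<bar>x - y\<bar> / (s - 1) ^ 2"
    unfolding power2_eq_square using xy s by (intro divide_left_mono mult_mono) auto
  finally show "\<bar>x / (x - 1) - y / (y - 1)\<bar> \<le> 1 / (s - 1) ^ 2 * \<bar>x - y\<bar>" by simp
qed (use pb pinf in \<open>auto simp: conj_exponent_def\<close>)

lemma LH_inverse:
  assumes s: "0 < s" and pb: "\<forall>x\<in>X. s \<le> p x \<and> p x \<le> pp" and pinf: "s \<le> pinf" "pinf \<le> pp" and LH: "LH p Hp pinf"
  shows "LH (\<lambda>x. 1 / p x) (1 / s ^ 2 * Hp) (1 / pinf)"
proof (rule LH_lipschitz[OF LH, where \<psi> = "\<lambda>t. 1 / t" and l = s and u = pp])
  fix x y assume xy: "s \<le> x" "x \<le> pp" "s \<le> y" "y \<le> pp"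
  have "1 / x - 1 / y = (y - x) / (x * y)" using xy s by (simp add: field_simps)
  then have "\<bar>1 / x - 1 / y\<bar> = \<bar>x - y\<bar> / (x * y)"
    using xy s by (simp add: abs_mult abs_minus_commute)
  also have "\<dots> \<le> \<bar>x - y\<bar> / s ^ 2"
    unfolding power2_eq_square using xy s by (intro divide_left_mono mult_mono) auto
  finally show "\<bar>1 / x - 1 / y\<bar> \<le> 1 / s ^ 2 * \<bar>x - y\<bar>" by simp
qed (use pb pinf in auto)

text \<open>The exponent \<open>q\<close> gets its regularity from its reciprocal, which differs
  from a sum of log-Hoelder reciprocals by a constant. The limit is clamped before inversion to keep
  it away from 0.\<close>

lemma exponents0_bounds:
  assumes q: "q \<in> exponents0 M" and r: "LH (\<lambda>x. 1 / q x) H b"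
  shows "\<exists>ql qu Hq qinf. 0 < ql \<and> (\<forall>x\<in>X. ql \<le> q x \<and> q x \<le> qu) \<and> ql \<le> qinf \<and> qinf \<le> qu \<and> LH q Hq qinf"
proof -
  have q0: "0 < q x" if "x \<in> X" for x using q that by (auto simp: exponents0_def)
  have "0 < ess_inf M q" "ess_sup M q < \<infinity>" using q by (auto simp: exponents0_def)
  then obtain l u' where l: "0 < ereal l" "AE x in M. l \<le> q x" and u': "AE x in M. q x \<le> u'"
    using AE_ess_inf_gt[of 0 M q] AE_ess_sup_less[of M q] by auto
  define u where "u = max u' l"
  have lu: "0 < l" "l \<le> u" using l by (auto simp: u_def)
  have ae1: "AE x in M. 1 / q x \<le> 1 / l"
    using l(2) AE_space by eventually_elim (use lu q0 in \<open>auto intro: divide_left_mono\<close>)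
  have ae2: "AE x in M. 1 / u \<le> 1 / q x"
    using u' AE_space by eventually_elim (use lu q0 in \<open>auto intro!: divide_left_mono simp: u_def\<close>)
  have bd: "1 / u \<le> 1 / q x \<and> 1 / q x \<le> 1 / l" if "x \<in> X" for x
    using LH_AE_le[OF r ae1 that] LH_AE_ge[OF r ae2 that] by simp
  define b' where "b' = max (1 / u) (min (1 / l) b)"
  have r': "LH (\<lambda>x. 1 / q x) H b'" unfolding b'_def by (rule LH_clamp[OF r bd])
  have ul: "1 / u \<le> 1 / l" using lu by (intro divide_left_mono) auto
  have b': "1 / u \<le> b'" "b' \<le> 1 / l" unfolding b'_def using ul by auto
  have up: "0 < 1 / u" using lu by simp
  have "LH (\<lambda>x. 1 / (1 / q x)) (1 / (1 / u) ^ 2 * H) (1 / b')"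
    by (rule LH_inverse[OF up _ b' r']) (use bd in auto)
  then have "LH q (1 / (1 / u) ^ 2 * H) (1 / b')" by simp
  moreover have "l \<le> q x \<and> q x \<le> u" if "x \<in> X" for x
    using bd[OF that] q0[OF that] lu by (auto simp: field_simps)
  moreover have "l \<le> 1 / b'" "1 / b' \<le> u"
  proof -
    have "0 < b'" using b' up by linarith
    then show "l \<le> 1 / b'" "1 / b' \<le> u" using b' lu by (auto simp: field_simps)
  qed
  ultimately show ?thesis using lu
    by (intro exI[of _ l] exI[of _ u] exI[of _ "1 / (1 / u) ^ 2 * H"] exI[of _ "1 / b'"]) auto
qed

lemma frac_maximal_scale:
  assumes l: "\<And>i. i < m \<Longrightarrow> 0 < l i" and f: "\<And>i. i < m \<Longrightarrow> f i \<in> borel_measurable M"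
  shows "frac_maximal M d m \<eta> f x \<le> ennreal (\<Prod>i<m. l i) * frac_maximal M d m \<eta> (\<lambda>i y. f i y / l i) x"
  unfolding frac_maximal_def
proof (rule SUP_least)
  fix E assume EE: "E \<in> qballs X d"
  then obtain z r where zr: "z \<in> X" "0 < r" and E: "E = B z r" by (auto simp: qballs_def)
  have EM [measurable]: "E \<in> sets M" unfolding E using ball_sets zr by simp
  have eq: "(\<integral>\<^sup>+y\<in>E. ennreal \<bar>f i y\<bar> \<partial>M) / emeasure M E =
      ennreal (l i) * ((\<integral>\<^sup>+y\<in>E. ennreal \<bar>f i y / l i\<bar> \<partial>M) / emeasure M E)" if i: "i < m" for i
  proof -
    note f[OF i, measurable]
    have "(\<integral>\<^sup>+y\<in>E. ennreal \<bar>f i y\<bar> \<partial>M) = (\<integral>\<^sup>+y. ennreal (l i) * (ennreal \<bar>f i y / l i\<bar> * indicator E y) \<partial>M)"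
      using l[OF i] by (intro nn_integral_cong) (simp add: mult.assoc[symmetric] ennreal_mult[symmetric] abs_divide)
    also have "\<dots> = ennreal (l i) * (\<integral>\<^sup>+y\<in>E. ennreal \<bar>f i y / l i\<bar> \<partial>M)"
      by (rule nn_integral_cmult) measurable
    finally show ?thesis by (simp add: divide_ennreal_def mult.assoc)
  qed
  have "ennreal (measure M E powr \<eta>) * (\<Prod>i<m. (\<integral>\<^sup>+y\<in>E. ennreal \<bar>f i y\<bar> \<partial>M) / emeasure M E) * indicator E x
    = ennreal (measure M E powr \<eta>) * ((\<Prod>i<m. ennreal (l i)) * (\<Prod>i<m. (\<integral>\<^sup>+y\<in>E. ennreal \<bar>f i y / l i\<bar> \<partial>M) / emeasure M E)) * indicator E x"
    unfolding prod.distrib[symmetric] using eq by (intro arg_cong2[where f = "(*)"] prod.cong refl) auto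
  also have "(\<Prod>i<m. ennreal (l i)) = ennreal (\<Prod>i<m. l i)" using l by (intro prod_ennreal) (auto intro: less_imp_le)
  also have "ennreal (measure M E powr \<eta>) * (ennreal (\<Prod>i<m. l i) * (\<Prod>i<m. (\<integral>\<^sup>+y\<in>E. ennreal \<bar>f i y / l i\<bar> \<partial>M) / emeasure M E)) * indicator E x
    = ennreal (\<Prod>i<m. l i) * (ennreal (measure M E powr \<eta>) * (\<Prod>i<m. (\<integral>\<^sup>+y\<in>E. ennreal \<bar>f i y / l i\<bar> \<partial>M) / emeasure M E) * indicator E x)"
    by (simp add: mult_ac)
  also have "\<dots> \<le> ennreal (\<Prod>i<m. l i) * (SUP B\<in>qballs X d. ennreal (measure M B powr \<eta>) *
      (\<Prod>i<m. (\<integral>\<^sup>+y\<in>B. ennreal \<bar>f i y / l i\<bar> \<partial>M) / emeasure M B) * indicator B x)"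
    by (intro mult_left_mono SUP_upper EE) simp
  finally show "ennreal (measure M E powr \<eta>) * (\<Prod>i<m. (\<integral>\<^sup>+y\<in>E. ennreal \<bar>f i y\<bar> \<partial>M) / emeasure M E) * indicator E x
    \<le> ennreal (\<Prod>i<m. l i) * (SUP B\<in>qballs X d. ennreal (measure M B powr \<eta>) *
      (\<Prod>i<m. (\<integral>\<^sup>+y\<in>B. ennreal \<bar>f i y / l i\<bar> \<partial>M) / emeasure M B) * indicator B x)" .
qed

text \<open>A norm can be 0 and so cannot serve as a divisor. Positive admissible numbers within
  \<open>e\<close> of the norms are used instead, and \<open>e\<close> tends to 0 in the finite
  product.\<close>

lemma maximal_bound_from_admissible:
  fixes D :: real
  assumes D: "0 \<le> D"
    and bd: "\<And>f l. (\<And>i. i < m \<Longrightarrow> f i \<in> borel_measurable M) \<Longrightarrow> (\<And>i. i < m \<Longrightarrow> 0 < l i \<and>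
        (\<integral>\<^sup>+x. epowr (ws i x * ennreal \<bar>f i x\<bar> / ennreal (l i)) (ps i x) \<partial>M) \<le> 1) \<Longrightarrow>
      weighted_norm M q w (frac_maximal M d m \<eta> f) \<le> ennreal (D * (\<Prod>i<m. l i))"
  shows "maximal_bound M d m \<eta> ps q ws w (ennreal D)"
  unfolding maximal_bound_def
proof (intro allI impI)
  fix f assume f: "\<forall>i<m. f i \<in> weighted_space M (ps i) (ws i)"
  define V where "V i = enn2real (weighted_norm M (ps i) (ws i) (\<lambda>x. ennreal \<bar>f i x\<bar>))" for i
  have V: "weighted_norm M (ps i) (ws i) (\<lambda>x. ennreal \<bar>f i x\<bar>) = ennreal (V i)" "0 \<le> V i" if "i < m" for i
    using f that by (auto simp: V_def weighted_space_def)
  have eps: "weighted_norm M q w (frac_maximal M d m \<eta> f) \<le> ennreal (D * (\<Prod>i<m. V i + e))" if e: "0 < e" for e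
  proof -
    have "\<exists>l. i < m \<longrightarrow> 0 < l \<and> l < V i + e \<and> (\<integral>\<^sup>+x. epowr (ws i x * ennreal \<bar>f i x\<bar> / ennreal l) (ps i x) \<partial>M) \<le> 1" for i
    proof (cases "i < m")
      case True
      have "var_norm M (ps i) (\<lambda>x. ws i x * ennreal \<bar>f i x\<bar>) < ennreal (V i + e)"
        using V[OF True] e by (simp add: weighted_norm_def ennreal_less_iff)
      from var_norm_less[OF this] obtain l where l: "0 < l" "ennreal l < ennreal (V i + e)"
        "(\<integral>\<^sup>+x. epowr (ws i x * ennreal \<bar>f i x\<bar> / ennreal l) (ps i x) \<partial>M) \<le> 1" by blast
      then have "l < V i + e" by (simp add: ennreal_less_iff)
      then show ?thesis using l by blast
    qed simp
    then have "\<forall>i. \<exists>l. i < m \<longrightarrow> 0 < l \<and> l < V i + e \<and> (\<integral>\<^sup>+x. epowr (ws i x * ennreal \<bar>f i x\<bar> / ennreal l) (ps i x) \<partial>M) \<le> 1" ..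
    from choice[OF this] obtain l where l: "\<forall>i. i < m \<longrightarrow> 0 < l i \<and> l i < V i + e \<and>
      (\<integral>\<^sup>+x. epowr (ws i x * ennreal \<bar>f i x\<bar> / ennreal (l i)) (ps i x) \<partial>M) \<le> 1" ..
    have "weighted_norm M q w (frac_maximal M d m \<eta> f) \<le> ennreal (D * (\<Prod>i<m. l i))"
      using f l by (intro bd) (auto simp: weighted_space_def)
    also have "\<dots> \<le> ennreal (D * (\<Prod>i<m. V i + e))"
      using l D by (intro ennreal_leI mult_left_mono prod_mono) (auto intro: less_imp_le)
    finally show ?thesis .
  qed
  have "(\<lambda>k. D * (\<Prod>i<m. V i + 1 / real (Suc k))) \<longlonglongrightarrow> D * (\<Prod>i<m. V i + 0)"
    by (intro tendsto_mult tendsto_prod tendsto_add tendsto_const) (rule LIMSEQ_Suc[OF lim_1_over_n])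
  then have "(\<lambda>k. ennreal (D * (\<Prod>i<m. V i + 1 / real (Suc k)))) \<longlonglongrightarrow> ennreal (D * (\<Prod>i<m. V i + 0))"
    by (rule tendsto_ennrealI)
  then have "weighted_norm M q w (frac_maximal M d m \<eta> f) \<le> ennreal (D * (\<Prod>i<m. V i + 0))"
    by (rule LIMSEQ_le_const) (intro exI[of _ 0] allI impI eps, simp)
  also have "\<dots> = ennreal D * (\<Prod>i<m. weighted_norm M (ps i) (ws i) (\<lambda>x. ennreal \<bar>f i x\<bar>))"
  proof -
    have "(\<Prod>i<m. weighted_norm M (ps i) (ws i) (\<lambda>x. ennreal \<bar>f i x\<bar>)) = (\<Prod>i<m. ennreal (V i))"
      using V(1) by (intro prod.cong) auto
    also have "\<dots> = ennreal (\<Prod>i<m. V i)" using V(2) by (intro prod_ennreal) auto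
    finally show ?thesis using D by (simp add: ennreal_mult')
  qed
  finally show "weighted_norm M q w (frac_maximal M d m \<eta> f) \<le>
    ennreal D * (\<Prod>i<m. weighted_norm M (ps i) (ws i) (\<lambda>x. ennreal \<bar>f i x\<bar>))" .
qed

end

context hom_type
begin

lemma LH_cong: "LH f H b \<Longrightarrow> (\<And>x. x \<in> X \<Longrightarrow> f x = g x) \<Longrightarrow> LH g H b"
  by (simp add: LH_def)

lemma maximal_bound_of_Apq:
  fixes ps :: "nat \<Rightarrow> 'a \<Rightarrow> real" and q :: "'a \<Rightarrow> real" and \<eta> :: real
  assumes P: "\<And>i. i < m \<Longrightarrow> ps i \<in> exponents M" and LHp: "\<And>i. i < m \<Longrightarrow> log_Hoelder X d (ps i)"
    and q: "q \<in> exponents0 M" and eta: "0 \<le> \<eta>" "\<eta> < real m"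
    and rel: "\<And>x. x \<in> X \<Longrightarrow> (\<Sum>i<m. 1 / ps i x) - 1 / q x = \<eta>"
    and ws: "\<And>i. i < m \<Longrightarrow> weight M d (ws i)" and w: "weight M d w"
    and wprod: "AE x in M. w x = (\<Prod>i<m. ws i x)"
    and Apq: "in_Apq M d m \<eta> ps q ws w"
  shows "\<exists>D\<ge>0. maximal_bound M d m \<eta> ps q ws w (ennreal D)"
proof -
  define Ex where "Ex i s pp Hp pinf \<longleftrightarrow> 1 < s \<and> (\<forall>x\<in>X. s \<le> ps i x \<and> ps i x \<le> pp) \<and> s \<le> pinf \<and> pinf \<le> pp \<and>
    LH (ps i) Hp pinf" for i s pp Hp pinf
  have "\<exists>s pp Hp pinf. Ex i s pp Hp pinf" if "i < m" for i
    unfolding Ex_def by (rule exponents_bounds[OF P[OF that] LHp[OF that]])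
  then have "\<forall>i. \<exists>s pp Hp pinf. i < m \<longrightarrow> Ex i s pp Hp pinf" by blast
  from choice[OF this] obtain s where "\<forall>i. \<exists>pp Hp pinf. i < m \<longrightarrow> Ex i (s i) pp Hp pinf" ..
  from choice[OF this] obtain pp where "\<forall>i. \<exists>Hp pinf. i < m \<longrightarrow> Ex i (s i) (pp i) Hp pinf" ..
  from choice[OF this] obtain Hp where "\<forall>i. \<exists>pinf. i < m \<longrightarrow> Ex i (s i) (pp i) (Hp i) pinf" ..
  from choice[OF this] obtain pinf where "\<forall>i. i < m \<longrightarrow> Ex i (s i) (pp i) (Hp i) (pinf i)" ..
  then have s: "1 < s i" and pb: "\<forall>x\<in>X. s i \<le> ps i x \<and> ps i x \<le> pp i" and pinf: "s i \<le> pinf i" "pinf i \<le> pp i"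
    and LHi: "LH (ps i) (Hp i) (pinf i)" if "i < m" for i
    using that by (auto simp: Ex_def)
  have "\<exists>H b. LH (\<lambda>x. 1 / ps i x) H b" if "i \<in> {..<m}" for i
  proof -
    have i: "i < m" using that by simp
    have "0 < s i" using s[OF i] by simp
    from LH_inverse[OF this pb[OF i] pinf[OF i] LHi[OF i]] show ?thesis by blast
  qed
  then obtain H1 b1 where "LH (\<lambda>x. \<Sum>i<m. 1 / ps i x) H1 b1" using LH_sum[of "{..<m}" "\<lambda>i x. 1 / ps i x"] by auto
  from LH_add[OF this LH_const[of "- \<eta>"]] have "LH (\<lambda>x. 1 / q x) (H1 + 0) (b1 + - \<eta>)"
    by (rule LH_cong) (use rel in force)
  from exponents0_bounds[OF q this] obtain ql qu Hq qinf where ql: "0 < ql" and qb: "\<forall>x\<in>X. ql \<le> q x \<and> q x \<le> qu"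
    and qinf: "ql \<le> qinf" "qinf \<le> qu" and LHq: "LH q Hq qinf" by blast
  have qm: "q \<in> borel_measurable M" using q by (simp add: exponents0_def)
  have psm: "ps i \<in> borel_measurable M" if "i < m" for i using P[OF that] by (simp add: exponents_def)
  have wsm: "ws i \<in> borel_measurable M" and ws0: "AE x in M. 0 < ws i x \<and> ws i x < \<infinity>" if "i < m" for i
    using ws[OF that] by (auto simp: weight_def)
  have wm: "w \<in> borel_measurable M" and w0: "AE x in M. 0 < w x \<and> w x < \<infinity>" using w by (auto simp: weight_def)

  \<comment> \<open>The indices below \<open>m\<close> carry the dual weights with the conjugate
    exponents, the index \<open>m\<close> carries the target weight with \<open>q\<close>. In this
    notation the weights multiply to 1 and play symmetric parts.\<close>
  define a where "a j = (if j < m then conj_exponent (ps j) else q)" for j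
  define al where "al j = (if j < m then 1 else ql)" for j
  define au where "au j = (if j < m then s j / (s j - 1) else qu)" for j
  define Hj where "Hj j = (if j < m then 1 / (s j - 1) ^ 2 * Hp j else Hq)" for j
  define ainf where "ainf j = (if j < m then pinf j / (pinf j - 1) else qinf)" for j
  define u where "u j x = (if j < m then enn2real (inverse (ws j x)) else enn2real (w x))" for j x
  define V where "V j z r = var_norm M (a j) (\<lambda>x. ennreal (u j x) * indicator (B z r) x)" for j z r
  define n where "n j z r = enn2real (V j z r)" for j z r
  define K where "K = 1 + (\<Sum>j<Suc m. 2 powr au j)"
  have K: "1 \<le> K" unfolding K_def by (simp add: sum_nonneg)
  have auK: "2 powr au j \<le> K" if "j < Suc m" for j
  proof -
    have "2 powr au j \<le> (\<Sum>j<Suc m. 2 powr au j)" using that by (intro member_le_sum) auto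
    then show ?thesis by (simp add: K_def)
  qed
  have am: "a j \<in> borel_measurable M" for j
  proof (cases "j < m")
    case True
    note psm[OF True, measurable]
    show ?thesis unfolding a_def conj_exponent_def[abs_def] using True by simp
  qed (simp add: a_def qm)
  have um: "u j \<in> borel_measurable M" for j
  proof (cases "j < m")
    case True
    note wsm[OF True, measurable]
    show ?thesis unfolding u_def[abs_def] using True by simp
  next
    case False
    note wm[measurable]
    show ?thesis unfolding u_def[abs_def] using False by simp
  qed
  have u0: "0 \<le> u j x" for j x by (simp add: u_def)
  have alp: "0 < al j" for j using ql by (simp add: al_def)
  have ab: "al j \<le> a j x \<and> a j x \<le> au j" if "x \<in> X" for j x
    using conj_exponent_bounds(1,2)[of "s j" "ps j" x "pp j"] s[of j] pb[of j] qb that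
    by (auto simp: a_def al_def au_def)
  have ainfb: "al j \<le> ainf j \<and> ainf j \<le> au j" for j
    using conj_exponent_bounds(1,2)[of "s j" "\<lambda>_. pinf j" undefined "pp j"] s[of j] pinf[of j] qinf
    by (auto simp: ainf_def al_def au_def conj_exponent_def)
  have LHa: "LH (a j) (Hj j) (ainf j)" for j
  proof (cases "j < m")
    case True
    from LH_conj_exponent[OF s[OF True] pb[OF True] pinf[OF True] LHi[OF True]]
    show ?thesis using True by (simp add: a_def Hj_def ainf_def)
  next
    case False
    then show ?thesis using LHq by (simp add: a_def Hj_def ainf_def)
  qed

  have uj: "AE x in M. 0 < u i x \<and> inverse (ws i x) = ennreal (u i x) \<and> ws i x = ennreal (1 / u i x)" if i: "i < m" for i
    using ws0[OF i]
  proof eventually_elim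
    case (elim x)
    then obtain t where t: "ws i x = ennreal t" "0 < t" by (cases "ws i x") auto
    then have inv: "inverse (ws i x) = ennreal (1 / t)" by (simp add: inverse_ennreal inverse_eq_divide)
    then have "u i x = 1 / t" using t i by (simp add: u_def)
    then show ?case using t inv by simp
  qed
  have um': "AE x in M. 0 < u m x \<and> w x = ennreal (u m x)"
    using w0
  proof eventually_elim
    case (elim x)
    then obtain t where "w x = ennreal t" "0 < t" by (cases "w x") auto
    then show ?case by (simp add: u_def)
  qed
  have upos: "AE x in M. 0 < u j x" if "j < Suc m" for j
  proof (cases "j < m")
    case True
    show ?thesis using uj[OF True] by eventually_elim simp
  next
    case False
    then have "j = m" using that by simp
    then show ?thesis using um' by (auto elim: eventually_mono)
  qed
  have uall: "AE x in M. \<forall>i\<in>{..<m}. 0 < u i x \<and> inverse (ws i x) = ennreal (u i x) \<and> ws i x = ennreal (1 / u i x)"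
    using uj by (intro AE_finite_allI) auto
  have u1: "AE x in M. (\<Prod>j<Suc m. u j x) = 1"
    using uall um' wprod
  proof eventually_elim
    case (elim x)
    have up: "0 < u i x" and wu: "ws i x = ennreal (1 / u i x)" if "i < m" for i
      using elim(1) that by blast+
    have "ennreal (u m x) = (\<Prod>i<m. ws i x)" using elim(2,3) by simp
    also have "\<dots> = (\<Prod>i<m. ennreal (1 / u i x))" using wu by (intro prod.cong) auto
    also have "\<dots> = ennreal (\<Prod>i<m. 1 / u i x)" using u0 by (intro prod_ennreal) auto
    finally have "u m x = (\<Prod>i<m. 1 / u i x)"
      using u0 by (subst (asm) ennreal_inj) (auto intro!: prod_nonneg)
    then have "(\<Prod>j<Suc m. u j x) = (\<Prod>i<m. u i x * (1 / u i x))"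
      unfolding prod.distrib by simp
    also have "\<dots> = (\<Prod>i<m. 1)"
    proof (rule prod.cong[OF refl])
      show "u i x * (1 / u i x) = 1" if "i \<in> {..<m}" for i using up[of i] that by simp
    qed
    finally show ?case by simp
  qed

  have Vi: "V i z r = var_norm M (conj_exponent (ps i)) (\<lambda>x. inverse (ws i x) * indicator (B z r) x)" if i: "i < m" for i z r
  proof -
    have "V i z r = var_norm M (conj_exponent (ps i)) (\<lambda>x. ennreal (u i x) * indicator (B z r) x)"
      using i by (simp add: V_def a_def)
    also have "\<dots> = var_norm M (conj_exponent (ps i)) (\<lambda>x. inverse (ws i x) * indicator (B z r) x)"
    proof (rule var_norm_cong_AE, use uj[OF i] in eventually_elim)
      case (elim x)
      then have "inverse (ws i x) = ennreal (u i x)" by blast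
      then show ?case by (simp only:)
    qed
    finally show ?thesis .
  qed
  have Vm: "V m z r = var_norm M q (\<lambda>x. w x * indicator (B z r) x)" for z r
  proof -
    have "V m z r = var_norm M q (\<lambda>x. ennreal (u m x) * indicator (B z r) x)" by (simp add: V_def a_def)
    also have "\<dots> = var_norm M q (\<lambda>x. w x * indicator (B z r) x)"
      by (rule var_norm_cong_AE, use um' in eventually_elim) simp
    finally show ?thesis .
  qed
  have Vpos: "0 < V j z r" if "j < Suc m" "z \<in> X" "0 < r" for j z r
    unfolding V_def
    by (rule var_norm_pos[OF upos[OF that(1)] _ alp[of j] um am ball_sets[OF that(2,3)] ball_pos[OF that(2,3)]])
      (use ab in auto)
  define Ka where "Ka = enn2real (Apq_const M d m \<eta> ps q ws w)"
  have Ka: "Apq_const M d m \<eta> ps q ws w = ennreal Ka" "0 \<le> Ka" using Apq by (auto simp: Ka_def in_Apq_def)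
  have Vle: "ennreal (measure M (B z r) powr (\<eta> - real m)) * (\<Prod>j<Suc m. V j z r) \<le> ennreal Ka"
    if zr: "z \<in> X" "0 < r" for z r
  proof -
    have "ennreal (measure M (B z r) powr (\<eta> - real m)) * (\<Prod>j<Suc m. V j z r) =
       ennreal (measure M (B z r) powr (\<eta> - real m)) * var_norm M q (\<lambda>x. w x * indicator (B z r) x) *
       (\<Prod>i<m. var_norm M (conj_exponent (ps i)) (\<lambda>x. inverse (ws i x) * indicator (B z r) x))"
      by (simp add: Vi Vm mult_ac)
    also have "\<dots> \<le> Apq_const M d m \<eta> ps q ws w"
      unfolding Apq_const_def using zr by (intro SUP_upper) (auto simp: qballs_def)
    finally show ?thesis unfolding Ka .
  qed
  \<comment> \<open>The weight condition bounds only the product of the norms. Every factor is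
    positive, so each of them is finite.\<close>
  have Vfin: "V j z r = ennreal (n j z r) \<and> 0 < n j z r" if j: "j < Suc m" and zr: "z \<in> X" "0 < r" for j z r
  proof -
    have mp: "ennreal (measure M (B z r) powr (\<eta> - real m)) \<noteq> 0" using mB_pos[OF zr] by (simp add: ennreal_eq_0_iff)
    have "ennreal (measure M (B z r) powr (\<eta> - real m)) * (\<Prod>j<Suc m. V j z r) < top"
      using Vle[OF zr] by (rule order_le_less_trans) simp
    moreover have "b \<noteq> top" if "a * b < top" "a \<noteq> 0" for a b :: ennreal
      using that by (auto simp: ennreal_mult_less_top)
    ultimately have fin: "(\<Prod>j<Suc m. V j z r) \<noteq> top" using mp by blast
    have "V i z r \<noteq> 0" if "i \<in> {..<Suc m}" for i using Vpos[of i z r] that zr by simp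
    then have "V j z r \<noteq> top" using fin j unfolding ennreal_prod_eq_top by blast
    then have "V j z r = ennreal (n j z r)" by (simp add: n_def less_top)
    moreover from this have "0 < n j z r" using Vpos[OF j zr] by simp
    ultimately show ?thesis by simp
  qed
  \<comment> \<open>Adding 1 gives a positive constant at once; negative powers of it are formed
    later.\<close>
  define Kp where "Kp = Ka + 1"
  have Kp: "0 < Kp" using Ka(2) by (simp add: Kp_def)
  have npr: "(\<Prod>j<Suc m. n j z r) \<le> Kp * measure M (B z r) powr (real m - \<eta>)" if zr: "z \<in> X" "0 < r" for z r
  proof -
    define v where "v = measure M (B z r)"
    have v: "0 < v" unfolding v_def by (rule mB_pos[OF zr])
    have n0: "0 \<le> (\<Prod>j<Suc m. n j z r)" using Vfin[OF _ zr] by (intro prod_nonneg) (auto intro: less_imp_le)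
    have "(\<Prod>j<Suc m. V j z r) = (\<Prod>j<Suc m. ennreal (n j z r))" using Vfin[OF _ zr] by (intro prod.cong) auto
    also have "\<dots> = ennreal (\<Prod>j<Suc m. n j z r)" using Vfin[OF _ zr] by (intro prod_ennreal) (auto intro: less_imp_le)
    finally have "ennreal (v powr (\<eta> - real m) * (\<Prod>j<Suc m. n j z r)) \<le> ennreal Ka"
      using Vle[OF zr] n0 unfolding v_def by (simp add: ennreal_mult')
    then have "v powr (\<eta> - real m) * (\<Prod>j<Suc m. n j z r) \<le> Kp"
      using Ka(2) unfolding Kp_def by (subst (asm) ennreal_le_iff) auto
    then have "v powr (real m - \<eta>) * (v powr (- (real m - \<eta>)) * (\<Prod>j<Suc m. n j z r)) \<le> v powr (real m - \<eta>) * Kp"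
      by (intro mult_left_mono) auto
    then have "(\<Prod>j<Suc m. n j z r) \<le> v powr (real m - \<eta>) * Kp" unfolding powr_mult_minus_cancel[OF v] .
    then show ?thesis unfolding v_def by (simp only: mult.commute)
  qed
  have up: "(\<integral>\<^sup>+x\<in>B z r. ennreal (u j x powr a j x * n j z r powr (- a j x)) \<partial>M) \<le> ennreal K"
    if j: "j < Suc m" and zr: "z \<in> X" "0 < r" for j z r
  proof -
    have "(\<integral>\<^sup>+x\<in>B z r. ennreal (u j x powr a j x * n j z r powr (- a j x)) \<partial>M) \<le> ennreal (2 powr au j)"
    proof (rule modular_le_var_norm[OF u0 _ _ _ um am ball_sets[OF zr]])
      show "0 < a j x \<and> a j x \<le> au j" if "x \<in> X" for x using ab[OF that, of j] alp[of j] by linarith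
      show "var_norm M (a j) (\<lambda>x. ennreal (u j x) * indicator (B z r) x) = ennreal (n j z r)" "0 < n j z r"
        using Vfin[OF j zr] by (auto simp: V_def)
    qed
    also have "\<dots> \<le> ennreal K" using auK[OF j] by (rule ennreal_leI)
    finally show ?thesis .
  qed
  have gam: "(\<Sum>j<Suc m. 1 / a j x) = real m - \<eta>" if x: "x \<in> X" for x
  proof -
    have "1 / a i x = 1 - 1 / ps i x" if i: "i < m" for i
      using conj_exponent_bounds(3)[of "s i" "ps i" x "pp i"] s[OF i] pb[OF i] x i by (simp add: a_def)
    then have "(\<Sum>i<m. 1 / a i x) = (\<Sum>i<m. 1 - 1 / ps i x)" by (intro sum.cong) auto
    then have "(\<Sum>j<Suc m. 1 / a j x) = (\<Sum>i<m. 1 - 1 / ps i x) + 1 / q x" by (simp add: a_def)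
    also have "\<dots> = real m - \<eta>" using rel[OF x] by (simp add: sum_subtractf)
    finally show ?thesis .
  qed
  have "\<exists>c D. density_data M d A Cd o' (\<lambda>x. u j x powr a j x) (a j) (n j) (al j) (au j) (Hj j) (ainf j) K c D"
    if j: "j < Suc m" for j
  proof (rule density_data_of_norms[where J = "{..<Suc m}" and \<gamma> = "real m - \<eta>" and Kp = Kp, OF _ _ am alp ab ainfb LHa um u0 u1])
    show "0 < real m - \<eta>" using eta by simp
  qed (use j gam Vfin K up Kp npr in auto)
  then have "\<forall>j. \<exists>c D. j < Suc m \<longrightarrow>
      density_data M d A Cd o' (\<lambda>x. u j x powr a j x) (a j) (n j) (al j) (au j) (Hj j) (ainf j) K c D" by blast
  from choice[OF this] obtain c where "\<forall>j. \<exists>D. j < Suc m \<longrightarrow>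
      density_data M d A Cd o' (\<lambda>x. u j x powr a j x) (a j) (n j) (al j) (au j) (Hj j) (ainf j) K (c j) D" ..
  from choice[OF this] obtain D where "\<forall>j. j < Suc m \<longrightarrow>
      density_data M d A Cd o' (\<lambda>x. u j x powr a j x) (a j) (n j) (al j) (au j) (Hj j) (ainf j) K (c j) (D j)" ..
  then have DD: "density_data M d A Cd o' (\<lambda>x. u j x powr a j x) (a j) (n j) (al j) (au j) (Hj j) (ainf j) K (c j) (D j)"
    if "j < Suc m" for j using that by simp
  have CD: "conj_data M d A Cd o' (\<lambda>x. u i x powr a i x) (a i) (n i) (al i) (au i) (Hj i) (ainf i) K (c i) (D i)
      (ps i) (s i) (pp i) (Hp i) (pinf i)" if i: "i < m" for i
  proof (rule conj_data.intro)
    show "density_data M d A Cd o' (\<lambda>x. u i x powr a i x) (a i) (n i) (al i) (au i) (Hj i) (ainf i) K (c i) (D i)"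
      using DD i by simp
    show "conj_data_axioms M d o' (a i) (ainf i) (ps i) (s i) (pp i) (Hp i) (pinf i)"
      using psm[OF i] s[OF i] pb[OF i] pinf[OF i] LHi[OF i] i
      by unfold_locales (auto simp: a_def ainf_def conj_exponent_def)
  qed
  have "\<exists>C\<ge>1. \<forall>f. (\<forall>i<m. f i \<in> borel_measurable M \<and>
      (\<integral>\<^sup>+x. ennreal (u i x powr a i x * (\<bar>f i x\<bar> / u i x powr a i x) powr ps i x) \<partial>M) \<le> 1) \<longrightarrow>
    (\<exists>G\<in>borel_measurable M. (\<forall>x\<in>X. epowr (frac_maximal M d m \<eta> f x) (a m x) \<le> G x) \<and>
      (\<integral>\<^sup>+x. ennreal (u m x powr a m x) * G x \<partial>M) \<le> ennreal C)"
  proof (rule frac_maximal_modular[OF CD DD[OF lessI] _ _ Kp eta(2) K])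
    show "1 / a m x \<le> (\<Sum>i<m. 1 / ps i x)" if "x \<in> X" for x
      using rel[OF that] eta by (simp add: a_def)
    show "(\<Prod>i<m. n i z r) * n m z r \<le> Kp * measure M (B z r) powr (real m - \<eta>)" if "z \<in> X" "0 < r" for z r
      using npr[OF that] by simp
    show "AE x in M. 0 < u i x powr a i x" if "i < m" for i
      using upos[of i] that by (auto elim: eventually_mono)
  qed
  then obtain C where C: "1 \<le> C" and bd: "\<And>f. (\<forall>i<m. f i \<in> borel_measurable M \<and>
      (\<integral>\<^sup>+x. ennreal (u i x powr a i x * (\<bar>f i x\<bar> / u i x powr a i x) powr ps i x) \<partial>M) \<le> 1) \<Longrightarrow>
    (\<exists>G\<in>borel_measurable M. (\<forall>x\<in>X. epowr (frac_maximal M d m \<eta> f x) (a m x) \<le> G x) \<and>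
      (\<integral>\<^sup>+x. ennreal (u m x powr a m x) * G x \<partial>M) \<le> ennreal C)" by blast
  \<comment> \<open>Dividing by \<open>D'\<close> lowers the modular from \<open>C\<close> to 1,
    because \<open>D' \<ge> 1\<close> and the exponent \<open>q\<close> is at least
    \<open>ql\<close>.\<close>
  define D' where "D' = C powr (1 / ql)"
  have D': "1 \<le> D'" "D' powr ql = C" unfolding D'_def using C ql by (auto simp: powr_powr ge_one_powr_ge_zero)
  have "maximal_bound M d m \<eta> ps q ws w (ennreal D')"
  proof (rule maximal_bound_from_admissible)
    fix f l
    assume f: "\<And>i. i < m \<Longrightarrow> f i \<in> borel_measurable M" and l: "\<And>i. i < m \<Longrightarrow> 0 < l i \<and>
        (\<integral>\<^sup>+x. epowr (ws i x * ennreal \<bar>f i x\<bar> / ennreal (l i)) (ps i x) \<partial>M) \<le> 1"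
    define g where "g i x = f i x / l i" for i x
    have gm: "g i \<in> borel_measurable M" if "i < m" for i unfolding g_def[abs_def] using f[OF that] by simp
    have gmod: "(\<integral>\<^sup>+x. ennreal (u i x powr a i x * (\<bar>g i x\<bar> / u i x powr a i x) powr ps i x) \<partial>M) \<le> 1" if i: "i < m" for i
    proof -
      have "(\<integral>\<^sup>+x. ennreal (u i x powr a i x * (\<bar>g i x\<bar> / u i x powr a i x) powr ps i x) \<partial>M) =
        (\<integral>\<^sup>+x. epowr (ws i x * ennreal \<bar>f i x\<bar> / ennreal (l i)) (ps i x) \<partial>M)"
      proof (rule nn_integral_cong_AE, use uj[OF i] AE_space in eventually_elim)
        case (elim x)
        have up: "0 < u i x" and wu: "ws i x = ennreal (1 / u i x)" and x: "x \<in> X" using elim by auto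
        have li: "0 < l i" using l[OF i] by simp
        have "ws i x * ennreal \<bar>f i x\<bar> / ennreal (l i) = ennreal (\<bar>g i x\<bar> / u i x)"
          unfolding ennreal_divide_real[OF li] wu using up li
          by (simp add: ennreal_mult[symmetric] g_def abs_divide mult_ac)
        then have e1: "epowr (ws i x * ennreal \<bar>f i x\<bar> / ennreal (l i)) (ps i x) = ennreal ((\<bar>g i x\<bar> / u i x) powr ps i x)"
          using up by (simp add: epowr_ennreal)
        have ap: "(a i x - 1) * ps i x = a i x"
          using conj_exponent_bounds(4)[of "s i" "ps i" x "pp i"] s[OF i] pb[OF i] x i by (simp add: a_def)
        \<comment> \<open>The modular of the function divided by the density, taken against the
          density, is its modular with the original weight. The powers of \<open>u i x\<close>
          combine by \<open>(a i x - 1) * ps i x = a i x\<close>.\<close>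
        have "u i x powr a i x * (\<bar>g i x\<bar> / u i x powr a i x) powr ps i x =
           \<bar>g i x\<bar> powr ps i x * (u i x powr a i x * u i x powr (- (a i x * ps i x)))"
          using up by (simp add: powr_divide powr_powr powr_minus_divide)
        also have "u i x powr a i x * u i x powr (- (a i x * ps i x)) = u i x powr (- ps i x)"
          unfolding powr_add[symmetric] using ap by (simp add: algebra_simps)
        also have "\<bar>g i x\<bar> powr ps i x * u i x powr (- ps i x) = (\<bar>g i x\<bar> / u i x) powr ps i x"
          using up by (simp add: powr_divide powr_minus_divide)
        finally show ?case using e1 by simp
      qed
      then show ?thesis using l[OF i] by simp
    qed
    have "\<exists>G\<in>borel_measurable M. (\<forall>x\<in>X. epowr (frac_maximal M d m \<eta> g x) (a m x) \<le> G x) \<and>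
      (\<integral>\<^sup>+x. ennreal (u m x powr a m x) * G x \<partial>M) \<le> ennreal C"
      using gm gmod by (intro bd) simp
    then obtain G where Gm [measurable]: "G \<in> borel_measurable M" and G: "\<forall>x\<in>X. epowr (frac_maximal M d m \<eta> g x) (a m x) \<le> G x"
      and Gi: "(\<integral>\<^sup>+x. ennreal (u m x powr a m x) * G x \<partial>M) \<le> ennreal C" by blast
    define Lp where "Lp = (\<Prod>i<m. l i)"
    have Lp: "0 < Lp" unfolding Lp_def using l by (intro prod_pos) auto
    have DL: "0 < D' * Lp" using D' Lp by simp
    have am' [measurable]: "a m \<in> borel_measurable M" "u m \<in> borel_measurable M" using am um by auto
    have "(\<integral>\<^sup>+x. epowr (w x * frac_maximal M d m \<eta> f x / ennreal (D' * Lp)) (q x) \<partial>M) \<le>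
       (\<integral>\<^sup>+x. ennreal (1 / C) * (ennreal (u m x powr a m x) * G x) \<partial>M)"
    proof (rule nn_integral_mono_AE, use um' AE_space in eventually_elim)
      case (elim x)
      have up: "0 < u m x" and wu: "w x = ennreal (u m x)" and x: "x \<in> X" using elim by auto
      have qx: "ql \<le> q x" "0 < q x" using qb x ql by force+
      have aq: "a m x = q x" by (simp add: a_def)
      have "w x * frac_maximal M d m \<eta> f x / ennreal (D' * Lp) \<le>
          w x * (ennreal Lp * frac_maximal M d m \<eta> g x) / ennreal (D' * Lp)"
        unfolding Lp_def g_def using frac_maximal_scale[of m l f \<eta> x] l f
        by (intro divide_right_mono_ennreal mult_left_mono) auto
      also have "\<dots> = ennreal (u m x / D') * frac_maximal M d m \<eta> g x"
      proof -
        have "ennreal (1 / (D' * Lp)) * (ennreal (u m x) * ennreal Lp) = ennreal (u m x / D')"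
          using Lp DL up D' by (simp add: ennreal_mult[symmetric])
        then show ?thesis unfolding ennreal_divide_real[OF DL] wu by (simp add: mult.assoc[symmetric])
      qed
      finally have "epowr (w x * frac_maximal M d m \<eta> f x / ennreal (D' * Lp)) (q x) \<le>
         epowr (ennreal (u m x / D') * frac_maximal M d m \<eta> g x) (q x)"
        using qx by (intro epowr_mono) auto
      also have "\<dots> = ennreal ((u m x / D') powr q x) * epowr (frac_maximal M d m \<eta> g x) (q x)"
        using up D' by (intro epowr_mult_ennreal) auto
      also have "\<dots> \<le> ennreal (1 / C * u m x powr q x) * G x"
      proof (intro mult_mono ennreal_leI)
        have "(u m x / D') powr q x = u m x powr q x / D' powr q x"
          using up D' by (simp add: powr_divide)
        also have "\<dots> \<le> u m x powr q x / D' powr ql"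
          using D' qx by (intro divide_left_mono powr_mono) auto
        finally show "(u m x / D') powr q x \<le> 1 / C * u m x powr q x" using D' by simp
        show "epowr (frac_maximal M d m \<eta> g x) (q x) \<le> G x" using G x aq by auto
      qed auto
      also have "\<dots> = ennreal (1 / C) * (ennreal (u m x powr a m x) * G x)"
      proof -
        have "ennreal (1 / C * u m x powr q x) = ennreal (1 / C) * ennreal (u m x powr q x)"
          using C by (intro ennreal_mult) auto
        then show ?thesis by (simp only: aq mult.assoc)
      qed
      finally show ?case .
    qed
    also have "\<dots> = ennreal (1 / C) * (\<integral>\<^sup>+x. ennreal (u m x powr a m x) * G x \<partial>M)"
      by (rule nn_integral_cmult) measurable
    also have "\<dots> \<le> ennreal (1 / C) * ennreal C" using Gi by (intro mult_left_mono) auto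
    also have "\<dots> = 1" using C by (simp add: ennreal_mult[symmetric])
    finally show "weighted_norm M q w (frac_maximal M d m \<eta> f) \<le> ennreal (D' * (\<Prod>i<m. l i))"
      unfolding weighted_norm_def Lp_def[symmetric] by (intro var_norm_le DL) auto
  qed (use D' in auto)
  then show ?thesis using D' by (intro exI[of _ D']) auto
qed

end

lemma maximal_opnorm_cong_exponent:
  assumes "\<And>x. x \<in> space M \<Longrightarrow> q x = q' x"
  shows "maximal_opnorm M d m \<eta> ps q ws w = maximal_opnorm M d m \<eta> ps q' ws w"
proof -
  have "weighted_norm M q w f = weighted_norm M q' w f" for f
    unfolding weighted_norm_def by (rule var_norm_cong_exponent[OF assms])
  then show ?thesis by (simp add: maximal_opnorm_def maximal_bound_def)
qed

theorem theorem1p15: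
  fixes X :: "'a set" and m :: nat and ps :: "nat \<Rightarrow> 'a \<Rightarrow> real"
  assumes "1 \<le> m"
  shows "\<exists>C::real. 0 < C \<and>
    (\<forall>(M :: 'a measure) (d :: 'a \<Rightarrow> 'a \<Rightarrow> real) (\<eta> :: real)
      (ws :: nat \<Rightarrow> 'a \<Rightarrow> ennreal) (w :: 'a \<Rightarrow> ennreal).
      \<exists>D::real. \<forall>(p :: 'a \<Rightarrow> real) (q :: 'a \<Rightarrow> real).
        space M = X \<longrightarrow>
        homogeneous_type M d \<longrightarrow>
        (\<forall>i<m. ps i \<in> exponents M \<and> log_Hoelder X d (ps i)) \<longrightarrow>
        (\<forall>x\<in>X. 1 / p x = (\<Sum>i<m. 1 / ps i x)) \<longrightarrow>
        q \<in> exponents0 M \<longrightarrow>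
        0 \<le> \<eta> \<longrightarrow> \<eta> < real m \<longrightarrow>
        (\<forall>x\<in>X. 1 / p x - 1 / q x = \<eta>) \<longrightarrow>
        (\<forall>i<m. weight M d (ws i)) \<longrightarrow> weight M d w \<longrightarrow>
        (AE x in M. w x = (\<Prod>i<m. ws i x)) \<longrightarrow>
        (maximal_bounded M d m \<eta> ps q ws w \<longleftrightarrow> in_Apq M d m \<eta> ps q ws w) \<and>
        ennreal (inverse C) * Apq_const M d m \<eta> ps q ws w \<le> maximal_opnorm M d m \<eta> ps q ws w \<and>
        (in_Apq M d m \<eta> ps q ws w \<longrightarrow> maximal_opnorm M d m \<eta> ps q ws w \<le> ennreal D))"
proof (rule exI[of _ 1], rule conjI[OF zero_less_one], intro allI)
  fix M :: "'a measure" and d :: "'a \<Rightarrow> 'a \<Rightarrow> real" and \<eta> :: real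
    and ws :: "nat \<Rightarrow> 'a \<Rightarrow> ennreal" and w :: "'a \<Rightarrow> ennreal"
  \<comment> \<open>The relations between the exponents determine \<open>q\<close> on the space, so \<open>D\<close> may be chosen before \<open>q\<close>.\<close>
  define q0 where "q0 x = 1 / ((\<Sum>i<m. 1 / ps i x) - \<eta>)" for x
  show "\<exists>D::real. \<forall>(p :: 'a \<Rightarrow> real) (q :: 'a \<Rightarrow> real).
        space M = X \<longrightarrow>
        homogeneous_type M d \<longrightarrow>
        (\<forall>i<m. ps i \<in> exponents M \<and> log_Hoelder X d (ps i)) \<longrightarrow>
        (\<forall>x\<in>X. 1 / p x = (\<Sum>i<m. 1 / ps i x)) \<longrightarrow>
        q \<in> exponents0 M \<longrightarrow>
        0 \<le> \<eta> \<longrightarrow> \<eta> < real m \<longrightarrow>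
        (\<forall>x\<in>X. 1 / p x - 1 / q x = \<eta>) \<longrightarrow>
        (\<forall>i<m. weight M d (ws i)) \<longrightarrow> weight M d w \<longrightarrow>
        (AE x in M. w x = (\<Prod>i<m. ws i x)) \<longrightarrow>
        (maximal_bounded M d m \<eta> ps q ws w \<longleftrightarrow> in_Apq M d m \<eta> ps q ws w) \<and>
        ennreal (inverse 1) * Apq_const M d m \<eta> ps q ws w \<le> maximal_opnorm M d m \<eta> ps q ws w \<and>
        (in_Apq M d m \<eta> ps q ws w \<longrightarrow> maximal_opnorm M d m \<eta> ps q ws w \<le> ennreal D)"
  \<comment> \<open>The operator norm itself serves as the constant. Were it infinite,
    \<open>enn2real\<close> would return 0, but the weight condition, under which the bound is
    claimed, makes it finite.\<close>
  proof (intro exI[of _ "enn2real (maximal_opnorm M d m \<eta> ps q0 ws w)"] allI impI)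
    fix p q :: "'a \<Rightarrow> real"
    assume X: "space M = X" and hom: "homogeneous_type M d"
      and ps: "\<forall>i<m. ps i \<in> exponents M \<and> log_Hoelder X d (ps i)"
      and p: "\<forall>x\<in>X. 1 / p x = (\<Sum>i<m. 1 / ps i x)" and q: "q \<in> exponents0 M"
      and eta: "0 \<le> \<eta>" "\<eta> < real m" and rel: "\<forall>x\<in>X. 1 / p x - 1 / q x = \<eta>"
      and ws: "\<forall>i<m. weight M d (ws i)" and w: "weight M d w" and wp: "AE x in M. w x = (\<Prod>i<m. ws i x)"
    obtain x0 where x0: "x0 \<in> space M" using hom by (auto simp: homogeneous_type_def)
    obtain A Cd where "hom_type M d A Cd x0" using homogeneous_type_imp_hom_type[OF hom x0] by blast
    then interpret hom_type M d A Cd x0 .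
    have rel': "(\<Sum>i<m. 1 / ps i x) - 1 / q x = \<eta>" if "x \<in> space M" for x using rel p that X by force
    have "\<exists>s pp Hp pinf. 1 < s \<and> (\<forall>x\<in>space M. s \<le> ps i x \<and> ps i x \<le> pp) \<and> s \<le> pinf \<and> pinf \<le> pp \<and> LH (ps i) Hp pinf"
      if "i < m" for i
      using ps that X by (intro exponents_bounds) auto
    then have "\<forall>i. \<exists>s pp. i < m \<longrightarrow> 1 < s \<and> (\<forall>x\<in>space M. s \<le> ps i x \<and> ps i x \<le> pp)" by blast
    from choice[OF this] obtain s where "\<forall>i. \<exists>pp. i < m \<longrightarrow> 1 < s i \<and> (\<forall>x\<in>space M. s i \<le> ps i x \<and> ps i x \<le> pp)" ..
    from choice[OF this] obtain pp where sp: "\<forall>i. i < m \<longrightarrow> 1 < s i \<and> (\<forall>x\<in>space M. s i \<le> ps i x \<and> ps i x \<le> pp i)" ..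
    have le: "Apq_const M d m \<eta> ps q ws w \<le> C" if bd: "maximal_bound M d m \<eta> ps q ws w C" for C
    proof (rule Apq_const_le_of_bound[where s = s and pp = pp, OF _ _ _ _ _ _ bd])
      show "0 \<le> q x" if "x \<in> space M" for x using q that by (auto simp: exponents0_def intro: less_imp_le)
    qed (use sp ps ws in \<open>auto simp: exponents_def weight_def\<close>)
    have upper: "\<exists>D\<ge>0. maximal_bound M d m \<eta> ps q ws w (ennreal D)" if "in_Apq M d m \<eta> ps q ws w"
      using ps ws X by (intro maximal_bound_of_Apq[OF _ _ q eta rel' _ w wp that]) auto
    have qq: "q x = q0 x" if "x \<in> space M" for x
    proof -
      have "1 / q x = (\<Sum>i<m. 1 / ps i x) - \<eta>" using rel'[OF that] by simp
      then show ?thesis unfolding q0_def by (metis div_by_1 divide_divide_eq_right mult_1)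
    qed
    have iff: "maximal_bounded M d m \<eta> ps q ws w \<longleftrightarrow> in_Apq M d m \<eta> ps q ws w"
    proof
      assume "maximal_bounded M d m \<eta> ps q ws w"
      then obtain C where "C < \<infinity>" "maximal_bound M d m \<eta> ps q ws w C" by (auto simp: maximal_bounded_def)
      then show "in_Apq M d m \<eta> ps q ws w" unfolding in_Apq_def using le order_le_less_trans by blast
    next
      assume "in_Apq M d m \<eta> ps q ws w"
      then obtain D where "maximal_bound M d m \<eta> ps q ws w (ennreal D)" using upper by blast
      then show "maximal_bounded M d m \<eta> ps q ws w"
        unfolding maximal_bounded_def by (intro exI[of _ "ennreal D"]) auto
    qed
    have lower: "ennreal (inverse 1) * Apq_const M d m \<eta> ps q ws w \<le> maximal_opnorm M d m \<eta> ps q ws w"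
      unfolding maximal_opnorm_def using le by (auto intro!: Inf_greatest)
    have "maximal_opnorm M d m \<eta> ps q ws w \<le> ennreal (enn2real (maximal_opnorm M d m \<eta> ps q0 ws w))"
      if Apq: "in_Apq M d m \<eta> ps q ws w"
    proof -
      obtain D where "maximal_bound M d m \<eta> ps q ws w (ennreal D)" using upper[OF Apq] by blast
      then have "maximal_opnorm M d m \<eta> ps q ws w \<le> ennreal D" unfolding maximal_opnorm_def by (intro Inf_lower) auto
      then have "maximal_opnorm M d m \<eta> ps q ws w < \<infinity>" by (rule order_le_less_trans) simp
      moreover have "maximal_opnorm M d m \<eta> ps q ws w = maximal_opnorm M d m \<eta> ps q0 ws w"
        by (rule maximal_opnorm_cong_exponent[OF qq])
      ultimately show ?thesis by simp
    qed
    then show "(maximal_bounded M d m \<eta> ps q ws w \<longleftrightarrow> in_Apq M d m \<eta> ps q ws w) \<and>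
        ennreal (inverse 1) * Apq_const M d m \<eta> ps q ws w \<le> maximal_opnorm M d m \<eta> ps q ws w \<and>
        (in_Apq M d m \<eta> ps q ws w \<longrightarrow>
          maximal_opnorm M d m \<eta> ps q ws w \<le> ennreal (enn2real (maximal_opnorm M d m \<eta> ps q0 ws w)))"
      using iff lower by blast
  qed
qed

end
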